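(* Let $A,B\in\mathbb{R}^{m\times m}$ and let $C_{s,t}$ ($0\le s\le t$) be the solution flow of the linear SDE $\mathrm{d}X_t=AX_t\,\mathrm{d}t+BX_t\,\mathrm{d}\xi_t$. Let $F:\{(x,y)\in\mathbb{R}^2: y\ge x\ge 0\}\to L^2(\Omega,\mathbb{R}^{m\times m})$ be a mapping, and consider the following properties: (i) $F(s,t)=1+(t-s)A+(\xi_t-\xi_s)B+o(t-s)$ for $t\to s$; (i)' $F(s,t)=1+\int_s^t AF(s,\tau)\,\mathrm{d}\tau+\int_s^t BF(s,\tau)\,\mathrm{d}\xi_\tau+o(t-s)$ for $t\to s$; (ii) for $\Delta>0$ and $u\ge s+\Delta$, $F(s,s+\Delta)$ and $F(u,u+\Delta)$ are independent and identically distributed. For $T>0$, $n\in\mathbb{N}$ and $t\in[0,T]$ define $$f_{n,T}(t):=\prod_{k=0}^{\lfloor nt/T\rfloor-1}F\left(\tfrac{k}{n}T,\tfrac{k+1}{n}T\right),\qquad g_{n,T}(t):=F\left(\lfloor\tfrac{nt}{T}\rfloor\tfrac{T}{n},t\right)\prod_{k=0}^{\lfloor nt/T\rfloor-1}F\left(\tfrac{k}{n}T,\tfrac{k+1}{n}T\right).$$ a) If (i) and (ii) hold, then $\mathbb{E}\sup_{t\in[0,T]}\|f_{n,T}(t)-C_{0,t}\|^2\to 0$ as $n\to\infty$. b) If (i)' and (ii) hold, then $\mathbb{E}\sup_{t\in[0,T]}\|g_{n,T}(t)-C_{0,t}\|^2\to 0$ as $n\to\infty$.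
   Context: $(\xi_t)_{t\ge0}$ is a one-dimensional standard Wiener process on a probability space $(\Omega,\mathfrak{A},\mathbb{P})$; stochastic integrals are Itô integrals. The solution flow $C_{s,t}$ is the $\mathbb{R}^{m\times m}$-valued process with $C_{s,t}=1+\int_s^tAC_{s,\tau}\,\mathrm{d}\tau+\int_s^tBC_{s,\tau}\,\mathrm{d}\xi_\tau$, so that $X_t=C_{s,t}X_s$ for solutions $X$. Here $1$ denotes the identity matrix and $\|\cdot\|$ a norm on $\mathbb{R}^{m\times m}$ (all are equivalent). Products of matrices are ordered according to their action on a vector: $\prod_{k=1}^nH_k:=H_n\cdots H_1$, and the empty product is $1$. The symbol $o(t-s)$ denotes a random matrix $R(s,t)$ with $\left(\mathbb{E}\|R(s,t)\|^2\right)^{1/2}/(t-s)\to0$ as $t\downarrow s$.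
   Formalization: Here o(t-s) is uniform for s in bounded sets and independence in (ii) is mutual; b) also assumes F(s,·) right-continuous and, with the increments of ξ after s, independent of the past at s, and E sup_{s≤τ≤s+h}‖F(s,τ)-1-(ξ_τ-ξ_s)B‖²=o(h) locally uniformly in s. *)

theory Defs
  imports "HOL-Probability.Probability"
begin

text \<open>
  Matrices are elements of \<open>real^'m^'m\<close>; the library norm on this type (Frobenius) serves as
  the norm. A two-parameter random field \<open>F(s,t)\<close> is a function \<open>F s t \<omega>\<close>, of which only the
  values with \<open>0 \<le> s \<le> t\<close> matter.
\<close>

definition L2 :: "'a measure \<Rightarrow> ('a \<Rightarrow> 'b::euclidean_space) \<Rightarrow> bool" where
  "L2 M X \<longleftrightarrow> X \<in> borel_measurable M \<and> integrable M (\<lambda>\<omega>. (norm (X \<omega>))\<^sup>2)"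

definition L2_norm :: "'a measure \<Rightarrow> ('a \<Rightarrow> 'b::euclidean_space) \<Rightarrow> real" where
  "L2_norm M X = sqrt (\<integral>\<omega>. (norm (X \<omega>))\<^sup>2 \<partial>M)"


section \<open>Wiener process and It\^o integral\<close>

text \<open>
  The Wiener process is taken relative to a filtration, which the It\^o integral needs anyway.
  A Wiener process without a given filtration is covered by its own natural filtration.
  The values of the filtration at negative times play no role.
\<close>

definition wiener_process ::
    "'a measure \<Rightarrow> (real \<Rightarrow> 'a measure) \<Rightarrow> (real \<Rightarrow> 'a \<Rightarrow> real) \<Rightarrow> bool" where
  "wiener_process M \<FF> \<xi> \<longleftrightarrow>
     prob_space M \<and> filtration (space M) \<FF> \<and> (\<forall>t. subalgebra M (\<FF> t)) \<and>
     (\<forall>t\<ge>0. \<xi> t \<in> borel_measurable (\<FF> t)) \<and>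
     (AE \<omega> in M. \<xi> 0 \<omega> = 0) \<and>
     (AE \<omega> in M. continuous_on {0..} (\<lambda>t. \<xi> t \<omega>)) \<and>
     (\<forall>s t. 0 \<le> s \<and> s < t \<longrightarrow>
        distributed M lborel (\<lambda>\<omega>. \<xi> t \<omega> - \<xi> s \<omega>) (normal_density 0 (sqrt (t - s))) \<and>
        prob_space.indep_set M (sets (\<FF> s))
          (sets (vimage_algebra (space M) (\<lambda>\<omega>. \<xi> t \<omega> - \<xi> s \<omega>) borel)))"

text \<open>
  A simple process on \<open>[s,t]\<close> is \<open>\<Sum>j<N. 1[p\<^sub>j, p\<^sub>j\<^sub>+\<^sub>1) e\<^sub>j\<close> with deterministic
  \<open>s = p\<^sub>0 \<le> \<dots> \<le> p\<^sub>N = t\<close> and square integrable \<open>e\<^sub>j\<close>, measurable at time \<open>p\<^sub>j\<close>.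
\<close>

definition simple_data ::
    "'a measure \<Rightarrow> (real \<Rightarrow> 'a measure) \<Rightarrow> real \<Rightarrow> real \<Rightarrow>
     nat \<Rightarrow> (nat \<Rightarrow> real) \<Rightarrow> (nat \<Rightarrow> 'a \<Rightarrow> 'b::euclidean_space) \<Rightarrow> bool" where
  "simple_data M \<FF> s t N p e \<longleftrightarrow>
     p 0 = s \<and> p N = t \<and>
     (\<forall>j<N. p j \<le> p (Suc j) \<and> e j \<in> borel_measurable (\<FF> (p j)) \<and> L2 M (e j))"

definition simple_process ::
    "nat \<Rightarrow> (nat \<Rightarrow> real) \<Rightarrow> (nat \<Rightarrow> 'a \<Rightarrow> 'b::euclidean_space) \<Rightarrow> real \<Rightarrow> 'a \<Rightarrow> 'b" where
  "simple_process N p e \<tau> \<omega> = (\<Sum>j<N. indicator {p j..<p (Suc j)} \<tau> *\<^sub>R e j \<omega>)"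

definition simple_integral ::
    "(real \<Rightarrow> 'a \<Rightarrow> real) \<Rightarrow>
     nat \<Rightarrow> (nat \<Rightarrow> real) \<Rightarrow> (nat \<Rightarrow> 'a \<Rightarrow> 'b::euclidean_space) \<Rightarrow> 'a \<Rightarrow> 'b" where
  "simple_integral \<xi> N p e \<omega> = (\<Sum>j<N. (\<xi> (p (Suc j)) \<omega> - \<xi> (p j) \<omega>) *\<^sub>R e j \<omega>)"

definition ito_integrand ::
    "'a measure \<Rightarrow> (real \<Rightarrow> 'a measure) \<Rightarrow> real \<Rightarrow> real \<Rightarrow>
     (real \<Rightarrow> 'a \<Rightarrow> 'b::euclidean_space) \<Rightarrow> bool" where
  "ito_integrand M \<FF> s t H \<longleftrightarrow>
     (\<lambda>(\<tau>, \<omega>). H \<tau> \<omega>) \<in> borel_measurable (restrict_space borel {s..t} \<Otimes>\<^sub>M M) \<and>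
     (\<forall>\<tau>\<in>{s..t}. H \<tau> \<in> borel_measurable (\<FF> \<tau>)) \<and>
     (\<integral>\<^sup>+\<tau>\<in>{s..t}. (\<integral>\<^sup>+\<omega>. ennreal ((norm (H \<tau> \<omega>))\<^sup>2) \<partial>M) \<partial>lborel) < \<infinity>"

text \<open>
  \<open>I\<close> is a version of the It\^o integral of \<open>H\<close> over \<open>[s,t]\<close>. The integral is determined
  only up to null sets, so it is given as a relation.
\<close>

definition is_ito_integral ::
    "'a measure \<Rightarrow> (real \<Rightarrow> 'a measure) \<Rightarrow> (real \<Rightarrow> 'a \<Rightarrow> real) \<Rightarrow> real \<Rightarrow> real \<Rightarrow>
     (real \<Rightarrow> 'a \<Rightarrow> 'b::euclidean_space) \<Rightarrow> ('a \<Rightarrow> 'b) \<Rightarrow> bool" where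
  "is_ito_integral M \<FF> \<xi> s t H I \<longleftrightarrow>
     ito_integrand M \<FF> s t H \<and> L2 M I \<and>
     (\<exists>N p e.
        (\<forall>n. simple_data M \<FF> s t (N n) (p n) (e n)) \<and>
        (\<lambda>n. \<integral>\<^sup>+\<tau>\<in>{s..t}. (\<integral>\<^sup>+\<omega>. ennreal ((norm
            (H \<tau> \<omega> - simple_process (N n) (p n) (e n) \<tau> \<omega>))\<^sup>2) \<partial>M) \<partial>lborel) \<longlonglongrightarrow> 0 \<and>
        (\<lambda>n. \<integral>\<^sup>+\<omega>. ennreal ((norm
            (I \<omega> - simple_integral \<xi> (N n) (p n) (e n) \<omega>))\<^sup>2) \<partial>M) \<longlonglongrightarrow> 0)"

text \<open>
  The last clause says \<open>C\<^bsub>s,t\<^esub> = 1 + \<integral>\<^bsub>s\<^esub>\<^bsup>t\<^esup> A C\<^bsub>s,\<tau>\<^esub> d\<tau> + \<integral>\<^bsub>s\<^esub>\<^bsup>t\<^esup> B C\<^bsub>s,\<tau>\<^esub> d\<xi>\<^bsub>\<tau>\<^esub>\<close>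
  almost surely. As usual, solutions have continuous paths.
\<close>

definition solution_flow ::
    "'a measure \<Rightarrow> (real \<Rightarrow> 'a measure) \<Rightarrow> (real \<Rightarrow> 'a \<Rightarrow> real) \<Rightarrow>
     real^'m^'m \<Rightarrow> real^'m^'m \<Rightarrow> (real \<Rightarrow> real \<Rightarrow> 'a \<Rightarrow> real^'m^'m) \<Rightarrow> bool" where
  "solution_flow M \<FF> \<xi> A B C \<longleftrightarrow>
     (\<forall>s\<ge>0. (AE \<omega> in M. continuous_on {s..} (\<lambda>t. C s t \<omega>)) \<and>
       (\<forall>t\<ge>s. ito_integrand M \<FF> s t (C s) \<and>
          is_ito_integral M \<FF> \<xi> s t (\<lambda>\<tau> \<omega>. B ** C s \<tau> \<omega>)
            (\<lambda>\<omega>. C s t \<omega> - mat 1 - (LINT \<tau>:{s..t}|lborel. A ** C s \<tau> \<omega>))))"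


section \<open>The properties of the approximating field\<close>

text \<open>
  \<open>R(s,t) = o(t - s)\<close> in mean square, as \<open>t - s\<close> tends to 0 from above. The limit is uniform
  for \<open>s\<close> in bounded sets: with a limit for each \<open>s\<close> separately the remainder would not be
  controlled along the grid points \<open>kT/n\<close>.
\<close>

definition small_o :: "'a measure \<Rightarrow> (real \<Rightarrow> real \<Rightarrow> 'a \<Rightarrow> real^'m^'m) \<Rightarrow> bool" where
  "small_o M R \<longleftrightarrow>
     (\<forall>s t. 0 \<le> s \<and> s \<le> t \<longrightarrow> L2 M (R s t)) \<and>
     (\<forall>K. uniform_limit {0..K} (\<lambda>h s. L2_norm M (R s (s + h)) / h) (\<lambda>s. 0) (at_right 0))"

definition prop_i ::
    "'a measure \<Rightarrow> (real \<Rightarrow> 'a \<Rightarrow> real) \<Rightarrow>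
     real^'m^'m \<Rightarrow> real^'m^'m \<Rightarrow> (real \<Rightarrow> real \<Rightarrow> 'a \<Rightarrow> real^'m^'m) \<Rightarrow> bool" where
  "prop_i M \<xi> A B F \<longleftrightarrow>
     (\<exists>R. small_o M R \<and>
       (\<forall>s t. 0 \<le> s \<and> s \<le> t \<longrightarrow>
         (AE \<omega> in M. F s t \<omega> = mat 1 + (t - s) *\<^sub>R A + (\<xi> t \<omega> - \<xi> s \<omega>) *\<^sub>R B + R s t \<omega>)))"

text \<open>\<open>J s t\<close> is the It\^o integral of \<open>B F(s,\<tau>)\<close> over \<open>[s,t]\<close>.\<close>

definition prop_i' ::
    "'a measure \<Rightarrow> (real \<Rightarrow> 'a measure) \<Rightarrow> (real \<Rightarrow> 'a \<Rightarrow> real) \<Rightarrow>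
     real^'m^'m \<Rightarrow> real^'m^'m \<Rightarrow> (real \<Rightarrow> real \<Rightarrow> 'a \<Rightarrow> real^'m^'m) \<Rightarrow> bool" where
  "prop_i' M \<FF> \<xi> A B F \<longleftrightarrow>
     (\<exists>J R. small_o M R \<and>
       (\<forall>s t. 0 \<le> s \<and> s \<le> t \<longrightarrow>
         ito_integrand M \<FF> s t (F s) \<and>
         is_ito_integral M \<FF> \<xi> s t (\<lambda>\<tau> \<omega>. B ** F s \<tau> \<omega>) (J s t) \<and>
         (AE \<omega> in M. F s t \<omega> =
            mat 1 + (LINT \<tau>:{s..t}|lborel. A ** F s \<tau> \<omega>) + J s t \<omega> + R s t \<omega>)))"

text \<open>
  Independence over non-overlapping intervals of equal length is mutual, as for independent
  increments. Pairwise independence would not suffice: a product of three square integrable,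
  pairwise independent factors need not be square integrable.
\<close>

definition prop_ii ::
    "'a measure \<Rightarrow> (real \<Rightarrow> real \<Rightarrow> 'a \<Rightarrow> real^'m^'m) \<Rightarrow> bool" where
  "prop_ii M F \<longleftrightarrow>
     (\<forall>\<Delta>>0.
       (\<forall>s::nat \<Rightarrow> real. 0 \<le> s 0 \<and> (\<forall>k. s k + \<Delta> \<le> s (Suc k)) \<longrightarrow>
          prob_space.indep_vars M (\<lambda>_. borel) (\<lambda>k. F (s k) (s k + \<Delta>)) UNIV) \<and>
       (\<forall>s u. 0 \<le> s \<and> s + \<Delta> \<le> u \<longrightarrow>
          distr M borel (F s (s + \<Delta>)) = distr M borel (F u (u + \<Delta>))))"

text \<open>
  The next two conditions are used only for the process that also evaluates \<open>F(t\<^sub>k, t)\<close>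
  between grid points \<open>t\<^sub>k\<close>, where \<^const>\<open>prop_ii\<close> does not relate \<open>F(t\<^sub>k, t)\<close> to the preceding
  factors and where the mean square smallness of \<^const>\<open>small_o\<close>, for each fixed pair of times,
  does not bound a supremum over \<open>t\<close>. The flow itself satisfies both.

  The first one: \<open>F(s,\<cdot>)\<close> together with the Wiener increments after time \<open>s\<close> is independent
  of the past at time \<open>s\<close>.
\<close>

definition independent_of_past ::
    "'a measure \<Rightarrow> (real \<Rightarrow> 'a measure) \<Rightarrow> (real \<Rightarrow> 'a \<Rightarrow> real) \<Rightarrow>
     (real \<Rightarrow> real \<Rightarrow> 'a \<Rightarrow> real^'m^'m) \<Rightarrow> bool" where
  "independent_of_past M \<FF> \<xi> F \<longleftrightarrow>
     (\<forall>s\<ge>0. prob_space.indep_set M (sets (\<FF> s))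
        (sigma_sets (space M) (\<Union>\<tau>\<in>{s..}.
           sets (vimage_algebra (space M) (\<lambda>\<omega>. (F s \<tau> \<omega>, \<xi> \<tau> \<omega> - \<xi> s \<omega>)) borel))))"

text \<open>
  The second one: right-continuous paths, and a running supremum of
  \<open>F(s,\<tau>) - 1 - (\<xi>\<^sub>\<tau> - \<xi>\<^sub>s) B\<close> whose second moment over \<open>[s, s + h]\<close> is \<open>o(h)\<close>, locally
  uniformly in \<open>s\<close>. For the flow it is \<open>O(h\<^sup>2)\<close>.
\<close>

definition path_regular ::
    "'a measure \<Rightarrow> (real \<Rightarrow> 'a \<Rightarrow> real) \<Rightarrow>
     real^'m^'m \<Rightarrow> (real \<Rightarrow> real \<Rightarrow> 'a \<Rightarrow> real^'m^'m) \<Rightarrow> bool" where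
  "path_regular M \<xi> B F \<longleftrightarrow>
     (\<forall>s\<ge>0. AE \<omega> in M. \<forall>\<tau>\<ge>s. continuous (at_right \<tau>) (\<lambda>u. F s u \<omega>)) \<and>
     (\<forall>K. \<forall>e>0. \<forall>\<^sub>F h in at_right 0. \<forall>s\<in>{0..K}.
        (\<integral>\<^sup>+\<omega>. (SUP \<tau>\<in>{s..s + h}.
            ennreal ((norm (F s \<tau> \<omega> - mat 1 - (\<xi> \<tau> \<omega> - \<xi> s \<omega>) *\<^sub>R B))\<^sup>2)) \<partial>M)
          \<le> ennreal (e * h))"


section \<open>The product approximations\<close>

text \<open>\<open>mprod H n = H (n - 1) ** \<dots> ** H 0\<close>\<close>

primrec mprod :: "(nat \<Rightarrow> real^'m^'m) \<Rightarrow> nat \<Rightarrow> real^'m^'m" where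
  "mprod H 0 = mat 1"
| "mprod H (Suc n) = H n ** mprod H n"

definition f_approx ::
    "(real \<Rightarrow> real \<Rightarrow> 'a \<Rightarrow> real^'m^'m) \<Rightarrow> nat \<Rightarrow> real \<Rightarrow> real \<Rightarrow> 'a \<Rightarrow> real^'m^'m" where
  "f_approx F n T t \<omega> =
     mprod (\<lambda>k. F (real k / real n * T) (real (k + 1) / real n * T) \<omega>) (nat \<lfloor>real n * t / T\<rfloor>)"

definition g_approx ::
    "(real \<Rightarrow> real \<Rightarrow> 'a \<Rightarrow> real^'m^'m) \<Rightarrow> nat \<Rightarrow> real \<Rightarrow> real \<Rightarrow> 'a \<Rightarrow> real^'m^'m" where
  "g_approx F n T t \<omega> =
     F (of_int \<lfloor>real n * t / T\<rfloor> * (T / real n)) t \<omega> ** f_approx F n T t \<omega>"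

definition mean_sup_sq ::
    "'a measure \<Rightarrow> real \<Rightarrow> (real \<Rightarrow> 'a \<Rightarrow> real^'m^'m) \<Rightarrow> ennreal" where
  "mean_sup_sq M T X = (\<integral>\<^sup>+\<omega>. (SUP t\<in>{0..T}. ennreal ((norm (X t \<omega>))\<^sup>2)) \<partial>M)"

end

theory Submission
  imports Defs
begin

text \<open>
  A product of factors, and likewise the flow sampled on a grid of mesh \<open>h\<close>, solves a perturbed linear
  difference equation \<open>Y\<^sub>j\<^sub>+\<^sub>1 = Y\<^sub>j + h A Y\<^sub>j + G\<^sub>j Y\<^sub>j + a\<^sub>j + m\<^sub>j\<close> with \<open>G\<^sub>j\<close> centered and independent of the
  past; for the flow \<open>G\<^sub>j\<close> is \<open>B\<close> times a Wiener increment. Doob's inequality and Gronwall's lemma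
  bound the distance to the Euler scheme that freezes \<open>Y\<close> over blocks of \<open>b\<close> steps by a multiple
  of \<open>b h + o(1)\<close>.

  In b) factors and flow are driven by the same noise, so \<open>b = 1\<close> suffices, and the gaps between grid
  points are controlled by \<^const>\<open>path_regular\<close>.

  In a) the factors need not be independent of the past of \<open>\<xi>\<close>, so that the schemes driven
  by the centered factors and by \<open>B d\<xi>\<close> are martingales for different filtrations only. They are compared
  over a fixed number \<open>N\<close> of blocks: within a block a frozen scheme depends on its noise only through
  partial sums, which are close in mean square, and truncation together with the fourth moments
  of the Wiener scheme replaces the missing independence. Letting first \<open>n \<rightarrow> \<infinity>\<close> and then
  \<open>N \<rightarrow> \<infinity>\<close> gives the claim.
\<close>

text \<open>Two scales govern every estimate: over about T/h steps, drift errors of mean square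
  o(h^2) accumulate through Cauchy-Schwarz, and centered errors orthogonal to the past need only
  mean square o(h) because they add up by Pythagoras. In b) orthogonality is at hand; only the mean
  of the remainder must be o(h). In a) the centered factor and its Wiener counterpart differ in mean
  square by o(h^2), so their partial sums are close by the triangle inequality alone. The difficulty
  is multiplication by the current state: the difference of the two noises need not be independent
  of the past state, so products of two square integrable variables cannot be estimated directly.
  Freezing the state makes the factors of a block add instead of multiply; a bounded state can then
  be pulled out. Truncation supplies the bound at the price of a tail, which the fourth moment of
  the Wiener scheme controls. The bound on this moment is geometric in the number of blocks but free
  of the mesh, hence the order of the limits. All constants of the Gronwall step are uniform in the
  mesh, the block length and the filtration.\<close>

section \<open>Matrix products in the Frobenius norm\<close>

text \<open>Adjointness in the Frobenius inner product: a past-measurable right factor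
  \<open>W\<close> moves to the test variable, so that orthogonality of \<open>G ** W\<close> to the
  past reduces to orthogonality of \<open>G\<close>.\<close>

lemma matrix_mult_inner_transpose:
  fixes X G W :: "real^'m^'m"
  shows "X \<bullet> (G ** W) = (X ** transpose W) \<bullet> G"
proof -
  have "X \<bullet> (G ** W) = (\<Sum>i\<in>UNIV. \<Sum>j\<in>UNIV. \<Sum>k\<in>UNIV. X $ i $ j * (G $ i $ k * W $ k $ j))"
    by (simp add: inner_vec_def matrix_matrix_mult_def sum_distrib_left)
  also have "\<dots> = (\<Sum>i\<in>UNIV. \<Sum>k\<in>UNIV. \<Sum>j\<in>UNIV. X $ i $ j * (G $ i $ k * W $ k $ j))"
    by (intro sum.cong refl sum.swap)
  also have "\<dots> = (X ** transpose W) \<bullet> G"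
    by (simp add: inner_vec_def matrix_matrix_mult_def transpose_def sum_distrib_right sum_distrib_left mult_ac)
  finally show ?thesis .
qed

lemma norm_matrix_sq: "(norm (A :: real^'m^'n))\<^sup>2 = (\<Sum>i\<in>UNIV. \<Sum>j\<in>UNIV. (A $ i $ j)\<^sup>2)"
  unfolding power2_norm_eq_inner by (simp add: inner_vec_def power2_eq_square)

lemma norm_matrix_mult_le:
  fixes A B :: "real^'m^'m"
  shows "norm (A ** B) \<le> norm A * norm B"
proof (rule power2_le_imp_le)
  have "(norm (A ** B))\<^sup>2 = (\<Sum>i\<in>UNIV. \<Sum>j\<in>UNIV. (\<Sum>k\<in>UNIV. A $ i $ k * B $ k $ j)\<^sup>2)"
    by (simp add: norm_matrix_sq matrix_matrix_mult_def)
  also have "\<dots> \<le> (\<Sum>i\<in>UNIV. \<Sum>j\<in>UNIV. (\<Sum>k\<in>UNIV. (A $ i $ k)\<^sup>2) * (\<Sum>k\<in>UNIV. (B $ k $ j)\<^sup>2))"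
    by (intro sum_mono Cauchy_Schwarz_ineq_sum)
  also have "\<dots> = (\<Sum>i\<in>UNIV. \<Sum>k\<in>UNIV. (A $ i $ k)\<^sup>2) * (\<Sum>j\<in>UNIV. \<Sum>k\<in>UNIV. (B $ k $ j)\<^sup>2)"
    by (rule sum_product[symmetric])
  also have "(\<Sum>j\<in>UNIV. \<Sum>k\<in>UNIV. (B $ k $ j)\<^sup>2) = (norm B)\<^sup>2"
    by (subst sum.swap) (simp add: norm_matrix_sq)
  finally show "(norm (A ** B))\<^sup>2 \<le> (norm A * norm B)\<^sup>2"
    by (simp add: norm_matrix_sq power_mult_distrib)
qed simp

lemma bounded_bilinear_matrix_mult:
  "bounded_bilinear ((**) :: real^'m^'m \<Rightarrow> real^'m^'m \<Rightarrow> real^'m^'m)"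
proof (unfold_locales, goal_cases)
  case 5 then show ?case
    by (intro exI[of _ 1]) (simp add: norm_matrix_mult_le)
qed (simp_all add: matrix_add_ldistrib matrix_matrix_mult_def vec_eq_iff sum.distrib sum_distrib_left
      algebra_simps)

lemmas mm_simps = bounded_bilinear.add_left[OF bounded_bilinear_matrix_mult]
  bounded_bilinear.add_right[OF bounded_bilinear_matrix_mult]
  bounded_bilinear.diff_left[OF bounded_bilinear_matrix_mult]
  bounded_bilinear.diff_right[OF bounded_bilinear_matrix_mult]
  bounded_bilinear.minus_left[OF bounded_bilinear_matrix_mult]
  bounded_bilinear.minus_right[OF bounded_bilinear_matrix_mult]
  bounded_bilinear.scaleR_left[OF bounded_bilinear_matrix_mult]
  bounded_bilinear.scaleR_right[OF bounded_bilinear_matrix_mult]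

lemma borel_measurable_matrix_mult[measurable (raw)]:
  fixes f g :: "'a \<Rightarrow> real^'m^'m"
  assumes "f \<in> borel_measurable M" "g \<in> borel_measurable M"
  shows "(\<lambda>x. f x ** g x) \<in> borel_measurable M"
  by (rule borel_measurable_continuous_Pair[OF assms])
     (intro bounded_bilinear.continuous_on[OF bounded_bilinear_matrix_mult] continuous_intros)

lemma norm_transpose: "norm (transpose A :: real^'m^'m) = norm A"
proof -
  have "(norm (transpose A))\<^sup>2 = (norm A)\<^sup>2"
    unfolding norm_matrix_sq by (subst sum.swap) (simp add: transpose_def)
  then show ?thesis by simp
qed

lemma borel_measurable_transpose[measurable (raw)]:
  fixes f :: "'a \<Rightarrow> real^'m^'m"
  assumes "f \<in> borel_measurable M"
  shows "(\<lambda>x. transpose (f x)) \<in> borel_measurable M"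
proof -
  have "bounded_linear (transpose :: real^'m^'m \<Rightarrow> _)"
    by (rule bounded_linear_intro[where K=1])
       (simp_all add: norm_transpose, simp_all add: transpose_def vec_eq_iff)
  then have "continuous_on UNIV (transpose :: real^'m^'m \<Rightarrow> _)"
    by (rule linear_continuous_on)
  then show ?thesis by (rule borel_measurable_continuous_on) (rule assms)
qed

lemma power2_norm_add_le: "(norm (x + y))\<^sup>2 \<le> 2 * (norm x)\<^sup>2 + 2 * (norm y)\<^sup>2"
proof -
  have "(norm (x + y))\<^sup>2 \<le> (norm x + norm y)\<^sup>2"
    by (simp add: norm_triangle_ineq power_mono)
  also have "\<dots> \<le> 2 * (norm x)\<^sup>2 + 2 * (norm y)\<^sup>2"
    using sum_squares_bound[of "norm x" "norm y"] by (simp add: power2_sum)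
  finally show ?thesis .
qed

lemma power2_norm_diff_le: "(norm (x - y))\<^sup>2 \<le> 2 * (norm x)\<^sup>2 + 2 * (norm y)\<^sup>2"
  using power2_norm_add_le[of x "- y"] by simp

lemma power2_add_le: "(x + y)\<^sup>2 \<le> 2 * x\<^sup>2 + 2 * (y::real)\<^sup>2"
  using sum_squares_bound[of x y] by (simp add: power2_sum)

lemma power2_sum_le:
  fixes f :: "'i \<Rightarrow> real" assumes "finite I"
  shows "(\<Sum>i\<in>I. f i)\<^sup>2 \<le> card I * (\<Sum>i\<in>I. (f i)\<^sup>2)"
  using Cauchy_Schwarz_ineq_sum[of f "\<lambda>_. 1" I] by (simp add: mult.commute)

lemma power2_norm_sum_le:
  fixes f :: "'i \<Rightarrow> 'b::real_normed_vector" assumes "finite I"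
  shows "(norm (\<Sum>i\<in>I. f i))\<^sup>2 \<le> card I * (\<Sum>i\<in>I. (norm (f i))\<^sup>2)"
proof -
  have "(norm (\<Sum>i\<in>I. f i))\<^sup>2 \<le> (\<Sum>i\<in>I. norm (f i))\<^sup>2"
    by (intro power_mono norm_sum) simp
  also have "\<dots> \<le> card I * (\<Sum>i\<in>I. (norm (f i))\<^sup>2)"
    by (rule power2_sum_le[OF assms])
  finally show ?thesis .
qed

section \<open>Square integrable random variables\<close>

lemma L2_measurable[measurable_dest]: "L2 M X \<Longrightarrow> X \<in> borel_measurable M"
  by (simp add: L2_def)

lemma L2_integrable_sq: "L2 M X \<Longrightarrow> integrable M (\<lambda>\<omega>. (norm (X \<omega>))\<^sup>2)"
  by (simp add: L2_def)

lemma L2_dominated: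
  assumes "X \<in> borel_measurable M" "integrable M f" "AE \<omega> in M. (norm (X \<omega>))\<^sup>2 \<le> f \<omega>"
  shows "L2 M X"
  unfolding L2_def
proof
  show "integrable M (\<lambda>\<omega>. (norm (X \<omega>))\<^sup>2)"
    by (rule Bochner_Integration.integrable_bound[OF assms(2)]) (use assms in auto)
qed fact

lemma L2_zero[simp]: "L2 M (\<lambda>_. 0)"
  by (simp add: L2_def)

lemma L2_add: assumes "L2 M X" "L2 M Y" shows "L2 M (\<lambda>\<omega>. X \<omega> + Y \<omega>)"
  by (rule L2_dominated[where f="\<lambda>\<omega>. 2 * (norm (X \<omega>))\<^sup>2 + 2 * (norm (Y \<omega>))\<^sup>2"])
     (use assms in \<open>auto simp: L2_def power2_norm_add_le\<close>)

lemma L2_scaleR: assumes "L2 M X" shows "L2 M (\<lambda>\<omega>. c *\<^sub>R X \<omega>)"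
  using assms by (auto simp: L2_def power_mult_distrib)

lemma L2_uminus: assumes "L2 M X" shows "L2 M (\<lambda>\<omega>. - X \<omega>)"
  using assms by (auto simp: L2_def)

lemma L2_diff: assumes "L2 M X" "L2 M Y" shows "L2 M (\<lambda>\<omega>. X \<omega> - Y \<omega>)"
  using L2_add[OF assms(1) L2_uminus[OF assms(2)]] by simp

lemma L2_sum: assumes "\<And>i. i \<in> I \<Longrightarrow> L2 M (X i)" shows "L2 M (\<lambda>\<omega>. \<Sum>i\<in>I. X i \<omega>)"
  using assms by (induction I rule: infinite_finite_induct) (auto intro: L2_add)

lemma L2_norm_iff: "X \<in> borel_measurable M \<Longrightarrow> L2 M (\<lambda>\<omega>. norm (X \<omega>)) \<longleftrightarrow> L2 M X"
  by (simp add: L2_def)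

lemma L2_matrix_const_left:
  fixes A :: "real^'m^'m" and X :: "'a \<Rightarrow> real^'m^'m"
  assumes "L2 M X" shows "L2 M (\<lambda>\<omega>. A ** X \<omega>)"
proof (rule L2_dominated[where f="\<lambda>\<omega>. (norm A)\<^sup>2 * (norm (X \<omega>))\<^sup>2"])
  show "AE \<omega> in M. (norm (A ** X \<omega>))\<^sup>2 \<le> (norm A)\<^sup>2 * (norm (X \<omega>))\<^sup>2"
    using norm_matrix_mult_le[of A] by (auto intro!: power_mono AE_I2 simp: power_mult_distrib[symmetric])
qed (use assms in \<open>auto simp: L2_def\<close>)

lemma (in finite_measure) L2_const[simp]: "L2 M (\<lambda>_. c)"
  by (simp add: L2_def)

lemma L2_inner_integrable:
  assumes "L2 M X" "L2 M Y" shows "integrable M (\<lambda>\<omega>. X \<omega> \<bullet> Y \<omega>)"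
proof (rule Bochner_Integration.integrable_bound)
  show "integrable M (\<lambda>\<omega>. (norm (X \<omega>))\<^sup>2 + (norm (Y \<omega>))\<^sup>2)"
    using assms by (auto simp: L2_def)
  show "AE \<omega> in M. norm (X \<omega> \<bullet> Y \<omega>) \<le> norm ((norm (X \<omega>))\<^sup>2 + (norm (Y \<omega>))\<^sup>2)"
  proof (intro AE_I2)
    fix \<omega>
    have "norm (X \<omega> \<bullet> Y \<omega>) \<le> norm (X \<omega>) * norm (Y \<omega>)"
      by (simp add: Cauchy_Schwarz_ineq2)
    also have "2 * (norm (X \<omega>) * norm (Y \<omega>)) \<le> (norm (X \<omega>))\<^sup>2 + (norm (Y \<omega>))\<^sup>2"
      using sum_squares_bound[of "norm (X \<omega>)" "norm (Y \<omega>)"] by simp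
    finally show "norm (X \<omega> \<bullet> Y \<omega>) \<le> norm ((norm (X \<omega>))\<^sup>2 + (norm (Y \<omega>))\<^sup>2)"
      by (smt (verit) mult_nonneg_nonneg norm_ge_zero real_norm_def)
  qed
qed (use assms in \<open>auto simp: L2_def\<close>)

lemma L2_mult_integrable:
  fixes X Y :: "'a \<Rightarrow> real"
  assumes "L2 M X" "L2 M Y" shows "integrable M (\<lambda>\<omega>. X \<omega> * Y \<omega>)"
  using L2_inner_integrable[OF assms] by simp

lemma L2_integrable: assumes "finite_measure M" "L2 M X" shows "integrable M X"
proof -
  interpret finite_measure M by fact
  show ?thesis
    using L2_mult_integrable[of M "\<lambda>\<omega>. norm (X \<omega>)" "\<lambda>_. 1"] assms
    by (simp add: L2_norm_iff L2_measurable integrable_norm_iff)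
qed

lemma integral_power2_norm_add_le:
  assumes "L2 M X" "L2 M Y"
  shows "(\<integral>\<omega>. (norm (X \<omega> + Y \<omega>))\<^sup>2 \<partial>M) \<le> 2 * (\<integral>\<omega>. (norm (X \<omega>))\<^sup>2 \<partial>M) + 2 * (\<integral>\<omega>. (norm (Y \<omega>))\<^sup>2 \<partial>M)"
proof -
  have "(\<integral>\<omega>. (norm (X \<omega> + Y \<omega>))\<^sup>2 \<partial>M) \<le> (\<integral>\<omega>. 2 * (norm (X \<omega>))\<^sup>2 + 2 * (norm (Y \<omega>))\<^sup>2 \<partial>M)"
    using assms L2_add[OF assms]
    by (intro integral_mono) (auto simp: L2_def power2_norm_add_le)
  also have "\<dots> = 2 * (\<integral>\<omega>. (norm (X \<omega>))\<^sup>2 \<partial>M) + 2 * (\<integral>\<omega>. (norm (Y \<omega>))\<^sup>2 \<partial>M)"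
    using assms by (subst Bochner_Integration.integral_add) (auto simp: L2_def)
  finally show ?thesis .
qed

lemma integral_power2_norm_diff_le:
  assumes "L2 M X" "L2 M Y"
  shows "(\<integral>\<omega>. (norm (X \<omega> - Y \<omega>))\<^sup>2 \<partial>M) \<le> 2 * (\<integral>\<omega>. (norm (X \<omega>))\<^sup>2 \<partial>M) + 2 * (\<integral>\<omega>. (norm (Y \<omega>))\<^sup>2 \<partial>M)"
  using integral_power2_norm_add_le[OF assms(1) L2_uminus[OF assms(2)]] by simp

lemma integral_power2_norm_sum_le:
  assumes "finite I" "\<And>i. i \<in> I \<Longrightarrow> L2 M (X i)"
  shows "(\<integral>\<omega>. (norm (\<Sum>i\<in>I. X i \<omega>))\<^sup>2 \<partial>M) \<le> card I * (\<Sum>i\<in>I. \<integral>\<omega>. (norm (X i \<omega>))\<^sup>2 \<partial>M)"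
proof -
  have "(\<integral>\<omega>. (norm (\<Sum>i\<in>I. X i \<omega>))\<^sup>2 \<partial>M) \<le> (\<integral>\<omega>. card I * (\<Sum>i\<in>I. (norm (X i \<omega>))\<^sup>2) \<partial>M)"
    using assms L2_sum[of I M X]
    by (intro integral_mono power2_norm_sum_le) (auto simp: L2_def)
  also have "\<dots> = card I * (\<Sum>i\<in>I. \<integral>\<omega>. (norm (X i \<omega>))\<^sup>2 \<partial>M)"
    using assms by (simp add: L2_def Bochner_Integration.integral_sum)
  finally show ?thesis .
qed

text \<open>The mean of the square of \<open>t * X + Y\<close> is a nonnegative quadratic in
  \<open>t\<close>, so its discriminant cannot be positive.\<close>

lemma L2_Cauchy_Schwarz:
  fixes X Y :: "'a \<Rightarrow> real"
  assumes "L2 M X" "L2 M Y"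
  shows "(\<integral>\<omega>. X \<omega> * Y \<omega> \<partial>M)\<^sup>2 \<le> (\<integral>\<omega>. (X \<omega>)\<^sup>2 \<partial>M) * (\<integral>\<omega>. (Y \<omega>)\<^sup>2 \<partial>M)"
proof -
  define a b c where "a = (\<integral>\<omega>. (X \<omega>)\<^sup>2 \<partial>M)" "b = (\<integral>\<omega>. X \<omega> * Y \<omega> \<partial>M)" "c = (\<integral>\<omega>. (Y \<omega>)\<^sup>2 \<partial>M)"
  have i: "integrable M (\<lambda>\<omega>. (X \<omega>)\<^sup>2)" "integrable M (\<lambda>\<omega>. (Y \<omega>)\<^sup>2)" "integrable M (\<lambda>\<omega>. X \<omega> * Y \<omega>)"
    using assms by (auto simp: L2_def L2_mult_integrable)
  have *: "0 \<le> a * t\<^sup>2 + 2 * b * t + c" for t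
  proof -
    have "0 \<le> (\<integral>\<omega>. (t * X \<omega> + Y \<omega>)\<^sup>2 \<partial>M)" by simp
    also have "(\<lambda>\<omega>. (t * X \<omega> + Y \<omega>)\<^sup>2) = (\<lambda>\<omega>. (X \<omega>)\<^sup>2 * t\<^sup>2 + (X \<omega> * Y \<omega>) * (2 * t) + (Y \<omega>)\<^sup>2)"
      by (simp add: fun_eq_iff power2_eq_square algebra_simps)
    also have "(\<integral>\<omega>. (X \<omega>)\<^sup>2 * t\<^sup>2 + (X \<omega> * Y \<omega>) * (2 * t) + (Y \<omega>)\<^sup>2 \<partial>M) = a * t\<^sup>2 + b * (2 * t) + c"
      using i by (simp add: a_b_c_def)
    finally show ?thesis by (simp add: mult_ac)
  qed
  have a0: "a \<ge> 0" "c \<ge> 0" by (auto simp: a_b_c_def)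
  show ?thesis unfolding a_b_c_def[symmetric]
  proof (cases "a = 0")
    case True
    have "b = 0"
    proof (rule ccontr)
      assume "b \<noteq> 0"
      \<comment> \<open>With leading coefficient 0 the quadratic is affine; at this point its value
        would be -1.\<close>
      with *[of "- (c + 1) / (2 * b)"] True show False by (simp add: field_simps)
    qed
    with True show "b\<^sup>2 \<le> a * c" by simp
  next
    case False
    then have "a > 0" using a0 by simp
    \<comment> \<open>The point \<open>- b / a\<close> minimises the quadratic.\<close>
    have "0 \<le> a * (a * (- b / a)\<^sup>2 + 2 * b * (- b / a) + c)"
      using *[of "- b / a"] \<open>a > 0\<close> by (intro mult_nonneg_nonneg) auto
    also have "\<dots> = a * c - b\<^sup>2" using \<open>a > 0\<close> by (simp add: field_simps power2_eq_square)
    finally show "b\<^sup>2 \<le> a * c" by simp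
  qed
qed

lemma L2_cong_AE:
  assumes "L2 M X" "Y \<in> borel_measurable M" "AE \<omega> in M. X \<omega> = Y \<omega>" shows "L2 M Y"
  by (rule L2_dominated[OF assms(2) L2_integrable_sq[OF assms(1)]]) (use assms(3) in auto)

section \<open>Running maxima\<close>

text \<open>A maximum over finitely many indices is attained and measurable, so suprema over a
  continuum enter only through limits of dyadic grids.\<close>

definition maxn :: "(nat \<Rightarrow> 'a \<Rightarrow> 'b::real_normed_vector) \<Rightarrow> nat \<Rightarrow> 'a \<Rightarrow> real" where
  "maxn X j \<omega> = Max ((\<lambda>i. norm (X i \<omega>)) ` {..j})"

lemma maxn_ge: "i \<le> j \<Longrightarrow> norm (X i \<omega>) \<le> maxn X j \<omega>"
  by (simp add: maxn_def)

lemma maxn_leI: "(\<And>i. i \<le> j \<Longrightarrow> norm (X i \<omega>) \<le> c) \<Longrightarrow> maxn X j \<omega> \<le> c"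
  by (auto simp: maxn_def)

lemma maxn_nonneg[simp]: "0 \<le> maxn X j \<omega>"
  by (rule order_trans[OF norm_ge_zero maxn_ge[of 0]]) simp

lemma maxn_0[simp]: "maxn X 0 \<omega> = norm (X 0 \<omega>)"
  by (simp add: maxn_def)

lemma maxn_Suc: "maxn X (Suc j) \<omega> = max (maxn X j \<omega>) (norm (X (Suc j) \<omega>))"
  by (simp add: maxn_def atMost_Suc max.commute)

lemma maxn_sq_leI:
  assumes "\<And>i. i \<le> j \<Longrightarrow> (norm (X i \<omega>))\<^sup>2 \<le> c"
  shows "(maxn X j \<omega>)\<^sup>2 \<le> c"
proof -
  have "maxn X j \<omega> \<in> (\<lambda>i. norm (X i \<omega>)) ` {..j}" unfolding maxn_def by (rule Max_in) auto
  with assms show ?thesis by auto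
qed

lemma maxn_measurable[measurable]:
  "(\<And>i. i \<le> j \<Longrightarrow> X i \<in> borel_measurable M) \<Longrightarrow> maxn X j \<in> borel_measurable M"
proof (induction j)
  case 0
  then have "(\<lambda>\<omega>. norm (X 0 \<omega>)) \<in> borel_measurable M" by simp
  then show ?case by (simp add: maxn_def[abs_def])
next
  case (Suc j)
  have "(\<lambda>\<omega>. max (maxn X j \<omega>) (norm (X (Suc j) \<omega>))) \<in> borel_measurable M"
    using Suc.prems[of "Suc j"] by (intro borel_measurable_max Suc.IH Suc.prems borel_measurable_norm) auto
  moreover have "maxn X (Suc j) = (\<lambda>\<omega>. max (maxn X j \<omega>) (norm (X (Suc j) \<omega>)))"
    by (simp add: fun_eq_iff maxn_Suc)
  ultimately show ?case by simp
qed

lemma maxn_L2: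
  assumes "\<And>i. i \<le> j \<Longrightarrow> L2 M (X i)" shows "L2 M (maxn X j)"
proof (rule L2_dominated[where f="\<lambda>\<omega>. \<Sum>i\<le>j. (norm (X i \<omega>))\<^sup>2"])
  show "AE \<omega> in M. (norm (maxn X j \<omega>))\<^sup>2 \<le> (\<Sum>i\<le>j. (norm (X i \<omega>))\<^sup>2)"
    by (auto intro!: AE_I2 maxn_sq_leI member_le_sum)
qed (use assms in \<open>auto simp: L2_def intro!: maxn_measurable\<close>)

section \<open>Independence of a sub-sigma-algebra and martingale differences\<close>

text \<open>Independence is stated against a whole sigma-algebra because the past is given as a
  filtration and not as generated by one variable; this is also the form in
  \<open>wiener_process\<close>.\<close>

definition indep_of :: "'a measure \<Rightarrow> 'a measure \<Rightarrow> ('a \<Rightarrow> 'b::topological_space) \<Rightarrow> bool" where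
  "indep_of M G U \<longleftrightarrow> U \<in> borel_measurable M \<and>
     prob_space.indep_set M (sets G) (sets (vimage_algebra (space M) U borel))"

text \<open>Orthogonality to all square integrable \<open>G\<close>-measurable variables, in place of a vanishing
  conditional expectation given \<open>G\<close>.\<close>

definition mart_diff :: "'a measure \<Rightarrow> 'a measure \<Rightarrow> ('a \<Rightarrow> 'b::euclidean_space) \<Rightarrow> bool" where
  "mart_diff M G U \<longleftrightarrow> L2 M U \<and>
     (\<forall>X. X \<in> borel_measurable G \<longrightarrow> L2 M X \<longrightarrow> (\<integral>\<omega>. X \<omega> \<bullet> U \<omega> \<partial>M) = 0)"

lemma subalgebra_measurable:
  "subalgebra M G \<Longrightarrow> X \<in> measurable G N \<Longrightarrow> X \<in> measurable M N"
  by (rule measurable_from_subalg)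

lemma (in prob_space) indep_set_mono:
  assumes "indep_set A B" "A' \<subseteq> A" "B' \<subseteq> B" shows "indep_set A' B'"
  using assms(1) unfolding indep_set_def
  by (rule indep_sets_mono_sets) (use assms in \<open>auto split: bool.splits\<close>)

text \<open>The sigma-algebra generated by \<open>f\<close> of \<open>U\<close> is contained in the
  one generated by \<open>U\<close>.\<close>

lemma indep_of_compose:
  assumes "prob_space M" "indep_of M G U" "f \<in> borel_measurable borel"
  shows "indep_of M G (\<lambda>\<omega>. f (U \<omega>))"
proof -
  interpret prob_space M by fact
  have [measurable]: "U \<in> borel_measurable M" and i: "indep_set (sets G) (sets (vimage_algebra (space M) U borel))"
    using assms(2) by (auto simp: indep_of_def)
  have "sets (vimage_algebra (space M) (\<lambda>\<omega>. f (U \<omega>)) borel) \<subseteq> sets (vimage_algebra (space M) U borel)"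
  proof (intro sets_vimage_algebra2[THEN equalityD1, THEN order_trans])
    show "(\<lambda>\<omega>. f (U \<omega>)) \<in> space M \<rightarrow> space borel" by simp
    show "{(\<lambda>\<omega>. f (U \<omega>)) -` A \<inter> space M |A. A \<in> sets borel} \<subseteq> sets (vimage_algebra (space M) U borel)"
    proof safe
      fix A :: "'c set" assume "A \<in> sets borel"
      then have "f -` A \<inter> space borel \<in> sets borel" by (rule measurable_sets[OF assms(3)])
      then have "U -` (f -` A) \<inter> space M \<in> sets (vimage_algebra (space M) U borel)"
        by (intro in_vimage_algebra) simp
      then show "(\<lambda>\<omega>. f (U \<omega>)) -` A \<inter> space M \<in> sets (vimage_algebra (space M) U borel)"
        by (simp add: vimage_def)
    qed
  qed
  from indep_set_mono[OF i order_refl this] show ?thesis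
    using assms(3) by (auto simp: indep_of_def)
qed

text \<open>A \<open>G\<close>-measurable \<open>X\<close> generates a sub-sigma-algebra of
  \<open>G\<close>; this gives access to the product formulas for pairs of independent
  variables.\<close>

lemma indep_of_indep_var:
  assumes "prob_space M" "subalgebra M G" "indep_of M G U" "X \<in> borel_measurable G"
  shows "prob_space.indep_var M borel X borel U"
proof -
  interpret prob_space M by fact
  have s: "space G = space M" using assms(2) by (simp add: subalgebra_def)
  have *: "sigma_sets (space M) {X -` A \<inter> space M |A. A \<in> sets borel} \<subseteq> sets G"
  proof (rule sets.sigma_sets_subset')
    show "{X -` A \<inter> space M |A. A \<in> sets borel} \<subseteq> sets G"
      using measurable_sets[OF assms(4)] by (auto simp: s)
  qed (metis s sets.top)
  have **: "sigma_sets (space M) {U -` A \<inter> space M |A. A \<in> sets borel} = sets (vimage_algebra (space M) U borel)"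
    by (simp add: sets_vimage_algebra)
  show ?thesis unfolding indep_var_eq **
    using assms indep_set_mono[OF _ * order_refl] subalgebra_measurable[OF assms(2,4)]
    by (auto simp: indep_of_def)
qed

lemma indep_of_integral_mult:
  fixes U X :: "'a \<Rightarrow> real"
  assumes "prob_space M" "subalgebra M G" "indep_of M G U" "X \<in> borel_measurable G"
    "integrable M X" "integrable M U"
  shows "integrable M (\<lambda>\<omega>. X \<omega> * U \<omega>)"
    "(\<integral>\<omega>. X \<omega> * U \<omega> \<partial>M) = (\<integral>\<omega>. X \<omega> \<partial>M) * (\<integral>\<omega>. U \<omega> \<partial>M)"
proof -
  interpret prob_space M by fact
  note i = indep_of_indep_var[OF assms(1-4)]
  show "integrable M (\<lambda>\<omega>. X \<omega> * U \<omega>)"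
    "(\<integral>\<omega>. X \<omega> * U \<omega> \<partial>M) = (\<integral>\<omega>. X \<omega> \<partial>M) * (\<integral>\<omega>. U \<omega> \<partial>M)"
    using indep_var_integrable[OF i] indep_var_lebesgue_integral[OF i] assms by auto
qed

text \<open>The extended real version asks for no integrability; it serves running suprema and
  fourth moments, whose finiteness is a conclusion of the estimates.\<close>

lemma indep_of_nn_integral_mult:
  fixes U X :: "'a \<Rightarrow> ennreal"
  assumes "prob_space M" "subalgebra M G" "indep_of M G U" "X \<in> borel_measurable G"
  shows "(\<integral>\<^sup>+\<omega>. X \<omega> * U \<omega> \<partial>M) = (\<integral>\<^sup>+\<omega>. X \<omega> \<partial>M) * (\<integral>\<^sup>+\<omega>. U \<omega> \<partial>M)"
proof -
  interpret prob_space M by fact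
  have "indep_vars (\<lambda>_. borel) (case_bool X U) UNIV"
    using indep_of_indep_var[OF assms] unfolding indep_var_def
    by (rule indep_vars_cong[THEN iffD1, rotated -1]) (auto split: bool.splits)
  from indep_vars_nn_integral[OF _ this] show ?thesis by (simp add: UNIV_bool mult.commute)
qed

text \<open>The product formula in each coordinate. It is stated for integrable instead of square
  integrable \<open>X\<close> because the test variables of \<open>mart_diff_matrix_mult\<close> are
  products of two square integrable ones.\<close>

lemma integral_inner_indep_eq_0:
  fixes U X :: "'a \<Rightarrow> 'b::euclidean_space"
  assumes "prob_space M" "subalgebra M G" "indep_of M G U" "X \<in> borel_measurable G"
    "integrable M X" "integrable M U" "(\<integral>\<omega>. U \<omega> \<partial>M) = 0"
  shows "(\<integral>\<omega>. X \<omega> \<bullet> U \<omega> \<partial>M) = 0"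
proof -
  interpret prob_space M by fact
  have ind: "indep_of M G (\<lambda>\<omega>. U \<omega> \<bullet> b)" for b
    by (rule indep_of_compose[OF assms(1,3)]) simp
  have *: "integrable M (\<lambda>\<omega>. (X \<omega> \<bullet> b) * (U \<omega> \<bullet> b))" "(\<integral>\<omega>. (X \<omega> \<bullet> b) * (U \<omega> \<bullet> b) \<partial>M) = 0" for b
  proof -
    have "(\<integral>\<omega>. U \<omega> \<bullet> b \<partial>M) = (\<integral>\<omega>. U \<omega> \<partial>M) \<bullet> b"
      by (rule integral_inner_left) (use assms in simp)
    then show "integrable M (\<lambda>\<omega>. (X \<omega> \<bullet> b) * (U \<omega> \<bullet> b))" "(\<integral>\<omega>. (X \<omega> \<bullet> b) * (U \<omega> \<bullet> b) \<partial>M) = 0"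
      using indep_of_integral_mult[OF assms(1,2) ind, of "\<lambda>\<omega>. X \<omega> \<bullet> b" b] assms by auto
  qed
  have "(\<integral>\<omega>. X \<omega> \<bullet> U \<omega> \<partial>M) = (\<integral>\<omega>. (\<Sum>b\<in>Basis. (X \<omega> \<bullet> b) * (U \<omega> \<bullet> b)) \<partial>M)"
    by (subst euclidean_inner) simp
  also have "\<dots> = 0" using * by (subst Bochner_Integration.integral_sum) auto
  finally show ?thesis .
qed

lemma mart_diff_L2: "mart_diff M G U \<Longrightarrow> L2 M U"
  by (simp add: mart_diff_def)

lemma mart_diffD: "mart_diff M G U \<Longrightarrow> X \<in> borel_measurable G \<Longrightarrow> L2 M X \<Longrightarrow> (\<integral>\<omega>. X \<omega> \<bullet> U \<omega> \<partial>M) = 0"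
  by (simp add: mart_diff_def)

lemma mart_diff_zero[simp]: "mart_diff M G (\<lambda>_. 0)"
  by (simp add: mart_diff_def)

lemma mart_diff_add:
  assumes "mart_diff M G U" "mart_diff M G V" shows "mart_diff M G (\<lambda>\<omega>. U \<omega> + V \<omega>)"
  using assms by (auto simp: mart_diff_def L2_add inner_add_right L2_inner_integrable)

lemma mart_diff_uminus:
  assumes "mart_diff M G U" shows "mart_diff M G (\<lambda>\<omega>. - U \<omega>)"
  using assms by (auto simp: mart_diff_def L2_uminus)

lemma mart_diff_diff:
  assumes "mart_diff M G U" "mart_diff M G V" shows "mart_diff M G (\<lambda>\<omega>. U \<omega> - V \<omega>)"
  using mart_diff_add[OF assms(1) mart_diff_uminus[OF assms(2)]] by simp

lemma mart_diff_cong_AE: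
  fixes U V :: "'a \<Rightarrow> 'b::euclidean_space"
  assumes "mart_diff M G U" "V \<in> borel_measurable M" "AE \<omega> in M. U \<omega> = V \<omega>"
  shows "mart_diff M G V"
  unfolding mart_diff_def
proof (intro conjI allI impI)
  show "L2 M V" by (rule L2_cong_AE[OF mart_diff_L2[OF assms(1)] assms(2,3)])
  fix X :: "'a \<Rightarrow> 'b" assume X: "X \<in> borel_measurable G" "L2 M X"
  have "(\<integral>\<omega>. X \<omega> \<bullet> V \<omega> \<partial>M) = (\<integral>\<omega>. X \<omega> \<bullet> U \<omega> \<partial>M)"
    using assms(2,3) L2_measurable[OF mart_diff_L2[OF assms(1)]] L2_measurable[OF X(2)] by (intro integral_cong_AE) auto
  then show "(\<integral>\<omega>. X \<omega> \<bullet> V \<omega> \<partial>M) = 0" using mart_diffD[OF assms(1) X] by simp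
qed

text \<open>Submultiplicativity reduces the claim to the squared norms, whose expectation factorises
  by independence. This is how products of many square integrable factors stay square
  integrable.\<close>

lemma L2_matrix_mult_indep:
  fixes U W :: "'a \<Rightarrow> real^'m^'m"
  assumes "prob_space M" "subalgebra M G" "indep_of M G U" "L2 M U" "W \<in> borel_measurable G" "L2 M W"
  shows "L2 M (\<lambda>\<omega>. U \<omega> ** W \<omega>)"
    "(\<integral>\<omega>. (norm (U \<omega> ** W \<omega>))\<^sup>2 \<partial>M) \<le> (\<integral>\<omega>. (norm (U \<omega>))\<^sup>2 \<partial>M) * (\<integral>\<omega>. (norm (W \<omega>))\<^sup>2 \<partial>M)"
proof -
  have "indep_of M G (\<lambda>\<omega>. (norm (U \<omega>))\<^sup>2)"
    by (rule indep_of_compose[OF assms(1,3)]) simp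
  note * = indep_of_integral_mult[OF assms(1,2) this, of "\<lambda>\<omega>. (norm (W \<omega>))\<^sup>2"]
  have **: "integrable M (\<lambda>\<omega>. (norm (W \<omega>))\<^sup>2 * (norm (U \<omega>))\<^sup>2)"
    "(\<integral>\<omega>. (norm (W \<omega>))\<^sup>2 * (norm (U \<omega>))\<^sup>2 \<partial>M) = (\<integral>\<omega>. (norm (W \<omega>))\<^sup>2 \<partial>M) * (\<integral>\<omega>. (norm (U \<omega>))\<^sup>2 \<partial>M)"
    using * assms by (auto simp: L2_def)
  have le: "(norm (U \<omega> ** W \<omega>))\<^sup>2 \<le> (norm (W \<omega>))\<^sup>2 * (norm (U \<omega>))\<^sup>2" for \<omega>
    using power_mono[OF norm_matrix_mult_le[of "U \<omega>" "W \<omega>"], of 2] by (simp add: power_mult_distrib mult.commute)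
  show "L2 M (\<lambda>\<omega>. U \<omega> ** W \<omega>)"
    by (rule L2_dominated[OF _ **(1)]) (use assms le in \<open>auto simp: L2_def\<close>)
  then have "(\<integral>\<omega>. (norm (U \<omega> ** W \<omega>))\<^sup>2 \<partial>M) \<le> (\<integral>\<omega>. (norm (W \<omega>))\<^sup>2 * (norm (U \<omega>))\<^sup>2 \<partial>M)"
    by (intro integral_mono ** le) (auto simp: L2_def)
  then show "(\<integral>\<omega>. (norm (U \<omega> ** W \<omega>))\<^sup>2 \<partial>M) \<le> (\<integral>\<omega>. (norm (U \<omega>))\<^sup>2 \<partial>M) * (\<integral>\<omega>. (norm (W \<omega>))\<^sup>2 \<partial>M)"
    using ** by (simp add: mult.commute)
qed

lemma L2_norm_mult_integrable:
  assumes "L2 M X" "L2 M Y" shows "integrable M (\<lambda>\<omega>. norm (X \<omega>) * norm (Y \<omega>))"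
  by (rule L2_mult_integrable) (use assms in \<open>auto simp: L2_norm_iff L2_measurable\<close>)

lemma mart_diff_matrix_mult:
  fixes U W :: "'a \<Rightarrow> real^'m^'m"
  assumes "prob_space M" "subalgebra M G" "indep_of M G U" "L2 M U" "(\<integral>\<omega>. U \<omega> \<partial>M) = 0"
    "W \<in> borel_measurable G" "L2 M W"
  shows "mart_diff M G (\<lambda>\<omega>. U \<omega> ** W \<omega>)"
  unfolding mart_diff_def
proof (intro conjI allI impI L2_matrix_mult_indep[OF assms(1-4) assms(6,7)])
  interpret prob_space M by fact
  fix X :: "'a \<Rightarrow> real^'m^'m" assume X: "X \<in> borel_measurable G" "L2 M X"
  \<comment> \<open>After transposition the test variable is a product of two square integrable
    matrices, hence integrable by Cauchy-Schwarz.\<close>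
  have "integrable M (\<lambda>\<omega>. X \<omega> ** transpose (W \<omega>))"
  proof (rule Bochner_Integration.integrable_bound[OF L2_norm_mult_integrable[OF X(2) assms(7)]])
    show "AE \<omega> in M. norm (X \<omega> ** transpose (W \<omega>)) \<le> norm (norm (X \<omega>) * norm (W \<omega>))"
      by (intro AE_I2 order_trans[OF norm_matrix_mult_le]) (simp add: norm_transpose)
  qed (use X assms(7) in \<open>auto simp: L2_def\<close>)
  then show "(\<integral>\<omega>. X \<omega> \<bullet> (U \<omega> ** W \<omega>) \<partial>M) = 0"
    unfolding matrix_mult_inner_transpose
    using X assms L2_integrable[OF finite_measure_axioms assms(4)]
    by (intro integral_inner_indep_eq_0[OF assms(1-3)]) auto
qed

lemma L2_scaleR_indep:
  fixes U :: "'a \<Rightarrow> real" and e :: "'a \<Rightarrow> 'b::euclidean_space"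
  assumes "prob_space M" "subalgebra M G" "indep_of M G U" "L2 M U" "e \<in> borel_measurable G" "L2 M e"
  shows "L2 M (\<lambda>\<omega>. U \<omega> *\<^sub>R e \<omega>)"
proof -
  have "indep_of M G (\<lambda>\<omega>. (U \<omega>)\<^sup>2)"
    by (rule indep_of_compose[OF assms(1,3)]) simp
  note * = indep_of_integral_mult[OF assms(1,2) this, of "\<lambda>\<omega>. (norm (e \<omega>))\<^sup>2"]
  have **: "integrable M (\<lambda>\<omega>. (norm (e \<omega>))\<^sup>2 * (U \<omega>)\<^sup>2)"
    using * assms by (auto simp: L2_def)
  show ?thesis
    by (rule L2_dominated[OF _ **(1)]) (use assms in \<open>auto simp: L2_def power_mult_distrib\<close>)
qed

lemma mart_diff_scaleR:
  fixes U :: "'a \<Rightarrow> real" and e :: "'a \<Rightarrow> 'b::euclidean_space"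
  assumes "prob_space M" "subalgebra M G" "indep_of M G U" "L2 M U" "(\<integral>\<omega>. U \<omega> \<partial>M) = 0"
    "e \<in> borel_measurable G" "L2 M e"
  shows "mart_diff M G (\<lambda>\<omega>. U \<omega> *\<^sub>R e \<omega>)"
  unfolding mart_diff_def
proof (intro conjI allI impI L2_scaleR_indep[OF assms(1-4) assms(6,7)])
  interpret prob_space M by fact
  fix X :: "'a \<Rightarrow> 'b" assume X: "X \<in> borel_measurable G" "L2 M X"
  have "(\<integral>\<omega>. (X \<omega> \<bullet> e \<omega>) \<bullet> U \<omega> \<partial>M) = 0"
    using X assms L2_integrable[OF finite_measure_axioms assms(4)]
    by (intro integral_inner_indep_eq_0[OF assms(1-3)]) (auto intro: L2_inner_integrable)
  then show "(\<integral>\<omega>. X \<omega> \<bullet> (U \<omega> *\<^sub>R e \<omega>) \<partial>M) = 0" by (simp add: mult.commute)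
qed

section \<open>Doob's maximal inequality\<close>

text \<open>The trajectorial form of Doob's inequality. The running maximum \<open>S\<close> moves
  only when it equals \<open>x\<close>, so each increment of its square is at most
  \<open>2 * x (Suc n)\<close> times the increment of \<open>S\<close>; summation by parts turns the
  total into a transform of \<open>x\<close> by \<open>S\<close>.\<close>

lemma maximal_ineq_pathwise:
  fixes x :: "nat \<Rightarrow> real"
  assumes S0: "S 0 = x 0" and S: "\<And>i. S (Suc i) = max (S i) (x (Suc i))"
  shows "(S n)\<^sup>2 + 2 * (\<Sum>i<n. S i * (x (Suc i) - x i)) \<le> 2 * S n * x n"
proof (induction n)
  case 0
  show ?case using S0 by (simp add: power2_eq_square)
next
  case (Suc n)
  have "(S (Suc n))\<^sup>2 - (S n)\<^sup>2 \<le> 2 * x (Suc n) * (S (Suc n) - S n)"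
  proof (cases "S n \<le> x (Suc n)")
    case True
    have "0 \<le> (x (Suc n) - S n)\<^sup>2" by simp
    with True show ?thesis by (simp add: S max_def power2_eq_square algebra_simps)
  qed (simp add: S max_def)
  with Suc show ?case by (simp add: algebra_simps)
qed

text \<open>Half of \<open>S^2\<close> is absorbed using that the square of \<open>S - 2 * x\<close>
  is nonnegative; this produces Doob's constant 4.\<close>

lemma doob_pathwise:
  fixes x :: "nat \<Rightarrow> real"
  assumes "S 0 = x 0" and "\<And>i. S (Suc i) = max (S i) (x (Suc i))"
  shows "(S n)\<^sup>2 + 4 * (\<Sum>i<n. S i * (x (Suc i) - x i)) \<le> 4 * (x n)\<^sup>2"
proof -
  have "0 \<le> (S n - 2 * x n)\<^sup>2" by simp
  then have "4 * (S n * x n) \<le> (S n)\<^sup>2 + 4 * (x n)\<^sup>2" by (simp add: power2_eq_square algebra_simps)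
  with maximal_ineq_pathwise[of S x n, OF assms] show ?thesis by simp
qed

text \<open>The sign vector is a subgradient of the norm, so increments of the norm dominate inner
  products with vector increments. For these a martingale transform has mean zero.\<close>

lemma doob_maxn_pathwise:
  fixes X :: "nat \<Rightarrow> 'a \<Rightarrow> 'b::real_inner"
  shows "(maxn X n \<omega>)\<^sup>2 + 4 * (\<Sum>i<n. (maxn X i \<omega> *\<^sub>R sgn (X i \<omega>)) \<bullet> (X (Suc i) \<omega> - X i \<omega>)) \<le> 4 * (norm (X n \<omega>))\<^sup>2"
proof -
  have "(maxn X i \<omega> *\<^sub>R sgn (X i \<omega>)) \<bullet> (X (Suc i) \<omega> - X i \<omega>) \<le> maxn X i \<omega> * (norm (X (Suc i) \<omega>) - norm (X i \<omega>))" for i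
  proof -
    have "sgn (X i \<omega>) \<bullet> X (Suc i) \<omega> \<le> norm (sgn (X i \<omega>)) * norm (X (Suc i) \<omega>)"
      by (rule norm_cauchy_schwarz)
    also have "\<dots> \<le> norm (X (Suc i) \<omega>)" by (simp add: norm_sgn)
    finally have 1: "sgn (X i \<omega>) \<bullet> X (Suc i) \<omega> \<le> norm (X (Suc i) \<omega>)" .
    have 2: "sgn (X i \<omega>) \<bullet> X i \<omega> = norm (X i \<omega>)"
      by (cases "X i \<omega> = 0") (simp_all add: sgn_div_norm dot_square_norm power2_eq_square)
    have "sgn (X i \<omega>) \<bullet> (X (Suc i) \<omega> - X i \<omega>) \<le> norm (X (Suc i) \<omega>) - norm (X i \<omega>)"
      using 1 2 by (simp add: inner_diff_right)
    then show ?thesis by (simp add: mult_left_mono)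
  qed
  then have "(\<Sum>i<n. (maxn X i \<omega> *\<^sub>R sgn (X i \<omega>)) \<bullet> (X (Suc i) \<omega> - X i \<omega>))
      \<le> (\<Sum>i<n. maxn X i \<omega> * (norm (X (Suc i) \<omega>) - norm (X i \<omega>)))" by (intro sum_mono)
  with doob_pathwise[of "\<lambda>i. maxn X i \<omega>" "\<lambda>i. norm (X i \<omega>)" n] show ?thesis by (simp add: maxn_Suc)
qed

text \<open>Indexing by steps covers the Wiener filtration on a grid, its shifts to the start of a
  block and the filtration generated by independent factors.\<close>

definition dfilt :: "'a measure \<Rightarrow> (nat \<Rightarrow> 'a measure) \<Rightarrow> bool" where
  "dfilt M G \<longleftrightarrow> (\<forall>j. subalgebra M (G j)) \<and> (\<forall>i j. i \<le> j \<longrightarrow> sets (G i) \<subseteq> sets (G j))"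

lemma dfilt_subalgebra: "dfilt M G \<Longrightarrow> subalgebra M (G j)"
  by (simp add: dfilt_def)

lemma dfilt_mono: "dfilt M G \<Longrightarrow> i \<le> j \<Longrightarrow> X \<in> measurable (G i) N \<Longrightarrow> X \<in> measurable (G j) N"
  by (rule measurable_from_subalg[of "G j" "G i"]) (auto simp: dfilt_def subalgebra_def)

lemma dfilt_meas: "dfilt M G \<Longrightarrow> X \<in> measurable (G i) N \<Longrightarrow> X \<in> measurable M N"
  using subalgebra_measurable dfilt_subalgebra by blast

lemma dfilt_partial_sum:
  fixes W :: "nat \<Rightarrow> 'a \<Rightarrow> 'b::euclidean_space"
  assumes "dfilt M G" "\<And>i. i < n \<Longrightarrow> W i \<in> borel_measurable (G (Suc i))" "m \<le> n" "m \<le> l"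
  shows "(\<lambda>\<omega>. \<Sum>i<m. W i \<omega>) \<in> borel_measurable (G l)"
proof (rule borel_measurable_sum)
  fix i assume "i \<in> {..<m}"
  then show "W i \<in> borel_measurable (G l)"
    using assms by (intro dfilt_mono[OF assms(1) _ assms(2)]) auto
qed

text \<open>Pythagoras: the partial sum belongs to the past of the next difference, so each cross
  term vanishes.\<close>

lemma orthogonal_sum:
  fixes W :: "nat \<Rightarrow> 'a \<Rightarrow> 'b::euclidean_space"
  assumes "dfilt M G" "\<And>i. i < n \<Longrightarrow> mart_diff M (G i) (W i)"
    "\<And>i. i < n \<Longrightarrow> W i \<in> borel_measurable (G (Suc i))"
  shows "(\<integral>\<omega>. (norm (\<Sum>i<n. W i \<omega>))\<^sup>2 \<partial>M) = (\<Sum>i<n. \<integral>\<omega>. (norm (W i \<omega>))\<^sup>2 \<partial>M)"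
  using assms(2,3)
proof (induction n)
  case (Suc n)
  let ?S = "\<lambda>\<omega>. \<Sum>i<n. W i \<omega>"
  have S: "?S \<in> borel_measurable (G n)"
    by (rule dfilt_partial_sum[OF assms(1), of n]) (use Suc in auto)
  have L2: "L2 M ?S" "L2 M (W n)"
    using mart_diff_L2[OF Suc.prems(1)] by (auto intro!: L2_sum)
  have 0: "(\<integral>\<omega>. ?S \<omega> \<bullet> W n \<omega> \<partial>M) = 0"
    using Suc S L2 by (intro mart_diffD[of M "G n"]) auto
  have "(\<integral>\<omega>. (norm (\<Sum>i<Suc n. W i \<omega>))\<^sup>2 \<partial>M)
     = (\<integral>\<omega>. (norm (?S \<omega>))\<^sup>2 + 2 * (?S \<omega> \<bullet> W n \<omega>) + (norm (W n \<omega>))\<^sup>2 \<partial>M)"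
    by (simp add: power2_norm_eq_inner algebra_simps inner_commute)
  also have "\<dots> = (\<integral>\<omega>. (norm (?S \<omega>))\<^sup>2 \<partial>M) + (\<integral>\<omega>. (norm (W n \<omega>))\<^sup>2 \<partial>M)"
    using L2 0 by (simp add: L2_inner_integrable L2_integrable_sq)
  finally show ?case using Suc by simp
qed simp

text \<open>Integration of the pathwise inequality. The weight \<open>maxn X i\<close> times the
  sign of \<open>X i\<close> is known at time \<open>i\<close>, so the transform has mean zero, and
  Pythagoras evaluates the terminal value.\<close>

lemma doob_maximal:
  fixes W :: "nat \<Rightarrow> 'a \<Rightarrow> 'b::euclidean_space"
  assumes "dfilt M G" "\<And>i. i < n \<Longrightarrow> mart_diff M (G i) (W i)"
    "\<And>i. i < n \<Longrightarrow> W i \<in> borel_measurable (G (Suc i))"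
  shows "(\<integral>\<omega>. (maxn (\<lambda>j \<omega>. \<Sum>i<j. W i \<omega>) n \<omega>)\<^sup>2 \<partial>M) \<le> 4 * (\<Sum>i<n. \<integral>\<omega>. (norm (W i \<omega>))\<^sup>2 \<partial>M)"
proof -
  define X where "X = (\<lambda>j \<omega>. \<Sum>i<j. W i \<omega>)"
  have XL2: "L2 M (X j)" if "j \<le> n" for j
    using that mart_diff_L2[OF assms(2)] unfolding X_def by (auto intro!: L2_sum)
  have Xm: "X j \<in> borel_measurable (G l)" if "j \<le> n" "j \<le> l" for j l
    unfolding X_def by (rule dfilt_partial_sum[OF assms(1,3)]) (use that in auto)
  have maxL2: "L2 M (maxn X j)" if "j \<le> n" for j
    by (rule maxn_L2) (use that XL2 in auto)
  have H: "(\<lambda>\<omega>. maxn X i \<omega> *\<^sub>R sgn (X i \<omega>)) \<in> borel_measurable (G i)" if "i < n" for i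
    using that Xm by (intro borel_measurable_scaleR maxn_measurable)
      (auto simp: sgn_div_norm[abs_def] intro!: borel_measurable_scaleR borel_measurable_inverse borel_measurable_norm)
  have HL2: "L2 M (\<lambda>\<omega>. maxn X i \<omega> *\<^sub>R sgn (X i \<omega>))" if "i < n" for i
    by (rule L2_dominated[OF dfilt_meas[OF assms(1) H[OF that]] L2_integrable_sq[OF maxL2[of i]]])
       (use that in \<open>auto simp: power_mult_distrib norm_sgn\<close>)
  have int: "integrable M (\<lambda>\<omega>. (maxn X i \<omega> *\<^sub>R sgn (X i \<omega>)) \<bullet> W i \<omega>)" if "i < n" for i
    by (rule L2_inner_integrable[OF HL2[OF that] mart_diff_L2[OF assms(2)[OF that]]])
  have z: "(\<integral>\<omega>. (maxn X i \<omega> *\<^sub>R sgn (X i \<omega>)) \<bullet> W i \<omega> \<partial>M) = 0" if "i < n" for i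
    by (rule mart_diffD[OF assms(2)[OF that] H[OF that] HL2[OF that]])
  have "(\<integral>\<omega>. (maxn X n \<omega>)\<^sup>2 \<partial>M) = (\<integral>\<omega>. (maxn X n \<omega>)\<^sup>2 + 4 * (\<Sum>i<n. (maxn X i \<omega> *\<^sub>R sgn (X i \<omega>)) \<bullet> W i \<omega>) \<partial>M)"
  proof -
    have "integrable M (\<lambda>\<omega>. (maxn X n \<omega>)\<^sup>2)" using maxL2[of n] by (simp add: L2_def)
    moreover have "integrable M (\<lambda>\<omega>. \<Sum>i<n. (maxn X i \<omega> *\<^sub>R sgn (X i \<omega>)) \<bullet> W i \<omega>)"
      using int by (intro Bochner_Integration.integrable_sum) auto
    moreover have "(\<integral>\<omega>. (\<Sum>i<n. (maxn X i \<omega> *\<^sub>R sgn (X i \<omega>)) \<bullet> W i \<omega>) \<partial>M) = 0"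
      using int z by (subst Bochner_Integration.integral_sum) auto
    ultimately show ?thesis by simp
  qed
  also have "\<dots> \<le> (\<integral>\<omega>. 4 * (norm (X n \<omega>))\<^sup>2 \<partial>M)"
  proof (intro integral_mono)
    show "integrable M (\<lambda>\<omega>. (maxn X n \<omega>)\<^sup>2 + 4 * (\<Sum>i<n. (maxn X i \<omega> *\<^sub>R sgn (X i \<omega>)) \<bullet> W i \<omega>))"
    proof (rule Bochner_Integration.integrable_add)
      show "integrable M (\<lambda>\<omega>. (maxn X n \<omega>)\<^sup>2)" using maxL2[of n] by (simp add: L2_def)
      show "integrable M (\<lambda>\<omega>. 4 * (\<Sum>i<n. (maxn X i \<omega> *\<^sub>R sgn (X i \<omega>)) \<bullet> W i \<omega>))"
        by (rule integrable_mult_right, rule Bochner_Integration.integrable_sum, rule int) simp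
    qed
    show "integrable M (\<lambda>\<omega>. 4 * (norm (X n \<omega>))\<^sup>2)"
      using XL2[of n] by (auto simp: L2_def)
    fix \<omega>
    show "(maxn X n \<omega>)\<^sup>2 + 4 * (\<Sum>i<n. (maxn X i \<omega> *\<^sub>R sgn (X i \<omega>)) \<bullet> W i \<omega>) \<le> 4 * (norm (X n \<omega>))\<^sup>2"
      using doob_maxn_pathwise[of X n \<omega>] by (simp add: X_def)
  qed
  also have "\<dots> = 4 * (\<Sum>i<n. \<integral>\<omega>. (norm (W i \<omega>))\<^sup>2 \<partial>M)"
    using orthogonal_sum[OF assms] by (simp add: X_def)
  finally show ?thesis by (simp add: X_def)
qed

section \<open>Gronwall estimates for stochastic difference equations\<close>

lemma discrete_gronwall:
  fixes \<phi> :: "nat \<Rightarrow> real"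
  assumes "\<And>j. j \<le> n \<Longrightarrow> \<phi> j \<le> a + k * (\<Sum>i<j. \<phi> i)" "k \<ge> 0" "a \<ge> 0" "j \<le> n"
  shows "\<phi> j \<le> a * exp (k * real j)"
proof -
  \<comment> \<open>The induction runs on the whole right-hand side, which grows by at most the
    factor \<open>1 + k\<close> per step; for \<phi> alone the hypothesis would not close.\<close>
  have *: "a + k * (\<Sum>i<j. \<phi> i) \<le> a * (1 + k) ^ j" if "j \<le> n" for j
    using that
  proof (induction j)
    case (Suc j)
    have "k * \<phi> j \<le> k * (a + k * (\<Sum>i<j. \<phi> i))"
      using Suc assms by (intro mult_left_mono) auto
    then have "a + k * (\<Sum>i<Suc j. \<phi> i) \<le> (a + k * (\<Sum>i<j. \<phi> i)) * (1 + k)"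
      by (simp add: algebra_simps)
    also have "\<dots> \<le> a * (1 + k) ^ j * (1 + k)"
      using Suc assms by (intro mult_right_mono) auto
    finally show ?case by (simp add: mult_ac)
  qed simp
  have "(1 + k) ^ j \<le> exp k ^ j"
    using assms by (intro power_mono exp_ge_add_one_self) auto
  then have "a * (1 + k) ^ j \<le> a * exp (k * real j)"
    using assms by (intro mult_left_mono) (auto simp: exp_of_nat_mult[symmetric] mult.commute)
  with order_trans[OF assms(1)[OF assms(4)] *[OF assms(4)]] show ?thesis by (rule order_trans)
qed

text \<open>Start value, drift and martingale part are separated at the cost of a factor 3.
  Cauchy-Schwarz treats the drift and contributes \<open>T\<close>, Doob treats the martingale part
  and contributes 4. Bounds in terms of the running maximum make Gronwall applicable, and the result
  does not involve the mesh.\<close>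

lemma doob_gronwall:
  fixes X U W :: "nat \<Rightarrow> 'a \<Rightarrow> 'b::euclidean_space"
  assumes "prob_space M" "dfilt M G"
    and XL2: "\<And>j. j \<le> n \<Longrightarrow> L2 M (X j)"
    and UL2: "\<And>j. j < n \<Longrightarrow> L2 M (U j)"
    and W: "\<And>j. j < n \<Longrightarrow> mart_diff M (G j) (W j)" "\<And>j. j < n \<Longrightarrow> W j \<in> borel_measurable (G (Suc j))"
    and step: "\<And>j. j < n \<Longrightarrow> AE \<omega> in M. X (Suc j) \<omega> = X j \<omega> + U j \<omega> + W j \<omega>"
    and h: "h \<ge> 0" "real n * h \<le> T" and pq: "p \<ge> 0" "q \<ge> 0"
    and U2: "\<And>j. j < n \<Longrightarrow> (\<integral>\<omega>. (norm (U j \<omega>))\<^sup>2 \<partial>M) \<le> h\<^sup>2 * (p * (\<integral>\<omega>. (maxn X j \<omega>)\<^sup>2 \<partial>M) + q)"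
    and W2: "\<And>j. j < n \<Longrightarrow> (\<integral>\<omega>. (norm (W j \<omega>))\<^sup>2 \<partial>M) \<le> h * (p * (\<integral>\<omega>. (maxn X j \<omega>)\<^sup>2 \<partial>M) + q)"
    and jn: "j \<le> n"
  shows "(\<integral>\<omega>. (maxn X j \<omega>)\<^sup>2 \<partial>M)
    \<le> (3 * (\<integral>\<omega>. (norm (X 0 \<omega>))\<^sup>2 \<partial>M) + 3 * (T + 4) * T * q) * exp (3 * (T + 4) * p * T)"
proof -
  interpret prob_space M by fact
  define \<phi> where "\<phi> j = (\<integral>\<omega>. (maxn X j \<omega>)\<^sup>2 \<partial>M)" for j
  define x0 where "x0 = (\<integral>\<omega>. (norm (X 0 \<omega>))\<^sup>2 \<partial>M)"
  have [simp]: "\<phi> j \<ge> 0" "x0 \<ge> 0" for j by (auto simp: \<phi>_def x0_def)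
  have T0: "T \<ge> 0" using h by (meson mult_nonneg_nonneg of_nat_0_le_iff order_trans)
  have sum: "AE \<omega> in M. \<forall>i\<le>n. X i \<omega> = X 0 \<omega> + (\<Sum>k<i. U k \<omega>) + (\<Sum>k<i. W k \<omega>)"
  proof -
    have "AE \<omega> in M. \<forall>j\<in>{..<n}. X (Suc j) \<omega> = X j \<omega> + U j \<omega> + W j \<omega>"
      using step by (intro AE_finite_allI) auto
    then show ?thesis
    proof eventually_elim
      case (elim \<omega>)
      show ?case
      proof (intro allI impI)
        fix i assume "i \<le> n" then show "X i \<omega> = X 0 \<omega> + (\<Sum>k<i. U k \<omega>) + (\<Sum>k<i. W k \<omega>)"
          using elim by (induction i) auto
      qed
    qed
  qed
  have main: "\<phi> j \<le> (3 * x0 + 3 * (T + 4) * T * q) + (3 * (T + 4) * p * h) * (\<Sum>i<j. \<phi> i)" if j: "j \<le> n" for j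
  proof -
    let ?N = "maxn (\<lambda>j \<omega>. \<Sum>i<j. W i \<omega>) j"
    have jh: "real j * h \<le> T" using h j by (meson mult_right_mono of_nat_le_iff order_trans)
    have L2N: "L2 M ?N" using j mart_diff_L2[OF W(1)] by (intro maxn_L2 L2_sum) auto
    have L2X: "L2 M (maxn X j)" using j XL2 by (intro maxn_L2) auto
    have ints: "integrable M (\<lambda>\<omega>. (maxn X j \<omega>)\<^sup>2)" "integrable M (\<lambda>\<omega>. (?N \<omega>)\<^sup>2)"
      "integrable M (\<lambda>\<omega>. (norm (X 0 \<omega>))\<^sup>2)" "integrable M (\<lambda>\<omega>. \<Sum>i<j. (norm (U i \<omega>))\<^sup>2)"
      using L2X L2N XL2[of 0] UL2 j by (auto simp: L2_def intro!: Bochner_Integration.integrable_sum)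
    have "AE \<omega> in M. (maxn X j \<omega>)\<^sup>2 \<le> 3 * (norm (X 0 \<omega>))\<^sup>2 + 3 * (real j * (\<Sum>i<j. (norm (U i \<omega>))\<^sup>2)) + 3 * (?N \<omega>)\<^sup>2"
      using sum
    proof eventually_elim
      case (elim \<omega>)
      show ?case
      proof (rule maxn_sq_leI)
        fix i assume i: "i \<le> j"
        define a b c where "a = X 0 \<omega>" "b = (\<Sum>k<i. U k \<omega>)" "c = (\<Sum>k<i. W k \<omega>)"
        have "X i \<omega> = a + b + c" unfolding a_b_c_def by (rule elim[rule_format]) (use i j in simp)
        then have "norm (X i \<omega>) \<le> norm a + norm b + norm c"
          using norm_triangle_ineq[of "a + b" c] norm_triangle_ineq[of a b] by simp
        then have "(norm (X i \<omega>))\<^sup>2 \<le> (norm a + norm b + norm c)\<^sup>2"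
          by (intro power_mono) auto
        also have "\<dots> \<le> 3 * (norm a)\<^sup>2 + 3 * (norm b)\<^sup>2 + 3 * (norm c)\<^sup>2"
          using sum_squares_bound[of "norm a" "norm b"] sum_squares_bound[of "norm a" "norm c"]
            sum_squares_bound[of "norm b" "norm c"] by (simp add: power2_eq_square algebra_simps)
        also have "(norm b)\<^sup>2 \<le> real j * (\<Sum>i<j. (norm (U i \<omega>))\<^sup>2)"
        proof -
          have "(norm b)\<^sup>2 \<le> real (card {..<i}) * (\<Sum>k<i. (norm (U k \<omega>))\<^sup>2)"
            unfolding a_b_c_def by (rule power2_norm_sum_le) simp
          also have "\<dots> \<le> real j * (\<Sum>k<j. (norm (U k \<omega>))\<^sup>2)"
            using i by (intro mult_mono sum_mono2 sum_nonneg) auto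
          finally show ?thesis .
        qed
        also have "(norm c)\<^sup>2 \<le> (?N \<omega>)\<^sup>2"
          unfolding a_b_c_def using maxn_ge[of i j "\<lambda>j \<omega>. \<Sum>i<j. W i \<omega>" \<omega>] i by (intro power_mono) auto
        finally show "(norm (X i \<omega>))\<^sup>2 \<le> 3 * (norm (X 0 \<omega>))\<^sup>2 + 3 * (real j * (\<Sum>i<j. (norm (U i \<omega>))\<^sup>2)) + 3 * (?N \<omega>)\<^sup>2"
          by (simp add: a_b_c_def)
      qed
    qed
    then have "\<phi> j \<le> (\<integral>\<omega>. 3 * (norm (X 0 \<omega>))\<^sup>2 + 3 * (real j * (\<Sum>i<j. (norm (U i \<omega>))\<^sup>2)) + 3 * (?N \<omega>)\<^sup>2 \<partial>M)"
      unfolding \<phi>_def by (intro integral_mono_AE Bochner_Integration.integrable_add integrable_mult_right ints)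
    also have "\<dots> = 3 * x0 + 3 * (real j * (\<Sum>i<j. \<integral>\<omega>. (norm (U i \<omega>))\<^sup>2 \<partial>M)) + 3 * (\<integral>\<omega>. (?N \<omega>)\<^sup>2 \<partial>M)"
    proof -
      have "(\<integral>\<omega>. (\<Sum>i<j. (norm (U i \<omega>))\<^sup>2) \<partial>M) = (\<Sum>i<j. \<integral>\<omega>. (norm (U i \<omega>))\<^sup>2 \<partial>M)"
        by (rule Bochner_Integration.integral_sum) (use UL2 j in \<open>auto simp: L2_def\<close>)
      then show ?thesis unfolding x0_def using ints by simp
    qed
    also have "\<dots> \<le> 3 * x0 + 3 * (real j * (\<Sum>i<j. h\<^sup>2 * (p * \<phi> i + q))) + 3 * (4 * (\<Sum>i<j. h * (p * \<phi> i + q)))"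
    proof (intro add_mono mult_left_mono sum_mono order_refl)
      have "(\<integral>\<omega>. (?N \<omega>)\<^sup>2 \<partial>M) \<le> 4 * (\<Sum>i<j. \<integral>\<omega>. (norm (W i \<omega>))\<^sup>2 \<partial>M)"
        by (rule doob_maximal[OF assms(2)]) (use W j in auto)
      also have "\<dots> \<le> 4 * (\<Sum>i<j. h * (p * \<phi> i + q))"
        using W2 j unfolding \<phi>_def by (intro mult_left_mono sum_mono) auto
      finally show "(\<integral>\<omega>. (?N \<omega>)\<^sup>2 \<partial>M) \<le> 4 * (\<Sum>i<j. h * (p * \<phi> i + q))" .
    qed (use U2 j \<phi>_def in auto)
    \<comment> \<open>The drift carries the factor \<open>real j\<close> from Cauchy-Schwarz and
      \<open>h^2\<close> from its size; one \<open>h\<close> pairs with \<open>real j\<close> into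
      elapsed time, so both parts are of order \<open>h\<close> per step.\<close>
    also have "\<dots> = 3 * x0 + 3 * (real j * h + 4) * (h * (\<Sum>i<j. p * \<phi> i + q))"
      unfolding sum_distrib_left[symmetric] by (simp add: power2_eq_square algebra_simps)
    also have "\<dots> \<le> 3 * x0 + 3 * (T + 4) * (h * (\<Sum>i<j. p * \<phi> i + q))"
      using jh h pq T0 by (intro add_left_mono mult_right_mono) (auto intro!: mult_nonneg_nonneg sum_nonneg add_nonneg_nonneg)
    also have "h * (\<Sum>i<j. p * \<phi> i + q) = p * h * (\<Sum>i<j. \<phi> i) + (real j * h) * q"
      by (simp add: sum.distrib sum_distrib_left algebra_simps)
    also have "3 * x0 + 3 * (T + 4) * (p * h * (\<Sum>i<j. \<phi> i) + (real j * h) * q)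
      \<le> 3 * x0 + 3 * (T + 4) * (p * h * (\<Sum>i<j. \<phi> i) + T * q)"
      using jh pq T0 by (intro add_left_mono mult_left_mono mult_right_mono) auto
    finally show ?thesis by (simp add: algebra_simps)
  qed
  have "\<phi> j \<le> (3 * x0 + 3 * (T + 4) * T * q) * exp ((3 * (T + 4) * p * h) * real j)"
    using T0 pq h by (intro discrete_gronwall[OF main _ _ jn]) auto
  also have "(3 * (T + 4) * p * h) * real j = 3 * (T + 4) * p * (real j * h)" by simp
  also have "real j * h \<le> T" using h jn by (meson mult_right_mono of_nat_le_iff order_trans)
  finally show ?thesis unfolding \<phi>_def x0_def
    using T0 pq by (simp add: mult_left_mono)
qed

section \<open>Stochastic difference equations and coarse Euler schemes\<close>

abbreviation msq :: "'a measure \<Rightarrow> ('a \<Rightarrow> 'b::real_normed_vector) \<Rightarrow> real" where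
  "msq M X \<equiv> \<integral>\<omega>. (norm (X \<omega>))\<^sup>2 \<partial>M"

lemma msq_le_maxn:
  assumes "\<And>i. i \<le> j \<Longrightarrow> L2 M (X i)" "i \<le> j"
  shows "msq M (X i) \<le> (\<integral>\<omega>. (maxn X j \<omega>)\<^sup>2 \<partial>M)"
proof (rule integral_mono)
  show "integrable M (\<lambda>\<omega>. (norm (X i \<omega>))\<^sup>2)" by (rule L2_integrable_sq) (use assms in auto)
  show "integrable M (\<lambda>\<omega>. (maxn X j \<omega>)\<^sup>2)" using L2_integrable_sq[OF maxn_L2[of j M X]] assms by auto
qed (use assms(2) in \<open>auto intro!: power_mono maxn_ge\<close>)

lemma msq_cong_AE: "X \<in> borel_measurable M \<Longrightarrow> Y \<in> borel_measurable M \<Longrightarrow> AE \<omega> in M. X \<omega> = Y \<omega> \<Longrightarrow> msq M X = msq M Y"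
  by (rule integral_cong_AE) auto

lemma msq_matrix_le:
  fixes A :: "real^'m^'m" and X :: "'a \<Rightarrow> real^'m^'m"
  assumes "L2 M X" shows "msq M (\<lambda>\<omega>. A ** X \<omega>) \<le> (norm A)\<^sup>2 * msq M X"
proof -
  have "msq M (\<lambda>\<omega>. A ** X \<omega>) \<le> (\<integral>\<omega>. (norm A)\<^sup>2 * (norm (X \<omega>))\<^sup>2 \<partial>M)"
  proof (rule integral_mono)
    show "(norm (A ** X \<omega>))\<^sup>2 \<le> (norm A)\<^sup>2 * (norm (X \<omega>))\<^sup>2" for \<omega>
      using power_mono[OF norm_matrix_mult_le[of A "X \<omega>"], of 2] by (simp add: power_mult_distrib)
  qed (use L2_matrix_const_left[OF assms, of A] assms in \<open>auto simp: L2_def\<close>)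
  then show ?thesis by simp
qed

text \<open>Over \<open>l\<close> steps Cauchy-Schwarz bounds the drift by the square of the elapsed
  time and Pythagoras bounds the martingale part by the elapsed time itself.\<close>

lemma increment_bound:
  fixes X U W :: "nat \<Rightarrow> 'a \<Rightarrow> 'b::euclidean_space"
  assumes "dfilt M G"
    and X: "\<And>j. j \<le> n \<Longrightarrow> L2 M (X j)"
    and U: "\<And>j. j < n \<Longrightarrow> L2 M (U j)"
    and W: "\<And>j. j < n \<Longrightarrow> mart_diff M (G j) (W j)" "\<And>j. j < n \<Longrightarrow> W j \<in> borel_measurable (G (Suc j))"
    and step: "\<And>j. j < n \<Longrightarrow> AE \<omega> in M. X (Suc j) \<omega> = X j \<omega> + U j \<omega> + W j \<omega>"
    and U2: "\<And>j. j < n \<Longrightarrow> msq M (U j) \<le> h\<^sup>2 * r"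
    and W2: "\<And>j. j < n \<Longrightarrow> msq M (W j) \<le> h * r"
    and l: "i + l \<le> n"
  shows "msq M (\<lambda>\<omega>. X (i + l) \<omega> - X i \<omega>) \<le> 2 * (real l * h) * (1 + real l * h) * r"
proof -
  let ?U = "\<lambda>\<omega>. \<Sum>k<l. U (i + k) \<omega>" and ?W = "\<lambda>\<omega>. \<Sum>k<l. W (i + k) \<omega>"
  have "AE \<omega> in M. \<forall>j\<in>{..<n}. X (Suc j) \<omega> = X j \<omega> + U j \<omega> + W j \<omega>"
    using step by (intro AE_finite_allI) auto
  then have "AE \<omega> in M. X (i + l) \<omega> - X i \<omega> = ?U \<omega> + ?W \<omega>"
  proof eventually_elim
    case (elim \<omega>)
    then show ?case using l by (induction l) auto
  qed
  moreover have L2U: "L2 M ?U" using U l by (intro L2_sum) auto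
  moreover have L2W: "L2 M ?W" using mart_diff_L2[OF W(1)] l by (intro L2_sum) auto
  ultimately have "msq M (\<lambda>\<omega>. X (i + l) \<omega> - X i \<omega>) = msq M (\<lambda>\<omega>. ?U \<omega> + ?W \<omega>)"
    using L2_diff[OF X[of "i + l"] X[of i]] l by (intro msq_cong_AE) (auto simp: L2_def)
  also have "\<dots> \<le> 2 * msq M ?U + 2 * msq M ?W"
    by (rule integral_power2_norm_add_le[OF L2U L2W])
  also have "msq M ?U \<le> real (card {..<l}) * (\<Sum>k<l. msq M (U (i + k)))"
    by (rule integral_power2_norm_sum_le) (use U l in auto)
  also have "\<dots> \<le> real l * (\<Sum>k<l. h\<^sup>2 * r)"
    using l by (subst card_lessThan, intro mult_left_mono sum_mono U2) auto
  also have "msq M ?W = (\<Sum>k<l. msq M (W (i + k)))"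
  \<comment> \<open>Orthogonality is used for the filtration restarted at step
    \<open>i\<close>.\<close>
  proof (rule orthogonal_sum[where G="\<lambda>k. G (i + k)"])
    show "dfilt M (\<lambda>k. G (i + k))" using assms(1) by (auto simp: dfilt_def)
  qed (use W l in auto)
  also have "\<dots> \<le> (\<Sum>k<l. h * r)"
    using l by (intro sum_mono W2) auto
  finally show ?thesis by (simp add: power2_eq_square algebra_simps)
qed

text \<open>The bound of \<open>doob_gronwall\<close> with growth \<open>2 * p + 2\<close>,
  inhomogeneity 2 and initial second moment at most \<open>k\<close>. A closed form makes uniformity
  in mesh, block length and filtration visible.\<close>

definition uniK :: "real \<Rightarrow> real \<Rightarrow> real \<Rightarrow> real" where
  "uniK p T k = (3 * k + 6 * (T + 4) * T) * exp (3 * (T + 4) * (2 * p + 2) * T)"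

text \<open>The bound of \<open>doob_gronwall\<close> with start value 0 and growth
  \<open>4 * p\<close>, divided by \<open>real b * h + e\<close>; the inner bracket collects the
  freezing error over a block and the perturbations.\<close>

definition uniC :: "real \<Rightarrow> real \<Rightarrow> real \<Rightarrow> real" where
  "uniC p T k = 3 * (T + 4) * T * (8 * p * (1 + T) * ((2 * p + 2) * uniK p T k + 2) + 2 * (1 + uniK p T k))
     * exp (3 * (T + 4) * (4 * p) * T)"

lemma uniK_nonneg: "p \<ge> 0 \<Longrightarrow> T \<ge> 0 \<Longrightarrow> k \<ge> 0 \<Longrightarrow> uniK p T k \<ge> 0"
  by (simp add: uniK_def)

lemma uniC_nonneg: "p \<ge> 0 \<Longrightarrow> T \<ge> 0 \<Longrightarrow> k \<ge> 0 \<Longrightarrow> uniC p T k \<ge> 0"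
  by (simp add: uniC_def uniK_nonneg)

lemma perturbed_scheme:
  fixes Y Z a m G :: "nat \<Rightarrow> 'a \<Rightarrow> real^'m^'m" and A :: "real^'m^'m"
  assumes prob: "prob_space M" and filt: "dfilt M F"
    and Gm: "\<And>j. j < n \<Longrightarrow> G j \<in> borel_measurable (F (Suc j))"
    and Gi: "\<And>j. j < n \<Longrightarrow> indep_of M (F j) (G j)"
    and GL2: "\<And>j. j < n \<Longrightarrow> L2 M (G j)"
    and G0: "\<And>j. j < n \<Longrightarrow> (\<integral>\<omega>. G j \<omega> \<partial>M) = 0"
    and G2: "\<And>j. j < n \<Longrightarrow> msq M (G j) \<le> p * h"
    and Ym: "\<And>j. j \<le> n \<Longrightarrow> Y j \<in> borel_measurable (F j)"
    and YL2: "\<And>j. j \<le> n \<Longrightarrow> L2 M (Y j)"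
    and aL2: "\<And>j. j < n \<Longrightarrow> L2 M (a j)"
    and mm: "\<And>j. j < n \<Longrightarrow> mart_diff M (F j) (m j)" "\<And>j. j < n \<Longrightarrow> m j \<in> borel_measurable (F (Suc j))"
    and step: "\<And>j. j < n \<Longrightarrow> AE \<omega> in M. Y (Suc j) \<omega> = Y j \<omega> + (h *\<^sub>R A ** Y j \<omega> + a j \<omega>) + (G j \<omega> ** Y j \<omega> + m j \<omega>)"
    and h: "h \<ge> 0" "real n * h \<le> T" "real b * h \<le> T" and p: "(norm A)\<^sup>2 \<le> p" and b: "b > 0"
    and e: "0 \<le> e" "e \<le> 1"
    and a2: "\<And>j. j < n \<Longrightarrow> msq M (a j) \<le> e * h\<^sup>2 * (1 + msq M (Y j))"
    and m2: "\<And>j. j < n \<Longrightarrow> msq M (m j) \<le> e * h * (1 + msq M (Y j))"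
    and Z0: "Z 0 = Y 0"
    and Z: "\<And>j \<omega>. j < n \<Longrightarrow> Z (Suc j) \<omega> = Z j \<omega> + (h *\<^sub>R A + G j \<omega>) ** Z (j div b * b) \<omega>"
    and k: "msq M (Y 0) \<le> k"
  shows "(\<integral>\<omega>. (maxn Y n \<omega>)\<^sup>2 \<partial>M) \<le> uniK p T k"
    and "\<And>j. j \<le> n \<Longrightarrow> Z j \<in> borel_measurable (F j) \<and> L2 M (Z j)"
    and "(\<integral>\<omega>. (maxn (\<lambda>j \<omega>. Y j \<omega> - Z j \<omega>) n \<omega>)\<^sup>2 \<partial>M) \<le> uniC p T k * (real b * h + e)"
proof -
  interpret prob_space M by fact
  have T0: "T \<ge> 0" using h by (meson mult_nonneg_nonneg of_nat_0_le_iff order_trans)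
  have p0: "p \<ge> 0" using p by (meson zero_le_power2 order_trans)
  have k0: "k \<ge> 0" by (rule order_trans[OF _ k]) simp
  note sub = dfilt_subalgebra[OF filt]
  define K where "K = uniK p T k"
  have K0: "K \<ge> 0" unfolding K_def by (rule uniK_nonneg[OF p0 T0 k0])
  let ?K = "\<lambda>j. j div b * b"
  define U where "U j = (\<lambda>\<omega>. h *\<^sub>R A ** Y j \<omega> + a j \<omega>)" for j
  define W where "W j = (\<lambda>\<omega>. G j \<omega> ** Y j \<omega> + m j \<omega>)" for j
  have hA: "msq M (\<lambda>\<omega>. h *\<^sub>R A ** X \<omega>) \<le> h\<^sup>2 * (p * msq M X)" if "L2 M X" for X :: "'a \<Rightarrow> real^'m^'m"
  proof -
    have "msq M (\<lambda>\<omega>. h *\<^sub>R A ** X \<omega>) \<le> (norm (h *\<^sub>R A))\<^sup>2 * msq M X" by (rule msq_matrix_le[OF that])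
    also have "\<dots> = h\<^sup>2 * ((norm A)\<^sup>2 * msq M X)" by (simp add: power_mult_distrib)
    also have "\<dots> \<le> h\<^sup>2 * (p * msq M X)" using p by (intro mult_left_mono mult_right_mono) auto
    finally show ?thesis .
  qed
  have GX: "mart_diff M (F j) (\<lambda>\<omega>. G j \<omega> ** X \<omega>)" "msq M (\<lambda>\<omega>. G j \<omega> ** X \<omega>) \<le> h * (p * msq M X)"
    if "j < n" "X \<in> borel_measurable (F j)" "L2 M X" for j and X :: "'a \<Rightarrow> real^'m^'m"
  proof -
    show "mart_diff M (F j) (\<lambda>\<omega>. G j \<omega> ** X \<omega>)"
      by (rule mart_diff_matrix_mult[OF prob sub]) (use that Gi GL2 G0 in auto)
    have "msq M (\<lambda>\<omega>. G j \<omega> ** X \<omega>) \<le> msq M (G j) * msq M X"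
      by (rule L2_matrix_mult_indep(2)[OF prob sub Gi GL2]) (use that in auto)
    also have "\<dots> \<le> (p * h) * msq M X" using G2[OF that(1)] by (intro mult_right_mono) auto
    finally show "msq M (\<lambda>\<omega>. G j \<omega> ** X \<omega>) \<le> h * (p * msq M X)" by (simp add: mult_ac)
  qed
  have UL2: "L2 M (U j)" if "j < n" for j
    unfolding U_def by (intro L2_add L2_matrix_const_left aL2 YL2) (use that in auto)
  have W: "mart_diff M (F j) (W j)" "W j \<in> borel_measurable (F (Suc j))" if "j < n" for j
  proof -
    show "mart_diff M (F j) (W j)"
      unfolding W_def by (intro mart_diff_add GX mm) (use that Ym YL2 in auto)
    have "Y j \<in> borel_measurable (F (Suc j))"
      by (rule dfilt_mono[OF filt _ Ym]) (use that in auto)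
    then show "W j \<in> borel_measurable (F (Suc j))"
      unfolding W_def using Gm[OF that] mm(2)[OF that] by simp
  qed
  have U2: "msq M (U j) \<le> h\<^sup>2 * ((2 * p + 2) * msq M (Y j) + 2)" if "j < n" for j
  proof -
    have "msq M (U j) \<le> 2 * msq M (\<lambda>\<omega>. h *\<^sub>R A ** Y j \<omega>) + 2 * msq M (a j)"
      unfolding U_def by (intro integral_power2_norm_add_le L2_matrix_const_left aL2 YL2) (use that in auto)
    also have "\<dots> \<le> 2 * (h\<^sup>2 * (p * msq M (Y j))) + 2 * (1 * h\<^sup>2 * (1 + msq M (Y j)))"
      using that e by (intro add_mono mult_left_mono hA YL2 order_trans[OF a2] mult_right_mono) auto
    finally show ?thesis by (simp add: algebra_simps)
  qed
  have W2: "msq M (W j) \<le> h * ((2 * p + 2) * msq M (Y j) + 2)" if "j < n" for j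
  proof -
    have "msq M (W j) \<le> 2 * msq M (\<lambda>\<omega>. G j \<omega> ** Y j \<omega>) + 2 * msq M (m j)"
      unfolding W_def by (intro integral_power2_norm_add_le mart_diff_L2[OF GX(1)] mart_diff_L2[OF mm(1)] YL2 Ym) (use that in auto)
    also have "\<dots> \<le> 2 * (h * (p * msq M (Y j))) + 2 * (1 * h * (1 + msq M (Y j)))"
      using that e h by (intro add_mono mult_left_mono GX(2) YL2 Ym order_trans[OF m2] mult_right_mono) auto
    finally show ?thesis by (simp add: algebra_simps)
  qed
  have step': "AE \<omega> in M. Y (Suc j) \<omega> = Y j \<omega> + U j \<omega> + W j \<omega>" if "j < n" for j
    using step[OF that] by (simp add: U_def W_def)
  have Ymax: "msq M (Y j) \<le> (\<integral>\<omega>. (maxn Y j \<omega>)\<^sup>2 \<partial>M)" if "j \<le> n" for j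
    by (rule msq_le_maxn) (use that YL2 in auto)
  show YK: "(\<integral>\<omega>. (maxn Y n \<omega>)\<^sup>2 \<partial>M) \<le> uniK p T k"
  proof -
    have "(\<integral>\<omega>. (maxn Y n \<omega>)\<^sup>2 \<partial>M) \<le> (3 * msq M (Y 0) + 3 * (T + 4) * T * 2) * exp (3 * (T + 4) * (2 * p + 2) * T)"
    proof (rule doob_gronwall[OF prob filt YL2 UL2 W step' h(1,2)])
      show "msq M (U j) \<le> h\<^sup>2 * ((2 * p + 2) * (\<integral>\<omega>. (maxn Y j \<omega>)\<^sup>2 \<partial>M) + 2)" if "j < n" for j
        using that p0 by (intro order_trans[OF U2] mult_left_mono add_right_mono Ymax) auto
      show "msq M (W j) \<le> h * ((2 * p + 2) * (\<integral>\<omega>. (maxn Y j \<omega>)\<^sup>2 \<partial>M) + 2)" if "j < n" for j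
        using that p0 h by (intro order_trans[OF W2] mult_left_mono add_right_mono Ymax) auto
    qed (use p0 in auto)
    also have "\<dots> \<le> uniK p T k"
      unfolding uniK_def using k by (intro mult_right_mono) (simp_all add: algebra_simps)
    finally show ?thesis .
  qed
  have YK': "msq M (Y j) \<le> K" if "j \<le> n" for j
    unfolding K_def by (rule order_trans[OF msq_le_maxn YK]) (use that YL2 in auto)
  define r where "r = (2 * p + 2) * K + 2"
  have r0: "r \<ge> 0" using p0 K0 by (simp add: r_def)
  have incr: "msq M (\<lambda>\<omega>. Y j \<omega> - Y (?K j) \<omega>) \<le> 2 * (real b * h) * (1 + T) * r" if "j < n" for j
  proof -
    have jb: "j = ?K j + j mod b" by (metis div_mult_mod_eq)
    have "msq M (\<lambda>\<omega>. Y (?K j + j mod b) \<omega> - Y (?K j) \<omega>) \<le> 2 * (real (j mod b) * h) * (1 + real (j mod b) * h) * r"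
    proof (rule increment_bound[OF filt YL2 UL2 W step'])
      show "msq M (U j) \<le> h\<^sup>2 * r" if "j < n" for j
        unfolding r_def using that p0 by (intro order_trans[OF U2] mult_left_mono add_right_mono YK') auto
      show "msq M (W j) \<le> h * r" if "j < n" for j
        unfolding r_def using that p0 h by (intro order_trans[OF W2] mult_left_mono add_right_mono YK') auto
      show "?K j + j mod b \<le> n" using that jb by linarith
    qed auto
    also have "\<dots> \<le> 2 * (real b * h) * (1 + T) * r"
    proof -
      have "real (j mod b) * h \<le> real b * h"
        using b h by (intro mult_right_mono) (auto intro: less_imp_le)
      moreover have "real (j mod b) * h \<le> T" using calculation h by linarith
      moreover have "0 \<le> real (j mod b) * h" using h by simp
      moreover have "2 * x * (1 + x) * r \<le> 2 * y * (1 + T) * r" if "0 \<le> x" "x \<le> y" "x \<le> T" for x y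
        using that r0 T0 by (intro mult_right_mono mult_mono) auto
      ultimately show ?thesis by blast
    qed
    finally show ?thesis using jb by simp
  qed
  have Zm: "Z j \<in> borel_measurable (F j) \<and> L2 M (Z j)" if "j \<le> n" for j
    using that
  \<comment> \<open>Strong induction, since the recursion refers back to the start of the
    block.\<close>
  proof (induction j rule: less_induct)
    case (less j)
    show ?case
    proof (cases j)
      case 0 then show ?thesis using Z0 Ym[of 0] YL2[of 0] by simp
    next
      case (Suc i)
      have le: "?K i \<le> i" by simp
      have *: "Z i \<in> borel_measurable (F i)" "L2 M (Z i)" "Z (?K i) \<in> borel_measurable (F i)" "L2 M (Z (?K i))"
      proof -
        have "i < j" "i \<le> n" "?K i < j" "?K i \<le> n" using less.prems Suc le by linarith+
        then have IH: "Z i \<in> borel_measurable (F i) \<and> L2 M (Z i)" "Z (?K i) \<in> borel_measurable (F (?K i)) \<and> L2 M (Z (?K i))"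
          using less.IH by blast+
        then show "Z i \<in> borel_measurable (F i)" "L2 M (Z i)" "L2 M (Z (?K i))" by blast+
        show "Z (?K i) \<in> borel_measurable (F i)" by (rule dfilt_mono[OF filt le]) (use IH in blast)
      qed
      have eq: "Z j = (\<lambda>\<omega>. Z i \<omega> + (h *\<^sub>R A ** Z (?K i) \<omega> + G i \<omega> ** Z (?K i) \<omega>))"
        using Z[of i] less.prems Suc by (auto simp: fun_eq_iff mm_simps)
      have s: "X \<in> borel_measurable (F (Suc i))" if "X \<in> borel_measurable (F i)" for X :: "'a \<Rightarrow> real^'m^'m"
        by (rule dfilt_mono[OF filt _ that]) simp
      have "L2 M (Z j)" unfolding eq
        using * less.prems Suc by (intro L2_add L2_matrix_const_left mart_diff_L2[OF GX(1)]) auto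
      moreover have "Z j \<in> borel_measurable (F j)" unfolding eq
        using s[OF *(1)] s[OF *(3)] Gm[of i] less.prems Suc by simp
      ultimately show ?thesis by simp
    qed
  qed
  then show "\<And>j. j \<le> n \<Longrightarrow> Z j \<in> borel_measurable (F j) \<and> L2 M (Z j)" .
  define D where "D j = (\<lambda>\<omega>. Y j \<omega> - Z j \<omega>)" for j
  \<comment> \<open>\<open>V\<close> replaces the state in the recursion of \<open>D\<close>; it is
    known at time \<open>j\<close>, so the noise stays orthogonal to it.\<close>
  define V where "V j = (\<lambda>\<omega>. Y j \<omega> - Z (?K j) \<omega>)" for j
  have DL2: "L2 M (D j)" if "j \<le> n" for j unfolding D_def by (intro L2_diff) (use that Zm YL2 in auto)
  have kle: "?K j \<le> j" for j by simp
  have kn: "?K j \<le> n" if "j < n" for j by (rule order_trans[OF kle]) (use that in simp)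
  have V: "V j \<in> borel_measurable (F j)" "L2 M (V j)" if "j < n" for j
  proof -
    have "Z (?K j) \<in> borel_measurable (F j)"
      by (rule dfilt_mono[OF filt kle]) (use Zm[OF kn[OF that]] in simp)
    then show "V j \<in> borel_measurable (F j)"
      unfolding V_def using Ym[of j] that by simp
    show "L2 M (V j)" unfolding V_def by (intro L2_diff) (use that Zm YL2 kn[of j] in auto)
  qed
  let ?\<phi> = "\<lambda>j. \<integral>\<omega>. (maxn D j \<omega>)\<^sup>2 \<partial>M"
  let ?I = "2 * (real b * h) * (1 + T) * r"
  have V2: "msq M (V j) \<le> 2 * ?I + 2 * ?\<phi> j" if "j < n" for j
  proof -
    have "msq M (V j) = msq M (\<lambda>\<omega>. (Y j \<omega> - Y (?K j) \<omega>) + D (?K j) \<omega>)" by (simp add: V_def D_def)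
    also have "\<dots> \<le> 2 * msq M (\<lambda>\<omega>. Y j \<omega> - Y (?K j) \<omega>) + 2 * msq M (D (?K j))"
      by (intro integral_power2_norm_add_le L2_diff YL2 DL2) (use that kn[of j] in auto)
    also have "\<dots> \<le> 2 * ?I + 2 * ?\<phi> j"
      by (intro add_mono mult_left_mono incr msq_le_maxn DL2) (use that kn[of j] in auto)
    finally show ?thesis .
  qed
  \<comment> \<open>The inhomogeneity: the freezing error \<open>?I\<close> passes through two
    splittings of squares and the coefficient bound \<open>p\<close>; the second summand comes from
    \<open>a\<close> and \<open>m\<close>.\<close>
  define q where "q = 4 * p * ?I + 2 * e * (1 + K)"
  have q0: "q \<ge> 0" unfolding q_def using p0 h T0 r0 e K0 by simp
  have "?\<phi> n \<le> (3 * msq M (D 0) + 3 * (T + 4) * T * q) * exp (3 * (T + 4) * (4 * p) * T)"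
  proof (rule doob_gronwall[OF prob filt DL2, where U="\<lambda>j \<omega>. h *\<^sub>R A ** V j \<omega> + a j \<omega>" and W="\<lambda>j \<omega>. G j \<omega> ** V j \<omega> + m j \<omega>" and h=h])
    fix j assume j: "j < n"
    show "L2 M (\<lambda>\<omega>. h *\<^sub>R A ** V j \<omega> + a j \<omega>)"
      by (intro L2_add L2_matrix_const_left aL2 V j)
    show "mart_diff M (F j) (\<lambda>\<omega>. G j \<omega> ** V j \<omega> + m j \<omega>)"
      by (intro mart_diff_add GX mm V j)
    show "(\<lambda>\<omega>. G j \<omega> ** V j \<omega> + m j \<omega>) \<in> borel_measurable (F (Suc j))"
      using dfilt_mono[OF filt _ V(1)[OF j], of "Suc j"] Gm[OF j] mm(2)[OF j] by simp
    show "AE \<omega> in M. D (Suc j) \<omega> = D j \<omega> + (h *\<^sub>R A ** V j \<omega> + a j \<omega>) + (G j \<omega> ** V j \<omega> + m j \<omega>)"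
      using step[OF j] by eventually_elim (simp add: D_def V_def Z[OF j] mm_simps algebra_simps)
    have eK: "e * (1 + msq M (Y j)) \<le> e * (1 + K)"
      using e YK'[of j] j by (intro mult_left_mono add_left_mono) auto
    have "msq M (\<lambda>\<omega>. h *\<^sub>R A ** V j \<omega> + a j \<omega>) \<le> 2 * msq M (\<lambda>\<omega>. h *\<^sub>R A ** V j \<omega>) + 2 * msq M (a j)"
      by (intro integral_power2_norm_add_le L2_matrix_const_left aL2 V j)
    also have "\<dots> \<le> 2 * (h\<^sup>2 * (p * (2 * ?I + 2 * ?\<phi> j))) + 2 * (h\<^sup>2 * (e * (1 + K)))"
    proof (intro add_mono mult_left_mono order_trans[OF hA] order_trans[OF a2])
      show "e * h\<^sup>2 * (1 + msq M (Y j)) \<le> h\<^sup>2 * (e * (1 + K))"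
        using mult_left_mono[OF eK, of "h\<^sup>2"] by (simp add: mult_ac)
    qed (use V2 V j p0 in auto)
    also have "\<dots> = h\<^sup>2 * (4 * p * ?\<phi> j + q)" by (simp add: q_def algebra_simps)
    finally show "msq M (\<lambda>\<omega>. h *\<^sub>R A ** V j \<omega> + a j \<omega>) \<le> h\<^sup>2 * (4 * p * ?\<phi> j + q)" .
    have "msq M (\<lambda>\<omega>. G j \<omega> ** V j \<omega> + m j \<omega>) \<le> 2 * msq M (\<lambda>\<omega>. G j \<omega> ** V j \<omega>) + 2 * msq M (m j)"
      by (intro integral_power2_norm_add_le mart_diff_L2[OF GX(1)] mart_diff_L2[OF mm(1)] V j)
    also have "\<dots> \<le> 2 * (h * (p * (2 * ?I + 2 * ?\<phi> j))) + 2 * (h * (e * (1 + K)))"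
    proof (intro add_mono mult_left_mono order_trans[OF GX(2)] order_trans[OF m2])
      show "e * h * (1 + msq M (Y j)) \<le> h * (e * (1 + K))"
        using mult_left_mono[OF eK h(1)] by (simp add: mult_ac)
    qed (use V2 V j p0 h in auto)
    also have "\<dots> = h * (4 * p * ?\<phi> j + q)" by (simp add: q_def algebra_simps)
    finally show "msq M (\<lambda>\<omega>. G j \<omega> ** V j \<omega> + m j \<omega>) \<le> h * (4 * p * ?\<phi> j + q)" .
  qed (use h p0 q0 in auto)
  also have "msq M (D 0) = 0" by (simp add: D_def Z0)
  also have "(3 * 0 + 3 * (T + 4) * T * q) * exp (3 * (T + 4) * (4 * p) * T)
    \<le> (3 * (T + 4) * T * ((8 * p * (1 + T) * r + 2 * (1 + K)) * (real b * h + e))) * exp (3 * (T + 4) * (4 * p) * T)"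
  proof -
    have "q \<le> (8 * p * (1 + T) * r + 2 * (1 + K)) * (real b * h + e)"
      unfolding q_def using p0 T0 r0 h e K0 by (simp add: algebra_simps)
    then show ?thesis using T0 by (intro mult_right_mono mult_left_mono) (auto intro!: mult_left_mono)
  qed
  also have "\<dots> = uniC p T k * (real b * h + e)"
    by (simp add: uniC_def r_def K_def)
  finally show "(\<integral>\<omega>. (maxn (\<lambda>j \<omega>. Y j \<omega> - Z j \<omega>) n \<omega>)\<^sup>2 \<partial>M) \<le> uniC p T k * (real b * h + e)"
    by (simp add: D_def[abs_def])
qed

section \<open>Wiener increments and the Ito isometry\<close>

lemma integral_add4:
  fixes f g h k :: "'a \<Rightarrow> real"
  assumes "integrable M f" "integrable M g" "integrable M h" "integrable M k"
  shows "(\<integral>\<omega>. f \<omega> + g \<omega> + h \<omega> + k \<omega> \<partial>M) = (\<integral>\<omega>. f \<omega> \<partial>M) + (\<integral>\<omega>. g \<omega> \<partial>M) + (\<integral>\<omega>. h \<omega> \<partial>M) + (\<integral>\<omega>. k \<omega> \<partial>M)"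
  using assms by simp

text \<open>A constant generates only the trivial events. Increments of length zero need this, since
  \<open>wiener_process\<close> speaks of \<open>s < t\<close>.\<close>

lemma (in prob_space) indep_of_const:
  assumes "subalgebra M G" shows "indep_of M G (\<lambda>_. c)"
  unfolding indep_of_def
proof (intro conjI)
  have "sets (vimage_algebra (space M) (\<lambda>_. c) borel) \<subseteq> {{}, space M}"
  proof (intro sets_vimage_algebra2[THEN equalityD1, THEN order_trans])
    show "{(\<lambda>_. c) -` A \<inter> space M |A. A \<in> sets borel} \<subseteq> {{}, space M}" by auto
  qed auto
  then show "indep_set (sets G) (sets (vimage_algebra (space M) (\<lambda>_. c) borel))"
    using assms by (intro indep_setI) (auto simp: subalgebra_def prob_space Int_absorb1 sets.sets_into_space dest!: subsetD)
qed simp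

locale wiener = prob_space M for M :: "'a measure" +
  fixes FF :: "real \<Rightarrow> 'a measure" and \<xi> :: "real \<Rightarrow> 'a \<Rightarrow> real"
  assumes W: "wiener_process M FF \<xi>"
begin

lemma FF_sub: "subalgebra M (FF t)"
  using W by (simp add: wiener_process_def)

lemma FF_sets_mono: "s \<le> t \<Longrightarrow> sets (FF s) \<subseteq> sets (FF t)"
  using filtration.sets_F_mono[of "space M" FF] W by (simp add: wiener_process_def)

lemma FF_mono: "s \<le> t \<Longrightarrow> X \<in> measurable (FF s) N \<Longrightarrow> X \<in> measurable (FF t) N"
  using FF_sets_mono[of s t] FF_sub[of s] FF_sub[of t]
  by (intro measurable_from_subalg[of "FF t" "FF s"]) (simp_all add: subalgebra_def)

lemma FF_meas: "X \<in> measurable (FF s) N \<Longrightarrow> X \<in> measurable M N"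
  by (rule subalgebra_measurable[OF FF_sub])

lemma xi_FF: "0 \<le> s \<Longrightarrow> s \<le> t \<Longrightarrow> \<xi> s \<in> borel_measurable (FF t)"
  by (rule FF_mono[of s t]) (use W in \<open>simp_all add: wiener_process_def\<close>)

lemma xi_meas[measurable]: "0 \<le> t \<Longrightarrow> \<xi> t \<in> borel_measurable M"
  using xi_FF[of t t] FF_meas by simp

lemma mart_diff_FF_mono: "s \<le> t \<Longrightarrow> mart_diff M (FF t) U \<Longrightarrow> mart_diff M (FF s) U"
  unfolding mart_diff_def using FF_mono by blast

lemma indep_increment:
  assumes "0 \<le> s" "s \<le> t" shows "indep_of M (FF s) (\<lambda>\<omega>. \<xi> t \<omega> - \<xi> s \<omega>)"
proof (cases "s = t")
  case True
  then show ?thesis using indep_of_const[OF FF_sub, of s "0::real"] by simp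
next
  case False
  then show ?thesis using W assms by (auto simp: wiener_process_def indep_of_def)
qed

text \<open>Gaussian moments, with \<open>s = t\<close> included so that partitions may repeat
  points. The fourth moment enters in \<open>coarse_fourth_moment\<close>.\<close>

lemma increment_moment:
  assumes "0 \<le> s" "s \<le> t"
  shows "integrable M (\<lambda>\<omega>. (\<xi> t \<omega> - \<xi> s \<omega>) ^ k)"
    "(\<integral>\<omega>. \<xi> t \<omega> - \<xi> s \<omega> \<partial>M) = 0"
    "(\<integral>\<omega>. (\<xi> t \<omega> - \<xi> s \<omega>)\<^sup>2 \<partial>M) = t - s"
    "(\<integral>\<omega>. (\<xi> t \<omega> - \<xi> s \<omega>) ^ 4 \<partial>M) = 3 * (t - s)\<^sup>2"
proof -
  let ?X = "\<lambda>\<omega>. \<xi> t \<omega> - \<xi> s \<omega>" and ?d = "normal_density 0 (sqrt (t - s))"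
  have "integrable M (\<lambda>\<omega>. ?X \<omega> ^ k) \<and> (\<integral>\<omega>. ?X \<omega> \<partial>M) = 0 \<and> (\<integral>\<omega>. (?X \<omega>)\<^sup>2 \<partial>M) = t - s
    \<and> (\<integral>\<omega>. ?X \<omega> ^ 4 \<partial>M) = 3 * (t - s)\<^sup>2"
  proof (cases "s = t")
    case True then show ?thesis by (cases "k = 0") auto
  next
    case False
    then have pos: "0 < sqrt (t - s)" and ts: "t - s > 0" using assms by auto
    have D: "distributed M lborel ?X ?d" using W assms False by (auto simp: wiener_process_def)
    have I: "(\<integral>x. ?d x * x ^ j \<partial>lborel) = (\<integral>\<omega>. ?X \<omega> ^ j \<partial>M)" for j
      by (rule distributed_integral[OF D]) auto
    have "integrable lborel (\<lambda>x. ?d x * x ^ k)"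
      using integrable_normal_moment[OF pos, of 0 k] by simp
    then have "integrable M (\<lambda>\<omega>. ?X \<omega> ^ k)"
      by (subst (asm) distributed_integrable[OF D]) auto
    moreover have "(\<integral>\<omega>. ?X \<omega> \<partial>M) = 0"
      using I[of 1] integral_normal_moment_odd[OF pos, of 0 0] by simp
    moreover have "(\<integral>\<omega>. (?X \<omega>)\<^sup>2 \<partial>M) = t - s"
      using I[of 2] integral_normal_moment_even[OF pos, of 0 1] ts by (simp add: fact_numeral)
    moreover have "(\<integral>\<omega>. ?X \<omega> ^ 4 \<partial>M) = 3 * (t - s)\<^sup>2"
      using I[of 4] integral_normal_moment_even[OF pos, of 0 2] ts
      by (simp add: fact_numeral power_divide)
    ultimately show ?thesis by blast
  qed
  then show "integrable M (\<lambda>\<omega>. (\<xi> t \<omega> - \<xi> s \<omega>) ^ k)"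
    "(\<integral>\<omega>. \<xi> t \<omega> - \<xi> s \<omega> \<partial>M) = 0"
    "(\<integral>\<omega>. (\<xi> t \<omega> - \<xi> s \<omega>)\<^sup>2 \<partial>M) = t - s"
    "(\<integral>\<omega>. (\<xi> t \<omega> - \<xi> s \<omega>) ^ 4 \<partial>M) = 3 * (t - s)\<^sup>2" by blast+
qed

lemma increment_L2: "0 \<le> s \<Longrightarrow> s \<le> t \<Longrightarrow> L2 M (\<lambda>\<omega>. \<xi> t \<omega> - \<xi> s \<omega>)"
  using increment_moment(1)[of s t 2] by (simp add: L2_def)

lemma increment_scaleR:
  assumes "0 \<le> s" "s \<le> t" "e \<in> borel_measurable (FF s)" "L2 M e"
  shows "mart_diff M (FF s) (\<lambda>\<omega>. (\<xi> t \<omega> - \<xi> s \<omega>) *\<^sub>R e \<omega>)"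
    "L2 M (\<lambda>\<omega>. (\<xi> t \<omega> - \<xi> s \<omega>) *\<^sub>R e \<omega>)"
    "(\<lambda>\<omega>. (\<xi> t \<omega> - \<xi> s \<omega>) *\<^sub>R e \<omega>) \<in> borel_measurable (FF t)"
proof -
  show "mart_diff M (FF s) (\<lambda>\<omega>. (\<xi> t \<omega> - \<xi> s \<omega>) *\<^sub>R e \<omega>)"
    using assms by (intro mart_diff_scaleR[OF prob_space_axioms FF_sub indep_increment increment_L2 increment_moment(2)])
  then show "L2 M (\<lambda>\<omega>. (\<xi> t \<omega> - \<xi> s \<omega>) *\<^sub>R e \<omega>)" by (rule mart_diff_L2)
  show "(\<lambda>\<omega>. (\<xi> t \<omega> - \<xi> s \<omega>) *\<^sub>R e \<omega>) \<in> borel_measurable (FF t)"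
    using assms xi_FF[of s t] xi_FF[of t t] FF_mono[OF assms(2,3)] by simp
qed

text \<open>Both intervals are cut at \<open>c\<close> and at \<open>m\<close>, the end of their
  overlap. Only the common piece from \<open>c\<close> to \<open>m\<close> contributes; every other
  product pairs an increment with a variable of its past.\<close>

lemma increment_cov_le:
  assumes a: "0 \<le> a" "a \<le> b" and c: "a \<le> c" "c \<le> d"
    and e: "e \<in> borel_measurable (FF a)" "L2 M e"
    and f: "f \<in> borel_measurable (FF c)" "L2 M f"
  shows "(\<integral>\<omega>. ((\<xi> b \<omega> - \<xi> a \<omega>) *\<^sub>R e \<omega>) \<bullet> ((\<xi> d \<omega> - \<xi> c \<omega>) *\<^sub>R f \<omega>) \<partial>M)
    = max 0 (min b d - c) * (\<integral>\<omega>. e \<omega> \<bullet> f \<omega> \<partial>M)"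
proof (cases "b \<le> c")
  case True
  have "(\<lambda>\<omega>. (\<xi> b \<omega> - \<xi> a \<omega>) *\<^sub>R e \<omega>) \<in> borel_measurable (FF c)"
    by (rule FF_mono[OF True increment_scaleR(3)]) (use assms in auto)
  then show ?thesis
    using mart_diffD[OF increment_scaleR(1)[of c d f] _ increment_scaleR(2)[of a b e]] assms True by simp
next
  case False
  define m where "m = min b d"
  have m: "c \<le> m" "m \<le> b" "m \<le> d" "m = b \<or> m = d" using False c by (auto simp: m_def)
  define D where "D x y = (\<lambda>\<omega>. \<xi> y \<omega> - \<xi> x \<omega>)" for x y
  have ec: "e \<in> borel_measurable (FF c)" by (rule FF_mono[OF c(1) e(1)])
  have em: "e \<in> borel_measurable (FF m)" by (rule FF_mono[OF m(1) ec])
  have fm: "f \<in> borel_measurable (FF m)" by (rule FF_mono[OF m(1) f(1)])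
  have c0: "0 \<le> c" "0 \<le> m" using a c m by auto
  have L: "L2 M (\<lambda>\<omega>. D a c \<omega> *\<^sub>R e \<omega>)" "L2 M (\<lambda>\<omega>. D c m \<omega> *\<^sub>R e \<omega>)" "L2 M (\<lambda>\<omega>. D m b \<omega> *\<^sub>R e \<omega>)"
    "L2 M (\<lambda>\<omega>. D c m \<omega> *\<^sub>R f \<omega>)" "L2 M (\<lambda>\<omega>. D m d \<omega> *\<^sub>R f \<omega>)" "L2 M (\<lambda>\<omega>. D c d \<omega> *\<^sub>R f \<omega>)"
    unfolding D_def using a c c0 m e f ec em fm by (auto intro!: increment_scaleR(2))
  have 1: "(\<integral>\<omega>. (D a c \<omega> *\<^sub>R e \<omega>) \<bullet> (D c d \<omega> *\<^sub>R f \<omega>) \<partial>M) = 0"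
    unfolding D_def using L(1) a c c0 e f
    by (intro mart_diffD[OF increment_scaleR(1)] increment_scaleR(3)) (auto simp: D_def)
  have 2: "(\<integral>\<omega>. (D c m \<omega> *\<^sub>R e \<omega>) \<bullet> (D m d \<omega> *\<^sub>R f \<omega>) \<partial>M) = 0"
    unfolding D_def using L(2) a c c0 e f m ec fm
    by (intro mart_diffD[OF increment_scaleR(1)] increment_scaleR(3)) (auto simp: D_def)
  have 3: "(\<integral>\<omega>. (D c m \<omega> *\<^sub>R f \<omega>) \<bullet> (D m b \<omega> *\<^sub>R e \<omega>) \<partial>M) = 0"
    unfolding D_def using L(4) a c c0 e f m em fm
    by (intro mart_diffD[OF increment_scaleR(1)] increment_scaleR(3)) (auto simp: D_def)
  have 4: "(\<integral>\<omega>. (D c m \<omega> *\<^sub>R e \<omega>) \<bullet> (D c m \<omega> *\<^sub>R f \<omega>) \<partial>M) = (m - c) * (\<integral>\<omega>. e \<omega> \<bullet> f \<omega> \<partial>M)"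
  proof -
    have "indep_of M (FF c) (\<lambda>\<omega>. (\<xi> m \<omega> - \<xi> c \<omega>)\<^sup>2)"
      by (rule indep_of_compose[OF prob_space_axioms indep_increment]) (use c0 m in auto)
    from indep_of_integral_mult(2)[OF prob_space_axioms FF_sub this, of "\<lambda>\<omega>. e \<omega> \<bullet> f \<omega>"]
    have "(\<integral>\<omega>. (e \<omega> \<bullet> f \<omega>) * (\<xi> m \<omega> - \<xi> c \<omega>)\<^sup>2 \<partial>M) = (\<integral>\<omega>. e \<omega> \<bullet> f \<omega> \<partial>M) * (m - c)"
      using ec f increment_moment(1)[of c m 2] increment_moment(3)[of c m] c0 m L2_inner_integrable[OF e(2) f(2)] by simp
    then show ?thesis by (simp add: D_def power2_eq_square mult_ac)
  qed
  \<comment> \<open>The product of the pieces from \<open>m\<close> to \<open>b\<close> and from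
    \<open>m\<close> to \<open>d\<close> does not occur: \<open>m\<close> equals \<open>b\<close> or
    \<open>d\<close>, so one of them is empty.\<close>
  have "(\<integral>\<omega>. (D a b \<omega> *\<^sub>R e \<omega>) \<bullet> (D c d \<omega> *\<^sub>R f \<omega>) \<partial>M)
    = (\<integral>\<omega>. (D a c \<omega> *\<^sub>R e \<omega>) \<bullet> (D c d \<omega> *\<^sub>R f \<omega>) + (D c m \<omega> *\<^sub>R e \<omega>) \<bullet> (D c m \<omega> *\<^sub>R f \<omega>)
       + (D c m \<omega> *\<^sub>R e \<omega>) \<bullet> (D m d \<omega> *\<^sub>R f \<omega>) + (D c m \<omega> *\<^sub>R f \<omega>) \<bullet> (D m b \<omega> *\<^sub>R e \<omega>) \<partial>M)"
    using m(4) by (intro Bochner_Integration.integral_cong refl) (auto simp: D_def algebra_simps inner_commute)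
  also have "\<dots> = (m - c) * (\<integral>\<omega>. e \<omega> \<bullet> f \<omega> \<partial>M)"
    by (subst integral_add4[OF L2_inner_integrable[OF L(1,6)] L2_inner_integrable[OF L(2,4)]
      L2_inner_integrable[OF L(2,5)] L2_inner_integrable[OF L(4,3)]]) (simp add: 1 2 3 4 del: inner_scaleR_left inner_scaleR_right)
  finally show ?thesis using m c by (simp add: D_def m_def)
qed

lemma increment_cov:
  assumes "0 \<le> a" "a \<le> b" "0 \<le> c" "c \<le> d"
    and "e \<in> borel_measurable (FF a)" "L2 M e" "f \<in> borel_measurable (FF c)" "L2 M f"
  shows "(\<integral>\<omega>. ((\<xi> b \<omega> - \<xi> a \<omega>) *\<^sub>R e \<omega>) \<bullet> ((\<xi> d \<omega> - \<xi> c \<omega>) *\<^sub>R f \<omega>) \<partial>M)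
    = max 0 (min b d - max a c) * (\<integral>\<omega>. e \<omega> \<bullet> f \<omega> \<partial>M)"
proof (cases "a \<le> c")
  case True
  then show ?thesis using increment_cov_le[of a b c d e f] assms by (simp add: max_def)
next
  case False
  then show ?thesis using increment_cov_le[of c d a b f e] assms by (simp add: max_def inner_commute min.commute)
qed

text \<open>Elementary integrands whose intervals may overlap, so that differences stay in the class
  without passing to a common partition.\<close>

definition fam :: "'i set \<Rightarrow> ('i \<Rightarrow> real) \<Rightarrow> ('i \<Rightarrow> real) \<Rightarrow> ('i \<Rightarrow> 'a \<Rightarrow> 'b::euclidean_space) \<Rightarrow> bool" where
  "fam J a b e \<longleftrightarrow> finite J \<and> (\<forall>j\<in>J. 0 \<le> a j \<and> a j \<le> b j \<and> e j \<in> borel_measurable (FF (a j)) \<and> L2 M (e j))"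

definition fproc :: "'i set \<Rightarrow> ('i \<Rightarrow> real) \<Rightarrow> ('i \<Rightarrow> real) \<Rightarrow> ('i \<Rightarrow> 'a \<Rightarrow> 'b::euclidean_space) \<Rightarrow> real \<Rightarrow> 'a \<Rightarrow> 'b" where
  "fproc J a b e \<tau> \<omega> = (\<Sum>j\<in>J. indicator {a j..<b j} \<tau> *\<^sub>R e j \<omega>)"

definition fint :: "'i set \<Rightarrow> ('i \<Rightarrow> real) \<Rightarrow> ('i \<Rightarrow> real) \<Rightarrow> ('i \<Rightarrow> 'a \<Rightarrow> 'b::euclidean_space) \<Rightarrow> 'a \<Rightarrow> 'b" where
  "fint J a b e \<omega> = (\<Sum>j\<in>J. (\<xi> (b j) \<omega> - \<xi> (a j) \<omega>) *\<^sub>R e j \<omega>)"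

lemma fam_fint_L2: "fam J a b e \<Longrightarrow> L2 M (fint J a b e)"
  unfolding fint_def[abs_def] by (intro L2_sum increment_scaleR(2)) (auto simp: fam_def)

lemma fam_fproc_L2: "fam J a b e \<Longrightarrow> L2 M (fproc J a b e \<tau>)"
  unfolding fproc_def[abs_def] by (intro L2_sum L2_scaleR) (auto simp: fam_def)

lemma fam_fproc_joint: "fam J a b e \<Longrightarrow> (\<lambda>(\<tau>, \<omega>). fproc J a b e \<tau> \<omega>) \<in> borel_measurable (borel \<Otimes>\<^sub>M M)"
proof -
  assume f: "fam J a b e"
  have "(\<lambda>x. indicator {a j..<b j} (fst x) *\<^sub>R e j (snd x)) \<in> borel_measurable (borel \<Otimes>\<^sub>M M)" if "j \<in> J" for j
  proof -
    have [measurable]: "e j \<in> borel_measurable M" using f that by (auto simp: fam_def L2_def)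
    show ?thesis by measurable
  qed
  then show ?thesis unfolding fproc_def split_beta by (intro borel_measurable_sum)
qed

lemma msq_sum_expand:
  assumes "finite J" "\<And>j. j \<in> J \<Longrightarrow> L2 M (X j)"
  shows "msq M (\<lambda>\<omega>. \<Sum>j\<in>J. X j \<omega>) = (\<Sum>j\<in>J. \<Sum>k\<in>J. \<integral>\<omega>. X j \<omega> \<bullet> X k \<omega> \<partial>M)"
proof -
  have "msq M (\<lambda>\<omega>. \<Sum>j\<in>J. X j \<omega>) = (\<integral>\<omega>. (\<Sum>j\<in>J. \<Sum>k\<in>J. X j \<omega> \<bullet> X k \<omega>) \<partial>M)"
    unfolding power2_norm_eq_inner inner_sum_left by (simp add: inner_sum_right)
  also have "\<dots> = (\<Sum>j\<in>J. \<integral>\<omega>. (\<Sum>k\<in>J. X j \<omega> \<bullet> X k \<omega>) \<partial>M)"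
    by (rule Bochner_Integration.integral_sum) (use assms in \<open>auto intro!: Bochner_Integration.integrable_sum L2_inner_integrable\<close>)
  also have "\<dots> = (\<Sum>j\<in>J. \<Sum>k\<in>J. \<integral>\<omega>. X j \<omega> \<bullet> X k \<omega> \<partial>M)"
    by (intro sum.cong refl Bochner_Integration.integral_sum) (use assms in \<open>auto intro!: L2_inner_integrable\<close>)
  finally show ?thesis .
qed

text \<open>Both sides expand into the same double sum, over pairs of intervals, of the length of
  the overlap times the mean inner product of the coefficients; \<open>increment_cov\<close>
  supplies this for the integral.\<close>

lemma ito_isometry:
  assumes f: "fam J a b e"
  shows "(\<integral>\<^sup>+\<tau>. (\<integral>\<^sup>+\<omega>. ennreal ((norm (fproc J a b e \<tau> \<omega>))\<^sup>2) \<partial>M) \<partial>lborel) = ennreal (msq M (fint J a b e))"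
proof -
  define c where "c j k = (\<integral>\<omega>. e j \<omega> \<bullet> e k \<omega> \<partial>M)" for j k
  have fin: "finite J" using f by (simp add: fam_def)
  have i: "integrable lborel (\<lambda>\<tau>::real. indicator {l..<u} \<tau> * x)" for l u x :: real
  proof (intro integrable_mult_left integrable_real_indicator)
    show "emeasure lborel {l..<u} < \<infinity>" by (cases "l \<le> u") auto
  qed auto
  have P: "msq M (fproc J a b e \<tau>) = (\<Sum>j\<in>J. \<Sum>k\<in>J. indicator {max (a j) (a k)..<min (b j) (b k)} \<tau> * c j k)" for \<tau>
  proof -
    have "msq M (fproc J a b e \<tau>) = (\<Sum>j\<in>J. \<Sum>k\<in>J. \<integral>\<omega>. (indicator {a j..<b j} \<tau> *\<^sub>R e j \<omega>) \<bullet> (indicator {a k..<b k} \<tau> *\<^sub>R e k \<omega>) \<partial>M)"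
      unfolding fproc_def by (intro msq_sum_expand fin L2_scaleR) (use f in \<open>auto simp: fam_def\<close>)
    also have "\<dots> = (\<Sum>j\<in>J. \<Sum>k\<in>J. indicator {max (a j) (a k)..<min (b j) (b k)} \<tau> * c j k)"
      by (intro sum.cong refl) (auto simp: c_def indicator_def)
    finally show ?thesis .
  qed
  have "(\<integral>\<^sup>+\<tau>. (\<integral>\<^sup>+\<omega>. ennreal ((norm (fproc J a b e \<tau> \<omega>))\<^sup>2) \<partial>M) \<partial>lborel) = (\<integral>\<^sup>+\<tau>. ennreal (msq M (fproc J a b e \<tau>)) \<partial>lborel)"
    by (intro nn_integral_cong nn_integral_eq_integral L2_integrable_sq fam_fproc_L2 f) auto
  also have "\<dots> = ennreal (\<integral>\<tau>. msq M (fproc J a b e \<tau>) \<partial>lborel)"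
  proof (rule nn_integral_eq_integral)
    show "integrable lborel (\<lambda>\<tau>. msq M (fproc J a b e \<tau>))"
      unfolding P by (intro Bochner_Integration.integrable_sum i)
  qed simp
  also have "(\<integral>\<tau>. msq M (fproc J a b e \<tau>) \<partial>lborel) = (\<Sum>j\<in>J. \<Sum>k\<in>J. max 0 (min (b j) (b k) - max (a j) (a k)) * c j k)"
  proof -
    have *: "measure lborel {l..<u} = max 0 (u - l)" for l u :: real by (cases "l \<le> u") auto
    have **: "(\<integral>\<tau>. indicator {l..<u} \<tau> * x \<partial>lborel) = max 0 (u - l) * x" for l u x :: real
      by (simp add: *)
    show ?thesis unfolding P **[symmetric]
      by (subst Bochner_Integration.integral_sum) (intro sum.cong refl Bochner_Integration.integral_sum i Bochner_Integration.integrable_sum)+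
  qed
  also have "\<dots> = msq M (fint J a b e)"
  proof -
    have "msq M (fint J a b e) = (\<Sum>j\<in>J. \<Sum>k\<in>J. \<integral>\<omega>. ((\<xi> (b j) \<omega> - \<xi> (a j) \<omega>) *\<^sub>R e j \<omega>) \<bullet> ((\<xi> (b k) \<omega> - \<xi> (a k) \<omega>) *\<^sub>R e k \<omega>) \<partial>M)"
      unfolding fint_def by (intro msq_sum_expand fin increment_scaleR(2)) (use f in \<open>auto simp: fam_def\<close>)
    also have "\<dots> = (\<Sum>j\<in>J. \<Sum>k\<in>J. max 0 (min (b j) (b k) - max (a j) (a k)) * c j k)"
      unfolding c_def by (intro sum.cong refl increment_cov) (use f in \<open>auto simp: fam_def\<close>)
    finally show ?thesis by simp
  qed
  finally show ?thesis .
qed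

end

section \<open>Ito integrals as limits of elementary integrals\<close>

text \<open>Integrands are jointly measurable on their time interval only, while Fubini is applied
  on the whole line; extension by zero mediates.\<close>

lemma joint_extend:
  fixes f :: "real \<times> 'a \<Rightarrow> 'b::euclidean_space"
  assumes "f \<in> borel_measurable (restrict_space borel S \<Otimes>\<^sub>M M)" "S \<in> sets borel"
  shows "(\<lambda>x. indicator S (fst x) *\<^sub>R f x) \<in> borel_measurable (borel \<Otimes>\<^sub>M M)"
proof (cases "S = {}")
  case False
  then obtain s where s: "s \<in> S" by auto
  \<comment> \<open>A measurable retraction of the line onto \<open>S\<close>; the indicator removes
    the values at retracted points.\<close>
  define g where "g \<tau> = (if \<tau> \<in> S then \<tau> else s)" for \<tau>
  have "g \<in> borel \<rightarrow>\<^sub>M restrict_space borel S"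
    by (rule measurable_restrict_space2) (use s assms(2) in \<open>auto simp: g_def[abs_def]\<close>)
  then have "(\<lambda>x. (g (fst x), snd x)) \<in> borel \<Otimes>\<^sub>M M \<rightarrow>\<^sub>M restrict_space borel S \<Otimes>\<^sub>M M"
    by measurable
  from measurable_compose[OF this assms(1)]
  have "(\<lambda>x. indicator S (fst x) *\<^sub>R f (g (fst x), snd x)) \<in> borel_measurable (borel \<Otimes>\<^sub>M M)"
    using assms(2) by measurable
  also have "(\<lambda>x. indicator S (fst x) *\<^sub>R f (g (fst x), snd x)) = (\<lambda>x. indicator S (fst x) *\<^sub>R f x)"
    by (auto simp: fun_eq_iff g_def indicator_def)
  finally show ?thesis .
qed simp

abbreviation dsq :: "'a measure \<Rightarrow> (real \<Rightarrow> 'a \<Rightarrow> 'b::real_normed_vector) \<Rightarrow> ennreal" where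
  "dsq M P \<equiv> \<integral>\<^sup>+\<tau>. (\<integral>\<^sup>+\<omega>. ennreal ((norm (P \<tau> \<omega>))\<^sup>2) \<partial>M) \<partial>lborel"

definition joint_meas :: "'a measure \<Rightarrow> (real \<Rightarrow> 'a \<Rightarrow> 'b::euclidean_space) \<Rightarrow> bool" where
  "joint_meas M P \<longleftrightarrow> (\<lambda>x. P (fst x) (snd x)) \<in> borel_measurable (borel \<Otimes>\<^sub>M M)"

lemma joint_meas_diff: "joint_meas M P \<Longrightarrow> joint_meas M Q \<Longrightarrow> joint_meas M (\<lambda>\<tau> \<omega>. P \<tau> \<omega> - Q \<tau> \<omega>)"
  unfolding joint_meas_def by (rule borel_measurable_diff)

lemma joint_meas_indicator: "joint_meas M P \<Longrightarrow> S \<in> sets borel \<Longrightarrow> joint_meas M (\<lambda>\<tau> \<omega>. indicator S \<tau> *\<^sub>R P \<tau> \<omega>)"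
proof -
  assume [measurable]: "joint_meas M P" "S \<in> sets borel"
  have [measurable]: "(\<lambda>x. P (fst x) (snd x)) \<in> borel_measurable (borel \<Otimes>\<^sub>M M)"
    using \<open>joint_meas M P\<close> by (simp add: joint_meas_def)
  show ?thesis unfolding joint_meas_def by measurable
qed

lemma joint_meas_fixed: "X \<in> borel_measurable M \<Longrightarrow> joint_meas M (\<lambda>\<tau>. X)"
  unfolding joint_meas_def by (rule measurable_compose[OF measurable_snd])

lemma joint_meas_section: "joint_meas M P \<Longrightarrow> P \<tau> \<in> borel_measurable M"
  unfolding joint_meas_def by (drule measurable_compose[OF measurable_Pair1'[of \<tau> borel M], rotated]) simp_all

lemma joint_meas_section2:
  assumes "joint_meas M P" "\<omega> \<in> space M" shows "(\<lambda>\<tau>. P \<tau> \<omega>) \<in> borel_measurable borel"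
proof -
  have "(\<lambda>\<tau>. (\<tau>, \<omega>)) \<in> borel \<rightarrow>\<^sub>M borel \<Otimes>\<^sub>M M" using assms(2) by measurable
  from measurable_compose[OF this assms(1)[unfolded joint_meas_def]] show ?thesis by simp
qed

lemma (in prob_space) joint_meas_sq_measurable:
  assumes "joint_meas M P" shows "(\<lambda>\<tau>. \<integral>\<^sup>+\<omega>. ennreal ((norm (P \<tau> \<omega>))\<^sup>2) \<partial>M) \<in> borel_measurable lborel"
proof -
  have "(\<lambda>x. ennreal ((norm (P (fst x) (snd x)))\<^sup>2)) \<in> borel_measurable (borel \<Otimes>\<^sub>M M)"
    using assms unfolding joint_meas_def by measurable
  from borel_measurable_nn_integral_fst[OF this] show ?thesis by simp
qed

lemma (in prob_space) dsq_add_le: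
  assumes "joint_meas M P" "joint_meas M Q"
  shows "dsq M (\<lambda>\<tau> \<omega>. P \<tau> \<omega> + Q \<tau> \<omega>) \<le> 2 * dsq M P + 2 * dsq M Q"
proof -
  have "dsq M (\<lambda>\<tau> \<omega>. P \<tau> \<omega> + Q \<tau> \<omega>) \<le> (\<integral>\<^sup>+\<tau>. (\<integral>\<^sup>+\<omega>. 2 * ennreal ((norm (P \<tau> \<omega>))\<^sup>2) + 2 * ennreal ((norm (Q \<tau> \<omega>))\<^sup>2) \<partial>M) \<partial>lborel)"
  proof (intro nn_integral_mono)
    fix \<tau> \<omega>
    have "ennreal ((norm (P \<tau> \<omega> + Q \<tau> \<omega>))\<^sup>2) \<le> ennreal (2 * (norm (P \<tau> \<omega>))\<^sup>2 + 2 * (norm (Q \<tau> \<omega>))\<^sup>2)"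
      by (intro ennreal_leI power2_norm_add_le)
    then show "ennreal ((norm (P \<tau> \<omega> + Q \<tau> \<omega>))\<^sup>2) \<le> 2 * ennreal ((norm (P \<tau> \<omega>))\<^sup>2) + 2 * ennreal ((norm (Q \<tau> \<omega>))\<^sup>2)"
      by (simp add: ennreal_plus ennreal_mult)
  qed
  also have "\<dots> = (\<integral>\<^sup>+\<tau>. 2 * (\<integral>\<^sup>+\<omega>. ennreal ((norm (P \<tau> \<omega>))\<^sup>2) \<partial>M) + 2 * (\<integral>\<^sup>+\<omega>. ennreal ((norm (Q \<tau> \<omega>))\<^sup>2) \<partial>M) \<partial>lborel)"
    using joint_meas_section[OF assms(1)] joint_meas_section[OF assms(2)]
    by (intro nn_integral_cong) (simp add: nn_integral_add nn_integral_cmult)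
  also have "\<dots> = 2 * dsq M P + 2 * dsq M Q"
    using joint_meas_sq_measurable[OF assms(1)] joint_meas_sq_measurable[OF assms(2)]
    by (simp add: nn_integral_add nn_integral_cmult)
  finally show ?thesis .
qed

lemma (in prob_space) dsq_diff_le:
  assumes "joint_meas M P" "joint_meas M Q"
  shows "dsq M (\<lambda>\<tau> \<omega>. P \<tau> \<omega> - Q \<tau> \<omega>) \<le> 2 * dsq M P + 2 * dsq M Q"
  using dsq_add_le[OF assms(1), of "\<lambda>\<tau> \<omega>. - Q \<tau> \<omega>"] joint_meas_diff[OF joint_meas_fixed[of "\<lambda>_. 0"] assms(2)] by simp

lemma set_nn_sq_eq:
  "(\<integral>\<^sup>+\<tau>\<in>S. (\<integral>\<^sup>+\<omega>. ennreal ((norm (P \<tau> \<omega>))\<^sup>2) \<partial>M) \<partial>lborel) = dsq M (\<lambda>\<tau> \<omega>. indicator S \<tau> *\<^sub>R P \<tau> \<omega>)"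
  by (intro nn_integral_cong) (auto simp: indicator_def)

lemma L2_uminus_iff: "L2 M (\<lambda>\<omega>. - X \<omega>) \<longleftrightarrow> L2 M X"
  using L2_uminus[of M X] L2_uminus[of M "\<lambda>\<omega>. - X \<omega>"] by auto

context wiener
begin

lemma ito_integrand_jm:
  assumes "ito_integrand M FF u t H" shows "joint_meas M (\<lambda>\<tau> \<omega>. indicator {u..t} \<tau> *\<^sub>R H \<tau> \<omega>)"
  using joint_extend[of "\<lambda>(\<tau>, \<omega>). H \<tau> \<omega>" "{u..t}" M] assms
  unfolding ito_integrand_def joint_meas_def by (simp add: split_beta)

text \<open>One member of the approximating sequence with both errors below \<delta>, rewritten as a
  family so that \<open>ito_isometry\<close> applies to differences.\<close>

lemma ito_approx:
  assumes I: "is_ito_integral M FF \<xi> u t H I" and u: "0 \<le> u" and d: "\<delta> > 0"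
  obtains N p e where "fam {..<N::nat} p (\<lambda>j. p (Suc j)) e"
    "\<And>j. j < N \<Longrightarrow> u \<le> p j \<and> p j \<le> p (Suc j) \<and> p (Suc j) \<le> t"
    "dsq M (\<lambda>\<tau> \<omega>. indicator {u..t} \<tau> *\<^sub>R H \<tau> \<omega> - fproc {..<N} p (\<lambda>j. p (Suc j)) e \<tau> \<omega>) \<le> ennreal \<delta>"
    "msq M (\<lambda>\<omega>. I \<omega> - fint {..<N} p (\<lambda>j. p (Suc j)) e \<omega>) \<le> \<delta>"
proof -
  obtain N p e where sd: "\<And>n. simple_data M FF u t (N n) (p n) (e n)"
    and l1: "(\<lambda>n. \<integral>\<^sup>+\<tau>\<in>{u..t}. (\<integral>\<^sup>+\<omega>. ennreal ((norm (H \<tau> \<omega> - simple_process (N n) (p n) (e n) \<tau> \<omega>))\<^sup>2) \<partial>M) \<partial>lborel) \<longlonglongrightarrow> 0"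
    and l2: "(\<lambda>n. \<integral>\<^sup>+\<omega>. ennreal ((norm (I \<omega> - simple_integral \<xi> (N n) (p n) (e n) \<omega>))\<^sup>2) \<partial>M) \<longlonglongrightarrow> 0"
    using I unfolding is_ito_integral_def by blast
  have "eventually (\<lambda>n. (\<integral>\<^sup>+\<tau>\<in>{u..t}. (\<integral>\<^sup>+\<omega>. ennreal ((norm (H \<tau> \<omega> - simple_process (N n) (p n) (e n) \<tau> \<omega>))\<^sup>2) \<partial>M) \<partial>lborel) < ennreal \<delta>
     \<and> (\<integral>\<^sup>+\<omega>. ennreal ((norm (I \<omega> - simple_integral \<xi> (N n) (p n) (e n) \<omega>))\<^sup>2) \<partial>M) < ennreal \<delta>) sequentially"
    using order_tendstoD(2)[OF l1, of "ennreal \<delta>"] order_tendstoD(2)[OF l2, of "ennreal \<delta>"] d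
    by (auto intro: eventually_conj)
  then obtain n where n: "(\<integral>\<^sup>+\<tau>\<in>{u..t}. (\<integral>\<^sup>+\<omega>. ennreal ((norm (H \<tau> \<omega> - simple_process (N n) (p n) (e n) \<tau> \<omega>))\<^sup>2) \<partial>M) \<partial>lborel) < ennreal \<delta>"
    "(\<integral>\<^sup>+\<omega>. ennreal ((norm (I \<omega> - simple_integral \<xi> (N n) (p n) (e n) \<omega>))\<^sup>2) \<partial>M) < ennreal \<delta>"
    by (auto simp: eventually_sequentially)
  let ?N = "N n" and ?p = "p n" and ?e = "e n" let ?q = "\<lambda>j. p n (Suc j)"
  have sdn: "?p 0 = u" "?p ?N = t" "\<And>j. j < ?N \<Longrightarrow> ?p j \<le> ?p (Suc j)"
    "\<And>j. j < ?N \<Longrightarrow> ?e j \<in> borel_measurable (FF (?p j))" "\<And>j. j < ?N \<Longrightarrow> L2 M (?e j)"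
    using sd[of n] by (auto simp: simple_data_def)
  \<comment> \<open>\<open>simple_data\<close> gives the end points and monotonicity of neighbours;
    inductions from either end confine all partition points to the interval.\<close>
  have up: "u \<le> ?p j" if "j \<le> ?N" for j
    using that
  proof (induction j)
    case (Suc j) then show ?case using sdn(3)[of j] by simp
  qed (simp add: sdn)
  have dn: "?p (?N - j) \<le> t" if "j \<le> ?N" for j
    using that
  proof (induction j)
    case (Suc j)
    have "?p (?N - Suc j) \<le> ?p (Suc (?N - Suc j))" by (rule sdn(3)) (use Suc in auto)
    with Suc show ?case by (simp add: Suc_diff_Suc)
  qed (simp add: sdn)
  have rng: "u \<le> ?p j \<and> ?p j \<le> ?p (Suc j) \<and> ?p (Suc j) \<le> t" if "j < ?N" for j
    using up[of j] sdn(3)[OF that] dn[of "?N - Suc j"] that by simp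
  have fm: "fam {..<?N} ?p ?q ?e"
    unfolding fam_def
  proof (intro conjI ballI)
    fix j assume "j \<in> {..<?N}"
    then have j: "j < ?N" by simp
    show "0 \<le> ?p j" "?p j \<le> ?q j" using rng[OF j] u by linarith+
    show "?e j \<in> borel_measurable (FF (?p j))" "L2 M (?e j)" using sdn(4,5)[OF j] by blast+
  qed simp
  have out: "fproc {..<?N} ?p ?q ?e \<tau> \<omega> = 0" if "\<tau> \<notin> {u..t}" for \<tau> \<omega>
    unfolding fproc_def
  proof (rule sum.neutral, safe)
    fix j assume "j < ?N"
    from rng[OF this] that have "\<tau> \<notin> {?p j..<?q j}" by auto
    then show "indicator {?p j..<?q j} \<tau> *\<^sub>R ?e j \<omega> = 0" by simp
  qed
  have sp: "simple_process ?N ?p ?e = fproc {..<?N} ?p ?q ?e"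
    by (simp add: fun_eq_iff simple_process_def fproc_def)
  have si: "simple_integral \<xi> ?N ?p ?e = fint {..<?N} ?p ?q ?e"
    by (simp add: fun_eq_iff simple_integral_def fint_def)
  have "dsq M (\<lambda>\<tau> \<omega>. indicator {u..t} \<tau> *\<^sub>R H \<tau> \<omega> - fproc {..<?N} ?p ?q ?e \<tau> \<omega>)
    = (\<integral>\<^sup>+\<tau>\<in>{u..t}. (\<integral>\<^sup>+\<omega>. ennreal ((norm (H \<tau> \<omega> - simple_process ?N ?p ?e \<tau> \<omega>))\<^sup>2) \<partial>M) \<partial>lborel)"
    unfolding set_nn_sq_eq sp
  proof (rule nn_integral_cong, rule nn_integral_cong)
    fix \<tau> \<omega>
    show "ennreal ((norm (indicator {u..t} \<tau> *\<^sub>R H \<tau> \<omega> - fproc {..<?N} ?p ?q ?e \<tau> \<omega>))\<^sup>2)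
      = ennreal ((norm (indicator {u..t} \<tau> *\<^sub>R (H \<tau> \<omega> - fproc {..<?N} ?p ?q ?e \<tau> \<omega>)))\<^sup>2)"
      using out[of \<tau> \<omega>] by (cases "\<tau> \<in> {u..t}") auto
  qed
  then have 1: "dsq M (\<lambda>\<tau> \<omega>. indicator {u..t} \<tau> *\<^sub>R H \<tau> \<omega> - fproc {..<?N} ?p ?q ?e \<tau> \<omega>) \<le> ennreal \<delta>"
    using n(1) by simp
  have "L2 M I" using I by (simp add: is_ito_integral_def)
  from L2_diff[OF this fam_fint_L2[OF fm]]
  have "(\<integral>\<^sup>+\<omega>. ennreal ((norm (I \<omega> - fint {..<?N} ?p ?q ?e \<omega>))\<^sup>2) \<partial>M) = ennreal (msq M (\<lambda>\<omega>. I \<omega> - fint {..<?N} ?p ?q ?e \<omega>))"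
    by (intro nn_integral_eq_integral L2_integrable_sq) auto
  then have 2: "msq M (\<lambda>\<omega>. I \<omega> - fint {..<?N} ?p ?q ?e \<omega>) \<le> \<delta>"
    using n(2) d unfolding si by (simp add: ennreal_less_iff)
  show thesis by (rule that[OF fm rng 1 2])
qed

text \<open>On a degenerate interval all partition points coincide, so every approximating sum is
  zero. An integral is thereby an increment of integrals from its own left end.\<close>

lemma ito_trivial:
  assumes I: "is_ito_integral M FF \<xi> u u H I" and u: "0 \<le> u"
  shows "AE \<omega> in M. I \<omega> = 0"
proof -
  have L: "L2 M I" using I by (simp add: is_ito_integral_def)
  have "msq M I \<le> \<delta>" if d: "\<delta> > 0" for \<delta>
  proof -
    obtain N p e where *: "fam {..<N::nat} p (\<lambda>j. p (Suc j)) e"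
      "\<And>j. j < N \<Longrightarrow> u \<le> p j \<and> p j \<le> p (Suc j) \<and> p (Suc j) \<le> u"
      "msq M (\<lambda>\<omega>. I \<omega> - fint {..<N} p (\<lambda>j. p (Suc j)) e \<omega>) \<le> \<delta>"
      by (rule ito_approx[OF I u d]) blast
    have "fint {..<N} p (\<lambda>j. p (Suc j)) e \<omega> = 0" for \<omega>
      unfolding fint_def
    proof (rule sum.neutral, safe)
      fix j assume "j < N" from *(2)[OF this] have "p (Suc j) = p j" by linarith
      then show "(\<xi> (p (Suc j)) \<omega> - \<xi> (p j) \<omega>) *\<^sub>R e j \<omega> = 0" by simp
    qed
    with *(3) show ?thesis by simp
  qed
  then have "msq M I \<le> 0" using field_le_epsilon[of "msq M I" 0] by simp
  then have "msq M I = 0" by (simp add: antisym)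
  then have "AE \<omega> in M. (norm (I \<omega>))\<^sup>2 = 0"
    by (subst (asm) integral_nonneg_eq_0_iff_AE[OF L2_integrable_sq[OF L]]) auto
  then show ?thesis by simp
qed

lemma fint_FF:
  assumes "fam J a b e" "\<And>j. j \<in> J \<Longrightarrow> b j \<le> t"
  shows "fint J a b e \<in> borel_measurable (FF t)"
  unfolding fint_def[abs_def]
proof (intro borel_measurable_sum)
  fix j assume j: "j \<in> J"
  show "(\<lambda>\<omega>. (\<xi> (b j) \<omega> - \<xi> (a j) \<omega>) *\<^sub>R e j \<omega>) \<in> borel_measurable (FF t)"
    by (rule FF_mono[OF assms(2)[OF j] increment_scaleR(3)]) (use assms j in \<open>auto simp: fam_def\<close>)
qed

text \<open>The integral is a mean square limit of adapted sums and, since the filtration need not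
  contain all null sets, equals an adapted variable only almost surely. A subsequence converging
  almost everywhere provides that version.\<close>

lemma ito_adapted:
  fixes I :: "'a \<Rightarrow> 'b::euclidean_space"
  assumes I: "is_ito_integral M FF \<xi> u t H I" and u: "0 \<le> u"
  shows "\<exists>J. J \<in> borel_measurable (FF t) \<and> (AE \<omega> in M. I \<omega> = J \<omega>)"
proof -
  have L: "L2 M I" using I by (simp add: is_ito_integral_def)
  have "\<exists>S. S \<in> borel_measurable (FF t) \<and> L2 M S \<and> msq M (\<lambda>\<omega>. I \<omega> - S \<omega>) \<le> (1 / real (Suc n))\<^sup>2" for n
  proof -
    have p: "(1 / real (Suc n))\<^sup>2 > 0" by simp
    obtain N p e where *: "fam {..<N::nat} p (\<lambda>j. p (Suc j)) e"
      "\<And>j. j < N \<Longrightarrow> u \<le> p j \<and> p j \<le> p (Suc j) \<and> p (Suc j) \<le> t"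
      "msq M (\<lambda>\<omega>. I \<omega> - fint {..<N} p (\<lambda>j. p (Suc j)) e \<omega>) \<le> (1 / real (Suc n))\<^sup>2"
      by (rule ito_approx[OF I u p]) blast
    then show ?thesis using fint_FF[OF *(1), of t] fam_fint_L2[OF *(1)] by blast
  qed
  then obtain S where S: "\<And>n. S n \<in> borel_measurable (FF t)" "\<And>n. L2 M (S n)"
    "\<And>n. msq M (\<lambda>\<omega>. I \<omega> - S n \<omega>) \<le> (1 / real (Suc n))\<^sup>2" by metis
  have D: "L2 M (\<lambda>\<omega>. S n \<omega> - I \<omega>)" for n by (intro L2_diff S L)
  have le: "(\<integral>\<omega>. norm (S n \<omega> - I \<omega>) \<partial>M) \<le> 1 / real (Suc n)" for n
  proof (rule power2_le_imp_le)
    have "(\<integral>\<omega>. norm (S n \<omega> - I \<omega>) * 1 \<partial>M)\<^sup>2 \<le> (\<integral>\<omega>. (norm (S n \<omega> - I \<omega>))\<^sup>2 \<partial>M) * (\<integral>\<omega>. 1\<^sup>2 \<partial>M)"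
      by (rule L2_Cauchy_Schwarz) (use D L2_norm_iff[of "\<lambda>\<omega>. S n \<omega> - I \<omega>" M] in \<open>auto simp: L2_measurable\<close>)
    also have "\<dots> \<le> (1 / real (Suc n))\<^sup>2" using S(3)[of n] by (simp add: prob_space norm_minus_commute)
    finally show "(\<integral>\<omega>. norm (S n \<omega> - I \<omega>) \<partial>M)\<^sup>2 \<le> (1 / real (Suc n))\<^sup>2" by simp
  qed simp
  have "(\<lambda>n. 1 / real (Suc n)) \<longlonglongrightarrow> 0"
    using LIMSEQ_inverse_real_of_nat by (simp add: inverse_eq_divide)
  then have "(\<lambda>n. \<integral>\<omega>. norm (S n \<omega> - I \<omega>) \<partial>M) \<longlonglongrightarrow> 0"
    by (rule tendsto_sandwich[OF always_eventually always_eventually tendsto_const, rotated 2]) (use le in \<open>auto simp del: of_nat_Suc\<close>)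
  moreover have "integrable M (\<lambda>\<omega>. S n \<omega> - I \<omega>)" for n
    by (rule L2_integrable[OF finite_measure_axioms D])
  ultimately obtain r where r: "strict_mono r" "AE \<omega> in M. (\<lambda>n. S (r n) \<omega> - I \<omega>) \<longlonglongrightarrow> 0"
    using tendsto_L1_AE_subseq[of M "\<lambda>n \<omega>. S n \<omega> - I \<omega>"] by auto
  \<comment> \<open>\<open>lim\<close> is total, so \<open>J\<close> is measurable at time
    \<open>t\<close> even though the sequence may diverge on a null set.\<close>
  define J where "J \<omega> = lim (\<lambda>n. S (r n) \<omega>)" for \<omega>
  have "J \<in> borel_measurable (FF t)"
    unfolding J_def[abs_def] by (rule borel_measurable_lim_metric) (rule S)
  moreover have "AE \<omega> in M. I \<omega> = J \<omega>"
    using r(2)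
  proof eventually_elim
    case (elim \<omega>)
    then have "(\<lambda>n. S (r n) \<omega>) \<longlonglongrightarrow> I \<omega>" by (simp add: LIM_zero_iff)
    then show ?case unfolding J_def by (simp add: limI)
  qed
  ultimately show ?thesis by blast
qed

lemma ito_increment_msq:
  fixes H :: "real \<Rightarrow> 'a \<Rightarrow> 'b::euclidean_space"
  assumes It: "is_ito_integral M FF \<xi> u t H I" and Is: "is_ito_integral M FF \<xi> u s H I'"
    and ust: "0 \<le> u" "u \<le> s" "s \<le> t"
    and X: "X \<in> borel_measurable (FF s)" "L2 M X"
  shows "ennreal (msq M (\<lambda>\<omega>. I \<omega> - I' \<omega> - (\<xi> t \<omega> - \<xi> s \<omega>) *\<^sub>R X \<omega>))
    \<le> 4 * (\<integral>\<^sup>+\<tau>\<in>{s..t}. (\<integral>\<^sup>+\<omega>. ennreal ((norm (H \<tau> \<omega> - X \<omega>))\<^sup>2) \<partial>M) \<partial>lborel)" (is "?L \<le> 4 * ?R")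
proof (rule ennreal_le_epsilon)
  let ?Ht = "\<lambda>\<tau> \<omega>. indicator {u..t} \<tau> *\<^sub>R H \<tau> \<omega>" and ?Hs = "\<lambda>\<tau> \<omega>. indicator {u..s} \<tau> *\<^sub>R H \<tau> \<omega>"
  let ?X = "\<lambda>\<tau> \<omega>. indicator {s..<t} \<tau> *\<^sub>R X \<omega>" and ?D = "\<lambda>\<omega>. (\<xi> t \<omega> - \<xi> s \<omega>) *\<^sub>R X \<omega>"
  fix \<epsilon> :: real assume \<epsilon>: "0 < \<epsilon>"
  \<comment> \<open>The errors add up to \<open>8 * \<delta>\<close> from the integrals and twice
    \<open>8 * \<delta>\<close> from the integrands.\<close>
  define \<delta> where "\<delta> = \<epsilon> / 24"
  have d: "\<delta> > 0" using \<epsilon> by (simp add: \<delta>_def)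
  obtain N p e where 1: "fam {..<N::nat} p (\<lambda>j. p (Suc j)) e"
      "dsq M (\<lambda>\<tau> \<omega>. ?Ht \<tau> \<omega> - fproc {..<N} p (\<lambda>j. p (Suc j)) e \<tau> \<omega>) \<le> ennreal \<delta>"
      "msq M (\<lambda>\<omega>. I \<omega> - fint {..<N} p (\<lambda>j. p (Suc j)) e \<omega>) \<le> \<delta>"
    by (rule ito_approx[OF It ust(1) d]) blast
  obtain N' p' e' where 2: "fam {..<N'::nat} p' (\<lambda>j. p' (Suc j)) e'"
      "dsq M (\<lambda>\<tau> \<omega>. ?Hs \<tau> \<omega> - fproc {..<N'} p' (\<lambda>j. p' (Suc j)) e' \<tau> \<omega>) \<le> ennreal \<delta>"
      "msq M (\<lambda>\<omega>. I' \<omega> - fint {..<N'} p' (\<lambda>j. p' (Suc j)) e' \<omega>) \<le> \<delta>"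
    by (rule ito_approx[OF Is ust(1) d]) blast
  define P where "P = fproc {..<N} p (\<lambda>j. p (Suc j)) e"
  define P' where "P' = fproc {..<N'} p' (\<lambda>j. p' (Suc j)) e'"
  define S where "S = fint {..<N} p (\<lambda>j. p (Suc j)) e"
  define S' where "S' = fint {..<N'} p' (\<lambda>j. p' (Suc j)) e'"
  define J where "J = {..<N} <+> ({..<N'} <+> {()})"
  define a where "a = case_sum p (case_sum p' (\<lambda>_::unit. s))"
  define b where "b = case_sum (\<lambda>j. p (Suc j)) (case_sum (\<lambda>j. p' (Suc j)) (\<lambda>_::unit. t))"
  define f where "f = case_sum e (case_sum (\<lambda>j \<omega>. - e' j \<omega>) (\<lambda>(_::unit) \<omega>. - X \<omega>))"
  have fm: "fam J a b f"
    using 1(1) 2(1) X ust unfolding fam_def J_def a_def b_def f_def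
    by (auto simp: L2_uminus_iff)
  have pr: "fproc J a b f \<tau> \<omega> = P \<tau> \<omega> - P' \<tau> \<omega> - ?X \<tau> \<omega>" for \<tau> \<omega>
    by (simp add: fproc_def J_def a_def b_def f_def P_def P'_def sum.Plus sum_negf del: sum_indicator_scaleR)
  have it: "fint J a b f \<omega> = S \<omega> - S' \<omega> - ?D \<omega>" for \<omega>
    by (simp add: fint_def J_def a_def b_def f_def S_def S'_def sum.Plus sum_negf)
  have iso: "dsq M (\<lambda>\<tau> \<omega>. P \<tau> \<omega> - P' \<tau> \<omega> - ?X \<tau> \<omega>) = ennreal (msq M (\<lambda>\<omega>. S \<omega> - S' \<omega> - ?D \<omega>))"
    using ito_isometry[OF fm] by (simp add: pr it)
  have jP: "joint_meas M P" "joint_meas M P'"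
    using fam_fproc_joint[OF 1(1)] fam_fproc_joint[OF 2(1)] by (simp_all add: joint_meas_def P_def P'_def split_beta)
  have jX: "joint_meas M ?X" using X(2) by (intro joint_meas_indicator joint_meas_fixed) (auto simp: L2_def)
  have jH: "joint_meas M ?Ht" "joint_meas M ?Hs"
    using It Is by (auto intro: ito_integrand_jm simp: is_ito_integral_def)
  have L: "L2 M I" "L2 M I'" "L2 M S" "L2 M S'" "L2 M ?D"
    using It Is 1(1) 2(1) X ust by (auto simp: is_ito_integral_def S_def S'_def intro: fam_fint_L2 increment_scaleR(2))
  have m: "msq M (\<lambda>\<omega>. I \<omega> - I' \<omega> - ?D \<omega>) \<le> 8 * \<delta> + 2 * msq M (\<lambda>\<omega>. S \<omega> - S' \<omega> - ?D \<omega>)"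
  proof -
    have "msq M (\<lambda>\<omega>. I \<omega> - I' \<omega> - ?D \<omega>) = msq M (\<lambda>\<omega>. ((I \<omega> - S \<omega>) - (I' \<omega> - S' \<omega>)) + (S \<omega> - S' \<omega> - ?D \<omega>))"
      by (simp add: algebra_simps)
    also have "\<dots> \<le> 2 * msq M (\<lambda>\<omega>. (I \<omega> - S \<omega>) - (I' \<omega> - S' \<omega>)) + 2 * msq M (\<lambda>\<omega>. S \<omega> - S' \<omega> - ?D \<omega>)"
      by (intro integral_power2_norm_add_le L2_diff L)
    also have "msq M (\<lambda>\<omega>. (I \<omega> - S \<omega>) - (I' \<omega> - S' \<omega>)) \<le> 2 * msq M (\<lambda>\<omega>. I \<omega> - S \<omega>) + 2 * msq M (\<lambda>\<omega>. I' \<omega> - S' \<omega>)"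
      by (intro integral_power2_norm_diff_le L2_diff L)
    also have "\<dots> \<le> 2 * \<delta> + 2 * \<delta>"
      using 1(3) 2(3) by (simp add: S_def S'_def)
    finally show ?thesis by simp
  qed
  have two: "2 * ennreal x = ennreal (2 * x)" if "x \<ge> 0" for x using that by (simp add: ennreal_mult)
  have e8: "2 * (2 * ennreal \<delta> + 2 * ennreal \<delta>) = ennreal (8 * \<delta>)"
    using d by (simp add: two ennreal_plus[symmetric] del: ennreal_plus)
  have "dsq M (\<lambda>\<tau> \<omega>. P \<tau> \<omega> - P' \<tau> \<omega> - ?X \<tau> \<omega>)
    = dsq M (\<lambda>\<tau> \<omega>. (?Ht \<tau> \<omega> - ?Hs \<tau> \<omega> - ?X \<tau> \<omega>) - ((?Ht \<tau> \<omega> - P \<tau> \<omega>) - (?Hs \<tau> \<omega> - P' \<tau> \<omega>)))"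
    by (simp add: algebra_simps)
  also have "\<dots> \<le> 2 * dsq M (\<lambda>\<tau> \<omega>. ?Ht \<tau> \<omega> - ?Hs \<tau> \<omega> - ?X \<tau> \<omega>) + 2 * dsq M (\<lambda>\<tau> \<omega>. (?Ht \<tau> \<omega> - P \<tau> \<omega>) - (?Hs \<tau> \<omega> - P' \<tau> \<omega>))"
    by (intro dsq_diff_le joint_meas_diff jP jX jH)
  finally have q1: "dsq M (\<lambda>\<tau> \<omega>. P \<tau> \<omega> - P' \<tau> \<omega> - ?X \<tau> \<omega>)
    \<le> 2 * dsq M (\<lambda>\<tau> \<omega>. ?Ht \<tau> \<omega> - ?Hs \<tau> \<omega> - ?X \<tau> \<omega>) + 2 * dsq M (\<lambda>\<tau> \<omega>. (?Ht \<tau> \<omega> - P \<tau> \<omega>) - (?Hs \<tau> \<omega> - P' \<tau> \<omega>))" .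
  have "dsq M (\<lambda>\<tau> \<omega>. (?Ht \<tau> \<omega> - P \<tau> \<omega>) - (?Hs \<tau> \<omega> - P' \<tau> \<omega>))
    \<le> 2 * dsq M (\<lambda>\<tau> \<omega>. ?Ht \<tau> \<omega> - P \<tau> \<omega>) + 2 * dsq M (\<lambda>\<tau> \<omega>. ?Hs \<tau> \<omega> - P' \<tau> \<omega>)"
    by (intro dsq_diff_le joint_meas_diff jP jX jH)
  also have "\<dots> \<le> 2 * ennreal \<delta> + 2 * ennreal \<delta>"
    using 1(2) 2(2) by (intro add_mono mult_left_mono) (simp_all add: P_def P'_def)
  finally have q2: "2 * dsq M (\<lambda>\<tau> \<omega>. (?Ht \<tau> \<omega> - P \<tau> \<omega>) - (?Hs \<tau> \<omega> - P' \<tau> \<omega>)) \<le> ennreal (8 * \<delta>)"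
    unfolding e8[symmetric] by (rule mult_left_mono) simp
  have q3: "dsq M (\<lambda>\<tau> \<omega>. ?Ht \<tau> \<omega> - ?Hs \<tau> \<omega> - ?X \<tau> \<omega>) = ?R"
    unfolding set_nn_sq_eq
  proof (rule nn_integral_cong_AE)
    \<comment> \<open>Closed and half-open intervals disagree only at \<open>s\<close> and
      \<open>t\<close>.\<close>
    show "AE \<tau> in lborel. (\<integral>\<^sup>+\<omega>. ennreal ((norm (?Ht \<tau> \<omega> - ?Hs \<tau> \<omega> - ?X \<tau> \<omega>))\<^sup>2) \<partial>M)
      = (\<integral>\<^sup>+\<omega>. ennreal ((norm (indicator {s..t} \<tau> *\<^sub>R (H \<tau> \<omega> - X \<omega>)))\<^sup>2) \<partial>M)"
      using AE_lborel_singleton[of s] AE_lborel_singleton[of t]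
    proof eventually_elim
      case (elim \<tau>)
      then show ?case using ust by (intro nn_integral_cong) (auto simp: indicator_def)
    qed
  qed
  have n: "ennreal (msq M (\<lambda>\<omega>. S \<omega> - S' \<omega> - ?D \<omega>)) \<le> 2 * ?R + ennreal (8 * \<delta>)"
    using order_trans[OF q1 add_left_mono[OF q2]] unfolding iso q3 .
  have "?L \<le> ennreal (8 * \<delta> + 2 * msq M (\<lambda>\<omega>. S \<omega> - S' \<omega> - ?D \<omega>))"
    by (rule ennreal_leI[OF m])
  also have "\<dots> = ennreal (8 * \<delta>) + 2 * ennreal (msq M (\<lambda>\<omega>. S \<omega> - S' \<omega> - ?D \<omega>))"
    using d by (simp add: ennreal_plus ennreal_mult)
  also have "\<dots> \<le> ennreal (8 * \<delta>) + 2 * (2 * ?R + ennreal (8 * \<delta>))"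
    by (intro add_left_mono mult_left_mono n) simp
  also have "\<dots> = 4 * ?R + (ennreal (8 * \<delta>) + 2 * ennreal (8 * \<delta>))"
    by (simp add: distrib_left add_ac flip: mult.assoc)
  also have "ennreal (8 * \<delta>) + 2 * ennreal (8 * \<delta>) = ennreal \<epsilon>"
    using d by (simp add: two ennreal_plus[symmetric] \<delta>_def del: ennreal_plus)
  finally show "?L \<le> 4 * ?R + ennreal \<epsilon>" .
qed

text \<open>The two integrals have unrelated approximating sums. The sum \<open>S\<close> for the
  longer interval is cut at \<open>s\<close>: the part after \<open>s\<close> consists of later
  increments and is orthogonal to the past, and the part \<open>R\<close> before \<open>s\<close> is
  close to \<open>S'\<close> by the isometry. Cauchy-Schwarz bounds what remains.\<close>

lemma ito_increment_mart_diff: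
  fixes H :: "real \<Rightarrow> 'a \<Rightarrow> 'b::euclidean_space"
  assumes It: "is_ito_integral M FF \<xi> u t H I" and Is: "is_ito_integral M FF \<xi> u s H I'"
    and ust: "0 \<le> u" "u \<le> s" "s \<le> t"
  shows "mart_diff M (FF s) (\<lambda>\<omega>. I \<omega> - I' \<omega>)"
  unfolding mart_diff_def
proof (intro conjI allI impI)
  have L: "L2 M I" "L2 M I'" using It Is by (auto simp: is_ito_integral_def)
  then show "L2 M (\<lambda>\<omega>. I \<omega> - I' \<omega>)" by (rule L2_diff)
  fix X :: "'a \<Rightarrow> 'b" assume X: "X \<in> borel_measurable (FF s)" "L2 M X"
  let ?Ht = "\<lambda>\<tau> \<omega>. indicator {u..t} \<tau> *\<^sub>R H \<tau> \<omega>" and ?Hs = "\<lambda>\<tau> \<omega>. indicator {u..s} \<tau> *\<^sub>R H \<tau> \<omega>"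
  have jH: "joint_meas M ?Ht" "joint_meas M ?Hs"
    using It Is by (auto intro: ito_integrand_jm simp: is_ito_integral_def)
  define x where "x = (\<integral>\<omega>. X \<omega> \<bullet> (I \<omega> - I' \<omega>) \<partial>M)"
  have bound: "x\<^sup>2 \<le> msq M X * (16 * \<delta>)" if d: "\<delta> > 0" for \<delta>
  proof -
    obtain N p e where 1: "fam {..<N::nat} p (\<lambda>j. p (Suc j)) e"
        "dsq M (\<lambda>\<tau> \<omega>. ?Ht \<tau> \<omega> - fproc {..<N} p (\<lambda>j. p (Suc j)) e \<tau> \<omega>) \<le> ennreal \<delta>"
        "msq M (\<lambda>\<omega>. I \<omega> - fint {..<N} p (\<lambda>j. p (Suc j)) e \<omega>) \<le> \<delta>"
        "\<And>j. j < N \<Longrightarrow> u \<le> p j \<and> p j \<le> p (Suc j) \<and> p (Suc j) \<le> t"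
      by (rule ito_approx[OF It ust(1) d]) blast
    obtain N' p' e' where 2: "fam {..<N'::nat} p' (\<lambda>j. p' (Suc j)) e'"
        "dsq M (\<lambda>\<tau> \<omega>. ?Hs \<tau> \<omega> - fproc {..<N'} p' (\<lambda>j. p' (Suc j)) e' \<tau> \<omega>) \<le> ennreal \<delta>"
        "msq M (\<lambda>\<omega>. I' \<omega> - fint {..<N'} p' (\<lambda>j. p' (Suc j)) e' \<omega>) \<le> \<delta>"
        "\<And>j. j < N' \<Longrightarrow> u \<le> p' j \<and> p' j \<le> p' (Suc j) \<and> p' (Suc j) \<le> s"
      by (rule ito_approx[OF Is ust(1) d]) blast
    \<comment> \<open>Only intervals starting by time \<open>s\<close> may be kept, since later
      coefficients belong to the future; the one containing \<open>s\<close> is shortened by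
      \<open>q\<close>.\<close>
    define K where "K = {j. j < N \<and> p j \<le> s}"
    define q where "q j = min (p (Suc j)) s" for j
    define P where "P = fproc {..<N} p (\<lambda>j. p (Suc j)) e"
    define P' where "P' = fproc {..<N'} p' (\<lambda>j. p' (Suc j)) e'"
    define S where "S = fint {..<N} p (\<lambda>j. p (Suc j)) e"
    define S' where "S' = fint {..<N'} p' (\<lambda>j. p' (Suc j)) e'"
    define R where "R = fint K p q e"
    have fK: "fam K p q e" using 1(1) unfolding fam_def K_def q_def by auto
    define J where "J = K <+> {..<N'}"
    define a where "a = case_sum p p'"
    define b where "b = case_sum q (\<lambda>j. p' (Suc j))"
    define f where "f = case_sum e (\<lambda>j \<omega>. - e' j \<omega>)"
    have fm: "fam J a b f"
      using fK 2(1) unfolding fam_def J_def a_def b_def f_def by (auto simp: L2_uminus_iff)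
    have pr: "fproc J a b f \<tau> \<omega> = fproc K p q e \<tau> \<omega> - P' \<tau> \<omega>" for \<tau> \<omega>
      using fK by (simp add: fproc_def J_def a_def b_def f_def P'_def sum.Plus sum_negf fam_def del: sum_indicator_scaleR)
    have it: "fint J a b f \<omega> = R \<omega> - S' \<omega>" for \<omega>
      using fK by (simp add: fint_def J_def a_def b_def f_def S'_def R_def sum.Plus sum_negf fam_def)
    have iso: "dsq M (\<lambda>\<tau> \<omega>. fproc K p q e \<tau> \<omega> - P' \<tau> \<omega>) = ennreal (msq M (\<lambda>\<omega>. R \<omega> - S' \<omega>))"
      using ito_isometry[OF fm] by (simp add: pr it)
    have Kp: "fproc K p q e \<tau> \<omega> = indicator {u..<s} \<tau> *\<^sub>R P \<tau> \<omega>" for \<tau> \<omega>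
    proof -
      have "fproc K p q e \<tau> \<omega> = (\<Sum>j<N. if p j \<le> s then indicator {p j..<q j} \<tau> *\<^sub>R e j \<omega> else 0)"
        unfolding fproc_def K_def by (rule sum.mono_neutral_cong_left) auto
      also have "\<dots> = (\<Sum>j<N. indicator {u..<s} \<tau> *\<^sub>R (indicator {p j..<p (Suc j)} \<tau> *\<^sub>R e j \<omega>))"
      proof (rule sum.cong[OF refl])
        fix j assume "j \<in> {..<N}"
        then have "u \<le> p j" "p j \<le> p (Suc j)" using 1(4)[of j] by auto
        then show "(if p j \<le> s then indicator {p j..<q j} \<tau> *\<^sub>R e j \<omega> else 0) = indicator {u..<s} \<tau> *\<^sub>R (indicator {p j..<p (Suc j)} \<tau> *\<^sub>R e j \<omega>)"
          by (auto simp: indicator_def q_def)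
      qed
      finally have "fproc K p q e \<tau> \<omega> = (\<Sum>j<N. indicator {u..<s} \<tau> *\<^sub>R (indicator {p j..<p (Suc j)} \<tau> *\<^sub>R e j \<omega>))" .
      then show ?thesis unfolding P_def fproc_def scaleR_sum_right .
    qed
    have P'0: "indicator {u..<s} \<tau> *\<^sub>R P' \<tau> \<omega> = P' \<tau> \<omega>" for \<tau> \<omega>
      unfolding P'_def fproc_def scaleR_sum_right
    proof (rule sum.cong[OF refl])
      fix j assume "j \<in> {..<N'}"
      then have "u \<le> p' j" "p' (Suc j) \<le> s" using 2(4)[of j] by auto
      then show "indicator {u..<s} \<tau> *\<^sub>R (indicator {p' j..<p' (Suc j)} \<tau> *\<^sub>R e' j \<omega>) = indicator {p' j..<p' (Suc j)} \<tau> *\<^sub>R e' j \<omega>"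
        by (auto simp: indicator_def)
    qed
    have jP: "joint_meas M P" "joint_meas M P'"
      using fam_fproc_joint[OF 1(1)] fam_fproc_joint[OF 2(1)] by (simp_all add: joint_meas_def P_def P'_def split_beta)
    let ?i = "\<lambda>Q \<tau> \<omega>. indicator {u..<s} \<tau> *\<^sub>R Q \<tau> \<omega> :: 'b"
    have ile: "dsq M (?i Q) \<le> dsq M Q" for Q
      by (intro nn_integral_mono ennreal_leI power_mono) (auto simp: indicator_def)
    have "dsq M (\<lambda>\<tau> \<omega>. fproc K p q e \<tau> \<omega> - P' \<tau> \<omega>)
      = dsq M (\<lambda>\<tau> \<omega>. ?i (\<lambda>\<tau> \<omega>. ?Hs \<tau> \<omega> - P' \<tau> \<omega>) \<tau> \<omega> - ?i (\<lambda>\<tau> \<omega>. ?Ht \<tau> \<omega> - P \<tau> \<omega>) \<tau> \<omega>)"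
    proof (rule nn_integral_cong, rule nn_integral_cong)
      fix \<tau> \<omega>
      have "fproc K p q e \<tau> \<omega> - P' \<tau> \<omega> = ?i (\<lambda>\<tau> \<omega>. ?Hs \<tau> \<omega> - P' \<tau> \<omega>) \<tau> \<omega> - ?i (\<lambda>\<tau> \<omega>. ?Ht \<tau> \<omega> - P \<tau> \<omega>) \<tau> \<omega>"
        using Kp[of \<tau> \<omega>] P'0[of \<tau> \<omega>] ust by (cases "\<tau> \<in> {u..<s}") auto
      then show "ennreal ((norm (fproc K p q e \<tau> \<omega> - P' \<tau> \<omega>))\<^sup>2) = ennreal ((norm (?i (\<lambda>\<tau> \<omega>. ?Hs \<tau> \<omega> - P' \<tau> \<omega>) \<tau> \<omega> - ?i (\<lambda>\<tau> \<omega>. ?Ht \<tau> \<omega> - P \<tau> \<omega>) \<tau> \<omega>))\<^sup>2)"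
        by simp
    qed
    also have "\<dots> \<le> 2 * dsq M (?i (\<lambda>\<tau> \<omega>. ?Hs \<tau> \<omega> - P' \<tau> \<omega>)) + 2 * dsq M (?i (\<lambda>\<tau> \<omega>. ?Ht \<tau> \<omega> - P \<tau> \<omega>))"
      by (intro dsq_diff_le joint_meas_indicator joint_meas_diff jP jH) auto
    also have "\<dots> \<le> 2 * ennreal \<delta> + 2 * ennreal \<delta>"
      using 1(2) 2(2) by (intro add_mono mult_left_mono order_trans[OF ile]) (simp_all add: P_def P'_def)
    also have "\<dots> = ennreal (4 * \<delta>)"
      using d by (simp add: ennreal_mult[of 2, simplified, symmetric] ennreal_plus[symmetric] del: ennreal_plus)
    finally have RS: "msq M (\<lambda>\<omega>. R \<omega> - S' \<omega>) \<le> 4 * \<delta>"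
      unfolding iso using d by (simp add: ennreal_le_iff)
    have LS: "L2 M S" "L2 M S'" "L2 M R"
      using 1(1) 2(1) fK by (auto simp: S_def S'_def R_def intro: fam_fint_L2)
    \<comment> \<open>Moving the partition points up to at least \<open>s\<close> keeps each
      coefficient measurable at the start of its interval and gives zero increments before
      \<open>s\<close>.\<close>
    have md: "mart_diff M (FF s) (\<lambda>\<omega>. \<Sum>j<n. (\<xi> (max (p (Suc j)) s) \<omega> - \<xi> (max (p j) s) \<omega>) *\<^sub>R e j \<omega>)" if "n \<le> N" for n
      using that
    proof (induction n)
      case (Suc n)
      have n: "n < N" using Suc.prems by simp
      have f: "e n \<in> borel_measurable (FF (p n))" "L2 M (e n)" using n 1(1) by (auto simp: fam_def)
      have le: "0 \<le> max (p n) s" "max (p n) s \<le> max (p (Suc n)) s" using 1(4)[OF n] ust by auto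
      have "e n \<in> borel_measurable (FF (max (p n) s))" by (rule FF_mono[OF _ f(1)]) simp
      then have "mart_diff M (FF (max (p n) s)) (\<lambda>\<omega>. (\<xi> (max (p (Suc n)) s) \<omega> - \<xi> (max (p n) s) \<omega>) *\<^sub>R e n \<omega>)"
        by (rule increment_scaleR(1)[OF le _ f(2)])
      then have "mart_diff M (FF s) (\<lambda>\<omega>. (\<xi> (max (p (Suc n)) s) \<omega> - \<xi> (max (p n) s) \<omega>) *\<^sub>R e n \<omega>)"
        by (rule mart_diff_FF_mono[rotated]) simp
      from mart_diff_add[OF Suc.IH[OF Suc_leD[OF Suc.prems]] this] show ?case by simp
    qed simp
    have SR: "S \<omega> - R \<omega> = (\<Sum>j<N. (\<xi> (max (p (Suc j)) s) \<omega> - \<xi> (max (p j) s) \<omega>) *\<^sub>R e j \<omega>)" for \<omega>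
    proof -
      have "R \<omega> = (\<Sum>j<N. if p j \<le> s then (\<xi> (q j) \<omega> - \<xi> (p j) \<omega>) *\<^sub>R e j \<omega> else 0)"
        unfolding R_def fint_def K_def by (rule sum.mono_neutral_cong_left) auto
      also have "\<dots> = (\<Sum>j<N. (\<xi> (min (p (Suc j)) s) \<omega> - \<xi> (min (p j) s) \<omega>) *\<^sub>R e j \<omega>)"
      proof (rule sum.cong[OF refl])
        fix j assume "j \<in> {..<N}"
        then have "p j \<le> p (Suc j)" using 1(4)[of j] by auto
        then show "(if p j \<le> s then (\<xi> (q j) \<omega> - \<xi> (p j) \<omega>) *\<^sub>R e j \<omega> else 0) = (\<xi> (min (p (Suc j)) s) \<omega> - \<xi> (min (p j) s) \<omega>) *\<^sub>R e j \<omega>"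
          by (auto simp: q_def min_def)
      qed
      finally have "R \<omega> = (\<Sum>j<N. (\<xi> (min (p (Suc j)) s) \<omega> - \<xi> (min (p j) s) \<omega>) *\<^sub>R e j \<omega>)" .
      then show ?thesis unfolding S_def fint_def
        by (simp add: sum_subtractf[symmetric]) (intro sum.cong refl, auto simp: min_def max_def algebra_simps)
    qed
    have 0: "(\<integral>\<omega>. X \<omega> \<bullet> (S \<omega> - R \<omega>) \<partial>M) = 0"
      using mart_diffD[OF md[OF order_refl] X] by (simp add: SR)
    \<comment> \<open>\<open>I - I'\<close> equals \<open>?Y\<close> plus \<open>S - R\<close>; the
      second summand is orthogonal to \<open>X\<close> and the first is small.\<close>
    let ?Y = "\<lambda>\<omega>. (I \<omega> - S \<omega>) - (I' \<omega> - S' \<omega>) + (R \<omega> - S' \<omega>)"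
    have LY: "L2 M ?Y" by (intro L2_add L2_diff L LS)
    have "x = (\<integral>\<omega>. X \<omega> \<bullet> ?Y \<omega> + X \<omega> \<bullet> (S \<omega> - R \<omega>) \<partial>M)"
      unfolding x_def by (simp add: inner_diff_right inner_add_right)
    also have "\<dots> = (\<integral>\<omega>. X \<omega> \<bullet> ?Y \<omega> \<partial>M)"
      using L2_inner_integrable[OF X(2) LY] L2_inner_integrable[OF X(2) L2_diff[OF LS(1,3)]] 0
      by (subst Bochner_Integration.integral_add) auto
    finally have xY: "x = (\<integral>\<omega>. X \<omega> \<bullet> ?Y \<omega> \<partial>M)" .
    have "\<bar>x\<bar> \<le> (\<integral>\<omega>. norm (X \<omega>) * norm (?Y \<omega>) \<partial>M)"
      unfolding xY using integral_norm_bound[of M "\<lambda>\<omega>. X \<omega> \<bullet> ?Y \<omega>"]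
      by (rule order_trans[OF eq_refl[OF real_norm_def[symmetric]], OF order_trans])
         (intro integral_mono L2_norm_mult_integrable integrable_norm L2_inner_integrable X LY, auto simp: Cauchy_Schwarz_ineq2)
    then have "x\<^sup>2 \<le> (\<integral>\<omega>. norm (X \<omega>) * norm (?Y \<omega>) \<partial>M)\<^sup>2"
      by (metis abs_ge_zero power2_abs power_mono)
    also have "\<dots> \<le> msq M X * msq M ?Y"
      by (rule L2_Cauchy_Schwarz) (use X(2) LY in \<open>auto simp: L2_norm_iff L2_measurable\<close>)
    also have "\<dots> \<le> msq M X * (16 * \<delta>)"
    proof (rule mult_left_mono)
      have "msq M ?Y \<le> 2 * msq M (\<lambda>\<omega>. (I \<omega> - S \<omega>) - (I' \<omega> - S' \<omega>)) + 2 * msq M (\<lambda>\<omega>. R \<omega> - S' \<omega>)"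
        by (intro integral_power2_norm_add_le L2_diff L LS)
      also have "msq M (\<lambda>\<omega>. (I \<omega> - S \<omega>) - (I' \<omega> - S' \<omega>)) \<le> 2 * msq M (\<lambda>\<omega>. I \<omega> - S \<omega>) + 2 * msq M (\<lambda>\<omega>. I' \<omega> - S' \<omega>)"
        by (intro integral_power2_norm_diff_le L2_diff L LS)
      finally show "msq M ?Y \<le> 16 * \<delta>" using RS 1(3) 2(3) by (simp add: S_def S'_def)
    qed simp
    finally show ?thesis .
  qed
  have "x\<^sup>2 \<le> \<epsilon>" if "\<epsilon> > 0" for \<epsilon>
  proof -
    define y where "y = msq M X"
    have y0: "y \<ge> 0" by (simp add: y_def)
    \<comment> \<open>The denominator \<open>y + 1\<close> avoids a division by zero when
      \<open>X\<close> vanishes almost surely.\<close>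
    have "x\<^sup>2 \<le> y * (16 * (\<epsilon> / (16 * (y + 1))))"
      unfolding y_def by (rule bound) (use that y0 in \<open>intro divide_pos_pos mult_pos_pos add_nonneg_pos; simp add: y_def\<close>)
    also have "\<dots> = \<epsilon> * (y / (y + 1))" using y0 by (simp add: field_simps)
    also have "\<dots> \<le> \<epsilon> * 1" using y0 that by (intro mult_left_mono) (auto simp: divide_simps)
    finally show ?thesis by simp
  qed
  then have "x\<^sup>2 \<le> 0" using field_le_epsilon[of "x\<^sup>2" 0] by simp
  then show "(\<integral>\<omega>. X \<omega> \<bullet> (I \<omega> - I' \<omega>) \<partial>M) = 0" by (simp add: x_def)
qed

end

section \<open>The solution flow along a grid\<close>

lemma (in prob_space) dsq_swap:
  fixes P :: "real \<Rightarrow> 'a \<Rightarrow> 'b::euclidean_space"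
  assumes "joint_meas M P"
  shows "dsq M P = (\<integral>\<^sup>+\<omega>. (\<integral>\<^sup>+\<tau>. ennreal ((norm (P \<tau> \<omega>))\<^sup>2) \<partial>lborel) \<partial>M)"
    and "(\<lambda>\<omega>. \<integral>\<^sup>+\<tau>. ennreal ((norm (P \<tau> \<omega>))\<^sup>2) \<partial>lborel) \<in> borel_measurable M"
proof -
  interpret L: pair_sigma_finite lborel M ..
  have "(\<lambda>x. P (fst x) (snd x)) \<in> borel_measurable (lborel \<Otimes>\<^sub>M M)"
    using assms unfolding joint_meas_def by (simp cong: measurable_cong_sets sets_pair_measure_cong)
  then have m: "(\<lambda>x. ennreal ((norm (P (fst x) (snd x)))\<^sup>2)) \<in> borel_measurable (lborel \<Otimes>\<^sub>M M)"
    by measurable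
  show "dsq M P = (\<integral>\<^sup>+\<omega>. (\<integral>\<^sup>+\<tau>. ennreal ((norm (P \<tau> \<omega>))\<^sup>2) \<partial>lborel) \<partial>M)"
    by (rule L.Fubini'[symmetric]) (use m in \<open>simp add: split_beta\<close>)
  have "(\<lambda>x. ennreal ((norm (P (snd x) (fst x)))\<^sup>2)) \<in> borel_measurable (M \<Otimes>\<^sub>M lborel)"
    using measurable_compose[OF measurable_pair_swap' m] by (simp add: split_beta)
  from lborel.borel_measurable_nn_integral_fst[OF this]
  show "(\<lambda>\<omega>. \<integral>\<^sup>+\<tau>. ennreal ((norm (P \<tau> \<omega>))\<^sup>2) \<partial>lborel) \<in> borel_measurable M" by simp
qed

text \<open>Cauchy-Schwarz in time on each path, followed by Fubini.\<close>

lemma (in prob_space) path_sq_bound: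
  fixes K :: "real \<Rightarrow> 'a \<Rightarrow> 'b::euclidean_space"
  assumes j: "joint_meas M (\<lambda>\<tau> \<omega>. indicator {s..t} \<tau> *\<^sub>R K \<tau> \<omega>)" and st: "s \<le> t"
  shows "(\<integral>\<^sup>+\<omega>. ennreal ((norm (LINT \<tau>:{s..t}|lborel. K \<tau> \<omega>))\<^sup>2) \<partial>M)
    \<le> ennreal (t - s) * dsq M (\<lambda>\<tau> \<omega>. indicator {s..t} \<tau> *\<^sub>R K \<tau> \<omega>)"
proof -
  let ?P = "\<lambda>\<tau> \<omega>. indicator {s..t} \<tau> *\<^sub>R K \<tau> \<omega>"
  have pt: "ennreal ((norm (LINT \<tau>:{s..t}|lborel. K \<tau> \<omega>))\<^sup>2) \<le> ennreal (t - s) * (\<integral>\<^sup>+\<tau>. ennreal ((norm (?P \<tau> \<omega>))\<^sup>2) \<partial>lborel)"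
    if w: "\<omega> \<in> space M" for \<omega>
  proof (cases "integrable lborel (\<lambda>\<tau>. ?P \<tau> \<omega>)")
    \<comment> \<open>For a non-integrable path the Bochner integral is 0 by convention and the
      bound is trivial.\<close>
    case False
    then have "(LINT \<tau>:{s..t}|lborel. K \<tau> \<omega>) = 0"
      unfolding set_lebesgue_integral_def by (rule not_integrable_integral_eq)
    then show ?thesis by simp
  next
    case True
    have m[measurable]: "(\<lambda>\<tau>. ?P \<tau> \<omega>) \<in> borel_measurable lborel"
      using joint_meas_section2[OF j w] by simp
    have "ennreal (norm (LINT \<tau>:{s..t}|lborel. K \<tau> \<omega>)) \<le> (\<integral>\<^sup>+\<tau>. ennreal (norm (?P \<tau> \<omega>)) \<partial>lborel)"
      unfolding set_lebesgue_integral_def by (rule integral_norm_bound_ennreal[OF True])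
    also have "\<dots> = (\<integral>\<^sup>+\<tau>. indicator {s..t} \<tau> * ennreal (norm (?P \<tau> \<omega>)) \<partial>lborel)"
      by (intro nn_integral_cong) (auto simp: indicator_def)
    finally have "(ennreal (norm (LINT \<tau>:{s..t}|lborel. K \<tau> \<omega>)))\<^sup>2 \<le> (\<integral>\<^sup>+\<tau>. indicator {s..t} \<tau> * ennreal (norm (?P \<tau> \<omega>)) \<partial>lborel)\<^sup>2"
      by (intro power_mono) auto
    also have "\<dots> \<le> (\<integral>\<^sup>+\<tau>. (indicator {s..t} \<tau>)\<^sup>2 \<partial>lborel) * (\<integral>\<^sup>+\<tau>. (ennreal (norm (?P \<tau> \<omega>)))\<^sup>2 \<partial>lborel)"
      by (rule Cauchy_Schwarz_nn_integral) measurable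
    also have "(\<integral>\<^sup>+\<tau>. (indicator {s..t} \<tau>)\<^sup>2 \<partial>lborel) = (\<integral>\<^sup>+\<tau>. indicator {s..t} \<tau> \<partial>lborel)"
      by (intro nn_integral_cong) (auto simp: indicator_def)
    also have "\<dots> = ennreal (t - s)" using st by simp
    finally show ?thesis by (simp add: ennreal_power)
  qed
  have "(\<integral>\<^sup>+\<omega>. ennreal ((norm (LINT \<tau>:{s..t}|lborel. K \<tau> \<omega>))\<^sup>2) \<partial>M)
    \<le> (\<integral>\<^sup>+\<omega>. ennreal (t - s) * (\<integral>\<^sup>+\<tau>. ennreal ((norm (?P \<tau> \<omega>))\<^sup>2) \<partial>lborel) \<partial>M)"
    by (intro nn_integral_mono pt)
  also have "\<dots> = ennreal (t - s) * dsq M ?P"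
    unfolding dsq_swap(1)[OF j] by (rule nn_integral_cmult[OF dsq_swap(2)[OF j]])
  finally show ?thesis .
qed

lemma dsq_interval_le:
  assumes "s \<le> t" "c \<ge> 0" "\<And>\<tau>. s \<le> \<tau> \<Longrightarrow> \<tau> \<le> t \<Longrightarrow> L2 M (P \<tau>) \<and> msq M (P \<tau>) \<le> c"
  shows "dsq M (\<lambda>\<tau> \<omega>. indicator {s..t} \<tau> *\<^sub>R P \<tau> \<omega>) \<le> ennreal ((t - s) * c)"
proof -
  have "dsq M (\<lambda>\<tau> \<omega>. indicator {s..t} \<tau> *\<^sub>R P \<tau> \<omega>) \<le> (\<integral>\<^sup>+\<tau>. ennreal c * indicator {s..t} \<tau> \<partial>lborel)"
  proof (rule nn_integral_mono)
    fix \<tau> :: real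
    show "(\<integral>\<^sup>+\<omega>. ennreal ((norm (indicator {s..t} \<tau> *\<^sub>R P \<tau> \<omega>))\<^sup>2) \<partial>M) \<le> ennreal c * indicator {s..t} \<tau>"
    proof (cases "\<tau> \<in> {s..t}")
      case True
      then have "(\<integral>\<^sup>+\<omega>. ennreal ((norm (P \<tau> \<omega>))\<^sup>2) \<partial>M) = ennreal (msq M (P \<tau>))"
        using assms(3)[of \<tau>] by (intro nn_integral_eq_integral L2_integrable_sq) auto
      then show ?thesis using True assms(3)[of \<tau>] by (simp add: ennreal_leI)
    qed simp
  qed
  also have "\<dots> = ennreal ((t - s) * c)"
    using assms(1,2) by (simp add: nn_integral_cmult ennreal_mult mult.commute)
  finally show ?thesis .
qed

lemma L2_nnI:
  assumes "X \<in> borel_measurable M" "(\<integral>\<^sup>+\<omega>. ennreal ((norm (X \<omega>))\<^sup>2) \<partial>M) \<le> ennreal c" "c \<ge> 0"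
  shows "L2 M X" "msq M X \<le> c"
proof -
  have "(\<integral>\<^sup>+\<omega>. ennreal ((norm (X \<omega>))\<^sup>2) \<partial>M) < \<infinity>"
    using assms(2) by (rule le_less_trans) simp
  then have i: "integrable M (\<lambda>\<omega>. (norm (X \<omega>))\<^sup>2)"
    using assms(1) by (intro integrableI_nonneg) auto
  then show "L2 M X" using assms(1) by (simp add: L2_def)
  have "ennreal (msq M X) \<le> ennreal c"
    using assms(2) nn_integral_eq_integral[OF i] by simp
  then show "msq M X \<le> c" using assms(3) by (simp add: ennreal_le_iff)
qed

lemma L2_nn_msq: "L2 M X \<Longrightarrow> (\<integral>\<^sup>+\<omega>. ennreal ((norm (X \<omega>))\<^sup>2) \<partial>M) = ennreal (msq M X)"
  by (intro nn_integral_eq_integral L2_integrable_sq) auto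

lemma joint_meas_matrix_mult:
  fixes P :: "real \<Rightarrow> 'a \<Rightarrow> real^'m^'m" and A :: "real^'m^'m"
  assumes "joint_meas M P" shows "joint_meas M (\<lambda>\<tau> \<omega>. A ** P \<tau> \<omega>)"
  using assms unfolding joint_meas_def by measurable

context wiener
begin

text \<open>By Fubini almost every path is square integrable in time; on a bounded interval
  \<open>x \<le> 1 + x^2\<close> turns this into integrability.\<close>

lemma path_integrable:
  fixes H :: "real \<Rightarrow> 'a \<Rightarrow> 'b::euclidean_space"
  assumes H: "ito_integrand M FF u t H"
  shows "AE \<omega> in M. set_integrable lborel {u..t} (\<lambda>\<tau>. H \<tau> \<omega>)"
proof -
  let ?P = "\<lambda>\<tau> \<omega>. indicator {u..t} \<tau> *\<^sub>R H \<tau> \<omega>"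
  have j: "joint_meas M ?P" by (rule ito_integrand_jm[OF H])
  have "dsq M ?P < \<infinity>" using H unfolding ito_integrand_def set_nn_sq_eq by blast
  then have "(\<integral>\<^sup>+\<omega>. (\<integral>\<^sup>+\<tau>. ennreal ((norm (?P \<tau> \<omega>))\<^sup>2) \<partial>lborel) \<partial>M) \<noteq> \<infinity>"
    unfolding dsq_swap(1)[OF j] by simp
  from nn_integral_PInf_AE[OF dsq_swap(2)[OF j] this] AE_space
  show ?thesis
  proof eventually_elim
    case (elim \<omega>)
    have m[measurable]: "(\<lambda>\<tau>. ?P \<tau> \<omega>) \<in> borel_measurable lborel"
      using joint_meas_section2[OF j elim(2)] by simp
    have "(\<integral>\<^sup>+\<tau>. ennreal (norm (?P \<tau> \<omega>)) \<partial>lborel) \<le> (\<integral>\<^sup>+\<tau>. indicator {u..t} \<tau> + ennreal ((norm (?P \<tau> \<omega>))\<^sup>2) \<partial>lborel)"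
    proof (rule nn_integral_mono)
      fix \<tau> :: real
      have "x \<le> 1 + x\<^sup>2" for x :: real using sum_squares_bound[of x 1] by (simp add: power2_eq_square) (smt (verit) zero_le_square)
      then have "ennreal (norm (H \<tau> \<omega>)) \<le> 1 + ennreal ((norm (H \<tau> \<omega>))\<^sup>2)"
        by (metis ennreal_1 ennreal_leI ennreal_plus zero_le_one zero_le_power2)
      then show "ennreal (norm (?P \<tau> \<omega>)) \<le> indicator {u..t} \<tau> + ennreal ((norm (?P \<tau> \<omega>))\<^sup>2)"
        by (cases "\<tau> \<in> {u..t}") auto
    qed
    also have "\<dots> = (\<integral>\<^sup>+\<tau>. indicator {u..t} \<tau> \<partial>lborel) + (\<integral>\<^sup>+\<tau>. ennreal ((norm (?P \<tau> \<omega>))\<^sup>2) \<partial>lborel)"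
      by (intro nn_integral_add) measurable
    also have "\<dots> < \<infinity>"
    proof -
      have "emeasure lborel {u..t} < \<infinity>" by (cases "u \<le> t") auto
      then show ?thesis using elim(1) by (auto simp: less_top)
    qed
    finally show ?case unfolding set_integrable_def by (intro integrableI_bounded m)
  qed
qed

lemma ito_integrand_dsq: "ito_integrand M FF u t H \<Longrightarrow> dsq M (\<lambda>\<tau> \<omega>. indicator {u..t} \<tau> *\<^sub>R H \<tau> \<omega>) < \<infinity>"
  unfolding ito_integrand_def set_nn_sq_eq by blast

lemma joint_meas_sub:
  assumes "joint_meas M (\<lambda>\<tau> \<omega>. indicator {u..t} \<tau> *\<^sub>R H \<tau> \<omega>)" "u \<le> s" "s' \<le> t"
  shows "joint_meas M (\<lambda>\<tau> \<omega>. indicator {s..s'} \<tau> *\<^sub>R H \<tau> \<omega>)"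
proof -
  have "(\<lambda>\<tau> \<omega>. indicator {s..s'} \<tau> *\<^sub>R (indicator {u..t} \<tau> *\<^sub>R H \<tau> \<omega>)) = (\<lambda>\<tau> \<omega>. indicator {s..s'} \<tau> *\<^sub>R H \<tau> \<omega>)"
    using assms(2,3) by (auto simp: fun_eq_iff indicator_def)
  then show ?thesis using joint_meas_indicator[OF assms(1), of "{s..s'}"] by simp
qed

end

section \<open>A priori estimates for the flow\<close>

locale flow = wiener M FF \<xi> for M :: "'a measure" and FF \<xi> +
  fixes A B :: "real^'m^'m" and C :: "real \<Rightarrow> real \<Rightarrow> 'a \<Rightarrow> real^'m^'m"
  assumes flow: "solution_flow M FF \<xi> A B C"
begin

definition c :: "real \<Rightarrow> 'a \<Rightarrow> real^'m^'m" where "c = C 0"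

definition Jc :: "real \<Rightarrow> 'a \<Rightarrow> real^'m^'m" where
  "Jc t \<omega> = (LINT \<tau>:{0..t}|lborel. A ** c \<tau> \<omega>)"

text \<open>The stochastic integral is taken as a difference, as in \<open>solution_flow\<close>, so
  the integral equation \<open>c_eq\<close> holds at every sample point.\<close>

definition Ic :: "real \<Rightarrow> 'a \<Rightarrow> real^'m^'m" where
  "Ic t \<omega> = c t \<omega> - mat 1 - Jc t \<omega>"

lemma c_eq: "c t \<omega> = mat 1 + Jc t \<omega> + Ic t \<omega>"
  by (simp add: Ic_def)

lemma c_continuous: "AE \<omega> in M. continuous_on {0..} (\<lambda>t. c t \<omega>)"
  using flow by (auto simp: solution_flow_def c_def)

lemma c_integrand: "0 \<le> t \<Longrightarrow> ito_integrand M FF 0 t c"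
  using flow by (auto simp: solution_flow_def c_def)

lemma Ic_ito: "0 \<le> t \<Longrightarrow> is_ito_integral M FF \<xi> 0 t (\<lambda>\<tau> \<omega>. B ** c \<tau> \<omega>) (Ic t)"
  using flow unfolding solution_flow_def c_def Ic_def[abs_def] Jc_def by auto

lemma c_adapted: "0 \<le> t \<Longrightarrow> c t \<in> borel_measurable (FF t)"
  using c_integrand[of t] by (auto simp: ito_integrand_def)

lemma c_meas: "0 \<le> t \<Longrightarrow> c t \<in> borel_measurable M"
  by (rule FF_meas[OF c_adapted])

lemma Ic_L2: "0 \<le> t \<Longrightarrow> L2 M (Ic t)"
  using Ic_ito[of t] by (simp add: is_ito_integral_def)

lemma Jc_meas: "0 \<le> t \<Longrightarrow> Jc t \<in> borel_measurable M"
proof -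
  assume t: "0 \<le> t"
  have "(\<lambda>\<omega>. c t \<omega> - mat 1 - Ic t \<omega>) \<in> borel_measurable M"
    using c_meas[OF t] Ic_L2[OF t] by (auto simp: L2_def)
  then show ?thesis by (simp add: Ic_def)
qed

lemma joint_meas_c: "0 \<le> s \<Longrightarrow> s \<le> t \<Longrightarrow> joint_meas M (\<lambda>\<tau> \<omega>. indicator {s..t} \<tau> *\<^sub>R c \<tau> \<omega>)"
  by (rule joint_meas_sub[OF ito_integrand_jm[OF c_integrand[of t]]]) auto

lemma joint_meas_Ac: fixes D :: "real^'m^'m" shows "0 \<le> s \<Longrightarrow> s \<le> t \<Longrightarrow> joint_meas M (\<lambda>\<tau> \<omega>. indicator {s..t} \<tau> *\<^sub>R (D ** c \<tau> \<omega>))"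
  using joint_meas_matrix_mult[OF joint_meas_c[of s t], of D] by (simp add: mm_simps)

lemma dsq_matrix_le:
  fixes P :: "real \<Rightarrow> 'a \<Rightarrow> real^'m^'m" and D :: "real^'m^'m"
  assumes "joint_meas M P"
  shows "dsq M (\<lambda>\<tau> \<omega>. D ** P \<tau> \<omega>) \<le> ennreal ((norm D)\<^sup>2) * dsq M P"
proof -
  have "dsq M (\<lambda>\<tau> \<omega>. D ** P \<tau> \<omega>) \<le> (\<integral>\<^sup>+\<tau>. (\<integral>\<^sup>+\<omega>. ennreal ((norm D)\<^sup>2) * ennreal ((norm (P \<tau> \<omega>))\<^sup>2) \<partial>M) \<partial>lborel)"
  proof (intro nn_integral_mono)
    fix \<tau> \<omega>
    show "ennreal ((norm (D ** P \<tau> \<omega>))\<^sup>2) \<le> ennreal ((norm D)\<^sup>2) * ennreal ((norm (P \<tau> \<omega>))\<^sup>2)"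
      using power_mono[OF norm_matrix_mult_le[of D "P \<tau> \<omega>"], of 2]
      by (simp add: ennreal_mult[symmetric] power_mult_distrib ennreal_leI)
  qed
  also have "\<dots> = ennreal ((norm D)\<^sup>2) * dsq M P"
    using joint_meas_section[OF assms] joint_meas_sq_measurable[OF assms] by (simp add: nn_integral_cmult)
  finally show ?thesis .
qed

text \<open>A bootstrap: \<open>ito_integrand\<close> bounds the second moment integrated over time,
  and the integral equation expresses \<open>c t\<close> through integrals of \<open>c\<close>,
  which turns this into a bound at each time.\<close>

lemma c_second_moment:
  assumes T: "0 \<le> T"
  shows "\<exists>S\<ge>0. \<forall>t. 0 \<le> t \<longrightarrow> t \<le> T \<longrightarrow> L2 M (c t) \<and> msq M (c t) \<le> S"
proof -
  define Q where "Q = enn2real (dsq M (\<lambda>\<tau> \<omega>. indicator {0..T} \<tau> *\<^sub>R c \<tau> \<omega>))"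
  have Q: "dsq M (\<lambda>\<tau> \<omega>. indicator {0..T} \<tau> *\<^sub>R c \<tau> \<omega>) = ennreal Q" "Q \<ge> 0"
    using ito_integrand_dsq[OF c_integrand[OF T]] by (auto simp: Q_def less_top)
  have Qt: "dsq M (\<lambda>\<tau> \<omega>. indicator {0..t} \<tau> *\<^sub>R (D ** c \<tau> \<omega>)) \<le> ennreal ((norm D)\<^sup>2 * Q)" if t: "0 \<le> t" "t \<le> T" for t and D :: "real^'m^'m"
  proof -
    have "dsq M (\<lambda>\<tau> \<omega>. indicator {0..t} \<tau> *\<^sub>R (D ** c \<tau> \<omega>)) = dsq M (\<lambda>\<tau> \<omega>. D ** (indicator {0..t} \<tau> *\<^sub>R c \<tau> \<omega>))"
      by (simp add: mm_simps)
    also have "\<dots> \<le> ennreal ((norm D)\<^sup>2) * dsq M (\<lambda>\<tau> \<omega>. indicator {0..t} \<tau> *\<^sub>R c \<tau> \<omega>)"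
      by (rule dsq_matrix_le[OF joint_meas_c]) (use t in auto)
    also have "dsq M (\<lambda>\<tau> \<omega>. indicator {0..t} \<tau> *\<^sub>R c \<tau> \<omega>) \<le> dsq M (\<lambda>\<tau> \<omega>. indicator {0..T} \<tau> *\<^sub>R c \<tau> \<omega>)"
      using t by (intro nn_integral_mono ennreal_leI power_mono) (auto simp: indicator_def)
    finally show ?thesis using Q by (simp add: ennreal_mult mult_left_mono)
  qed
  let ?m = "(norm (mat 1 :: real^'m^'m))\<^sup>2"
  define S where "S = 2 * (2 * ?m + 2 * (T * ((norm A)\<^sup>2 * Q))) + 2 * (4 * ((norm B)\<^sup>2 * Q))"
  have "L2 M (c t) \<and> msq M (c t) \<le> S" if t: "0 \<le> t" "t \<le> T" for t
  proof -
    have "(\<integral>\<^sup>+\<omega>. ennreal ((norm (Jc t \<omega>))\<^sup>2) \<partial>M) \<le> ennreal (t - 0) * dsq M (\<lambda>\<tau> \<omega>. indicator {0..t} \<tau> *\<^sub>R (A ** c \<tau> \<omega>))"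
      unfolding Jc_def by (rule path_sq_bound[OF joint_meas_Ac]) (use t in auto)
    also have "\<dots> \<le> ennreal T * ennreal ((norm A)\<^sup>2 * Q)"
      using t by (intro mult_mono Qt ennreal_leI) auto
    also have "\<dots> = ennreal (T * ((norm A)\<^sup>2 * Q))" using T Q by (simp add: ennreal_mult)
    finally have J: "L2 M (Jc t)" "msq M (Jc t) \<le> T * ((norm A)\<^sup>2 * Q)"
      using L2_nnI[OF Jc_meas[OF t(1)]] T Q by auto
    have I: "msq M (Ic t) \<le> 4 * ((norm B)\<^sup>2 * Q)"
    proof -
      have "ennreal (msq M (\<lambda>\<omega>. Ic t \<omega> - Ic 0 \<omega> - (\<xi> t \<omega> - \<xi> 0 \<omega>) *\<^sub>R (0::real^'m^'m)))
        \<le> 4 * (\<integral>\<^sup>+\<tau>\<in>{0..t}. (\<integral>\<^sup>+\<omega>. ennreal ((norm (B ** c \<tau> \<omega> - 0))\<^sup>2) \<partial>M) \<partial>lborel)"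
        by (rule ito_increment_msq[OF Ic_ito Ic_ito]) (use t in auto)
      also have "\<dots> \<le> 4 * ennreal ((norm B)\<^sup>2 * Q)"
        unfolding set_nn_sq_eq using Qt[OF t, of B] by (intro mult_left_mono) auto
      also have "\<dots> = ennreal (4 * ((norm B)\<^sup>2 * Q))" using Q by (simp add: ennreal_mult)
      finally have "msq M (\<lambda>\<omega>. Ic t \<omega> - Ic 0 \<omega>) \<le> 4 * ((norm B)\<^sup>2 * Q)"
        using Q by (simp add: ennreal_le_iff)
      moreover have "msq M (\<lambda>\<omega>. Ic t \<omega> - Ic 0 \<omega>) = msq M (Ic t)"
        using ito_trivial[OF Ic_ito[OF order_refl]] Ic_L2[OF t(1)] Ic_L2[of 0]
        by (intro msq_cong_AE) (auto simp: L2_def)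
      ultimately show ?thesis by simp
    qed
    have L: "L2 M (\<lambda>\<omega>. mat 1 + Jc t \<omega>)" by (intro L2_add J L2_const)
    have "c t = (\<lambda>\<omega>. (mat 1 + Jc t \<omega>) + Ic t \<omega>)" by (simp add: fun_eq_iff c_eq)
    then have "L2 M (c t)" and "msq M (c t) \<le> 2 * msq M (\<lambda>\<omega>. mat 1 + Jc t \<omega>) + 2 * msq M (Ic t)"
      using L2_add[OF L Ic_L2[OF t(1)]] integral_power2_norm_add_le[OF L Ic_L2[OF t(1)]] by simp_all
    moreover have "msq M (\<lambda>\<omega>. mat 1 + Jc t \<omega>) \<le> 2 * ?m + 2 * msq M (Jc t)"
      using integral_power2_norm_add_le[OF L2_const J(1), of "mat 1"] by (simp add: prob_space)
    ultimately show ?thesis using I J(2) unfolding S_def by auto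
  qed
  moreover have "S \<ge> 0" using T Q by (simp add: S_def)
  ultimately show ?thesis by blast
qed

text \<open>\<open>X\<close> may be any frozen value: zero gives the size of the increment,
  \<open>c s\<close> gives the local drift error. Splitting the time integral needs an integrable
  path, hence the exceptional null set.\<close>

lemma Jc_increment:
  assumes "0 \<le> s" "s \<le> t"
  shows "AE \<omega> in M. Jc t \<omega> - Jc s \<omega> - (t - s) *\<^sub>R (A ** X \<omega>) = (LINT \<tau>:{s..t}|lborel. A ** (c \<tau> \<omega> - X \<omega>))"
  using path_integrable[OF c_integrand[OF order_trans[OF assms]]]
proof eventually_elim
  case (elim \<omega>)
  have bl: "bounded_linear (\<lambda>x. A ** x :: real^'m^'m)"
    by (rule bounded_bilinear.bounded_linear_right[OF bounded_bilinear_matrix_mult])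
  have i: "set_integrable lborel {0..t} (\<lambda>\<tau>. A ** c \<tau> \<omega>)"
    using integrable_bounded_linear[OF bl elim[unfolded set_integrable_def]]
    by (simp add: set_integrable_def mm_simps)
  have i1: "set_integrable lborel {0..s} (\<lambda>\<tau>. A ** c \<tau> \<omega>)" "set_integrable lborel {s..t} (\<lambda>\<tau>. A ** c \<tau> \<omega>)"
    by (rule set_integrable_subset[OF i]; use assms in auto)+
  have i2: "set_integrable lborel {s..t} (\<lambda>\<tau>. A ** X \<omega>)"
    unfolding set_integrable_def by (intro integrable_scaleR_left integrable_real_indicator) (use assms in auto)
  have "Jc t \<omega> = Jc s \<omega> + (LINT \<tau>:{s..t}|lborel. A ** c \<tau> \<omega>)"
  proof -
    have "(LINT \<tau>:{0..t}|lborel. A ** c \<tau> \<omega>) = (LINT \<tau>:{0..s} \<union> {s..t}|lborel. A ** c \<tau> \<omega>)"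
      using assms by (simp add: ivl_disj_un_two_touch)
    also have "\<dots> = (LINT \<tau>:{0..s}|lborel. A ** c \<tau> \<omega>) + (LINT \<tau>:{s..t}|lborel. A ** c \<tau> \<omega>)"
    proof (rule set_integral_Un_AE[OF _ _ _ i1])
      show "AE \<tau> in lborel. \<not> (\<tau> \<in> {0..s} \<and> \<tau> \<in> {s..t})"
        using AE_lborel_singleton[of s] by eventually_elim auto
    qed auto
    finally show ?thesis by (simp add: Jc_def)
  qed
  moreover have "(LINT \<tau>:{s..t}|lborel. A ** (c \<tau> \<omega> - X \<omega>)) = (LINT \<tau>:{s..t}|lborel. A ** c \<tau> \<omega>) - (t - s) *\<^sub>R (A ** X \<omega>)"
  proof -
    have "(LINT \<tau>:{s..t}|lborel. A ** (c \<tau> \<omega> - X \<omega>)) = (LINT \<tau>:{s..t}|lborel. A ** c \<tau> \<omega>) - (LINT \<tau>:{s..t}|lborel. A ** X \<omega>)"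
      unfolding mm_simps by (rule set_integral_diff(2)[OF i1(2) i2])
    also have "(LINT \<tau>:{s..t}|lborel. A ** X \<omega>) = (t - s) *\<^sub>R (A ** X \<omega>)"
      using assms by (simp add: set_lebesgue_integral_def)
    finally show ?thesis .
  qed
  ultimately show ?case by simp
qed

text \<open>The second round of the bootstrap: with second moments bounded at each time, the
  integral equation yields increments of mean square order \<open>t - s\<close>.\<close>

lemma c_increment:
  assumes T: "0 \<le> T"
  shows "\<exists>\<kappa>\<ge>0. \<forall>s t. 0 \<le> s \<longrightarrow> s \<le> t \<longrightarrow> t \<le> T \<longrightarrow> msq M (\<lambda>\<omega>. c t \<omega> - c s \<omega>) \<le> \<kappa> * (t - s)"
proof -
  obtain S where S: "S \<ge> 0" "\<And>t. 0 \<le> t \<Longrightarrow> t \<le> T \<Longrightarrow> L2 M (c t) \<and> msq M (c t) \<le> S"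
    using c_second_moment[OF T] by blast
  have Dc: "L2 M (\<lambda>\<omega>. D ** c t \<omega>) \<and> msq M (\<lambda>\<omega>. D ** c t \<omega>) \<le> (norm D)\<^sup>2 * S" if "0 \<le> t" "t \<le> T" for t and D :: "real^'m^'m"
    using S(2)[OF that] msq_matrix_le[of M "c t" D] L2_matrix_const_left[of M "c t" D]
      mult_left_mono[OF conjunct2[OF S(2)[OF that]], of "(norm D)\<^sup>2"] by auto
  have bnd: "dsq M (\<lambda>\<tau> \<omega>. indicator {s..t} \<tau> *\<^sub>R (D ** c \<tau> \<omega>)) \<le> ennreal ((t - s) * ((norm D)\<^sup>2 * S))"
    if "0 \<le> s" "s \<le> t" "t \<le> T" for s t and D :: "real^'m^'m"
    by (rule dsq_interval_le) (use that S(1) Dc in auto)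
  define \<kappa> where "\<kappa> = 2 * (T * ((norm A)\<^sup>2 * S)) + 2 * (4 * ((norm B)\<^sup>2 * S))"
  have "msq M (\<lambda>\<omega>. c t \<omega> - c s \<omega>) \<le> \<kappa> * (t - s)" if st: "0 \<le> s" "s \<le> t" "t \<le> T" for s t
  proof -
    have mJ: "(\<lambda>\<omega>. Jc t \<omega> - Jc s \<omega>) \<in> borel_measurable M" using Jc_meas[of t] Jc_meas[of s] st by simp
    have "(\<integral>\<^sup>+\<omega>. ennreal ((norm (Jc t \<omega> - Jc s \<omega>))\<^sup>2) \<partial>M) = (\<integral>\<^sup>+\<omega>. ennreal ((norm (LINT \<tau>:{s..t}|lborel. A ** c \<tau> \<omega>))\<^sup>2) \<partial>M)"
      using Jc_increment[OF st(1,2), of "\<lambda>_. 0"] by (intro nn_integral_cong_AE) auto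
    also have "\<dots> \<le> ennreal (t - s) * dsq M (\<lambda>\<tau> \<omega>. indicator {s..t} \<tau> *\<^sub>R (A ** c \<tau> \<omega>))"
      by (rule path_sq_bound[OF joint_meas_Ac]) (use st in auto)
    also have "\<dots> \<le> ennreal T * ennreal ((t - s) * ((norm A)\<^sup>2 * S))"
      using st by (intro mult_mono bnd ennreal_leI) auto
    also have "\<dots> = ennreal (T * ((t - s) * ((norm A)\<^sup>2 * S)))" using T S st by (simp add: ennreal_mult)
    finally have J: "L2 M (\<lambda>\<omega>. Jc t \<omega> - Jc s \<omega>)" "msq M (\<lambda>\<omega>. Jc t \<omega> - Jc s \<omega>) \<le> T * ((t - s) * ((norm A)\<^sup>2 * S))"
      using L2_nnI[OF mJ] T S st by auto
    have "ennreal (msq M (\<lambda>\<omega>. Ic t \<omega> - Ic s \<omega> - (\<xi> t \<omega> - \<xi> s \<omega>) *\<^sub>R (0::real^'m^'m)))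
        \<le> 4 * (\<integral>\<^sup>+\<tau>\<in>{s..t}. (\<integral>\<^sup>+\<omega>. ennreal ((norm (B ** c \<tau> \<omega> - 0))\<^sup>2) \<partial>M) \<partial>lborel)"
      by (rule ito_increment_msq[OF Ic_ito Ic_ito]) (use st in auto)
    also have "\<dots> \<le> 4 * ennreal ((t - s) * ((norm B)\<^sup>2 * S))"
      unfolding set_nn_sq_eq using bnd[OF st, of B] by (intro mult_left_mono) auto
    also have "\<dots> = ennreal (4 * ((t - s) * ((norm B)\<^sup>2 * S)))" using S st by (simp add: ennreal_mult)
    finally have I: "msq M (\<lambda>\<omega>. Ic t \<omega> - Ic s \<omega>) \<le> 4 * ((t - s) * ((norm B)\<^sup>2 * S))"
      using S st by (simp add: ennreal_le_iff)
    have LI: "L2 M (\<lambda>\<omega>. Ic t \<omega> - Ic s \<omega>)" by (intro L2_diff Ic_L2) (use st in auto)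
    have "msq M (\<lambda>\<omega>. c t \<omega> - c s \<omega>) = msq M (\<lambda>\<omega>. (Jc t \<omega> - Jc s \<omega>) + (Ic t \<omega> - Ic s \<omega>))"
      by (simp add: c_eq algebra_simps)
    also have "\<dots> \<le> 2 * msq M (\<lambda>\<omega>. Jc t \<omega> - Jc s \<omega>) + 2 * msq M (\<lambda>\<omega>. Ic t \<omega> - Ic s \<omega>)"
      by (rule integral_power2_norm_add_le[OF J(1) LI])
    also have "\<dots> \<le> \<kappa> * (t - s)" using J(2) I by (simp add: \<kappa>_def algebra_simps)
    finally show ?thesis .
  qed
  moreover have "\<kappa> \<ge> 0" using T S by (simp add: \<kappa>_def)
  ultimately show ?thesis by blast
qed

text \<open>The third round: the increment bound is inserted into the integrals of
  \<open>c \<tau> - c s\<close>. The drift error gains two powers of \<open>t - s\<close> from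
  Cauchy-Schwarz in time, the martingale error one from the isometry.\<close>

lemma c_step:
  assumes T: "0 \<le> T"
  shows "\<exists>\<kappa>\<ge>0. \<forall>s t. 0 \<le> s \<longrightarrow> s \<le> t \<longrightarrow> t \<le> T \<longrightarrow> (\<exists>a m. L2 M a \<and> mart_diff M (FF s) m \<and> m \<in> borel_measurable (FF t) \<and>
    (AE \<omega> in M. c t \<omega> = c s \<omega> + ((t - s) *\<^sub>R A ** c s \<omega> + a \<omega>) + ((\<xi> t \<omega> - \<xi> s \<omega>) *\<^sub>R B ** c s \<omega> + m \<omega>)) \<and>
    msq M a \<le> \<kappa> * (t - s) ^ 3 \<and> msq M m \<le> \<kappa> * (t - s)\<^sup>2)"
proof -
  obtain S where S: "S \<ge> 0" "\<And>t. 0 \<le> t \<Longrightarrow> t \<le> T \<Longrightarrow> L2 M (c t) \<and> msq M (c t) \<le> S"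
    using c_second_moment[OF T] by blast
  obtain \<kappa> where \<kappa>: "\<kappa> \<ge> 0" "\<And>s t. 0 \<le> s \<Longrightarrow> s \<le> t \<Longrightarrow> t \<le> T \<Longrightarrow> msq M (\<lambda>\<omega>. c t \<omega> - c s \<omega>) \<le> \<kappa> * (t - s)"
    using c_increment[OF T] by blast
  define k where "k = (norm A)\<^sup>2 * \<kappa> + 4 * ((norm B)\<^sup>2 * \<kappa>)"
  have k0: "k \<ge> 0" using \<kappa> by (simp add: k_def)
  have "\<exists>a m. L2 M a \<and> mart_diff M (FF s) m \<and> m \<in> borel_measurable (FF t) \<and>
    (AE \<omega> in M. c t \<omega> = c s \<omega> + ((t - s) *\<^sub>R A ** c s \<omega> + a \<omega>) + ((\<xi> t \<omega> - \<xi> s \<omega>) *\<^sub>R B ** c s \<omega> + m \<omega>)) \<and>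
    msq M a \<le> k * (t - s) ^ 3 \<and> msq M m \<le> k * (t - s)\<^sup>2" if st: "0 \<le> s" "s \<le> t" "t \<le> T" for s t
  proof -
    have cs: "c s \<in> borel_measurable (FF s)" "L2 M (c s)" using st S(2)[of s] c_adapted[of s] by auto
    have Bcs: "(\<lambda>\<omega>. B ** c s \<omega>) \<in> borel_measurable (FF s)" "L2 M (\<lambda>\<omega>. B ** c s \<omega>)"
      using cs by (auto intro: L2_matrix_const_left)
    have bnd: "dsq M (\<lambda>\<tau> \<omega>. indicator {s..t} \<tau> *\<^sub>R (D ** (c \<tau> \<omega> - c s \<omega>))) \<le> ennreal ((t - s) * ((norm D)\<^sup>2 * (\<kappa> * (t - s))))" for D :: "real^'m^'m"
    proof (rule dsq_interval_le)
      fix \<tau> assume \<tau>: "s \<le> \<tau>" "\<tau> \<le> t"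
      have L: "L2 M (\<lambda>\<omega>. c \<tau> \<omega> - c s \<omega>)" by (intro L2_diff) (use S(2) \<tau> st in auto)
      have "msq M (\<lambda>\<omega>. D ** (c \<tau> \<omega> - c s \<omega>)) \<le> (norm D)\<^sup>2 * msq M (\<lambda>\<omega>. c \<tau> \<omega> - c s \<omega>)"
        by (rule msq_matrix_le[OF L])
      also have "\<dots> \<le> (norm D)\<^sup>2 * (\<kappa> * (\<tau> - s))" using \<kappa>(2)[of s \<tau>] \<tau> st by (intro mult_left_mono) auto
      also have "\<dots> \<le> (norm D)\<^sup>2 * (\<kappa> * (t - s))" using \<kappa>(1) \<tau> by (intro mult_left_mono) auto
      finally show "L2 M (\<lambda>\<omega>. D ** (c \<tau> \<omega> - c s \<omega>)) \<and> msq M (\<lambda>\<omega>. D ** (c \<tau> \<omega> - c s \<omega>)) \<le> (norm D)\<^sup>2 * (\<kappa> * (t - s))"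
        using L2_matrix_const_left[OF L] by blast
    qed (use st \<kappa> in auto)
    define a where "a \<omega> = Jc t \<omega> - Jc s \<omega> - (t - s) *\<^sub>R (A ** c s \<omega>)" for \<omega>
    have jd: "joint_meas M (\<lambda>\<tau> \<omega>. indicator {s..t} \<tau> *\<^sub>R (A ** (c \<tau> \<omega> - c s \<omega>)))"
    proof -
      have "joint_meas M (\<lambda>\<tau> \<omega>. indicator {s..t} \<tau> *\<^sub>R (A ** c \<tau> \<omega>) - indicator {s..t} \<tau> *\<^sub>R (A ** c s \<omega>))"
        by (intro joint_meas_diff joint_meas_Ac joint_meas_indicator joint_meas_fixed) (use st c_meas[of s] in auto)
      then show ?thesis by (simp add: mm_simps scaleR_diff_right)
    qed
    have ma: "a \<in> borel_measurable M" unfolding a_def[abs_def] using Jc_meas[of t] Jc_meas[of s] c_meas[of s] st by simp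
    have "(\<integral>\<^sup>+\<omega>. ennreal ((norm (a \<omega>))\<^sup>2) \<partial>M) = (\<integral>\<^sup>+\<omega>. ennreal ((norm (LINT \<tau>:{s..t}|lborel. A ** (c \<tau> \<omega> - c s \<omega>)))\<^sup>2) \<partial>M)"
      unfolding a_def using Jc_increment[OF st(1,2), of "c s"] by (intro nn_integral_cong_AE) auto
    also have "\<dots> \<le> ennreal (t - s) * dsq M (\<lambda>\<tau> \<omega>. indicator {s..t} \<tau> *\<^sub>R (A ** (c \<tau> \<omega> - c s \<omega>)))"
      by (rule path_sq_bound[OF jd st(2)])
    also have "\<dots> \<le> ennreal (t - s) * ennreal ((t - s) * ((norm A)\<^sup>2 * (\<kappa> * (t - s))))"
      using st by (intro mult_mono bnd ennreal_leI) auto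
    also have "\<dots> = ennreal ((norm A)\<^sup>2 * \<kappa> * (t - s) ^ 3)"
      using \<kappa> st by (simp add: ennreal_mult[symmetric] power3_eq_cube mult_ac)
    finally have a: "L2 M a" "msq M a \<le> (norm A)\<^sup>2 * \<kappa> * (t - s) ^ 3"
      using L2_nnI[OF ma] \<kappa> st by auto
    \<comment> \<open>\<open>m\<close> has to be measurable at time \<open>t\<close>, whereas
      measurability of the drift integral, and so of \<open>Ic\<close>, is at hand only for
      \<open>M\<close>; adapted versions replace \<open>Ic\<close>.\<close>
    obtain It Is where It: "It \<in> borel_measurable (FF t)" "AE \<omega> in M. Ic t \<omega> = It \<omega>"
      and Is: "Is \<in> borel_measurable (FF s)" "AE \<omega> in M. Ic s \<omega> = Is \<omega>"
      using ito_adapted[OF Ic_ito[of t] order_refl] ito_adapted[OF Ic_ito[of s] order_refl] st by auto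
    define m where "m \<omega> = It \<omega> - Is \<omega> - (\<xi> t \<omega> - \<xi> s \<omega>) *\<^sub>R (B ** c s \<omega>)" for \<omega>
    have mt: "m \<in> borel_measurable (FF t)"
      unfolding m_def[abs_def]
      by (intro borel_measurable_diff It(1) FF_mono[OF st(2) Is(1)] increment_scaleR(3) Bcs) (use st in auto)
    have eqm: "AE \<omega> in M. Ic t \<omega> - Ic s \<omega> - (\<xi> t \<omega> - \<xi> s \<omega>) *\<^sub>R (B ** c s \<omega>) = m \<omega>"
      using It(2) Is(2) by eventually_elim (simp add: m_def)
    have md0: "mart_diff M (FF s) (\<lambda>\<omega>. Ic t \<omega> - Ic s \<omega> - (\<xi> t \<omega> - \<xi> s \<omega>) *\<^sub>R (B ** c s \<omega>))"
      by (intro mart_diff_diff ito_increment_mart_diff[OF Ic_ito Ic_ito] increment_scaleR(1) Bcs) (use st in auto)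
    have md: "mart_diff M (FF s) m" by (rule mart_diff_cong_AE[OF md0 FF_meas[OF mt] eqm])
    have "ennreal (msq M (\<lambda>\<omega>. Ic t \<omega> - Ic s \<omega> - (\<xi> t \<omega> - \<xi> s \<omega>) *\<^sub>R (B ** c s \<omega>)))
        \<le> 4 * (\<integral>\<^sup>+\<tau>\<in>{s..t}. (\<integral>\<^sup>+\<omega>. ennreal ((norm (B ** c \<tau> \<omega> - B ** c s \<omega>))\<^sup>2) \<partial>M) \<partial>lborel)"
      by (rule ito_increment_msq[OF Ic_ito Ic_ito]) (use st Bcs in auto)
    also have "\<dots> \<le> 4 * ennreal ((t - s) * ((norm B)\<^sup>2 * (\<kappa> * (t - s))))"
      unfolding set_nn_sq_eq using bnd[of B] by (intro mult_left_mono) (auto simp: mm_simps)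
    also have "\<dots> = ennreal (4 * ((norm B)\<^sup>2 * \<kappa>) * (t - s)\<^sup>2)"
    proof -
      have "4 * ennreal x = ennreal (4 * x)" if "x \<ge> 0" for x using that by (simp add: ennreal_mult)
      from this[of "(t - s) * ((norm B)\<^sup>2 * (\<kappa> * (t - s)))"] show ?thesis
        using \<kappa> st by (simp add: power2_eq_square mult_ac)
    qed
    finally have "msq M (\<lambda>\<omega>. Ic t \<omega> - Ic s \<omega> - (\<xi> t \<omega> - \<xi> s \<omega>) *\<^sub>R (B ** c s \<omega>)) \<le> 4 * ((norm B)\<^sup>2 * \<kappa>) * (t - s)\<^sup>2"
      using \<kappa> st by (simp add: ennreal_le_iff)
    moreover have "msq M (\<lambda>\<omega>. Ic t \<omega> - Ic s \<omega> - (\<xi> t \<omega> - \<xi> s \<omega>) *\<^sub>R (B ** c s \<omega>)) = msq M m"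
      by (rule msq_cong_AE[OF _ _ eqm]) (use mart_diff_L2[OF md0] mart_diff_L2[OF md] in \<open>auto simp: L2_def\<close>)
    ultimately have m2: "msq M m \<le> 4 * ((norm B)\<^sup>2 * \<kappa>) * (t - s)\<^sup>2" by simp
    have step: "AE \<omega> in M. c t \<omega> = c s \<omega> + ((t - s) *\<^sub>R A ** c s \<omega> + a \<omega>) + ((\<xi> t \<omega> - \<xi> s \<omega>) *\<^sub>R B ** c s \<omega> + m \<omega>)"
      using eqm
    proof eventually_elim
      case (elim \<omega>)
      have "c t \<omega> = c s \<omega> + (Jc t \<omega> - Jc s \<omega>) + (Ic t \<omega> - Ic s \<omega>)" by (simp add: c_eq)
      then show ?case unfolding elim[symmetric] a_def by (simp add: mm_simps)
    qed
    have "msq M a \<le> k * (t - s) ^ 3" "msq M m \<le> k * (t - s)\<^sup>2"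
      using \<kappa> st by (auto intro!: order_trans[OF a(2)] order_trans[OF m2] mult_right_mono simp: k_def)
    with a(1) md mt step show ?thesis by blast
  qed
  with k0 show ?thesis by blast
qed

end

section \<open>Coarse Euler schemes in block form\<close>

context
  fixes A :: "real^'m^'m" and h :: real and b :: nat and G :: "nat \<Rightarrow> 'a \<Rightarrow> real^'m^'m"
begin

text \<open>The propagator from the start of block \<open>K\<close> over its first \<open>i\<close>
  steps. As the state is frozen, the steps contribute a sum and not a product.\<close>

definition block :: "nat \<Rightarrow> nat \<Rightarrow> 'a \<Rightarrow> real^'m^'m" where
  "block K i \<omega> = mat 1 + (\<Sum>k<i. h *\<^sub>R A + G (K * b + k) \<omega>)"

primrec coarse :: "nat \<Rightarrow> 'a \<Rightarrow> real^'m^'m" where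
  "coarse 0 \<omega> = mat 1"
| "coarse (Suc K) \<omega> = block K b \<omega> ** coarse K \<omega>"

definition euler :: "nat \<Rightarrow> 'a \<Rightarrow> real^'m^'m" where
  "euler j \<omega> = block (j div b) (j mod b) \<omega> ** coarse (j div b) \<omega>"

lemma block_0: "block K 0 \<omega> = mat 1"
  by (simp add: block_def)

lemma block_Suc: "block K (Suc i) \<omega> = block K i \<omega> + (h *\<^sub>R A + G (K * b + i) \<omega>)"
  by (simp add: block_def)

lemma euler_0: "euler 0 = (\<lambda>_. mat 1)"
  by (simp add: euler_def block_0 fun_eq_iff)

text \<open>The value \<open>i = b\<close> is included: the end of a block is the start of the next
  one.\<close>

lemma euler_block: "i \<le> b \<Longrightarrow> 0 < b \<Longrightarrow> euler (K * b + i) \<omega> = block K i \<omega> ** coarse K \<omega>"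
  by (cases "i = b") (simp_all add: euler_def block_0 add.commute[of "K * b"])

text \<open>The block form satisfies the recursion demanded of \<open>Z\<close> in
  \<open>perturbed_scheme\<close>.\<close>

lemma euler_Suc:
  assumes "0 < b"
  shows "euler (Suc j) \<omega> = euler j \<omega> + (h *\<^sub>R A + G j \<omega>) ** euler (j div b * b) \<omega>"
proof -
  define K i where "K = j div b" "i = j mod b"
  have j: "j = K * b + i" "i < b" using assms by (simp_all add: K_i_def)
  have "euler (Suc j) \<omega> = block K (Suc i) \<omega> ** coarse K \<omega>"
    using euler_block[of "Suc i" K \<omega>] j assms by simp
  moreover have "euler (j div b * b) \<omega> = coarse K \<omega>"
    using euler_block[of 0 K \<omega>] assms by (simp add: K_i_def block_0)
  moreover have "euler j \<omega> = block K i \<omega> ** coarse K \<omega>"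
    using euler_block[of i K \<omega>] j assms by simp
  ultimately show ?thesis using j by (simp add: block_Suc mm_simps)
qed

end

section \<open>Suprema over time intervals\<close>

lemma SUP_maxn: "(SUP k\<in>{..n}. ennreal ((norm (X k \<omega>))\<^sup>2)) = ennreal ((maxn X n \<omega>)\<^sup>2)"
proof (rule antisym)
  show "(SUP k\<in>{..n}. ennreal ((norm (X k \<omega>))\<^sup>2)) \<le> ennreal ((maxn X n \<omega>)\<^sup>2)"
    by (intro SUP_least ennreal_leI power_mono maxn_ge) auto
  have "maxn X n \<omega> \<in> (\<lambda>i. norm (X i \<omega>)) ` {..n}" unfolding maxn_def by (rule Max_in) auto
  then obtain k where "k \<le> n" "maxn X n \<omega> = norm (X k \<omega>)" by auto
  then show "ennreal ((maxn X n \<omega>)\<^sup>2) \<le> (SUP k\<in>{..n}. ennreal ((norm (X k \<omega>))\<^sup>2))"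
    by (intro SUP_upper2[of k]) auto
qed

text \<open>Countably many times make it measurable, and the nested grids make the inner suprema
  increase in \<open>m\<close>, as monotone convergence requires.\<close>

definition dyad_sup :: "real \<Rightarrow> real \<Rightarrow> (real \<Rightarrow> ennreal) \<Rightarrow> ennreal" where
  "dyad_sup s h g = (SUP m::nat. SUP k\<in>{..2^m::nat}. g (s + h * real k / 2 ^ m))"

lemma dyad_sup_le: "h \<ge> 0 \<Longrightarrow> dyad_sup s h g \<le> (SUP t\<in>{s..s + h}. g t)"
  unfolding dyad_sup_def
proof (intro SUP_least SUP_upper)
  fix m k :: nat assume "h \<ge> 0" "k \<in> {..2 ^ m}"
  then have "real k \<le> 2 ^ m" using of_nat_mono[of k "2 ^ m", where 'a=real] by simp
  then have "h * (real k / 2 ^ m) \<le> h * 1" using \<open>h \<ge> 0\<close> by (intro mult_left_mono) auto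
  then show "s + h * real k / 2 ^ m \<in> {s..s + h}" using \<open>h \<ge> 0\<close> by simp
qed

text \<open>Each time before \<open>s + h\<close> is approached from the right by dyadic times,
  where right limits suffice; \<open>s + h\<close> is itself a grid point.\<close>

lemma dyad_sup_eq:
  fixes g :: "real \<Rightarrow> ennreal"
  assumes h: "h > 0" and g: "\<And>t. s \<le> t \<Longrightarrow> t < s + h \<Longrightarrow> (g \<longlongrightarrow> g t) (at_right t)"
  shows "(SUP t\<in>{s..s + h}. g t) = dyad_sup s h g"
proof (rule antisym[OF SUP_least dyad_sup_le])
  have up: "g (s + h * real k / 2 ^ m) \<le> dyad_sup s h g" if "k \<le> 2 ^ m" for k m :: nat
    unfolding dyad_sup_def by (rule SUP_upper2[of m]) (use that in \<open>auto intro!: SUP_upper\<close>)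
  fix t assume t: "t \<in> {s..s + h}"
  show "g t \<le> dyad_sup s h g"
  proof (cases "t = s + h")
    case True
    then show ?thesis using up[of 1 0] by simp
  next
    case False
    with t have t: "s \<le> t" "t < s + h" by auto
    define x where "x = (t - s) / h"
    have x: "0 \<le> x" "x < 1" using t h by (auto simp: x_def divide_simps)
    \<comment> \<open>Adding 1 to the floor puts the grid point strictly to the right of
      \<open>t\<close>, at distance at most \<open>h / 2 ^ m\<close>.\<close>
    define k where "k m = nat (\<lfloor>x * 2 ^ m\<rfloor> + 1)" for m :: nat
    have k: "real (k m) = of_int \<lfloor>x * 2 ^ m\<rfloor> + 1" for m using x by (simp add: k_def)
    have kr: "x * 2 ^ m < real (k m)" "real (k m) \<le> x * 2 ^ m + 1" for m using k[of m] by linarith+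
    have kle: "k m \<le> 2 ^ m" for m
    proof -
      have "x * 2 ^ m < 2 ^ m" using x by simp
      then have "\<lfloor>x * 2 ^ m\<rfloor> < 2 ^ m" by (simp add: floor_less_iff)
      then show ?thesis unfolding k_def by (simp add: nat_le_iff)
    qed
    define u where "u m = s + h * real (k m) / 2 ^ m" for m
    have ut: "t < u m" for m
    proof -
      have "h * (x * 2 ^ m) < h * real (k m)" using kr(1) h by (intro mult_strict_left_mono) auto
      then have "t - s < h * real (k m) / 2 ^ m" using h by (simp add: x_def pos_less_divide_eq)
      then show ?thesis by (simp add: u_def)
    qed
    have ut2: "u m \<le> t + h * (1 / 2) ^ m" for m
    proof -
      have "h * real (k m) \<le> h * (x * 2 ^ m + 1)" using kr(2) h by (intro mult_left_mono) auto
      then have "h * real (k m) / 2 ^ m \<le> h * (x * 2 ^ m + 1) / 2 ^ m" by (rule divide_right_mono) simp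
      also have "\<dots> = t - s + h * (1 / 2) ^ m" using h by (simp add: x_def field_simps power_one_over)
      finally show ?thesis by (simp add: u_def)
    qed
    have "(\<lambda>m. t + h * (1 / 2) ^ m) \<longlonglongrightarrow> t + h * 0"
      by (intro tendsto_intros LIMSEQ_realpow_zero) auto
    then have lim: "(\<lambda>m. t + h * (1 / 2) ^ m) \<longlonglongrightarrow> t" by simp
    have "u \<longlonglongrightarrow> t"
    proof (rule tendsto_sandwich[OF _ _ tendsto_const lim])
      show "\<forall>\<^sub>F m in sequentially. t \<le> u m" using ut by (auto intro!: always_eventually less_imp_le)
      show "\<forall>\<^sub>F m in sequentially. u m \<le> t + h * (1 / 2) ^ m" using ut2 by (intro always_eventually allI)
    qed
    then have "filterlim u (at_right t) sequentially"
      unfolding filterlim_at using ut by (auto simp: less_imp_neq[symmetric])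
    from filterlim_compose[OF g[OF t] this] have "(\<lambda>m. g (u m)) \<longlonglongrightarrow> g t" .
    then show ?thesis
    proof (rule LIMSEQ_le_const2, intro exI[of _ 0] allI impI)
      show "g (u m) \<le> dyad_sup s h g" for m unfolding u_def by (rule up[OF kle])
    qed
  qed
qed (use h in simp)

text \<open>Monotone convergence along refining grids. Bounds from some level \<open>m0\<close> on
  suffice because the maxima increase, which allows estimates valid only for small mesh.\<close>

lemma dyad_sup_nn_integral_le:
  fixes X :: "real \<Rightarrow> 'a \<Rightarrow> 'b::euclidean_space"
  assumes X: "\<And>t. s \<le> t \<Longrightarrow> t \<le> s + h \<Longrightarrow> X t \<in> borel_measurable M" and h: "h \<ge> 0"
    and le: "\<And>m. m \<ge> m0 \<Longrightarrow> (\<integral>\<^sup>+\<omega>. ennreal ((maxn (\<lambda>k. X (s + h * real k / 2 ^ m)) (2 ^ m) \<omega>)\<^sup>2) \<partial>M) \<le> c"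
  shows "(\<integral>\<^sup>+\<omega>. dyad_sup s h (\<lambda>t. ennreal ((norm (X t \<omega>))\<^sup>2)) \<partial>M) \<le> c"
    and "(\<lambda>\<omega>. dyad_sup s h (\<lambda>t. ennreal ((norm (X t \<omega>))\<^sup>2))) \<in> borel_measurable M"
proof -
  have Xm: "X (s + h * real k / 2 ^ m) \<in> borel_measurable M" if "k \<le> 2 ^ m" for k m :: nat
  proof (rule X)
    have "real k \<le> 2 ^ m" using of_nat_mono[OF that, where 'a=real] by simp
    then have "h * (real k / 2 ^ m) \<le> h * 1" using h by (intro mult_left_mono) auto
    then show "s \<le> s + h * real k / 2 ^ m" "s + h * real k / 2 ^ m \<le> s + h" using h by auto
  qed
  let ?f = "\<lambda>m \<omega>. ennreal ((maxn (\<lambda>k. X (s + h * real k / 2 ^ m)) (2 ^ m) \<omega>)\<^sup>2)"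
  have fm: "?f m \<in> borel_measurable M" for m
    by (intro measurable_compose[OF _ measurable_ennreal] borel_measurable_power maxn_measurable Xm)
  have inc: "incseq ?f"
  proof (intro incseq_SucI le_funI ennreal_leI power_mono maxn_leI)
    fix m \<omega> k assume "k \<le> (2::nat) ^ m"
    then have "2 * k \<le> 2 ^ Suc m" by simp
    from maxn_ge[OF this, of "\<lambda>k. X (s + h * real k / 2 ^ Suc m)" \<omega>]
    show "norm (X (s + h * real k / 2 ^ m) \<omega>) \<le> maxn (\<lambda>k. X (s + h * real k / 2 ^ Suc m)) (2 ^ Suc m) \<omega>"
      by simp
  qed simp
  have eq: "dyad_sup s h (\<lambda>t. ennreal ((norm (X t \<omega>))\<^sup>2)) = (SUP m. ?f m \<omega>)" for \<omega>
    unfolding dyad_sup_def by (intro SUP_cong refl SUP_maxn)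
  show "(\<lambda>\<omega>. dyad_sup s h (\<lambda>t. ennreal ((norm (X t \<omega>))\<^sup>2))) \<in> borel_measurable M"
    unfolding eq using fm by measurable
  have "(\<integral>\<^sup>+\<omega>. (SUP m. ?f m \<omega>) \<partial>M) = (SUP m. \<integral>\<^sup>+\<omega>. ?f m \<omega> \<partial>M)"
    by (rule nn_integral_monotone_convergence_SUP[OF inc fm])
  also have "\<dots> \<le> c"
  proof (rule SUP_least)
    fix m
    have "(\<integral>\<^sup>+\<omega>. ?f m \<omega> \<partial>M) \<le> (\<integral>\<^sup>+\<omega>. ?f (max m m0) \<omega> \<partial>M)"
      using inc by (intro nn_integral_mono) (simp add: incseq_def le_fun_def)
    also have "\<dots> \<le> c" by (rule le) simp
    finally show "(\<integral>\<^sup>+\<omega>. ?f m \<omega> \<partial>M) \<le> c" .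
  qed
  finally show "(\<integral>\<^sup>+\<omega>. dyad_sup s h (\<lambda>t. ennreal ((norm (X t \<omega>))\<^sup>2)) \<partial>M) \<le> c" unfolding eq .
qed

lemma right_continuous_sq:
  fixes X :: "real \<Rightarrow> 'b::real_normed_vector"
  assumes "(X \<longlongrightarrow> X t) (at_right t)"
  shows "((\<lambda>t. ennreal ((norm (X t))\<^sup>2)) \<longlongrightarrow> ennreal ((norm (X t))\<^sup>2)) (at_right t)"
  by (intro tendsto_ennrealI tendsto_power tendsto_norm assms)

lemma continuous_on_right_limit:
  fixes X :: "real \<Rightarrow> 'b::topological_space"
  assumes "continuous_on {a..} X" "a \<le> t" shows "(X \<longlongrightarrow> X t) (at_right t)"
proof -
  have "(X \<longlongrightarrow> X t) (at t within {a..})" using assms by (simp add: continuous_on_def)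
  then show ?thesis by (rule tendsto_within_subset) (use assms in auto)
qed

text \<open>The root of the dyadic supremum is a measurable square integrable envelope of almost
  every path, for use in dominated convergence and tail bounds.\<close>

lemma sup_dominated_L2:
  fixes X :: "real \<Rightarrow> 'a \<Rightarrow> 'b::euclidean_space"
  assumes X: "\<And>t. s \<le> t \<Longrightarrow> t \<le> s + h \<Longrightarrow> X t \<in> borel_measurable M" and h: "h > 0"
    and rc: "AE \<omega> in M. \<forall>t\<ge>s. ((\<lambda>t. X t \<omega>) \<longlongrightarrow> X t \<omega>) (at_right t)"
    and le: "\<And>m. m \<ge> m0 \<Longrightarrow> (\<integral>\<^sup>+\<omega>. ennreal ((maxn (\<lambda>k. X (s + h * real k / 2 ^ m)) (2 ^ m) \<omega>)\<^sup>2) \<partial>M) \<le> ennreal c"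
    and c: "c \<ge> 0"
  shows "\<exists>S. L2 M S \<and> (\<forall>\<omega>. 0 \<le> S \<omega>) \<and> msq M S \<le> c \<and> (AE \<omega> in M. \<forall>t. s \<le> t \<longrightarrow> t \<le> s + h \<longrightarrow> norm (X t \<omega>) \<le> S \<omega>)"
proof -
  define Q where "Q \<omega> = dyad_sup s h (\<lambda>t. ennreal ((norm (X t \<omega>))\<^sup>2))" for \<omega>
  have Q: "(\<integral>\<^sup>+\<omega>. Q \<omega> \<partial>M) \<le> ennreal c" "Q \<in> borel_measurable M"
    unfolding Q_def[abs_def] using dyad_sup_nn_integral_le[OF X _ le] h by auto
  define S where "S \<omega> = sqrt (enn2real (Q \<omega>))" for \<omega>
  have Sm: "S \<in> borel_measurable M" unfolding S_def[abs_def] using Q(2) by measurable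
  have fin: "AE \<omega> in M. Q \<omega> \<noteq> \<infinity>"
    by (rule nn_integral_PInf_AE[OF Q(2)]) (use Q(1) in \<open>auto simp: top_unique\<close>)
  have "(\<integral>\<^sup>+\<omega>. ennreal ((norm (S \<omega>))\<^sup>2) \<partial>M) = (\<integral>\<^sup>+\<omega>. Q \<omega> \<partial>M)"
    using fin by (intro nn_integral_cong_AE) (auto simp: S_def less_top)
  with Q(1) have S: "L2 M S" "msq M S \<le> c" using L2_nnI[OF Sm _ c] by auto
  have "AE \<omega> in M. \<forall>t. s \<le> t \<longrightarrow> t \<le> s + h \<longrightarrow> norm (X t \<omega>) \<le> S \<omega>"
    using fin rc
  proof eventually_elim
    case (elim \<omega>)
    have eq: "(SUP t\<in>{s..s + h}. ennreal ((norm (X t \<omega>))\<^sup>2)) = Q \<omega>"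
      unfolding Q_def by (rule dyad_sup_eq[OF h right_continuous_sq]) (use elim in auto)
    show ?case
    proof (intro allI impI)
      fix t assume "s \<le> t" "t \<le> s + h"
      then have "ennreal ((norm (X t \<omega>))\<^sup>2) \<le> Q \<omega>" unfolding eq[symmetric] by (intro SUP_upper) auto
      also have "Q \<omega> = ennreal ((S \<omega>)\<^sup>2)" using elim(1) by (simp add: S_def less_top)
      finally have "(norm (X t \<omega>))\<^sup>2 \<le> (S \<omega>)\<^sup>2" by simp
      then show "norm (X t \<omega>) \<le> S \<omega>" by (rule power2_le_imp_le) (simp add: S_def)
    qed
  qed
  with S show ?thesis by (intro exI[of _ S]) (auto simp: S_def)
qed

text \<open>Dominated convergence, with the square itself as the majorant.\<close>

lemma L2_tail:
  fixes S :: "'a \<Rightarrow> real"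
  assumes "L2 M S" "\<eta> > 0"
  shows "\<exists>R>0. (\<integral>\<omega>. (S \<omega>)\<^sup>2 * indicator {\<omega>. R < \<bar>S \<omega>\<bar>} \<omega> \<partial>M) < \<eta>"
proof -
  have [measurable]: "S \<in> borel_measurable M" using assms(1) by (simp add: L2_def)
  have "(\<lambda>n. \<integral>\<omega>. (S \<omega>)\<^sup>2 * indicator {\<omega>. real n < \<bar>S \<omega>\<bar>} \<omega> \<partial>M) \<longlonglongrightarrow> (\<integral>\<omega>. 0 \<partial>M)"
  proof (rule integral_dominated_convergence[where w="\<lambda>\<omega>. (S \<omega>)\<^sup>2"])
    show "(\<lambda>\<omega>. (S \<omega>)\<^sup>2 * indicator {\<omega>. real n < \<bar>S \<omega>\<bar>} \<omega>) \<in> borel_measurable M" for n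
      unfolding indicator_def by measurable
    show "integrable M (\<lambda>\<omega>. (S \<omega>)\<^sup>2)" using assms(1) by (simp add: L2_def)
    show "AE \<omega> in M. (\<lambda>n. (S \<omega>)\<^sup>2 * indicator {\<omega>. real n < \<bar>S \<omega>\<bar>} \<omega>) \<longlonglongrightarrow> 0"
    proof (intro AE_I2)
      fix \<omega>
      have "eventually (\<lambda>n. (S \<omega>)\<^sup>2 * indicator {\<omega>. real n < \<bar>S \<omega>\<bar>} \<omega> = 0) sequentially"
        using eventually_ge_at_top[of "nat \<lceil>\<bar>S \<omega>\<bar>\<rceil>"]
        by eventually_elim (auto simp: indicator_def)
      then show "(\<lambda>n. (S \<omega>)\<^sup>2 * indicator {\<omega>. real n < \<bar>S \<omega>\<bar>} \<omega>) \<longlonglongrightarrow> 0"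
        by (rule tendsto_eventually)
    qed
    show "AE \<omega> in M. norm ((S \<omega>)\<^sup>2 * indicator {\<omega>. real n < \<bar>S \<omega>\<bar>} \<omega>) \<le> (S \<omega>)\<^sup>2" for n
      by (intro AE_I2) (auto simp: indicator_def)
  qed auto
  then have "eventually (\<lambda>n. (\<integral>\<omega>. (S \<omega>)\<^sup>2 * indicator {\<omega>. real n < \<bar>S \<omega>\<bar>} \<omega> \<partial>M) < \<eta>) sequentially"
    by (rule order_tendstoD(2)) (use assms in simp)
  from eventually_conj[OF this eventually_gt_at_top[of 0]]
  obtain n where "n > 0" "(\<integral>\<omega>. (S \<omega>)\<^sup>2 * indicator {\<omega>. real n < \<bar>S \<omega>\<bar>} \<omega> \<partial>M) < \<eta>"
    by (auto dest: eventually_happens)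
  then show ?thesis by (intro exI[of _ "real n"]) auto
qed

section \<open>Grid points and oscillation between them\<close>

text \<open>The last grid point of mesh \<open>T / real n\<close> not after \<open>t\<close>,
  written as in \<open>g_approx\<close>.\<close>

definition gfloor :: "real \<Rightarrow> nat \<Rightarrow> real \<Rightarrow> real" where
  "gfloor T n t = of_int \<lfloor>real n * t / T\<rfloor> * (T / real n)"

lemma gfloor_bounds:
  assumes "T > 0" "n > 0" shows "gfloor T n t \<le> t" "t < gfloor T n t + T / real n"
proof -
  define x where "x = real n * t / T"
  have t: "t = x * (T / real n)" using assms by (simp add: x_def)
  have p: "T / real n > 0" using assms by simp
  have "of_int \<lfloor>x\<rfloor> * (T / real n) \<le> x * (T / real n)" using p by (intro mult_right_mono) auto
  then show "gfloor T n t \<le> t" using t unfolding gfloor_def x_def[symmetric] by linarith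
  have "x * (T / real n) < (of_int \<lfloor>x\<rfloor> + 1) * (T / real n)" by (intro mult_strict_right_mono p) linarith
  then show "t < gfloor T n t + T / real n" using t unfolding gfloor_def x_def[symmetric] by (simp add: distrib_right add_divide_distrib)
qed

lemma gfloor_nonneg: "T > 0 \<Longrightarrow> 0 \<le> t \<Longrightarrow> 0 \<le> gfloor T n t"
  by (simp add: gfloor_def)

text \<open>Makes the grid-frozen path right-continuous, so that \<open>dyad_sup_eq\<close> applies
  to its distance from the path.\<close>

lemma gfloor_right_const:
  assumes "T > 0" "n > 0" shows "\<forall>\<^sub>F u in at_right t. gfloor T n u = gfloor T n t"
proof -
  have "t < gfloor T n t + T / real n" by (rule gfloor_bounds[OF assms])
  then have "\<forall>\<^sub>F u in at_right t. u < gfloor T n t + T / real n \<and> t < u"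
    by (intro eventually_conj eventually_at_right_less order_tendstoD(2)[OF tendsto_ident_at])
  then show ?thesis
  proof eventually_elim
    case (elim u)
    have p: "T / real n > 0" using assms by simp
    have 1: "real n * t / T \<le> real n * u / T" using elim assms by (intro divide_right_mono mult_left_mono) auto
    have "u < (of_int \<lfloor>real n * t / T\<rfloor> + 1) * (T / real n)" using elim by (simp add: gfloor_def algebra_simps)
    then have 2: "real n * u / T < of_int \<lfloor>real n * t / T\<rfloor> + 1" using assms by (simp add: field_simps)
    have "\<lfloor>real n * u / T\<rfloor> = \<lfloor>real n * t / T\<rfloor>" using 1 2 floor_mono[OF 1] by linarith
    then show ?case by (simp add: gfloor_def)
  qed
qed

text \<open>At \<open>t = T\<close> the index is \<open>n\<close>, and its interval reaches beyond
  \<open>T\<close>. Estimates between grid points therefore run over \<open>n + 1\<close>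
  intervals.\<close>

lemma gfloor_cases:
  assumes "T > 0" "n > 0" "0 \<le> t" "t \<le> T"
  obtains j where "j \<le> n" "gfloor T n t = real j * (T / real n)" "nat \<lfloor>real n * t / T\<rfloor> = j"
    "t \<in> {real j * (T / real n)..real j * (T / real n) + T / real n}"
proof -
  define j where "j = nat \<lfloor>real n * t / T\<rfloor>"
  have "real n * t / T \<le> real n" using assms by (simp add: field_simps mult_left_mono)
  then have "j \<le> n" unfolding j_def by linarith
  moreover have j: "real j = of_int \<lfloor>real n * t / T\<rfloor>" using assms by (simp add: j_def)
  ultimately show thesis
    using gfloor_bounds[OF assms(1,2), of t] by (intro that[of j]) (auto simp: gfloor_def j_def[symmetric])
qed

lemma tendsto_0_le_ennreal:
  fixes f :: "'i \<Rightarrow> ennreal"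
  assumes "\<And>e. e > 0 \<Longrightarrow> eventually (\<lambda>n. f n \<le> ennreal e) F"
  shows "(f \<longlongrightarrow> 0) F"
proof (rule order_tendstoI)
  fix a :: ennreal assume "0 < a"
  then obtain e where e: "0 < e" "ennreal e < a"
    by (cases a) (auto intro: that[of "enn2real a / 2"] that[of 1] simp: ennreal_less_iff)
  show "eventually (\<lambda>n. f n < a) F"
    using assms[OF e(1)] by eventually_elim (use e(2) in auto)
qed simp

text \<open>The paths are right-continuous steps minus continuous, so that the supremum over \<open>t\<close> is
  attained along dyadic times, which makes it measurable.\<close>

lemma oscillation_tendsto_0:
  fixes X :: "real \<Rightarrow> 'a \<Rightarrow> 'b::euclidean_space"
  assumes T: "T > 0" and X: "\<And>t. 0 \<le> t \<Longrightarrow> t \<le> T \<Longrightarrow> X t \<in> borel_measurable M"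
    and co: "AE \<omega> in M. continuous_on {0..} (\<lambda>t. X t \<omega>)"
    and S: "L2 M S" "AE \<omega> in M. \<forall>t. 0 \<le> t \<longrightarrow> t \<le> T \<longrightarrow> norm (X t \<omega>) \<le> S \<omega>"
  shows "\<exists>Q. (\<forall>n>0. Q n \<in> borel_measurable M) \<and>
    (\<forall>n>0. AE \<omega> in M. \<forall>t. 0 \<le> t \<longrightarrow> t \<le> T \<longrightarrow> ennreal ((norm (X t \<omega> - X (gfloor T n t) \<omega>))\<^sup>2) \<le> Q n \<omega>) \<and>
    (\<lambda>n. \<integral>\<^sup>+\<omega>. Q n \<omega> \<partial>M) \<longlonglongrightarrow> 0"
proof -
  let ?D = "\<lambda>n \<omega> t. X t \<omega> - X (gfloor T n t) \<omega>"
  define Q where "Q n \<omega> = dyad_sup 0 T (\<lambda>t. ennreal ((norm (?D n \<omega> t))\<^sup>2))" for n \<omega>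
  have Qeq: "AE \<omega> in M. (SUP t\<in>{0..T}. ennreal ((norm (?D n \<omega> t))\<^sup>2)) = Q n \<omega>" if n: "n > 0" for n
    using co
  proof eventually_elim
    case (elim \<omega>)
    have "(SUP t\<in>{0..0 + T}. ennreal ((norm (?D n \<omega> t))\<^sup>2)) = Q n \<omega>"
      unfolding Q_def
    proof (rule dyad_sup_eq[OF T], rule right_continuous_sq)
      fix t :: real assume t: "0 \<le> t"
      have "((\<lambda>u. X u \<omega> - X (gfloor T n t) \<omega>) \<longlongrightarrow> ?D n \<omega> t) (at_right t)"
        by (intro tendsto_diff tendsto_const continuous_on_right_limit[OF elim t])
      then show "(?D n \<omega> \<longlongrightarrow> ?D n \<omega> t) (at_right t)"
        by (rule Lim_transform_eventually)
          (use gfloor_right_const[OF T n, of t] in \<open>eventually_elim, simp\<close>)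
    qed
    then show ?case by simp
  qed
  have Qm: "Q n \<in> borel_measurable M" if n: "n > 0" for n
    unfolding Q_def[abs_def]
  proof (rule dyad_sup_nn_integral_le(2))
    fix t assume t: "0 \<le> t" "t \<le> 0 + T"
    then have "0 \<le> gfloor T n t" "gfloor T n t \<le> T"
      using gfloor_bounds(1)[OF T n, of t] gfloor_nonneg[OF T, of t n] by auto
    then show "(\<lambda>\<omega>. X t \<omega> - X (gfloor T n t) \<omega>) \<in> borel_measurable M"
      using t by (intro borel_measurable_diff X) auto
  qed (use T in simp, rule top_greatest)
  have lim: "AE \<omega> in M. (\<lambda>n. Q n \<omega>) \<longlonglongrightarrow> 0"
    using co
  proof eventually_elim
    case (elim \<omega>)
    have uc: "uniformly_continuous_on {0..T} (\<lambda>t. X t \<omega>)"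
      by (rule compact_uniformly_continuous[OF continuous_on_subset[OF elim]]) auto
    show "(\<lambda>n. Q n \<omega>) \<longlonglongrightarrow> 0"
    proof (rule tendsto_0_le_ennreal)
      fix e :: real assume e: "e > 0"
      \<comment> \<open>The modulus is taken at \<open>sqrt e\<close> because \<open>Q\<close>
        bounds squares.\<close>
      then obtain d where d: "d > 0" "\<And>x y. x \<in> {0..T} \<Longrightarrow> y \<in> {0..T} \<Longrightarrow> dist y x < d \<Longrightarrow> dist (X y \<omega>) (X x \<omega>) < sqrt e"
        using uc[unfolded uniformly_continuous_on_def, rule_format, of "sqrt e"] by auto
      obtain N :: nat where N: "real N > T / d" using reals_Archimedean2 by blast
      show "\<forall>\<^sub>F n in sequentially. Q n \<omega> \<le> ennreal e"
        using eventually_gt_at_top[of "max N 0"]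
      proof eventually_elim
        case (elim n)
        then have n: "n > 0" "n > N" by auto
        have "T / d < real n" using N n by linarith
        then have Tn: "T / real n < d" using d(1) T n by (simp add: field_simps)
        have "Q n \<omega> \<le> (SUP t\<in>{0..0 + T}. ennreal ((norm (?D n \<omega> t))\<^sup>2))"
          unfolding Q_def by (rule dyad_sup_le) (use T in simp)
        also have "\<dots> \<le> ennreal e"
        proof (intro SUP_least ennreal_leI)
          fix t assume t: "t \<in> {0..0 + T}"
          have g: "gfloor T n t \<le> t" "t < gfloor T n t + T / real n" "0 \<le> gfloor T n t"
            using gfloor_bounds[OF T n(1), of t] gfloor_nonneg[OF T, of t n] t by auto
          have "dist (X t \<omega>) (X (gfloor T n t) \<omega>) < sqrt e"
            by (rule d(2)) (use t g Tn in \<open>auto simp: dist_real_def\<close>)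
          then have "(norm (?D n \<omega> t))\<^sup>2 \<le> (sqrt e)\<^sup>2" by (intro power_mono) (auto simp: dist_norm)
          then show "(norm (?D n \<omega> t))\<^sup>2 \<le> e" using e by simp
        qed
        finally show ?case .
      qed
    qed
  qed
  \<comment> \<open>The shift avoids \<open>n = 0\<close>, which defines no grid. The majorant is
    the square of twice the envelope.\<close>
  have "(\<lambda>n. \<integral>\<^sup>+\<omega>. Q (Suc n) \<omega> \<partial>M) \<longlonglongrightarrow> (\<integral>\<^sup>+\<omega>. 0 \<partial>M)"
  proof (rule nn_integral_dominated_convergence[where w="\<lambda>\<omega>. 4 * ennreal ((norm (S \<omega>))\<^sup>2)"])
    show "Q (Suc n) \<in> borel_measurable M" for n by (rule Qm) simp
    show "(\<lambda>\<omega>. 4 * ennreal ((norm (S \<omega>))\<^sup>2)) \<in> borel_measurable M" using S(1) by (auto simp: L2_def)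
    show "(\<integral>\<^sup>+\<omega>. 4 * ennreal ((norm (S \<omega>))\<^sup>2) \<partial>M) < \<infinity>"
      using S(1) L2_nn_msq[OF S(1)] by (auto simp: L2_def nn_integral_cmult ennreal_mult_less_top)
    show "AE \<omega> in M. Q (Suc n) \<omega> \<le> 4 * ennreal ((norm (S \<omega>))\<^sup>2)" for n
      using S(2)
    proof eventually_elim
      case (elim \<omega>)
      have "Q (Suc n) \<omega> \<le> (SUP t\<in>{0..0 + T}. ennreal ((norm (?D (Suc n) \<omega> t))\<^sup>2))"
        unfolding Q_def by (rule dyad_sup_le) (use T in simp)
      also have "\<dots> \<le> ennreal (4 * (norm (S \<omega>))\<^sup>2)"
      proof (intro SUP_least ennreal_leI)
        fix t assume t: "t \<in> {0..0 + T}"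
        have g: "gfloor T (Suc n) t \<le> t" "0 \<le> gfloor T (Suc n) t"
          using gfloor_bounds[OF T, of "Suc n" t] gfloor_nonneg[OF T, of t "Suc n"] t by auto
        have 1: "norm (X t \<omega>) \<le> norm (S \<omega>)" using elim[rule_format, of t] t by auto
        have 2: "norm (X (gfloor T (Suc n) t) \<omega>) \<le> norm (S \<omega>)" using elim[rule_format, of "gfloor T (Suc n) t"] t g by auto
        have "norm (?D (Suc n) \<omega> t) \<le> 2 * norm (S \<omega>)"
          using norm_triangle_ineq4[of "X t \<omega>" "X (gfloor T (Suc n) t) \<omega>"] 1 2 by linarith
        then have "(norm (?D (Suc n) \<omega> t))\<^sup>2 \<le> (2 * norm (S \<omega>))\<^sup>2" by (rule power_mono) simp
        then show "(norm (?D (Suc n) \<omega> t))\<^sup>2 \<le> 4 * (norm (S \<omega>))\<^sup>2" by (simp add: power_mult_distrib)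
      qed
      finally show ?case by (simp add: ennreal_mult)
    qed
    show "AE \<omega> in M. (\<lambda>n. Q (Suc n) \<omega>) \<longlonglongrightarrow> 0"
      using lim by eventually_elim (rule LIMSEQ_Suc)
  qed simp
  then have "(\<lambda>n. \<integral>\<^sup>+\<omega>. Q n \<omega> \<partial>M) \<longlonglongrightarrow> 0" using filterlim_sequentially_Suc[of "\<lambda>n. \<integral>\<^sup>+\<omega>. Q n \<omega> \<partial>M"] by simp
  moreover have "AE \<omega> in M. \<forall>t. 0 \<le> t \<longrightarrow> t \<le> T \<longrightarrow> ennreal ((norm (?D n \<omega> t))\<^sup>2) \<le> Q n \<omega>" if "n > 0" for n
    using Qeq[OF that]
  proof eventually_elim
    case (elim \<omega>)
    show ?case unfolding elim[symmetric] by (intro allI impI SUP_upper) auto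
  qed
  ultimately show ?thesis using Qm by blast
qed

section \<open>Comparison of the flow with its Euler scheme\<close>

lemma (in wiener) grid_filtration: "0 \<le> h \<Longrightarrow> 0 \<le> s \<Longrightarrow> dfilt M (\<lambda>j. FF (s + real j * h))"
  unfolding dfilt_def by (intro conjI allI impI FF_sub FF_sets_mono add_left_mono mult_right_mono) auto

text \<open>Doob's inequality on each dyadic grid gives four times the total variance
  \<open>h\<close>, independently of the level.\<close>

lemma (in wiener) xi_sup:
  assumes s: "0 \<le> s" and h: "0 < h"
  shows "(\<integral>\<^sup>+\<omega>. dyad_sup s h (\<lambda>t. ennreal ((norm (\<xi> t \<omega> - \<xi> s \<omega>))\<^sup>2)) \<partial>M) \<le> ennreal (4 * h)"
    and "\<exists>S. L2 M S \<and> (\<forall>\<omega>. 0 \<le> S \<omega>) \<and> (AE \<omega> in M. \<forall>t. s \<le> t \<longrightarrow> t \<le> s + h \<longrightarrow> norm (\<xi> t \<omega> - \<xi> s \<omega>) \<le> S \<omega>)"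
proof -
  have meas: "(\<lambda>\<omega>. \<xi> t \<omega> - \<xi> s \<omega>) \<in> borel_measurable M" if "s \<le> t" for t
    using s that by (intro borel_measurable_diff xi_meas) auto
  have le: "(\<integral>\<^sup>+\<omega>. ennreal ((maxn (\<lambda>k \<omega>. \<xi> (s + h * real k / 2 ^ m) \<omega> - \<xi> s \<omega>) (2 ^ m) \<omega>)\<^sup>2) \<partial>M) \<le> ennreal (4 * h)" for m :: nat
  proof -
    define d where "d = h / 2 ^ m"
    have d: "d > 0" "2 ^ m * d = h" using h by (auto simp: d_def)
    have grid: "s + h * real k / 2 ^ m = s + real k * d" for k by (simp add: d_def)
    define W where "W j \<omega> = \<xi> (s + real (Suc j) * d) \<omega> - \<xi> (s + real j * d) \<omega>" for j \<omega>
    have p: "0 \<le> s + real j * d" "s + real j * d \<le> s + real (Suc j) * d" for j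
      using s d by (auto intro!: mult_right_mono)
    have md: "mart_diff M (FF (s + real j * d)) (W j)" for j
      using increment_scaleR(1)[OF p[of j], of "\<lambda>_. 1::real"] by (simp add: W_def[abs_def])
    have wm: "W j \<in> borel_measurable (FF (s + real (Suc j) * d))" for j
      using increment_scaleR(3)[OF p[of j], of "\<lambda>_. 1::real"] by (simp add: W_def[abs_def])
    have sum: "(\<Sum>i<j. W i \<omega>) = \<xi> (s + real j * d) \<omega> - \<xi> s \<omega>" for j \<omega>
      unfolding W_def by (subst sum_lessThan_telescope) simp
    have "(\<integral>\<omega>. (maxn (\<lambda>j \<omega>. \<Sum>i<j. W i \<omega>) (2 ^ m) \<omega>)\<^sup>2 \<partial>M) \<le> 4 * (\<Sum>i<2 ^ m. \<integral>\<omega>. (norm (W i \<omega>))\<^sup>2 \<partial>M)"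
      by (rule doob_maximal[OF grid_filtration[OF less_imp_le[OF d(1)] s] md wm])
    also have "\<dots> = 4 * (\<Sum>i<(2::nat) ^ m. d)"
    proof -
      have "(\<integral>\<omega>. (norm (W i \<omega>))\<^sup>2 \<partial>M) = d" for i
        using increment_moment(3)[OF p[of i]] by (simp add: W_def algebra_simps)
      then show ?thesis by simp
    qed
    also have "\<dots> = 4 * h" using d by simp
    finally have b: "(\<integral>\<omega>. (maxn (\<lambda>j \<omega>. \<Sum>i<j. W i \<omega>) (2 ^ m) \<omega>)\<^sup>2 \<partial>M) \<le> 4 * h" .
    have "L2 M (maxn (\<lambda>j \<omega>. \<Sum>i<j. W i \<omega>) (2 ^ m))"
      by (intro maxn_L2 L2_sum mart_diff_L2[OF md])
    from L2_nn_msq[OF this] b show ?thesis unfolding grid sum by (simp add: ennreal_leI)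
  qed
  show "(\<integral>\<^sup>+\<omega>. dyad_sup s h (\<lambda>t. ennreal ((norm (\<xi> t \<omega> - \<xi> s \<omega>))\<^sup>2)) \<partial>M) \<le> ennreal (4 * h)"
    by (rule dyad_sup_nn_integral_le(1)[OF meas less_imp_le[OF h] le])
  have co: "AE \<omega> in M. continuous_on {0..} (\<lambda>t. \<xi> t \<omega>)" using W by (simp add: wiener_process_def)
  have "\<exists>S. L2 M S \<and> (\<forall>\<omega>. 0 \<le> S \<omega>) \<and> msq M S \<le> 4 * h \<and> (AE \<omega> in M. \<forall>t. s \<le> t \<longrightarrow> t \<le> s + h \<longrightarrow> norm (\<xi> t \<omega> - \<xi> s \<omega>) \<le> S \<omega>)"
  proof (rule sup_dominated_L2[OF meas h _ le])
    show "AE \<omega> in M. \<forall>t\<ge>s. ((\<lambda>t. \<xi> t \<omega> - \<xi> s \<omega>) \<longlongrightarrow> \<xi> t \<omega> - \<xi> s \<omega>) (at_right t)"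
      using co
    proof eventually_elim
      case (elim \<omega>)
      show ?case using s by (auto intro!: tendsto_diff tendsto_const continuous_on_right_limit[OF elim])
    qed
  qed (use h in auto)
  then show "\<exists>S. L2 M S \<and> (\<forall>\<omega>. 0 \<le> S \<omega>) \<and> (AE \<omega> in M. \<forall>t. s \<le> t \<longrightarrow> t \<le> s + h \<longrightarrow> norm (\<xi> t \<omega> - \<xi> s \<omega>) \<le> S \<omega>)"
    by blast
qed

abbreviation one_sq :: "'m::finite itself \<Rightarrow> real" where
  "one_sq _ \<equiv> (norm (mat 1 :: real^'m^'m))\<^sup>2"

context flow
begin

definition noise :: "real \<Rightarrow> nat \<Rightarrow> 'a \<Rightarrow> real^'m^'m" where
  "noise h j \<omega> = (\<xi> (real (Suc j) * h) \<omega> - \<xi> (real j * h) \<omega>) *\<^sub>R B"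

text \<open>The flow starts at the identity only almost surely, but \<open>perturbed_scheme\<close>
  asks for equal initial values everywhere; hence the exact value at index 0.\<close>

definition cg :: "real \<Rightarrow> nat \<Rightarrow> 'a \<Rightarrow> real^'m^'m" where
  "cg h j = (if j = 0 then (\<lambda>_. mat 1) else c (real j * h))"

lemma noise_facts:
  assumes h: "0 \<le> h"
  shows "dfilt M (\<lambda>j. FF (real j * h))"
    "noise h j \<in> borel_measurable (FF (real (Suc j) * h))"
    "indep_of M (FF (real j * h)) (noise h j)" "L2 M (noise h j)" "(\<integral>\<omega>. noise h j \<omega> \<partial>M) = 0"
    "msq M (noise h j) = (norm B)\<^sup>2 * h"
proof -
  show "dfilt M (\<lambda>j. FF (real j * h))" using grid_filtration[OF h order_refl] by simp
  have p: "0 \<le> real j * h" "real j * h \<le> real (Suc j) * h" using h by (auto intro!: mult_right_mono)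
  show "noise h j \<in> borel_measurable (FF (real (Suc j) * h))"
    unfolding noise_def[abs_def] using p by (intro borel_measurable_scaleR borel_measurable_diff xi_FF) auto
  show "indep_of M (FF (real j * h)) (noise h j)"
    unfolding noise_def[abs_def] by (rule indep_of_compose[OF prob_space_axioms indep_increment[OF p]]) simp
  show "L2 M (noise h j)"
    using increment_scaleR(2)[OF p, of "\<lambda>_. B"] by (simp add: noise_def[abs_def])
  show "(\<integral>\<omega>. noise h j \<omega> \<partial>M) = 0"
    using increment_moment(2)[OF p] increment_moment(1)[OF p, of 1] by (simp add: noise_def)
  show "msq M (noise h j) = (norm B)\<^sup>2 * h"
  proof -
    have "real (Suc j) * h - real j * h = h" by (simp add: algebra_simps)
    then show ?thesis
      using increment_moment(3)[OF p] by (simp add: noise_def power_mult_distrib mult.commute del: of_nat_Suc)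
  qed
qed

lemma c_0: "AE \<omega> in M. c 0 \<omega> = mat 1"
proof -
  have J: "Jc 0 \<omega> = 0" for \<omega>
  proof -
    have "(\<integral>\<tau>. indicator {0..0} \<tau> *\<^sub>R (A ** c \<tau> \<omega>) \<partial>lborel) = 0"
      by (rule integral_eq_zero_AE) (use AE_lborel_singleton[of "0::real"] in \<open>auto elim!: eventually_mono\<close>)
    then show ?thesis by (simp add: Jc_def set_lebesgue_integral_def)
  qed
  show ?thesis using ito_trivial[OF Ic_ito[OF order_refl] order_refl] by eventually_elim (simp add: c_eq J)
qed

lemma cg_eq: "AE \<omega> in M. \<forall>j. cg h j \<omega> = c (real j * h) \<omega>"
  using c_0 by eventually_elim (auto simp: cg_def)

text \<open>An instance of \<open>perturbed_scheme\<close> with perturbation level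
  \<open>\<kappa> * h\<close>: the errors \<open>\<kappa> * h ^ 3\<close> and
  \<open>\<kappa> * h^2\<close> of \<open>c_step\<close> are that level times \<open>h^2\<close> and
  \<open>h\<close>. The condition \<open>\<kappa> * h \<le> 1\<close> says that the level is at most
  1.\<close>

lemma flow_grid:
  assumes T: "0 < T"
  shows "\<exists>\<kappa>\<ge>0. \<forall>h n b p. 0 < h \<longrightarrow> real n * h \<le> T \<longrightarrow> real b * h \<le> T \<longrightarrow> 0 < b \<longrightarrow> \<kappa> * h \<le> 1 \<longrightarrow>
      (norm A)\<^sup>2 \<le> p \<longrightarrow> (norm B)\<^sup>2 \<le> p \<longrightarrow>
    (\<integral>\<omega>. (maxn (cg h) n \<omega>)\<^sup>2 \<partial>M) \<le> uniK p T (one_sq TYPE('m)) \<and>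
    (\<forall>j\<le>n. cg h j \<in> borel_measurable (FF (real j * h)) \<and> L2 M (cg h j)) \<and>
    (\<forall>j\<le>n. euler A h b (noise h) j \<in> borel_measurable (FF (real j * h)) \<and> L2 M (euler A h b (noise h) j)) \<and>
    (\<integral>\<omega>. (maxn (\<lambda>j \<omega>. cg h j \<omega> - euler A h b (noise h) j \<omega>) n \<omega>)\<^sup>2 \<partial>M) \<le> uniC p T (one_sq TYPE('m)) * (real b * h + \<kappa> * h)"
proof -
  obtain \<kappa> where \<kappa>: "\<kappa> \<ge> 0" and st: "\<And>s t. 0 \<le> s \<Longrightarrow> s \<le> t \<Longrightarrow> t \<le> T \<Longrightarrow> \<exists>a m. L2 M a \<and> mart_diff M (FF s) m \<and> m \<in> borel_measurable (FF t) \<and>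
    (AE \<omega> in M. c t \<omega> = c s \<omega> + ((t - s) *\<^sub>R A ** c s \<omega> + a \<omega>) + ((\<xi> t \<omega> - \<xi> s \<omega>) *\<^sub>R B ** c s \<omega> + m \<omega>)) \<and>
    msq M a \<le> \<kappa> * (t - s) ^ 3 \<and> msq M m \<le> \<kappa> * (t - s)\<^sup>2"
    using c_step[OF less_imp_le[OF T]] by blast
  obtain S where S: "\<And>t. 0 \<le> t \<Longrightarrow> t \<le> T \<Longrightarrow> L2 M (c t)"
    using c_second_moment[OF less_imp_le[OF T]] by blast
  show ?thesis
  proof (intro exI[of _ \<kappa>] conjI \<kappa> allI impI)
    fix h n b p
    assume h: "0 < h" "real n * h \<le> T" "real b * h \<le> T" "0 < b" "\<kappa> * h \<le> 1" and p: "(norm A)\<^sup>2 \<le> p" "(norm B)\<^sup>2 \<le> p"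
    have h0: "0 \<le> h" using h by simp
    have gr: "0 \<le> real j * h" "real j * h \<le> real (Suc j) * h" "real (Suc j) * h \<le> T" "real (Suc j) * h - real j * h = h" if "j < n" for j
    proof -
      have "real (Suc j) * h \<le> real n * h" using that h0 by (intro mult_right_mono) auto
      then show "real (Suc j) * h \<le> T" using h by linarith
    qed (use h0 in \<open>auto simp: algebra_simps\<close>)
    have jn: "real j * h \<le> T" if "j \<le> n" for j
      using mult_right_mono[of "real j" "real n" h] that h by linarith
    define P where "P j a m \<longleftrightarrow> L2 M a \<and> mart_diff M (FF (real j * h)) m \<and> m \<in> borel_measurable (FF (real (Suc j) * h)) \<and>
      (AE \<omega> in M. c (real (Suc j) * h) \<omega> = c (real j * h) \<omega> + (h *\<^sub>R A ** c (real j * h) \<omega> + a \<omega>) + (noise h j \<omega> ** c (real j * h) \<omega> + m \<omega>)) \<and>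
      msq M a \<le> \<kappa> * h ^ 3 \<and> msq M m \<le> \<kappa> * h\<^sup>2" for j a m
    have "\<exists>a m. P j a m" if j: "j < n" for j
      using st[OF gr(1-3)[OF j]] unfolding gr(4)[OF j] P_def noise_def .
    then have "\<exists>a m. \<forall>j<n. P j (a j) (m j)" by metis
    then obtain a m where am: "\<And>j. j < n \<Longrightarrow> P j (a j) (m j)" by blast
    note am = am[unfolded P_def]
    have cgm: "cg h j \<in> borel_measurable (FF (real j * h)) \<and> L2 M (cg h j)" if "j \<le> n" for j
      using c_adapted[of "real j * h"] S[of "real j * h"] jn[OF that] h0 by (auto simp: cg_def)
    have ps: "\<And>j. j < n \<Longrightarrow> noise h j \<in> borel_measurable (FF (real (Suc j) * h))"
      "\<And>j. j < n \<Longrightarrow> indep_of M (FF (real j * h)) (noise h j)"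
      "\<And>j. j < n \<Longrightarrow> L2 M (noise h j)" "\<And>j. j < n \<Longrightarrow> (\<integral>\<omega>. noise h j \<omega> \<partial>M) = 0"
      "\<And>j. j < n \<Longrightarrow> msq M (noise h j) \<le> p * h"
      "\<And>j. j \<le> n \<Longrightarrow> cg h j \<in> borel_measurable (FF (real j * h))"
      "\<And>j. j \<le> n \<Longrightarrow> L2 M (cg h j)"
      "\<And>j. j < n \<Longrightarrow> L2 M (a j)" "\<And>j. j < n \<Longrightarrow> mart_diff M (FF (real j * h)) (m j)"
      "\<And>j. j < n \<Longrightarrow> m j \<in> borel_measurable (FF (real (Suc j) * h))"
      using noise_facts[OF h0] cgm am p h0 by (auto intro: mult_right_mono)
    have step: "AE \<omega> in M. cg h (Suc j) \<omega> = cg h j \<omega> + (h *\<^sub>R A ** cg h j \<omega> + a j \<omega>) + (noise h j \<omega> ** cg h j \<omega> + m j \<omega>)" if "j < n" for j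
      using am[OF that, THEN conjunct2, THEN conjunct2, THEN conjunct2, THEN conjunct1] cg_eq[of h]
      by eventually_elim simp
    have le1: "\<kappa> * h ^ 3 \<le> \<kappa> * h * h\<^sup>2 * (1 + x)" "\<kappa> * h\<^sup>2 \<le> \<kappa> * h * h * (1 + x)" if "x \<ge> 0" for x
    proof -
      have "\<kappa> * h * h\<^sup>2 * 1 \<le> \<kappa> * h * h\<^sup>2 * (1 + x)" using \<kappa> h0 that by (intro mult_left_mono) auto
      then show "\<kappa> * h ^ 3 \<le> \<kappa> * h * h\<^sup>2 * (1 + x)" by (simp add: power3_eq_cube power2_eq_square mult_ac)
      have "\<kappa> * h * h * 1 \<le> \<kappa> * h * h * (1 + x)" using \<kappa> h0 that by (intro mult_left_mono) auto
      then show "\<kappa> * h\<^sup>2 \<le> \<kappa> * h * h * (1 + x)" by (simp add: power2_eq_square mult_ac)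
    qed
    have a2: "msq M (a j) \<le> \<kappa> * h * h\<^sup>2 * (1 + msq M (cg h j))" if "j < n" for j
    proof (rule order_trans[OF _ le1(1)])
      show "msq M (a j) \<le> \<kappa> * h ^ 3" using am[OF that] by blast
    qed simp
    have m2: "msq M (m j) \<le> \<kappa> * h * h * (1 + msq M (cg h j))" if "j < n" for j
    proof (rule order_trans[OF _ le1(2)])
      show "msq M (m j) \<le> \<kappa> * h\<^sup>2" using am[OF that] by blast
    qed simp
    have e: "0 \<le> \<kappa> * h" using \<kappa> h0 by simp
    have Z0: "euler A h b (noise h) 0 = cg h 0" by (simp add: euler_0 cg_def)
    have k: "msq M (cg h 0) \<le> (one_sq TYPE('m))" by (simp add: cg_def prob_space)
    note P = perturbed_scheme[OF prob_space_axioms noise_facts(1)[OF h0] ps step h0 h(2,3) p(1) h(4) e h(5) a2 m2 Z0 euler_Suc[OF h(4)] k]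
    show "(\<integral>\<omega>. (maxn (cg h) n \<omega>)\<^sup>2 \<partial>M) \<le> uniK p T (one_sq TYPE('m))" by (rule P(1))
    show "(\<integral>\<omega>. (maxn (\<lambda>j \<omega>. cg h j \<omega> - euler A h b (noise h) j \<omega>) n \<omega>)\<^sup>2 \<partial>M) \<le> uniC p T (one_sq TYPE('m)) * (real b * h + \<kappa> * h)"
      by (rule P(3))
    fix j assume j: "j \<le> n"
    show "cg h j \<in> borel_measurable (FF (real j * h))" "L2 M (cg h j)" using cgm[OF j] by auto
    have "euler A h b (noise h) j \<in> borel_measurable (FF (real j * h)) \<and> L2 M (euler A h b (noise h) j)"
      by (rule P(2)) (simp_all add: j)
    then show "euler A h b (noise h) j \<in> borel_measurable (FF (real j * h))" "L2 M (euler A h b (noise h) j)" by blast+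
  qed
qed

text \<open>The maximum bound of \<open>flow_grid\<close> does not depend on the mesh, so it passes
  to the supremum along dyadic grids.\<close>

lemma c_sup:
  assumes T: "0 < T"
  shows "\<exists>S. L2 M S \<and> (\<forall>\<omega>. 0 \<le> S \<omega>) \<and> (AE \<omega> in M. \<forall>t. 0 \<le> t \<longrightarrow> t \<le> T \<longrightarrow> norm (c t \<omega>) \<le> S \<omega>)"
proof -
  obtain \<kappa> where \<kappa>: "\<kappa> \<ge> 0" and fg: "\<forall>h n b p. 0 < h \<longrightarrow> real n * h \<le> T \<longrightarrow> real b * h \<le> T \<longrightarrow> 0 < b \<longrightarrow> \<kappa> * h \<le> 1 \<longrightarrow>
      (norm A)\<^sup>2 \<le> p \<longrightarrow> (norm B)\<^sup>2 \<le> p \<longrightarrow>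
    (\<integral>\<omega>. (maxn (cg h) n \<omega>)\<^sup>2 \<partial>M) \<le> uniK p T (one_sq TYPE('m)) \<and>
    (\<forall>j\<le>n. cg h j \<in> borel_measurable (FF (real j * h)) \<and> L2 M (cg h j)) \<and>
    (\<forall>j\<le>n. euler A h b (noise h) j \<in> borel_measurable (FF (real j * h)) \<and> L2 M (euler A h b (noise h) j)) \<and>
    (\<integral>\<omega>. (maxn (\<lambda>j \<omega>. cg h j \<omega> - euler A h b (noise h) j \<omega>) n \<omega>)\<^sup>2 \<partial>M) \<le> uniC p T (one_sq TYPE('m)) * (real b * h + \<kappa> * h)"
    using flow_grid[OF T] by (elim exE conjE) (rule that)
  define p where "p = (norm A)\<^sup>2 + (norm B)\<^sup>2"
  \<comment> \<open>From this level on the mesh satisfies the smallness condition of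
    \<open>flow_grid\<close>.\<close>
  obtain m0 :: nat where m0: "\<kappa> * T < 2 ^ m0"
    using real_arch_pow[of 2 "\<kappa> * T"] by auto
  have le: "(\<integral>\<^sup>+\<omega>. ennreal ((maxn (\<lambda>k. c (0 + T * real k / 2 ^ m)) (2 ^ m) \<omega>)\<^sup>2) \<partial>M) \<le> ennreal (uniK p T (one_sq TYPE('m)))" if m: "m0 \<le> m" for m
  proof -
    define h where "h = T / 2 ^ m"
    have grid: "0 + T * real k / 2 ^ m = real k * h" for k by (simp add: h_def)
    have h: "h > 0" using T by (simp add: h_def)
    have "(2::real) ^ m0 \<le> 2 ^ m" using m by (intro power_increasing) auto
    with m0 have "\<kappa> * T \<le> 2 ^ m" by linarith
    then have "\<kappa> * h \<le> 1" by (simp add: h_def)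
    moreover have "real (2 ^ m) * h \<le> T" "real 1 * h \<le> T"
      using T by (auto simp: h_def field_simps)
    moreover have "(norm A)\<^sup>2 \<le> p" "(norm B)\<^sup>2 \<le> p" by (auto simp: p_def)
    ultimately have b: "(\<integral>\<omega>. (maxn (cg h) (2 ^ m) \<omega>)\<^sup>2 \<partial>M) \<le> uniK p T (one_sq TYPE('m))" "\<forall>j\<le>2 ^ m. L2 M (cg h j)"
      using fg[rule_format, OF h, of "2 ^ m" 1 p] by simp_all
    have "(\<integral>\<^sup>+\<omega>. ennreal ((maxn (\<lambda>k. c (real k * h)) (2 ^ m) \<omega>)\<^sup>2) \<partial>M) = (\<integral>\<^sup>+\<omega>. ennreal ((maxn (cg h) (2 ^ m) \<omega>)\<^sup>2) \<partial>M)"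
      using cg_eq[of h] by (intro nn_integral_cong_AE) (auto elim!: eventually_mono simp: maxn_def)
    also have "\<dots> = ennreal (\<integral>\<omega>. (maxn (cg h) (2 ^ m) \<omega>)\<^sup>2 \<partial>M)"
      using L2_nn_msq[OF maxn_L2, of "2 ^ m" M "cg h"] b(2) by simp
    finally show ?thesis unfolding grid using b(1) by (simp add: ennreal_leI)
  qed
  have "\<exists>S. L2 M S \<and> (\<forall>\<omega>. 0 \<le> S \<omega>) \<and> msq M S \<le> uniK p T (one_sq TYPE('m)) \<and> (AE \<omega> in M. \<forall>t. 0 \<le> t \<longrightarrow> t \<le> 0 + T \<longrightarrow> norm (c t \<omega>) \<le> S \<omega>)"
  proof (rule sup_dominated_L2[OF c_meas T _ le])
    show "AE \<omega> in M. \<forall>t\<ge>0. ((\<lambda>t. c t \<omega>) \<longlongrightarrow> c t \<omega>) (at_right t)"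
      using c_continuous by eventually_elim (auto intro: continuous_on_right_limit)
    show "0 \<le> uniK p T (one_sq TYPE('m))" using T by (intro uniK_nonneg) (auto simp: p_def)
  qed auto
  then show ?thesis by auto
qed

end

section \<open>The remainder terms\<close>

lemma small_oD:
  assumes R: "small_o M R" and e: "e > 0"
  shows "\<forall>\<^sub>F h in at_right 0. \<forall>s\<in>{0..K}. L2 M (R s (s + h)) \<and> msq M (R s (s + h)) \<le> e * h\<^sup>2"
proof -
  have "uniform_limit {0..K} (\<lambda>h s. L2_norm M (R s (s + h)) / h) (\<lambda>s. 0) (at_right 0)"
    using R by (simp add: small_o_def)
  from uniform_limitD[OF this, of "sqrt e"] e
  have "\<forall>\<^sub>F h in at_right 0. \<forall>s\<in>{0..K}. dist (L2_norm M (R s (s + h)) / h) 0 < sqrt e" by simp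
  moreover have "\<forall>\<^sub>F h in at_right 0. (0::real) < h" by (rule eventually_at_right_less)
  ultimately show ?thesis
  proof eventually_elim
    case (elim h)
    show ?case
    proof
      fix s assume s: "s \<in> {0..K}"
      have L: "L2 M (R s (s + h))" using R s elim(2) by (auto simp: small_o_def)
      have "0 \<le> L2_norm M (R s (s + h))" by (simp add: L2_norm_def)
      with bspec[OF elim(1) s] elim(2) have "L2_norm M (R s (s + h)) / h < sqrt e" by (simp add: dist_real_def)
      then have "L2_norm M (R s (s + h)) \<le> sqrt e * h" using elim(2) by (simp add: field_simps)
      then have "(L2_norm M (R s (s + h)))\<^sup>2 \<le> (sqrt e * h)\<^sup>2"
        by (rule power_mono) (simp add: L2_norm_def)
      then have "msq M (R s (s + h)) \<le> e * h\<^sup>2" using e by (simp add: L2_norm_def power_mult_distrib)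
      with L show "L2 M (R s (s + h)) \<and> msq M (R s (s + h)) \<le> e * h\<^sup>2" by simp
    qed
  qed
qed

lemma (in prob_space) norm_expectation_sq_le:
  fixes X :: "'a \<Rightarrow> 'b::euclidean_space"
  assumes "L2 M X" shows "(norm (\<integral>\<omega>. X \<omega> \<partial>M))\<^sup>2 \<le> msq M X"
proof -
  have "(norm (\<integral>\<omega>. X \<omega> \<partial>M))\<^sup>2 \<le> (\<integral>\<omega>. norm (X \<omega>) * 1 \<partial>M)\<^sup>2"
    by (intro power_mono) (simp_all add: integral_norm_bound)
  also have "\<dots> \<le> (\<integral>\<omega>. (norm (X \<omega>))\<^sup>2 \<partial>M) * (\<integral>\<omega>. 1\<^sup>2 \<partial>M)"
    by (rule L2_Cauchy_Schwarz) (use assms in \<open>auto simp: L2_norm_iff L2_measurable\<close>)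
  finally show ?thesis by (simp add: prob_space)
qed

lemma (in prob_space) centered_L2:
  fixes X :: "'a \<Rightarrow> 'b::euclidean_space"
  assumes "L2 M X"
  shows "L2 M (\<lambda>\<omega>. X \<omega> - expectation X)" "expectation (\<lambda>\<omega>. X \<omega> - expectation X) = 0"
    "msq M (\<lambda>\<omega>. X \<omega> - expectation X) \<le> 4 * msq M X"
proof -
  show "L2 M (\<lambda>\<omega>. X \<omega> - expectation X)" by (intro L2_diff assms L2_const)
  show "expectation (\<lambda>\<omega>. X \<omega> - expectation X) = 0"
    using L2_integrable[OF finite_measure_axioms assms] by (simp add: prob_space)
  have "msq M (\<lambda>\<omega>. X \<omega> - expectation X) \<le> 2 * msq M X + 2 * msq M (\<lambda>_. expectation X)"
    by (intro integral_power2_norm_diff_le assms L2_const)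
  also have "msq M (\<lambda>_. expectation X) \<le> msq M X" using norm_expectation_sq_le[OF assms] by (simp add: prob_space)
  finally show "msq M (\<lambda>\<omega>. X \<omega> - expectation X) \<le> 4 * msq M X" by simp
qed

text \<open>The variable is tested against the constant equal to its own mean.\<close>

lemma (in prob_space) mart_diff_mean_0:
  fixes U :: "'a \<Rightarrow> 'b::euclidean_space"
  assumes "mart_diff M G U" shows "expectation U = 0"
proof -
  have "(\<integral>\<omega>. expectation U \<bullet> U \<omega> \<partial>M) = 0" by (rule mart_diffD[OF assms]) auto
  moreover have "(\<integral>\<omega>. expectation U \<bullet> U \<omega> \<partial>M) = expectation U \<bullet> expectation U"
    by (rule integral_inner_right) (use L2_integrable[OF finite_measure_axioms mart_diff_L2[OF assms]] in simp)
  ultimately show ?thesis by simp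
qed

lemma (in prob_space) indep_of_sub:
  fixes U :: "'a \<Rightarrow> 'b::topological_space"
  assumes i: "indep_set (sets G) (sets H)" and H: "subalgebra M H" and U: "U \<in> borel_measurable H"
  shows "indep_of M G U"
  unfolding indep_of_def
proof
  show "U \<in> borel_measurable M" by (rule subalgebra_measurable[OF H U])
  have s: "space H = space M" using H by (simp add: subalgebra_def)
  have "sets (vimage_algebra (space M) U borel) \<subseteq> sets H"
    using measurable_sets[OF U] by (auto simp: sets_vimage_algebra2 s)
  from indep_set_mono[OF i order_refl this]
  show "indep_set (sets G) (sets (vimage_algebra (space M) U borel))" .
qed

definition prods :: "(real \<Rightarrow> real \<Rightarrow> 'a \<Rightarrow> real^'m^'m) \<Rightarrow> real \<Rightarrow> nat \<Rightarrow> 'a \<Rightarrow> real^'m^'m" where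
  "prods F h j \<omega> = mprod (\<lambda>k. F (real k * h) (real (Suc k) * h) \<omega>) j"

lemma f_approx_eq: "f_approx F n T t \<omega> = prods F (T / real n) (nat \<lfloor>real n * t / T\<rfloor>) \<omega>"
  by (simp add: f_approx_def prods_def)

lemma prods_0: "prods F h 0 = (\<lambda>_. mat 1)"
  by (simp add: prods_def fun_eq_iff)

lemma prods_Suc: "prods F h (Suc j) \<omega> = F (real j * h) (real (Suc j) * h) \<omega> ** prods F h j \<omega>"
  by (simp add: prods_def)

lemma eventually_at_right_inverse:
  assumes "T > 0" "eventually P (at_right (0::real))"
  shows "eventually (\<lambda>n. P (T / real n)) sequentially"
proof -
  have "(\<lambda>n. T / real n) \<longlonglongrightarrow> 0" by (rule lim_const_over_n)
  moreover have "\<forall>\<^sub>F n in sequentially. T / real n \<in> {0<..} \<and> T / real n \<noteq> 0"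
    using eventually_gt_at_top[of 0] by eventually_elim (use assms(1) in simp)
  ultimately have "filterlim (\<lambda>n. T / real n) (at_right 0) sequentially"
    by (simp add: filterlim_at)
  with assms(2) show ?thesis by (simp add: filterlim_iff)
qed

section \<open>The remainder of an interpolating field\<close>

context flow
begin

text \<open>The sigma-algebra of \<open>independent_of_past\<close> as a measure space, so that
  dyadic suprema can be shown measurable with respect to it.\<close>

definition future :: "(real \<Rightarrow> real \<Rightarrow> 'a \<Rightarrow> real^'m^'m) \<Rightarrow> real \<Rightarrow> 'a measure" where
  "future F s = sigma (space M) (\<Union>\<tau>\<in>{s..}. sets (vimage_algebra (space M) (\<lambda>\<omega>. (F s \<tau> \<omega>, \<xi> \<tau> \<omega> - \<xi> s \<omega>)) borel))"

lemma future_sets: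
  "sets (future F s) = sigma_sets (space M) (\<Union>\<tau>\<in>{s..}. sets (vimage_algebra (space M) (\<lambda>\<omega>. (F s \<tau> \<omega>, \<xi> \<tau> \<omega> - \<xi> s \<omega>)) borel))"
  "space (future F s) = space M"
proof -
  have "(\<Union>\<tau>\<in>{s..}. sets (vimage_algebra (space M) (\<lambda>\<omega>. (F s \<tau> \<omega>, \<xi> \<tau> \<omega> - \<xi> s \<omega>)) borel)) \<subseteq> Pow (space M)"
    using sets.sets_into_space by fastforce
  then show "sets (future F s) = sigma_sets (space M) (\<Union>\<tau>\<in>{s..}. sets (vimage_algebra (space M) (\<lambda>\<omega>. (F s \<tau> \<omega>, \<xi> \<tau> \<omega> - \<xi> s \<omega>)) borel))"
    "space (future F s) = space M"
    by (simp_all add: future_def)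
qed

lemma future_pair: "s \<le> \<tau> \<Longrightarrow> (\<lambda>\<omega>. (F s \<tau> \<omega>, \<xi> \<tau> \<omega> - \<xi> s \<omega>)) \<in> borel_measurable (future F s)"
proof (rule measurableI)
  fix S :: "((real^'m^'m) \<times> real) set" assume \<tau>: "s \<le> \<tau>" and S: "S \<in> sets borel"
  have "(\<lambda>\<omega>. (F s \<tau> \<omega>, \<xi> \<tau> \<omega> - \<xi> s \<omega>)) -` S \<inter> space M \<in> sets (vimage_algebra (space M) (\<lambda>\<omega>. (F s \<tau> \<omega>, \<xi> \<tau> \<omega> - \<xi> s \<omega>)) borel)"
    by (rule in_vimage_algebra[OF S])
  then show "(\<lambda>\<omega>. (F s \<tau> \<omega>, \<xi> \<tau> \<omega> - \<xi> s \<omega>)) -` S \<inter> space (future F s) \<in> sets (future F s)"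
    unfolding future_sets using \<tau> by (intro sigma_sets.Basic) auto
qed simp

lemma future_F: "s \<le> \<tau> \<Longrightarrow> F s \<tau> \<in> borel_measurable (future F s)"
  using measurable_compose[OF future_pair[of s \<tau> F], of fst borel]
  by (simp add: borel_measurable_continuous_onI continuous_on_fst)

lemma future_xi: "s \<le> \<tau> \<Longrightarrow> (\<lambda>\<omega>. \<xi> \<tau> \<omega> - \<xi> s \<omega>) \<in> borel_measurable (future F s)"
  using measurable_compose[OF future_pair[of s \<tau> F], of snd borel]
  by (simp add: borel_measurable_continuous_onI continuous_on_snd)

lemma future_indep:
  fixes U :: "'a \<Rightarrow> 'b::topological_space"
  assumes I: "independent_of_past M FF \<xi> F" and s: "0 \<le> s"
    and F: "\<And>\<tau>. s \<le> \<tau> \<Longrightarrow> F s \<tau> \<in> borel_measurable M"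
    and U: "U \<in> borel_measurable (future F s)"
  shows "indep_of M (FF s) U"
proof (rule indep_of_sub[OF _ _ U])
  show i: "indep_set (sets (FF s)) (sets (future F s))"
    using I s by (simp add: independent_of_past_def future_sets)
  \<comment> \<open>Independence of two systems of sets includes that both consist of
    events.\<close>
  have "sets (future F s) \<subseteq> sets M"
    using i[unfolded indep_set_def indep_sets_def, THEN conjunct1, rule_format, of False] by simp
  then show "subalgebra M (future F s)" by (simp add: subalgebra_def future_sets)
qed

text \<open>Two orders are needed. \<open>path_regular\<close> makes the remainder
  \<open>o(h)\<close> in mean square, enough for a centered perturbation. Its mean must have square
  \<open>o(h^2)\<close>: the stochastic integral and the Wiener increment are centered, so the mean
  sees only the drift error, of order \<open>h\<close> to the power 3/2, and
  \<open>R\<close>.\<close>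

lemma remainder_field:
  fixes F :: "real \<Rightarrow> real \<Rightarrow> 'a \<Rightarrow> real^'m^'m"
  assumes p: "prop_i' M FF \<xi> A B F" and pr: "path_regular M \<xi> B F"
    and FL2: "\<And>s t. 0 \<le> s \<Longrightarrow> s \<le> t \<Longrightarrow> L2 M (F s t)" and \<eta>: "\<eta> > 0"
  shows "\<forall>\<^sub>F h in at_right 0. \<forall>s\<in>{0..K}.
    msq M (\<lambda>\<omega>. F s (s + h) \<omega> - mat 1 - h *\<^sub>R A - (\<xi> (s + h) \<omega> - \<xi> s \<omega>) *\<^sub>R B) \<le> \<eta> * h \<and>
    (norm (\<integral>\<omega>. F s (s + h) \<omega> - mat 1 - h *\<^sub>R A - (\<xi> (s + h) \<omega> - \<xi> s \<omega>) *\<^sub>R B \<partial>M))\<^sup>2 \<le> \<eta> * h\<^sup>2 \<and>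
    (\<integral>\<^sup>+\<omega>. (SUP \<tau>\<in>{s..s + h}. ennreal ((norm (F s \<tau> \<omega> - mat 1 - (\<xi> \<tau> \<omega> - \<xi> s \<omega>) *\<^sub>R B))\<^sup>2)) \<partial>M) \<le> ennreal (\<eta> * h)"
proof -
  obtain J R where R: "small_o M R" and FJ: "\<And>s t. 0 \<le> s \<Longrightarrow> s \<le> t \<Longrightarrow> ito_integrand M FF s t (F s) \<and>
         is_ito_integral M FF \<xi> s t (\<lambda>\<tau> \<omega>. B ** F s \<tau> \<omega>) (J s t) \<and>
         (AE \<omega> in M. F s t \<omega> = mat 1 + (LINT \<tau>:{s..t}|lborel. A ** F s \<tau> \<omega>) + J s t \<omega> + R s t \<omega>)"
    using p unfolding prop_i'_def by blast
  define e where "e = \<eta> / 8"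
  have e: "e > 0" using \<eta> by (simp add: e_def)
  have e2: "\<forall>\<^sub>F h in at_right 0. \<forall>s\<in>{0..K}. (\<integral>\<^sup>+\<omega>. (SUP \<tau>\<in>{s..s + h}.
            ennreal ((norm (F s \<tau> \<omega> - mat 1 - (\<xi> \<tau> \<omega> - \<xi> s \<omega>) *\<^sub>R B))\<^sup>2)) \<partial>M) \<le> ennreal (e * h)"
    using pr e unfolding path_regular_def by blast
  have e3: "\<forall>\<^sub>F h in at_right 0. (h::real) * (2 * (norm A)\<^sup>2) < \<eta> / 2"
    by (rule order_tendstoD(2)[OF tendsto_mult[OF tendsto_ident_at tendsto_const]]) (use \<eta> in simp)
  have e4: "\<forall>\<^sub>F h in at_right 0. (h::real) * (4 * (norm A)\<^sup>2 * (e + (norm B)\<^sup>2)) < \<eta> / 2"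
    by (rule order_tendstoD(2)[OF tendsto_mult[OF tendsto_ident_at tendsto_const]]) (use \<eta> in simp)
  show ?thesis
    using small_oD[OF R e, of K] e2 e3 e4 eventually_at_right_less[of "0::real"]
  proof eventually_elim
    case (elim h)
    note h = elim(5)
    show ?case
    proof
      fix s assume sK: "s \<in> {0..K}"
      then have s: "0 \<le> s" by simp
      define D where "D \<tau> \<omega> = F s \<tau> \<omega> - mat 1 - (\<xi> \<tau> \<omega> - \<xi> s \<omega>) *\<^sub>R B" for \<tau> \<omega>
      define Q where "Q \<omega> = F s (s + h) \<omega> - mat 1 - h *\<^sub>R A - (\<xi> (s + h) \<omega> - \<xi> s \<omega>) *\<^sub>R B" for \<omega>
      have xB: "L2 M (\<lambda>\<omega>. (\<xi> \<tau> \<omega> - \<xi> s \<omega>) *\<^sub>R B)" "msq M (\<lambda>\<omega>. (\<xi> \<tau> \<omega> - \<xi> s \<omega>) *\<^sub>R B) = (norm B)\<^sup>2 * (\<tau> - s)" if "s \<le> \<tau>" for \<tau>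
        using increment_scaleR(2)[OF s that, of "\<lambda>_. B"] increment_moment(3)[OF s that]
        by (simp_all add: power_mult_distrib mult.commute)
      have DL2: "L2 M (D \<tau>)" if "s \<le> \<tau>" for \<tau>
        unfolding D_def[abs_def] by (intro L2_diff FL2 L2_const xB s that)
      have sup: "(\<integral>\<^sup>+\<omega>. (SUP \<tau>\<in>{s..s + h}. ennreal ((norm (D \<tau> \<omega>))\<^sup>2)) \<partial>M) \<le> ennreal (e * h)"
        using elim(2) sK by (simp add: D_def)
      have D2: "msq M (D \<tau>) \<le> e * h" if \<tau>: "s \<le> \<tau>" "\<tau> \<le> s + h" for \<tau>
      proof -
        have "ennreal (msq M (D \<tau>)) = (\<integral>\<^sup>+\<omega>. ennreal ((norm (D \<tau> \<omega>))\<^sup>2) \<partial>M)"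
          by (rule L2_nn_msq[OF DL2[OF \<tau>(1)], symmetric])
        also have "\<dots> \<le> (\<integral>\<^sup>+\<omega>. (SUP \<tau>\<in>{s..s + h}. ennreal ((norm (D \<tau> \<omega>))\<^sup>2)) \<partial>M)"
          by (intro nn_integral_mono SUP_upper) (use \<tau> in auto)
        also note sup
        finally show ?thesis using e h by (simp add: ennreal_le_iff)
      qed
      have F1: "L2 M (\<lambda>\<omega>. F s \<tau> \<omega> - mat 1)" "msq M (\<lambda>\<omega>. F s \<tau> \<omega> - mat 1) \<le> 2 * (e + (norm B)\<^sup>2) * h"
        if \<tau>: "s \<le> \<tau>" "\<tau> \<le> s + h" for \<tau>
      proof -
        show "L2 M (\<lambda>\<omega>. F s \<tau> \<omega> - mat 1)" by (intro L2_diff FL2 L2_const s \<tau>)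
        have "msq M (\<lambda>\<omega>. F s \<tau> \<omega> - mat 1) = msq M (\<lambda>\<omega>. D \<tau> \<omega> + (\<xi> \<tau> \<omega> - \<xi> s \<omega>) *\<^sub>R B)" by (simp add: D_def)
        also have "\<dots> \<le> 2 * msq M (D \<tau>) + 2 * msq M (\<lambda>\<omega>. (\<xi> \<tau> \<omega> - \<xi> s \<omega>) *\<^sub>R B)"
          by (intro integral_power2_norm_add_le DL2 xB \<tau>)
        also have "\<dots> \<le> 2 * (e * h) + 2 * ((norm B)\<^sup>2 * h)"
          unfolding xB(2)[OF \<tau>(1)] using \<tau> by (intro add_mono mult_left_mono D2) auto
        finally show "msq M (\<lambda>\<omega>. F s \<tau> \<omega> - mat 1) \<le> 2 * (e + (norm B)\<^sup>2) * h" by (simp add: algebra_simps)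
      qed
      have sh: "s \<le> s + h" using h by simp
      have QL2: "L2 M Q" unfolding Q_def[abs_def] by (intro L2_diff FL2 L2_const xB s sh)
      have Qle: "msq M Q \<le> \<eta> * h"
      proof -
        have "msq M Q = msq M (\<lambda>\<omega>. D (s + h) \<omega> - h *\<^sub>R A)" by (simp add: Q_def D_def algebra_simps)
        also have "\<dots> \<le> 2 * msq M (D (s + h)) + 2 * msq M (\<lambda>_. h *\<^sub>R A)"
          by (intro integral_power2_norm_diff_le DL2 L2_const sh)
        also have "\<dots> \<le> 2 * (e * h) + (h * (2 * (norm A)\<^sup>2)) * h"
          using D2[OF sh] h by (simp add: prob_space power_mult_distrib power2_eq_square algebra_simps)
        also have "\<dots> \<le> 2 * (e * h) + (\<eta> / 2) * h"
          using elim(3) h by (intro add_left_mono mult_right_mono) auto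
        also have "\<dots> \<le> \<eta> * h" using \<eta> h by (simp add: e_def field_simps)
        finally show ?thesis .
      qed
      have int: "ito_integrand M FF s (s + h) (F s)" and Ji: "is_ito_integral M FF \<xi> s (s + h) (\<lambda>\<tau> \<omega>. B ** F s \<tau> \<omega>) (J s (s + h))"
        and eqF: "AE \<omega> in M. F s (s + h) \<omega> = mat 1 + (LINT \<tau>:{s..s + h}|lborel. A ** F s \<tau> \<omega>) + J s (s + h) \<omega> + R s (s + h) \<omega>"
        using FJ[OF s sh] by auto
      have J0: "is_ito_integral M FF \<xi> s s (\<lambda>\<tau> \<omega>. B ** F s \<tau> \<omega>) (J s s)" using FJ[OF s order_refl] by auto
      have JL2: "L2 M (J s (s + h))" using Ji by (simp add: is_ito_integral_def)
      have EJ: "expectation (J s (s + h)) = 0"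
      proof -
        have "AE \<omega> in M. J s (s + h) \<omega> - J s s \<omega> = J s (s + h) \<omega>"
          using ito_trivial[OF J0 s] by eventually_elim simp
        then have "mart_diff M (FF s) (J s (s + h))"
          by (rule mart_diff_cong_AE[OF ito_increment_mart_diff[OF Ji J0 s order_refl sh] L2_measurable[OF JL2]])
        then show ?thesis by (rule mart_diff_mean_0)
      qed
      have Ex: "expectation (\<lambda>\<omega>. (\<xi> (s + h) \<omega> - \<xi> s \<omega>) *\<^sub>R B) = 0"
        using increment_moment(2)[OF s sh] increment_moment(1)[OF s sh, of 1] by simp
      have RL2: "L2 M (R s (s + h))" and R2: "msq M (R s (s + h)) \<le> e * h\<^sup>2" using elim(1) sK by auto
      \<comment> \<open>The drift error, defined by subtraction to obtain measurability; it almost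
        surely equals the time integral of \<open>A ** (F s \<tau> - 1)\<close>.\<close>
      define a where "a \<omega> = Q \<omega> - (J s (s + h) \<omega> - (\<xi> (s + h) \<omega> - \<xi> s \<omega>) *\<^sub>R B) - R s (s + h) \<omega>" for \<omega>
      have am: "a \<in> borel_measurable M"
        unfolding a_def[abs_def] using QL2 JL2 RL2 xB(1)[OF sh] by (intro borel_measurable_diff) (auto simp: L2_def)
      have jF: "joint_meas M (\<lambda>\<tau> \<omega>. indicator {s..s + h} \<tau> *\<^sub>R F s \<tau> \<omega>)" by (rule ito_integrand_jm[OF int])
      have jK: "joint_meas M (\<lambda>\<tau> \<omega>. indicator {s..s + h} \<tau> *\<^sub>R (A ** (F s \<tau> \<omega> - mat 1)))"
      proof -
        have "joint_meas M (\<lambda>\<tau> \<omega>. A ** (indicator {s..s + h} \<tau> *\<^sub>R F s \<tau> \<omega>) - indicator {s..s + h} \<tau> *\<^sub>R (A ** mat 1))"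
          by (intro joint_meas_diff joint_meas_matrix_mult jF joint_meas_indicator joint_meas_fixed) auto
        then show ?thesis by (simp add: mm_simps scaleR_diff_right)
      qed
      have aeq: "AE \<omega> in M. a \<omega> = (LINT \<tau>:{s..s + h}|lborel. A ** (F s \<tau> \<omega> - mat 1))"
        using eqF path_integrable[OF int]
      proof eventually_elim
        case (elim \<omega>)
        have bl: "bounded_linear (\<lambda>x. A ** x :: real^'m^'m)"
          by (rule bounded_bilinear.bounded_linear_right[OF bounded_bilinear_matrix_mult])
        have i1: "set_integrable lborel {s..s + h} (\<lambda>\<tau>. A ** F s \<tau> \<omega>)"
          using integrable_bounded_linear[OF bl elim(2)[unfolded set_integrable_def]]
          by (simp add: set_integrable_def mm_simps)
        have i2: "set_integrable lborel {s..s + h} (\<lambda>\<tau>. A ** mat 1)"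
          unfolding set_integrable_def by (intro integrable_scaleR_left integrable_real_indicator) (use h in auto)
        have "(LINT \<tau>:{s..s + h}|lborel. A ** (F s \<tau> \<omega> - mat 1)) = (LINT \<tau>:{s..s + h}|lborel. A ** F s \<tau> \<omega>) - (LINT \<tau>:{s..s + h}|lborel. A ** mat 1)"
          unfolding mm_simps by (rule set_integral_diff(2)[OF i1 i2])
        also have "(LINT \<tau>:{s..s + h}|lborel. A ** mat 1) = h *\<^sub>R A"
          using h by (simp add: set_lebesgue_integral_def)
        finally show ?case using elim(1) by (simp add: a_def Q_def)
      qed
      have "(\<integral>\<^sup>+\<omega>. ennreal ((norm (a \<omega>))\<^sup>2) \<partial>M) = (\<integral>\<^sup>+\<omega>. ennreal ((norm (LINT \<tau>:{s..s + h}|lborel. A ** (F s \<tau> \<omega> - mat 1)))\<^sup>2) \<partial>M)"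
        using aeq by (intro nn_integral_cong_AE) auto
      also have "\<dots> \<le> ennreal (s + h - s) * dsq M (\<lambda>\<tau> \<omega>. indicator {s..s + h} \<tau> *\<^sub>R (A ** (F s \<tau> \<omega> - mat 1)))"
        by (rule path_sq_bound[OF jK sh])
      also have "\<dots> \<le> ennreal (s + h - s) * ennreal ((s + h - s) * ((norm A)\<^sup>2 * (2 * (e + (norm B)\<^sup>2) * h)))"
      proof (intro mult_left_mono dsq_interval_le sh conjI)
        fix \<tau> assume \<tau>: "s \<le> \<tau>" "\<tau> \<le> s + h"
        show "L2 M (\<lambda>\<omega>. A ** (F s \<tau> \<omega> - mat 1))" by (rule L2_matrix_const_left[OF F1(1)[OF \<tau>]])
        show "msq M (\<lambda>\<omega>. A ** (F s \<tau> \<omega> - mat 1)) \<le> (norm A)\<^sup>2 * (2 * (e + (norm B)\<^sup>2) * h)"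
          by (intro order_trans[OF msq_matrix_le[OF F1(1)[OF \<tau>]]] mult_left_mono F1(2)[OF \<tau>]) simp
      qed (use e h in auto)
      also have "\<dots> = ennreal (h * (h * ((norm A)\<^sup>2 * (2 * (e + (norm B)\<^sup>2) * h))))"
        using h by (simp add: ennreal_mult')
      finally have a: "L2 M a" "msq M a \<le> h * (h * ((norm A)\<^sup>2 * (2 * (e + (norm B)\<^sup>2) * h)))"
        using L2_nnI[OF am] e h by auto
      have EQ: "expectation Q = expectation (\<lambda>\<omega>. a \<omega> + R s (s + h) \<omega>)"
      proof -
        note ints = L2_integrable[OF finite_measure_axioms]
        have "expectation Q = expectation (\<lambda>\<omega>. (a \<omega> + R s (s + h) \<omega>) + (J s (s + h) \<omega> - (\<xi> (s + h) \<omega> - \<xi> s \<omega>) *\<^sub>R B))"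
          by (simp add: a_def)
        also have "\<dots> = expectation (\<lambda>\<omega>. a \<omega> + R s (s + h) \<omega>) + expectation (\<lambda>\<omega>. J s (s + h) \<omega> - (\<xi> (s + h) \<omega> - \<xi> s \<omega>) *\<^sub>R B)"
          by (intro Bochner_Integration.integral_add ints L2_add L2_diff a RL2 JL2 xB sh)
        also have "expectation (\<lambda>\<omega>. J s (s + h) \<omega> - (\<xi> (s + h) \<omega> - \<xi> s \<omega>) *\<^sub>R B) = 0"
          using EJ Ex by (subst Bochner_Integration.integral_diff) (auto intro!: ints JL2 xB sh)
        finally show ?thesis by simp
      qed
      have "(norm (expectation Q))\<^sup>2 \<le> msq M (\<lambda>\<omega>. a \<omega> + R s (s + h) \<omega>)"
        unfolding EQ by (rule norm_expectation_sq_le[OF L2_add[OF a(1) RL2]])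
      also have "\<dots> \<le> 2 * msq M a + 2 * msq M (R s (s + h))" by (rule integral_power2_norm_add_le[OF a(1) RL2])
      also have "\<dots> \<le> (h * (4 * (norm A)\<^sup>2 * (e + (norm B)\<^sup>2))) * h\<^sup>2 + 2 * (e * h\<^sup>2)"
        using a(2) R2 by (simp add: power2_eq_square algebra_simps)
      also have "\<dots> \<le> (\<eta> / 2) * h\<^sup>2 + 2 * (e * h\<^sup>2)"
        using elim(4) by (intro add_right_mono mult_right_mono) auto
      also have "\<dots> \<le> \<eta> * h\<^sup>2" using \<eta> by (simp add: e_def field_simps)
      finally have "(norm (expectation Q))\<^sup>2 \<le> \<eta> * h\<^sup>2" .
      moreover have "ennreal (e * h) \<le> ennreal (\<eta> * h)" using \<eta> h by (intro ennreal_leI) (simp add: e_def)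
      ultimately show "msq M (\<lambda>\<omega>. F s (s + h) \<omega> - mat 1 - h *\<^sub>R A - (\<xi> (s + h) \<omega> - \<xi> s \<omega>) *\<^sub>R B) \<le> \<eta> * h \<and>
        (norm (\<integral>\<omega>. F s (s + h) \<omega> - mat 1 - h *\<^sub>R A - (\<xi> (s + h) \<omega> - \<xi> s \<omega>) *\<^sub>R B \<partial>M))\<^sup>2 \<le> \<eta> * h\<^sup>2 \<and>
        (\<integral>\<^sup>+\<omega>. (SUP \<tau>\<in>{s..s + h}. ennreal ((norm (F s \<tau> \<omega> - mat 1 - (\<xi> \<tau> \<omega> - \<xi> s \<omega>) *\<^sub>R B))\<^sup>2)) \<partial>M) \<le> ennreal (\<eta> * h)"
        using Qle order_trans[OF sup] unfolding Q_def[abs_def] D_def by blast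
    qed
  qed
qed

end

section \<open>Convergence of the interpolated products\<close>

lemma maxn_diff_triangle:
  fixes X Y Z :: "nat \<Rightarrow> 'a \<Rightarrow> 'b::euclidean_space"
  assumes "\<And>j. j \<le> n \<Longrightarrow> L2 M (X j)" "\<And>j. j \<le> n \<Longrightarrow> L2 M (Y j)" "\<And>j. j \<le> n \<Longrightarrow> L2 M (Z j)"
  shows "(\<integral>\<omega>. (maxn (\<lambda>j \<omega>. X j \<omega> - Y j \<omega>) n \<omega>)\<^sup>2 \<partial>M)
    \<le> 2 * (\<integral>\<omega>. (maxn (\<lambda>j \<omega>. X j \<omega> - Z j \<omega>) n \<omega>)\<^sup>2 \<partial>M) + 2 * (\<integral>\<omega>. (maxn (\<lambda>j \<omega>. Y j \<omega> - Z j \<omega>) n \<omega>)\<^sup>2 \<partial>M)"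
proof -
  have L: "L2 M (maxn (\<lambda>j \<omega>. X j \<omega> - Y j \<omega>) n)" "L2 M (maxn (\<lambda>j \<omega>. X j \<omega> - Z j \<omega>) n)" "L2 M (maxn (\<lambda>j \<omega>. Y j \<omega> - Z j \<omega>) n)"
    by (intro maxn_L2 L2_diff assms; assumption)+
  have "(maxn (\<lambda>j \<omega>. X j \<omega> - Y j \<omega>) n \<omega>)\<^sup>2 \<le> 2 * (maxn (\<lambda>j \<omega>. X j \<omega> - Z j \<omega>) n \<omega>)\<^sup>2 + 2 * (maxn (\<lambda>j \<omega>. Y j \<omega> - Z j \<omega>) n \<omega>)\<^sup>2" for \<omega>
  proof (rule maxn_sq_leI)
    fix i assume i: "i \<le> n"
    have "(norm (X i \<omega> - Y i \<omega>))\<^sup>2 \<le> 2 * (norm (X i \<omega> - Z i \<omega>))\<^sup>2 + 2 * (norm (Y i \<omega> - Z i \<omega>))\<^sup>2"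
      using power2_norm_diff_le[of "X i \<omega> - Z i \<omega>" "Y i \<omega> - Z i \<omega>"] by simp
    also have "\<dots> \<le> 2 * (maxn (\<lambda>j \<omega>. X j \<omega> - Z j \<omega>) n \<omega>)\<^sup>2 + 2 * (maxn (\<lambda>j \<omega>. Y j \<omega> - Z j \<omega>) n \<omega>)\<^sup>2"
      using maxn_ge[OF i, of "\<lambda>j \<omega>. X j \<omega> - Z j \<omega>" \<omega>] maxn_ge[OF i, of "\<lambda>j \<omega>. Y j \<omega> - Z j \<omega>" \<omega>]
      by (intro add_mono mult_left_mono power_mono) auto
    finally show "(norm (X i \<omega> - Y i \<omega>))\<^sup>2 \<le> 2 * (maxn (\<lambda>j \<omega>. X j \<omega> - Z j \<omega>) n \<omega>)\<^sup>2 + 2 * (maxn (\<lambda>j \<omega>. Y j \<omega> - Z j \<omega>) n \<omega>)\<^sup>2" .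
  qed
  then have "(\<integral>\<omega>. (maxn (\<lambda>j \<omega>. X j \<omega> - Y j \<omega>) n \<omega>)\<^sup>2 \<partial>M)
    \<le> (\<integral>\<omega>. 2 * (maxn (\<lambda>j \<omega>. X j \<omega> - Z j \<omega>) n \<omega>)\<^sup>2 + 2 * (maxn (\<lambda>j \<omega>. Y j \<omega> - Z j \<omega>) n \<omega>)\<^sup>2 \<partial>M)"
    using L by (intro integral_mono) (auto simp: L2_def)
  also have "\<dots> = 2 * (\<integral>\<omega>. (maxn (\<lambda>j \<omega>. X j \<omega> - Z j \<omega>) n \<omega>)\<^sup>2 \<partial>M) + 2 * (\<integral>\<omega>. (maxn (\<lambda>j \<omega>. Y j \<omega> - Z j \<omega>) n \<omega>)\<^sup>2 \<partial>M)"
    using L by (subst Bochner_Integration.integral_add) (auto simp: L2_def)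
  finally show ?thesis .
qed

context flow
begin

lemma flow_grid_obtain:
  assumes T: "0 < T"
  obtains \<kappa> where "\<kappa> \<ge> 0" "\<And>h n b p. 0 < h \<Longrightarrow> real n * h \<le> T \<Longrightarrow> real b * h \<le> T \<Longrightarrow> 0 < b \<Longrightarrow> \<kappa> * h \<le> 1 \<Longrightarrow>
      (norm A)\<^sup>2 \<le> p \<Longrightarrow> (norm B)\<^sup>2 \<le> p \<Longrightarrow>
    (\<integral>\<omega>. (maxn (cg h) n \<omega>)\<^sup>2 \<partial>M) \<le> uniK p T (one_sq TYPE('m)) \<and>
    (\<forall>j\<le>n. cg h j \<in> borel_measurable (FF (real j * h)) \<and> L2 M (cg h j)) \<and>
    (\<forall>j\<le>n. euler A h b (noise h) j \<in> borel_measurable (FF (real j * h)) \<and> L2 M (euler A h b (noise h) j)) \<and>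
    (\<integral>\<omega>. (maxn (\<lambda>j \<omega>. cg h j \<omega> - euler A h b (noise h) j \<omega>) n \<omega>)\<^sup>2 \<partial>M) \<le> uniC p T (one_sq TYPE('m)) * (real b * h + \<kappa> * h)"
  using flow_grid[OF T] by (elim exE conjE) (rule that, assumption, elim allE impE, assumption+)

text \<open>Each factor is the Euler factor plus a remainder independent of the past: its mean times
  the product becomes \<open>a\<close>, its centered part times the product becomes
  \<open>m\<close>. The flow has the same noise and filtration, so both are compared with one Euler
  scheme.\<close>

lemma adapted_products_grid:
  fixes F :: "real \<Rightarrow> real \<Rightarrow> 'a \<Rightarrow> real^'m^'m"
  assumes T: "T > 0" and p: "prop_i' M FF \<xi> A B F" and pr: "path_regular M \<xi> B F"
    and ip: "independent_of_past M FF \<xi> F"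
    and FL2: "\<And>s t. 0 \<le> s \<Longrightarrow> s \<le> t \<Longrightarrow> L2 M (F s t)"
  shows "\<exists>K\<ge>0. \<forall>\<delta>>0. \<forall>\<^sub>F n in sequentially.
    (\<forall>j\<le>n. prods F (T / real n) j \<in> borel_measurable (FF (real j * (T / real n))) \<and> L2 M (prods F (T / real n) j)
       \<and> cg (T / real n) j \<in> borel_measurable (FF (real j * (T / real n))) \<and> L2 M (cg (T / real n) j)) \<and>
    (\<integral>\<omega>. (maxn (prods F (T / real n)) n \<omega>)\<^sup>2 \<partial>M) \<le> K \<and>
    (\<integral>\<omega>. (maxn (\<lambda>j \<omega>. prods F (T / real n) j \<omega> - cg (T / real n) j \<omega>) n \<omega>)\<^sup>2 \<partial>M) \<le> \<delta>"
proof -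
  define p where "p = (norm A)\<^sup>2 + (norm B)\<^sup>2"
  have pAB: "(norm A)\<^sup>2 \<le> p" "(norm B)\<^sup>2 \<le> p" "0 \<le> p" by (auto simp: p_def)
  define CC where "CC = uniC p T (one_sq TYPE('m))"
  have CC: "CC \<ge> 0" using T pAB by (simp add: CC_def uniC_nonneg)
  obtain \<kappa> where \<kappa>: "\<kappa> \<ge> 0" and fg: "\<And>h n b p. 0 < h \<Longrightarrow> real n * h \<le> T \<Longrightarrow> real b * h \<le> T \<Longrightarrow> 0 < b \<Longrightarrow> \<kappa> * h \<le> 1 \<Longrightarrow>
      (norm A)\<^sup>2 \<le> p \<Longrightarrow> (norm B)\<^sup>2 \<le> p \<Longrightarrow>
    (\<integral>\<omega>. (maxn (cg h) n \<omega>)\<^sup>2 \<partial>M) \<le> uniK p T (one_sq TYPE('m)) \<and>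
    (\<forall>j\<le>n. cg h j \<in> borel_measurable (FF (real j * h)) \<and> L2 M (cg h j)) \<and>
    (\<forall>j\<le>n. euler A h b (noise h) j \<in> borel_measurable (FF (real j * h)) \<and> L2 M (euler A h b (noise h) j)) \<and>
    (\<integral>\<omega>. (maxn (\<lambda>j \<omega>. cg h j \<omega> - euler A h b (noise h) j \<omega>) n \<omega>)\<^sup>2 \<partial>M) \<le> uniC p T (one_sq TYPE('m)) * (real b * h + \<kappa> * h)"
    by (rule flow_grid_obtain[OF T]) blast
  have Fad: "F s t \<in> borel_measurable (FF t)" if "0 \<le> s" "s \<le> t" for s t
    using p that unfolding prop_i'_def ito_integrand_def by fastforce
  have "\<forall>\<^sub>F n in sequentially.
    (\<forall>j\<le>n. prods F (T / real n) j \<in> borel_measurable (FF (real j * (T / real n))) \<and> L2 M (prods F (T / real n) j)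
       \<and> cg (T / real n) j \<in> borel_measurable (FF (real j * (T / real n))) \<and> L2 M (cg (T / real n) j)) \<and>
    (\<integral>\<omega>. (maxn (prods F (T / real n)) n \<omega>)\<^sup>2 \<partial>M) \<le> uniK p T (one_sq TYPE('m)) \<and>
    (\<integral>\<omega>. (maxn (\<lambda>j \<omega>. prods F (T / real n) j \<omega> - cg (T / real n) j \<omega>) n \<omega>)\<^sup>2 \<partial>M) \<le> \<delta>" if \<delta>: "\<delta> > 0" for \<delta>
  proof -
    \<comment> \<open>Half of \<delta> is reserved for the perturbation level, the other half for
      the mesh.\<close>
    define \<eta> where "\<eta> = min 1 (\<delta> / (4 * (CC + 1)))"
    have \<eta>: "0 < \<eta>" "\<eta> \<le> 1" using \<delta> CC by (auto simp: \<eta>_def)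
    have C\<eta>: "2 * CC * \<eta> \<le> \<delta> / 2"
    proof -
      have "2 * CC * \<eta> \<le> 2 * CC * (\<delta> / (4 * (CC + 1)))" using CC by (intro mult_left_mono) (auto simp: \<eta>_def)
      also have "\<dots> \<le> \<delta> / 2" using CC \<delta> by (simp add: field_simps)
      finally show ?thesis .
    qed
    have h1: "\<forall>\<^sub>F h in at_right 0. (h::real) * \<kappa> < 1"
      by (rule order_tendstoD(2)[OF tendsto_mult[OF tendsto_ident_at tendsto_const]]) simp
    have h2: "\<forall>\<^sub>F h in at_right 0. (h::real) * (2 * CC * (2 + \<kappa>)) < \<delta> / 2"
      by (rule order_tendstoD(2)[OF tendsto_mult[OF tendsto_ident_at tendsto_const]]) (use \<delta> in simp)
    \<comment> \<open>The quarter compensates the factor 4 lost by centering in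
      \<open>centered_L2\<close>.\<close>
    have \<eta>4: "\<eta> / 4 > 0" using \<eta> by simp
    have rf: "\<forall>\<^sub>F h in at_right 0. \<forall>s\<in>{0..T}.
      msq M (\<lambda>\<omega>. F s (s + h) \<omega> - mat 1 - h *\<^sub>R A - (\<xi> (s + h) \<omega> - \<xi> s \<omega>) *\<^sub>R B) \<le> \<eta> / 4 * h \<and>
      (norm (\<integral>\<omega>. F s (s + h) \<omega> - mat 1 - h *\<^sub>R A - (\<xi> (s + h) \<omega> - \<xi> s \<omega>) *\<^sub>R B \<partial>M))\<^sup>2 \<le> \<eta> / 4 * h\<^sup>2"
      by (rule eventually_mono[OF remainder_field[OF assms(2) pr FL2 \<eta>4]]) blast+
    have ev: "\<forall>\<^sub>F h in at_right 0. h * \<kappa> < 1 \<and> h * (2 * CC * (2 + \<kappa>)) < \<delta> / 2 \<and> (\<forall>s\<in>{0..T}.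
      msq M (\<lambda>\<omega>. F s (s + h) \<omega> - mat 1 - h *\<^sub>R A - (\<xi> (s + h) \<omega> - \<xi> s \<omega>) *\<^sub>R B) \<le> \<eta> / 4 * h \<and>
      (norm (\<integral>\<omega>. F s (s + h) \<omega> - mat 1 - h *\<^sub>R A - (\<xi> (s + h) \<omega> - \<xi> s \<omega>) *\<^sub>R B \<partial>M))\<^sup>2 \<le> \<eta> / 4 * h\<^sup>2)"
      by (intro eventually_conj h1 h2 rf)
    show ?thesis
      using eventually_at_right_inverse[OF T ev] eventually_gt_at_top[of 0]
    proof eventually_elim
      case (elim n)
      define h where "h = T / real n"
      have n: "n > 0" and h: "h > 0" and nh: "real n * h = T" using elim T by (auto simp: h_def)
      have h1T: "real 1 * h \<le> T" using n T by (simp add: h_def field_simps)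
      have hk: "\<kappa> * h \<le> 1" and hd: "h * (2 * CC * (2 + \<kappa>)) \<le> \<delta> / 2" using elim(1) by (auto simp: h_def mult.commute)
      define tj where "tj j = real j * h" for j
      have tj: "0 \<le> tj j" "tj j \<le> tj (Suc j)" "tj (Suc j) = tj j + h" for j using h by (auto simp: tj_def algebra_simps)
      have tjT: "tj j \<le> T" if "j \<le> n" for j
        unfolding tj_def nh[symmetric] using that h by (intro mult_right_mono) auto
      define Q where "Q j \<omega> = F (tj j) (tj (Suc j)) \<omega> - mat 1 - h *\<^sub>R A - noise h j \<omega>" for j \<omega>
      have noise: "noise h j \<omega> = (\<xi> (tj (Suc j)) \<omega> - \<xi> (tj j) \<omega>) *\<^sub>R B" for j \<omega> by (simp add: noise_def tj_def)
      note nf = noise_facts[OF less_imp_le[OF h], folded tj_def]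
      have QL2: "L2 M (Q j)" for j
        unfolding Q_def[abs_def] by (intro L2_diff FL2 L2_const nf tj)
      have Q2: "msq M (Q j) \<le> \<eta> / 4 * h" "(norm (expectation (Q j)))\<^sup>2 \<le> \<eta> / 4 * h\<^sup>2" if "j < n" for j
        using elim(1) tj tjT[of j] that unfolding Q_def[abs_def] noise h_def[symmetric] by auto
      have Qi: "indep_of M (FF (tj j)) (Q j)" for j
      proof (rule future_indep[OF ip tj(1)])
        show "F (tj j) \<tau> \<in> borel_measurable M" if "tj j \<le> \<tau>" for \<tau> using FL2[OF tj(1) that] by (simp add: L2_def)
        show "Q j \<in> borel_measurable (future F (tj j))"
          unfolding Q_def[abs_def] noise
          by (intro borel_measurable_diff borel_measurable_scaleR future_F future_xi tj) auto
      qed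
      have Qm: "Q j \<in> borel_measurable (FF (tj (Suc j)))" for j
        unfolding Q_def[abs_def] by (intro borel_measurable_diff Fad tj nf) auto
      let ?Y = "prods F h"
      have F: "F (tj j) (tj (Suc j)) \<omega> = mat 1 + h *\<^sub>R A + noise h j \<omega> + Q j \<omega>" for j \<omega> by (simp add: Q_def)
      have Y: "?Y j \<in> borel_measurable (FF (tj j)) \<and> L2 M (?Y j)" for j
      proof (induction j)
        case 0 then show ?case by (simp add: prods_0)
      next
        case (Suc j)
        have "indep_of M (FF (tj j)) (F (tj j) (tj (Suc j)))"
          by (rule future_indep[OF ip tj(1)]) (use FL2[OF tj(1)] in \<open>auto intro!: future_F tj simp: L2_def\<close>)
        then have "L2 M (\<lambda>\<omega>. F (tj j) (tj (Suc j)) \<omega> ** ?Y j \<omega>)"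
          by (rule L2_matrix_mult_indep(1)[OF prob_space_axioms FF_sub _ FL2[OF tj(1,2)]]) (use Suc in auto)
        moreover have "(\<lambda>\<omega>. F (tj j) (tj (Suc j)) \<omega> ** ?Y j \<omega>) \<in> borel_measurable (FF (tj (Suc j)))"
          by (intro borel_measurable_matrix_mult Fad tj FF_mono[OF tj(2)]) (use Suc in auto)
        ultimately show ?case by (simp add: prods_Suc[abs_def] tj_def)
      qed
      define a where "a j \<omega> = expectation (Q j) ** ?Y j \<omega>" for j \<omega>
      define m where "m j \<omega> = (Q j \<omega> - expectation (Q j)) ** ?Y j \<omega>" for j \<omega>
      have ci: "indep_of M (FF (tj j)) (\<lambda>\<omega>. Q j \<omega> - expectation (Q j))" for j
        by (rule indep_of_compose[OF prob_space_axioms Qi]) simp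
      have aL2: "L2 M (a j)" for j unfolding a_def[abs_def] by (rule L2_matrix_const_left) (use Y in blast)
      have md: "mart_diff M (FF (tj j)) (m j)" for j
        unfolding m_def[abs_def]
        by (rule mart_diff_matrix_mult[OF prob_space_axioms FF_sub ci centered_L2(1,2)[OF QL2]]) (use Y in blast)+
      have mm: "m j \<in> borel_measurable (FF (tj (Suc j)))" for j
        unfolding m_def[abs_def]
        by (intro borel_measurable_matrix_mult borel_measurable_diff Qm FF_mono[OF tj(2)]) (use Y in auto)
      have a2: "msq M (a j) \<le> \<eta> * h\<^sup>2 * (1 + msq M (?Y j))" if "j < n" for j
      proof -
        have "msq M (a j) \<le> (norm (expectation (Q j)))\<^sup>2 * msq M (?Y j)"
          unfolding a_def by (rule msq_matrix_le) (use Y in blast)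
        also have "\<dots> \<le> (\<eta> * h\<^sup>2) * (1 + msq M (?Y j))"
        proof (rule mult_mono)
          have "(norm (expectation (Q j)))\<^sup>2 \<le> (\<eta> * h\<^sup>2) / 4" using Q2(2)[OF that] by simp
          also have "\<dots> \<le> \<eta> * h\<^sup>2" using \<eta> by (simp add: field_simps)
          finally show "(norm (expectation (Q j)))\<^sup>2 \<le> \<eta> * h\<^sup>2" .
        qed (use \<eta> in auto)
        finally show ?thesis .
      qed
      have m2: "msq M (m j) \<le> \<eta> * h * (1 + msq M (?Y j))" if "j < n" for j
      proof -
        have "msq M (m j) \<le> msq M (\<lambda>\<omega>. Q j \<omega> - expectation (Q j)) * msq M (?Y j)"
          unfolding m_def by (rule L2_matrix_mult_indep(2)[OF prob_space_axioms FF_sub ci centered_L2(1)[OF QL2]]) (use Y in blast)+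
        also have "\<dots> \<le> (\<eta> * h) * (1 + msq M (?Y j))"
          using order_trans[OF centered_L2(3)[OF QL2[of j]], of "\<eta> * h"] Q2(1)[OF that] \<eta> h by (intro mult_mono) auto
        finally show ?thesis .
      qed
      have step: "AE \<omega> in M. ?Y (Suc j) \<omega> = ?Y j \<omega> + (h *\<^sub>R A ** ?Y j \<omega> + a j \<omega>) + (noise h j \<omega> ** ?Y j \<omega> + m j \<omega>)" for j
        using F[of j] by (intro AE_I2) (simp add: prods_Suc tj_def a_def m_def mm_simps)
      have G2: "msq M (noise h j) \<le> p * h" for j using nf(6)[of j] pAB h by (auto intro: mult_right_mono)
      have Y0: "msq M (?Y 0) \<le> one_sq TYPE('m)" by (simp add: prods_0 prob_space)
      have Z0: "euler A h 1 (noise h) 0 = ?Y 0" by (simp add: euler_0 prods_0)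
      have Yn: "\<And>j. j \<le> n \<Longrightarrow> ?Y j \<in> borel_measurable (FF (tj j))" "\<And>j. j \<le> n \<Longrightarrow> L2 M (?Y j)" using Y by auto
      have b1: "0 < (1::nat)" by simp
      note P = perturbed_scheme[OF prob_space_axioms nf(1) nf(2) nf(3) nf(4) nf(5) G2 Yn aL2 md mm step
          less_imp_le[OF h] eq_refl[OF nh] h1T pAB(1) b1 less_imp_le[OF \<eta>(1)] \<eta>(2) a2 m2 Z0 euler_Suc[OF b1] Y0]
      have YK: "(\<integral>\<omega>. (maxn ?Y n \<omega>)\<^sup>2 \<partial>M) \<le> uniK p T (one_sq TYPE('m))" by (rule P(1))
      have YZ: "(\<integral>\<omega>. (maxn (\<lambda>j \<omega>. ?Y j \<omega> - euler A h 1 (noise h) j \<omega>) n \<omega>)\<^sup>2 \<partial>M) \<le> CC * (real 1 * h + \<eta>)"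
        unfolding CC_def by (rule P(3))
      note fgn = fg[OF h eq_refl[OF nh] h1T b1 hk pAB(1,2)]
      have "(\<integral>\<omega>. (maxn (\<lambda>j \<omega>. ?Y j \<omega> - cg h j \<omega>) n \<omega>)\<^sup>2 \<partial>M)
        \<le> 2 * (\<integral>\<omega>. (maxn (\<lambda>j \<omega>. ?Y j \<omega> - euler A h 1 (noise h) j \<omega>) n \<omega>)\<^sup>2 \<partial>M)
         + 2 * (\<integral>\<omega>. (maxn (\<lambda>j \<omega>. cg h j \<omega> - euler A h 1 (noise h) j \<omega>) n \<omega>)\<^sup>2 \<partial>M)"
        by (rule maxn_diff_triangle) (use Y fgn in blast)+
      also have "\<dots> \<le> 2 * (CC * (real 1 * h + \<eta>)) + 2 * (CC * (real 1 * h + \<kappa> * h))"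
        using YZ fgn unfolding CC_def by (intro add_mono mult_left_mono) auto
      also have "\<dots> = 2 * CC * \<eta> + h * (2 * CC * (2 + \<kappa>))" by (simp add: algebra_simps)
      also have "\<dots> \<le> \<delta>" using C\<eta> hd by linarith
      finally have D: "(\<integral>\<omega>. (maxn (\<lambda>j \<omega>. ?Y j \<omega> - cg h j \<omega>) n \<omega>)\<^sup>2 \<partial>M) \<le> \<delta>" .
      show ?case
        unfolding h_def[symmetric] using Y fgn YK D unfolding tj_def by blast
    qed
  qed
  moreover have "uniK p T (one_sq TYPE('m)) \<ge> 0" using T pAB by (simp add: uniK_nonneg)
  ultimately show ?thesis by blast
qed

end

lemma power2_norm_sum5_le:
  fixes a b c d e :: "'b::real_normed_vector"
  shows "(norm (a + b + c + d + e))\<^sup>2 \<le> 5 * ((norm a)\<^sup>2 + (norm b)\<^sup>2 + (norm c)\<^sup>2 + (norm d)\<^sup>2 + (norm e)\<^sup>2)"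
proof -
  let ?f = "(!) [a, b, c, d, e]"
  have "(norm (\<Sum>i<5::nat. ?f i))\<^sup>2 \<le> real (card {..<5::nat}) * (\<Sum>i<5. (norm (?f i))\<^sup>2)"
    by (rule power2_norm_sum_le) simp
  then show ?thesis by (simp add: eval_nat_numeral lessThan_Suc add_ac)
qed

lemma ennreal_sum5:
  assumes "0 \<le> a" "0 \<le> b" "0 \<le> c" "0 \<le> d" "0 \<le> e"
  shows "5 * (ennreal a + ennreal b + ennreal c + ennreal d + ennreal e) = ennreal (5 * (a + b + c + d + e))"
  using assms by (simp add: ennreal_mult ennreal_plus)

lemma ennreal_le_add5:
  fixes A B C D E :: ennreal
  assumes "ennreal a \<le> A" "ennreal b \<le> B" "ennreal c \<le> C" "ennreal d \<le> D" "ennreal e \<le> E"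
    and "x \<le> 5 * (a + b + c + d + e)" "0 \<le> a" "0 \<le> b" "0 \<le> c" "0 \<le> d" "0 \<le> e"
  shows "ennreal x \<le> 5 * (A + B + C + D + E)"
proof -
  have "ennreal x \<le> ennreal (5 * (a + b + c + d + e))" by (rule ennreal_leI[OF assms(6)])
  also have "\<dots> = 5 * (ennreal a + ennreal b + ennreal c + ennreal d + ennreal e)"
    by (rule ennreal_sum5[symmetric]) (fact assms)+
  also have "\<dots> \<le> 5 * (A + B + C + D + E)"
    by (intro mult_left_mono add_mono assms) simp
  finally show ?thesis .
qed

context flow
begin

lemma xi_continuous: "AE \<omega> in M. continuous_on {0..} (\<lambda>t. \<xi> t \<omega>)"
  using W by (simp add: wiener_process_def)

lemma xi_0: "AE \<omega> in M. \<xi> 0 \<omega> = 0"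
  using W by (simp add: wiener_process_def)

text \<open>Between grid points the error splits into five terms. A maximum over intervals is
  replaced by a sum where each contribution is small relative to \<open>h\<close>. The term with the
  Wiener increment times the flow is too large for that: it is treated by the uniform oscillation of
  \<xi> where the flow is below \<open>L\<close>, and by a sum over the tails otherwise.\<close>

lemma interpolated_products_converge:
  fixes F :: "real \<Rightarrow> real \<Rightarrow> 'a \<Rightarrow> real^'m^'m"
  assumes T: "T > 0" and p: "prop_i' M FF \<xi> A B F" and pr: "path_regular M \<xi> B F"
    and ip: "independent_of_past M FF \<xi> F"
    and FL2: "\<And>s t. 0 \<le> s \<Longrightarrow> s \<le> t \<Longrightarrow> L2 M (F s t)"
  shows "(\<lambda>n. mean_sup_sq M T (\<lambda>t \<omega>. g_approx F n T t \<omega> - C 0 t \<omega>)) \<longlonglongrightarrow> 0"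
proof (rule tendsto_0_le_ennreal)
  fix \<epsilon> :: real assume \<epsilon>: "0 < \<epsilon>"
  obtain K where K: "K \<ge> 0" and grid: "\<And>\<delta>. \<delta> > 0 \<Longrightarrow> \<forall>\<^sub>F n in sequentially.
    (\<forall>j\<le>n. prods F (T / real n) j \<in> borel_measurable (FF (real j * (T / real n))) \<and> L2 M (prods F (T / real n) j)
       \<and> cg (T / real n) j \<in> borel_measurable (FF (real j * (T / real n))) \<and> L2 M (cg (T / real n) j)) \<and>
    (\<integral>\<omega>. (maxn (prods F (T / real n)) n \<omega>)\<^sup>2 \<partial>M) \<le> K \<and>
    (\<integral>\<omega>. (maxn (\<lambda>j \<omega>. prods F (T / real n) j \<omega> - cg (T / real n) j \<omega>) n \<omega>)\<^sup>2 \<partial>M) \<le> \<delta>"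
    using adapted_products_grid[OF T p pr ip FL2] by blast
  define \<beta> where "\<beta> = (norm B)\<^sup>2"
  have \<beta>: "\<beta> \<ge> 0" by (simp add: \<beta>_def)
  \<comment> \<open>The summands are the constants of the bounds for \<open>T1\<close>,
    \<open>T2\<close>, \<open>T3\<close>, \<open>T4\<close> and \<open>Qc\<close>; 5 comes from
    squaring a sum of five terms.\<close>
  define \<Gamma> where "\<Gamma> = 5 * (2 * T * K + 8 * T * \<beta> + (\<beta> + 8 * T * \<beta>) + 1 + 1)"
  have G: "\<Gamma> > 0" unfolding \<Gamma>_def using T K \<beta> by (intro mult_pos_pos add_nonneg_pos) auto
  define \<delta> where "\<delta> = \<epsilon> / \<Gamma>"
  have \<delta>: "\<delta> > 0" using \<epsilon> G by (simp add: \<delta>_def)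
  obtain S where S: "L2 M S" "\<And>\<omega>. 0 \<le> S \<omega>" "AE \<omega> in M. \<forall>t. 0 \<le> t \<longrightarrow> t \<le> T \<longrightarrow> norm (c t \<omega>) \<le> S \<omega>"
    using c_sup[OF T] by blast
  obtain L where L: "L > 0" "(\<integral>\<omega>. (S \<omega>)\<^sup>2 * indicator {\<omega>. L < \<bar>S \<omega>\<bar>} \<omega> \<partial>M) < \<delta>"
    using L2_tail[OF S(1) \<delta>] by blast
  obtain Qc where Qc: "\<And>n. n > 0 \<Longrightarrow> Qc n \<in> borel_measurable M"
    "\<And>n. n > 0 \<Longrightarrow> AE \<omega> in M. \<forall>t. 0 \<le> t \<longrightarrow> t \<le> T \<longrightarrow> ennreal ((norm (c t \<omega> - c (gfloor T n t) \<omega>))\<^sup>2) \<le> Qc n \<omega>"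
    "(\<lambda>n. \<integral>\<^sup>+\<omega>. Qc n \<omega> \<partial>M) \<longlonglongrightarrow> 0"
    using oscillation_tendsto_0[OF T c_meas c_continuous S(1) S(3)] by blast
  obtain S\<xi> where S\<xi>: "L2 M S\<xi>" "AE \<omega> in M. \<forall>t. 0 \<le> t \<longrightarrow> t \<le> 0 + T \<longrightarrow> norm (\<xi> t \<omega> - \<xi> 0 \<omega>) \<le> S\<xi> \<omega>"
    using xi_sup(2)[OF order_refl T] by blast
  have S\<xi>': "AE \<omega> in M. \<forall>t. 0 \<le> t \<longrightarrow> t \<le> T \<longrightarrow> norm (\<xi> t \<omega>) \<le> S\<xi> \<omega>"
    using S\<xi>(2) xi_0 by eventually_elim simp
  obtain Qx where Qx: "\<And>n. n > 0 \<Longrightarrow> Qx n \<in> borel_measurable M"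
    "\<And>n. n > 0 \<Longrightarrow> AE \<omega> in M. \<forall>t. 0 \<le> t \<longrightarrow> t \<le> T \<longrightarrow> ennreal ((norm (\<xi> t \<omega> - \<xi> (gfloor T n t) \<omega>))\<^sup>2) \<le> Qx n \<omega>"
    "(\<lambda>n. \<integral>\<^sup>+\<omega>. Qx n \<omega> \<partial>M) \<longlonglongrightarrow> 0"
    using oscillation_tendsto_0[OF T xi_meas xi_continuous S\<xi>(1) S\<xi>'] by blast
  have e1: "\<forall>\<^sub>F n in sequentially. (\<integral>\<^sup>+\<omega>. Qc n \<omega> \<partial>M) < ennreal \<delta>"
    by (rule order_tendstoD(2)[OF Qc(3)]) (use \<delta> in simp)
  have e2: "\<forall>\<^sub>F n in sequentially. (\<integral>\<^sup>+\<omega>. Qx n \<omega> \<partial>M) < ennreal (\<delta> / L\<^sup>2)"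
    by (rule order_tendstoD(2)[OF Qx(3)]) (use \<delta> L in simp)
  have "\<forall>\<^sub>F h in at_right 0. \<forall>s\<in>{0..T}.
    (\<integral>\<^sup>+\<omega>. (SUP \<tau>\<in>{s..s + h}. ennreal ((norm (F s \<tau> \<omega> - mat 1 - (\<xi> \<tau> \<omega> - \<xi> s \<omega>) *\<^sub>R B))\<^sup>2)) \<partial>M) \<le> ennreal (\<delta> * h)"
    by (rule eventually_mono[OF remainder_field[OF p pr FL2 \<delta>]]) blast+
  from eventually_at_right_inverse[OF T this] grid[OF \<delta>] e1 e2 eventually_gt_at_top[of 0]
  show "\<forall>\<^sub>F n in sequentially. mean_sup_sq M T (\<lambda>t \<omega>. g_approx F n T t \<omega> - C 0 t \<omega>) \<le> ennreal \<epsilon>"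
  proof eventually_elim
    case (elim n)
    define h where "h = T / real n"
    have n: "n > 0" and h: "h > 0" and nh: "real n * h = T" using elim T by (auto simp: h_def)
    \<comment> \<open>\<open>Suc n\<close> counts the interval that starts at
      \<open>T\<close>.\<close>
    have n1h: "real (Suc n) * h \<le> 2 * T" using n T by (simp add: h_def field_simps)
    define tj where "tj j = real j * h" for j
    have tj: "0 \<le> tj j" for j using h by (simp add: tj_def)
    have tjT: "tj j \<in> {0..T}" if "j \<le> n" for j
      using tj[of j] mult_right_mono[of "real j" "real n" h] that h by (simp add: tj_def nh)
    let ?Y = "prods F h" and ?c = "cg h" let ?D = "\<lambda>j \<omega>. ?Y j \<omega> - ?c j \<omega>"
    have Y: "?Y j \<in> borel_measurable (FF (tj j))" "L2 M (?Y j)" "?c j \<in> borel_measurable (FF (tj j))" "L2 M (?c j)" if "j \<le> n" for j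
      using elim(2) that by (auto simp: h_def tj_def)
    have YK: "(\<integral>\<omega>. (maxn ?Y n \<omega>)\<^sup>2 \<partial>M) \<le> K" and DD: "(\<integral>\<omega>. (maxn ?D n \<omega>)\<^sup>2 \<partial>M) \<le> \<delta>"
      using elim(2) by (auto simp: h_def)
    \<comment> \<open>Dyadic suprema are measurable in the future of \<open>tj j\<close>, hence
      independent of everything known at that time; right-continuity later identifies them with the
      true suprema.\<close>
    define V where "V j \<omega> = dyad_sup (tj j) h (\<lambda>\<tau>. ennreal ((norm (F (tj j) \<tau> \<omega> - mat 1 - (\<xi> \<tau> \<omega> - \<xi> (tj j) \<omega>) *\<^sub>R B))\<^sup>2))" for j \<omega>
    define U where "U j \<omega> = dyad_sup (tj j) h (\<lambda>\<tau>. ennreal ((norm (\<xi> \<tau> \<omega> - \<xi> (tj j) \<omega>))\<^sup>2))" for j \<omega>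
    have Vf: "V j \<in> borel_measurable (future F (tj j))" for j
      unfolding V_def[abs_def]
    proof (rule dyad_sup_nn_integral_le(2))
      fix t assume "tj j \<le> t"
      then show "(\<lambda>\<omega>. F (tj j) t \<omega> - mat 1 - (\<xi> t \<omega> - \<xi> (tj j) \<omega>) *\<^sub>R B) \<in> borel_measurable (future F (tj j))"
        by (intro borel_measurable_diff borel_measurable_scaleR future_F future_xi) auto
    qed (use h in simp, rule top_greatest)
    have Uf: "U j \<in> borel_measurable (future F (tj j))" for j
      unfolding U_def[abs_def]
    proof (rule dyad_sup_nn_integral_le(2))
      fix t assume "tj j \<le> t"
      then show "(\<lambda>\<omega>. \<xi> t \<omega> - \<xi> (tj j) \<omega>) \<in> borel_measurable (future F (tj j))" by (rule future_xi)
    qed (use h in simp, rule top_greatest)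
    have Fm: "F (tj j) \<tau> \<in> borel_measurable M" if "tj j \<le> \<tau>" for j \<tau> using FL2[OF tj that] by (simp add: L2_def)
    note Vi = future_indep[OF ip tj Fm Vf] and Ui = future_indep[OF ip tj Fm Uf]
    have Vm: "V j \<in> borel_measurable M" and Um: "U j \<in> borel_measurable M" for j
      using Vi[of j] Ui[of j] by (auto simp: indep_of_def)
    have EV: "(\<integral>\<^sup>+\<omega>. V j \<omega> \<partial>M) \<le> ennreal (\<delta> * h)" if "j \<le> n" for j
    proof -
      have "(\<integral>\<^sup>+\<omega>. V j \<omega> \<partial>M) \<le> (\<integral>\<^sup>+\<omega>. (SUP \<tau>\<in>{tj j..tj j + h}. ennreal ((norm (F (tj j) \<tau> \<omega> - mat 1 - (\<xi> \<tau> \<omega> - \<xi> (tj j) \<omega>) *\<^sub>R B))\<^sup>2)) \<partial>M)"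
        unfolding V_def by (intro nn_integral_mono dyad_sup_le) (use h in simp)
      also have "\<dots> \<le> ennreal (\<delta> * h)" using elim(1) tjT[OF that] by (auto simp: h_def)
      finally show ?thesis .
    qed
    have EU: "(\<integral>\<^sup>+\<omega>. U j \<omega> \<partial>M) \<le> ennreal (4 * h)" for j
      unfolding U_def by (rule xi_sup(1)[OF tj h])
    have prodE: "(\<integral>\<^sup>+\<omega>. ennreal (X \<omega>) * Z \<omega> \<partial>M) \<le> ennreal (x * z)"
      if "indep_of M (FF (tj j)) Z" "X \<in> borel_measurable (FF (tj j))" "(\<integral>\<^sup>+\<omega>. ennreal (X \<omega>) \<partial>M) \<le> ennreal x" "(\<integral>\<^sup>+\<omega>. Z \<omega> \<partial>M) \<le> ennreal z" "0 \<le> x" "0 \<le> z"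
      for X :: "'a \<Rightarrow> real" and Z x z j
    proof -
      have "(\<integral>\<^sup>+\<omega>. ennreal (X \<omega>) * Z \<omega> \<partial>M) = (\<integral>\<^sup>+\<omega>. ennreal (X \<omega>) \<partial>M) * (\<integral>\<^sup>+\<omega>. Z \<omega> \<partial>M)"
        by (rule indep_of_nn_integral_mult[OF prob_space_axioms FF_sub that(1)]) (use that(2) in simp)
      also have "\<dots> \<le> ennreal x * ennreal z" by (intro mult_mono that) auto
      finally show ?thesis using that by (simp add: ennreal_mult)
    qed
    \<comment> \<open>Cutting at the current value and not at the envelope \<open>S\<close> keeps
      the tail measurable at time \<open>tj j\<close>; its mean is still below that of the tail of
      \<open>S\<close>.\<close>
    define tail where "tail j \<omega> = (norm (?c j \<omega>))\<^sup>2 * indicator {x. L < x} (norm (?c j \<omega>))" for j \<omega>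
    have tailm: "tail j \<in> borel_measurable (FF (tj j))" if "j \<le> n" for j
      unfolding tail_def[abs_def] using Y(3)[OF that] by measurable
    have tail0: "0 \<le> tail j \<omega>" for j \<omega> by (simp add: tail_def)
    have Etail: "(\<integral>\<^sup>+\<omega>. ennreal (tail j \<omega>) \<partial>M) \<le> ennreal \<delta>" if j: "j \<le> n" for j
    proof -
      have i: "integrable M (\<lambda>\<omega>. (S \<omega>)\<^sup>2 * indicator {\<omega>. L < \<bar>S \<omega>\<bar>} \<omega>)"
        by (rule Bochner_Integration.integrable_bound[OF L2_integrable_sq[OF S(1)]])
          (use L2_measurable[OF S(1)] in \<open>auto simp: indicator_def\<close>)
      have "(\<integral>\<^sup>+\<omega>. ennreal (tail j \<omega>) \<partial>M) \<le> (\<integral>\<^sup>+\<omega>. ennreal ((S \<omega>)\<^sup>2 * indicator {\<omega>. L < \<bar>S \<omega>\<bar>} \<omega>) \<partial>M)"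
      proof (rule nn_integral_mono_AE)
        show "AE \<omega> in M. ennreal (tail j \<omega>) \<le> ennreal ((S \<omega>)\<^sup>2 * indicator {\<omega>. L < \<bar>S \<omega>\<bar>} \<omega>)"
          using S(3) cg_eq[of h]
        proof eventually_elim
          case (elim \<omega>)
          have "norm (?c j \<omega>) \<le> S \<omega>" using elim tjT[OF j] by (simp add: tj_def)
          then show ?case unfolding tail_def by (intro ennreal_leI mult_mono power_mono) (auto simp: indicator_def)
        qed
      qed
      also have "\<dots> = ennreal (\<integral>\<omega>. (S \<omega>)\<^sup>2 * indicator {\<omega>. L < \<bar>S \<omega>\<bar>} \<omega> \<partial>M)"
        by (rule nn_integral_eq_integral[OF i]) (simp add: indicator_def)
      also have "\<dots> \<le> ennreal \<delta>" using L(2) by (intro ennreal_leI) simp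
      finally show ?thesis .
    qed
    define T1 where "T1 \<omega> = (\<Sum>j\<le>n. ennreal ((norm (?Y j \<omega>))\<^sup>2) * V j \<omega>)" for \<omega>
    define T2 where "T2 \<omega> = (\<Sum>j\<le>n. ennreal (\<beta> * (norm (?D j \<omega>))\<^sup>2) * U j \<omega>)" for \<omega>
    \<comment> \<open>A plain sum of the squared flow times \<open>U\<close> would have mean of
      order \<open>T\<close>, which does not vanish; hence the two regimes.\<close>
    define T3 where "T3 \<omega> = ennreal (\<beta> * L\<^sup>2) * Qx n \<omega> + (\<Sum>j\<le>n. ennreal (\<beta> * tail j \<omega>) * U j \<omega>)" for \<omega>
    define T4 where "T4 \<omega> = ennreal ((maxn ?D n \<omega>)\<^sup>2)" for \<omega>
    have meas: "T1 \<in> borel_measurable M" "T2 \<in> borel_measurable M" "T3 \<in> borel_measurable M" "T4 \<in> borel_measurable M"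
    proof -
      have 1: "(\<lambda>\<omega>. ennreal ((norm (?Y j \<omega>))\<^sup>2) * V j \<omega>) \<in> borel_measurable M" if "j \<le> n" for j
        using L2_measurable[OF Y(2)[OF that]] Vm[of j] by measurable
      have 2: "(\<lambda>\<omega>. ennreal (\<beta> * (norm (?D j \<omega>))\<^sup>2) * U j \<omega>) \<in> borel_measurable M" if "j \<le> n" for j
        using L2_measurable[OF Y(2)[OF that]] L2_measurable[OF Y(4)[OF that]] Um[of j] by measurable
      have 3: "(\<lambda>\<omega>. ennreal (\<beta> * tail j \<omega>) * U j \<omega>) \<in> borel_measurable M" if "j \<le> n" for j
        using FF_meas[OF tailm[OF that]] Um[of j] by measurable
      show "T1 \<in> borel_measurable M" "T2 \<in> borel_measurable M"
        unfolding T1_def[abs_def] T2_def[abs_def] using 1 2 by (auto intro!: borel_measurable_sum)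
      show "T3 \<in> borel_measurable M"
        unfolding T3_def[abs_def] using 3 Qx(1)[OF n] by (auto intro!: borel_measurable_add borel_measurable_sum borel_measurable_times)
      show "T4 \<in> borel_measurable M"
        unfolding T4_def[abs_def] using Y L2_measurable
        by (auto intro!: measurable_compose[OF _ measurable_ennreal] borel_measurable_power maxn_measurable borel_measurable_diff)
    qed
    have sumle: "(\<integral>\<^sup>+\<omega>. (\<Sum>j\<le>n. f j \<omega>) \<partial>M) \<le> ennreal (real (Suc n) * x)"
      if "\<And>j. j \<le> n \<Longrightarrow> f j \<in> borel_measurable M" "\<And>j. j \<le> n \<Longrightarrow> (\<integral>\<^sup>+\<omega>. f j \<omega> \<partial>M) \<le> ennreal x" "0 \<le> x" for f x
    proof -
      have "(\<integral>\<^sup>+\<omega>. (\<Sum>j\<le>n. f j \<omega>) \<partial>M) = (\<Sum>j\<le>n. \<integral>\<^sup>+\<omega>. f j \<omega> \<partial>M)" by (rule nn_integral_sum) (use that in auto)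
      also have "\<dots> \<le> (\<Sum>j\<le>n. ennreal x)" by (rule sum_mono) (use that in auto)
      also have "\<dots> = ennreal (real (Suc n) * x)" using that(3) by (simp add: ennreal_mult ennreal_of_nat_eq_real_of_nat[symmetric])
      finally show ?thesis .
    qed
    have I1: "(\<integral>\<^sup>+\<omega>. T1 \<omega> \<partial>M) \<le> ennreal (2 * T * K * \<delta>)"
    proof -
      have "(\<integral>\<^sup>+\<omega>. T1 \<omega> \<partial>M) \<le> ennreal (real (Suc n) * (K * (\<delta> * h)))"
        unfolding T1_def
      proof (rule sumle)
        fix j assume j: "j \<le> n"
        show "(\<lambda>\<omega>. ennreal ((norm (?Y j \<omega>))\<^sup>2) * V j \<omega>) \<in> borel_measurable M"
          using L2_measurable[OF Y(2)[OF j]] Vm[of j] by measurable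
        have "msq M (?Y j) \<le> K" by (rule order_trans[OF msq_le_maxn[OF Y(2) j] YK])
        then have "(\<integral>\<^sup>+\<omega>. ennreal ((norm (?Y j \<omega>))\<^sup>2) \<partial>M) \<le> ennreal K"
          unfolding L2_nn_msq[OF Y(2)[OF j]] by (rule ennreal_leI)
        then show "(\<integral>\<^sup>+\<omega>. ennreal ((norm (?Y j \<omega>))\<^sup>2) * V j \<omega> \<partial>M) \<le> ennreal (K * (\<delta> * h))"
          by (intro prodE[OF Vi] EV j) (use Y(1)[OF j] K \<delta> h in auto)
      qed (use K \<delta> h in auto)
      also have "\<dots> \<le> ennreal (2 * T * K * \<delta>)"
        using mult_right_mono[OF n1h, of "K * \<delta>"] K \<delta> by (intro ennreal_leI) (simp add: mult_ac)
      finally show ?thesis .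
    qed
    have I2: "(\<integral>\<^sup>+\<omega>. T2 \<omega> \<partial>M) \<le> ennreal (8 * T * \<beta> * \<delta>)"
    proof -
      have "(\<integral>\<^sup>+\<omega>. T2 \<omega> \<partial>M) \<le> ennreal (real (Suc n) * ((\<beta> * \<delta>) * (4 * h)))"
        unfolding T2_def
      proof (rule sumle)
        fix j assume j: "j \<le> n"
        show "(\<lambda>\<omega>. ennreal (\<beta> * (norm (?D j \<omega>))\<^sup>2) * U j \<omega>) \<in> borel_measurable M"
          using L2_measurable[OF Y(2)[OF j]] L2_measurable[OF Y(4)[OF j]] Um[of j] by measurable
        have DL: "L2 M (?D i)" if "i \<le> n" for i by (intro L2_diff Y that)
        have "msq M (?D j) \<le> \<delta>" by (rule order_trans[OF msq_le_maxn[of n M ?D, OF DL j] DD])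
        then have "(\<integral>\<^sup>+\<omega>. ennreal ((norm (?D j \<omega>))\<^sup>2) \<partial>M) \<le> ennreal \<delta>"
          unfolding L2_nn_msq[OF DL[OF j]] by (rule ennreal_leI)
        then have "ennreal \<beta> * (\<integral>\<^sup>+\<omega>. ennreal ((norm (?D j \<omega>))\<^sup>2) \<partial>M) \<le> ennreal \<beta> * ennreal \<delta>" by (rule mult_left_mono) simp
        then have "(\<integral>\<^sup>+\<omega>. ennreal (\<beta> * (norm (?D j \<omega>))\<^sup>2) \<partial>M) \<le> ennreal (\<beta> * \<delta>)"
          using \<beta> \<delta> L2_measurable[OF DL[OF j]] by (simp add: ennreal_mult nn_integral_cmult)
        then show "(\<integral>\<^sup>+\<omega>. ennreal (\<beta> * (norm (?D j \<omega>))\<^sup>2) * U j \<omega> \<partial>M) \<le> ennreal ((\<beta> * \<delta>) * (4 * h))"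
          by (intro prodE[OF Ui] EU) (use Y(1,3)[OF j] \<beta> \<delta> h in auto)
      qed (use \<beta> \<delta> h in auto)
      also have "\<dots> \<le> ennreal (8 * T * \<beta> * \<delta>)"
        using mult_right_mono[OF n1h, of "4 * \<beta> * \<delta>"] \<beta> \<delta> by (intro ennreal_leI) (simp add: mult_ac)
      finally show ?thesis .
    qed
    have I3: "(\<integral>\<^sup>+\<omega>. T3 \<omega> \<partial>M) \<le> ennreal ((\<beta> + 8 * T * \<beta>) * \<delta>)"
    proof -
      have "(\<integral>\<^sup>+\<omega>. (\<Sum>j\<le>n. ennreal (\<beta> * tail j \<omega>) * U j \<omega>) \<partial>M) \<le> ennreal (real (Suc n) * ((\<beta> * \<delta>) * (4 * h)))"
      proof (rule sumle)
        fix j assume j: "j \<le> n"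
        show "(\<lambda>\<omega>. ennreal (\<beta> * tail j \<omega>) * U j \<omega>) \<in> borel_measurable M"
          using FF_meas[OF tailm[OF j]] Um[of j] by measurable
        have "ennreal \<beta> * (\<integral>\<^sup>+\<omega>. ennreal (tail j \<omega>) \<partial>M) \<le> ennreal \<beta> * ennreal \<delta>" by (rule mult_left_mono[OF Etail[OF j]]) simp
        then have "(\<integral>\<^sup>+\<omega>. ennreal (\<beta> * tail j \<omega>) \<partial>M) \<le> ennreal (\<beta> * \<delta>)"
          using \<beta> \<delta> FF_meas[OF tailm[OF j]] tail0 by (simp add: ennreal_mult nn_integral_cmult)
        then show "(\<integral>\<^sup>+\<omega>. ennreal (\<beta> * tail j \<omega>) * U j \<omega> \<partial>M) \<le> ennreal ((\<beta> * \<delta>) * (4 * h))"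
          by (intro prodE[OF Ui] EU) (use tailm[OF j] \<beta> \<delta> h in auto)
      qed (use \<beta> \<delta> h in auto)
      also have "\<dots> \<le> ennreal (8 * T * \<beta> * \<delta>)"
        using mult_right_mono[OF n1h, of "4 * \<beta> * \<delta>"] \<beta> \<delta> by (intro ennreal_leI) (simp add: mult_ac)
      finally have a: "(\<integral>\<^sup>+\<omega>. (\<Sum>j\<le>n. ennreal (\<beta> * tail j \<omega>) * U j \<omega>) \<partial>M) \<le> ennreal (8 * T * \<beta> * \<delta>)" .
      have m3: "(\<lambda>\<omega>. \<Sum>j\<le>n. ennreal (\<beta> * tail j \<omega>) * U j \<omega>) \<in> borel_measurable M"
      proof (rule borel_measurable_sum)
        fix j assume "j \<in> {..n}"
        then have j: "j \<le> n" by simp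
        show "(\<lambda>\<omega>. ennreal (\<beta> * tail j \<omega>) * U j \<omega>) \<in> borel_measurable M"
          using FF_meas[OF tailm[OF j]] Um[of j] by measurable
      qed
      have "(\<integral>\<^sup>+\<omega>. T3 \<omega> \<partial>M) = ennreal (\<beta> * L\<^sup>2) * (\<integral>\<^sup>+\<omega>. Qx n \<omega> \<partial>M) + (\<integral>\<^sup>+\<omega>. (\<Sum>j\<le>n. ennreal (\<beta> * tail j \<omega>) * U j \<omega>) \<partial>M)"
        unfolding T3_def using Qx(1)[OF n] m3 by (subst nn_integral_add) (auto simp: nn_integral_cmult)
      also have "\<dots> \<le> ennreal (\<beta> * L\<^sup>2) * ennreal (\<delta> / L\<^sup>2) + ennreal (8 * T * \<beta> * \<delta>)"
        using elim(4) a by (intro add_mono mult_left_mono) auto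
      also have "\<dots> = ennreal ((\<beta> + 8 * T * \<beta>) * \<delta>)"
        using \<beta> \<delta> L T by (simp add: ennreal_mult[symmetric] ennreal_plus[symmetric] distrib_right del: ennreal_plus)
      finally show ?thesis .
    qed
    have I4: "(\<integral>\<^sup>+\<omega>. T4 \<omega> \<partial>M) \<le> ennreal \<delta>"
    proof -
      have "L2 M (maxn ?D n)" by (intro maxn_L2 L2_diff Y)
      from L2_nn_msq[OF this] DD show ?thesis by (simp add: T4_def ennreal_leI)
    qed
    have "mean_sup_sq M T (\<lambda>t \<omega>. g_approx F n T t \<omega> - C 0 t \<omega>) \<le> (\<integral>\<^sup>+\<omega>. 5 * (T1 \<omega> + T2 \<omega> + T3 \<omega> + T4 \<omega> + Qc n \<omega>) \<partial>M)"
      unfolding mean_sup_sq_def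
    proof (rule nn_integral_mono_AE)
      have rF: "AE \<omega> in M. \<forall>j\<in>{..n}. \<forall>\<tau>\<ge>tj j. continuous (at_right \<tau>) (\<lambda>u. F (tj j) u \<omega>)"
        using pr tj unfolding path_regular_def by (intro AE_finite_allI) auto
      show "AE \<omega> in M. (SUP t\<in>{0..T}. ennreal ((norm (g_approx F n T t \<omega> - C 0 t \<omega>))\<^sup>2)) \<le> 5 * (T1 \<omega> + T2 \<omega> + T3 \<omega> + T4 \<omega> + Qc n \<omega>)"
        using rF xi_continuous cg_eq[of h] Qc(2)[OF n] Qx(2)[OF n]
      proof eventually_elim
        case (elim \<omega>)
        show ?case
        proof (rule SUP_least)
          fix t assume "t \<in> {0..T}"
          then have t: "0 \<le> t" "t \<le> T" by auto
          obtain j where j: "j \<le> n" "gfloor T n t = real j * (T / real n)" "nat \<lfloor>real n * t / T\<rfloor> = j"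
            "t \<in> {real j * (T / real n)..real j * (T / real n) + T / real n}"
            by (rule gfloor_cases[OF T n t])
          have g: "gfloor T n t = tj j" and tt: "t \<in> {tj j..tj j + h}" using j by (auto simp: tj_def h_def)
          have g1: "g_approx F n T t \<omega> = F (tj j) t \<omega> ** ?Y j \<omega>"
            unfolding g_approx_def f_approx_eq j(3) using g by (simp add: gfloor_def h_def)
          define x where "x = \<xi> t \<omega> - \<xi> (tj j) \<omega>"
          define z where "z = F (tj j) t \<omega> - mat 1 - x *\<^sub>R B"
          have Fz: "F (tj j) t \<omega> = mat 1 + x *\<^sub>R B + z" by (simp add: z_def)
          have ct: "c (tj j) \<omega> = ?c j \<omega>" using elim(3) by (simp add: tj_def)
          \<comment> \<open>Remainder of the field, noise on the grid error, noise on the flow, grid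
            error, oscillation of the flow.\<close>
          have eq: "g_approx F n T t \<omega> - C 0 t \<omega> = z ** ?Y j \<omega> + x *\<^sub>R (B ** ?D j \<omega>) + x *\<^sub>R (B ** ?c j \<omega>) + ?D j \<omega> + - (c t \<omega> - c (tj j) \<omega>)"
            unfolding g1 Fz ct c_def[symmetric] by (simp add: mm_simps scaleR_diff_right)
          have Vz: "ennreal ((norm z)\<^sup>2) \<le> V j \<omega>"
          proof -
            have "V j \<omega> = (SUP \<tau>\<in>{tj j..tj j + h}. ennreal ((norm (F (tj j) \<tau> \<omega> - mat 1 - (\<xi> \<tau> \<omega> - \<xi> (tj j) \<omega>) *\<^sub>R B))\<^sup>2))"
              unfolding V_def
            proof (rule dyad_sup_eq[symmetric, OF h], rule right_continuous_sq)
              fix \<tau> assume \<tau>: "tj j \<le> \<tau>"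
              have "((\<lambda>\<tau>. F (tj j) \<tau> \<omega>) \<longlongrightarrow> F (tj j) \<tau> \<omega>) (at_right \<tau>)"
                using elim(1) j(1) \<tau> by (auto simp: continuous_within)
              then show "((\<lambda>\<tau>. F (tj j) \<tau> \<omega> - mat 1 - (\<xi> \<tau> \<omega> - \<xi> (tj j) \<omega>) *\<^sub>R B) \<longlongrightarrow> F (tj j) \<tau> \<omega> - mat 1 - (\<xi> \<tau> \<omega> - \<xi> (tj j) \<omega>) *\<^sub>R B) (at_right \<tau>)"
                by (intro tendsto_diff tendsto_const tendsto_scaleR continuous_on_right_limit[OF elim(2)] order_trans[OF tj \<tau>])
            qed
            then show ?thesis unfolding z_def x_def using tt by (auto intro!: SUP_upper2[of t])
          qed
          have Ux: "ennreal (x\<^sup>2) \<le> U j \<omega>"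
          proof -
            have "U j \<omega> = (SUP \<tau>\<in>{tj j..tj j + h}. ennreal ((norm (\<xi> \<tau> \<omega> - \<xi> (tj j) \<omega>))\<^sup>2))"
              unfolding U_def
            proof (rule dyad_sup_eq[symmetric, OF h], rule right_continuous_sq)
              fix \<tau> assume \<tau>: "tj j \<le> \<tau>"
              show "((\<lambda>\<tau>. \<xi> \<tau> \<omega> - \<xi> (tj j) \<omega>) \<longlongrightarrow> \<xi> \<tau> \<omega> - \<xi> (tj j) \<omega>) (at_right \<tau>)"
                by (intro tendsto_diff tendsto_const continuous_on_right_limit[OF elim(2)] order_trans[OF tj \<tau>])
            qed
            then show ?thesis unfolding x_def using tt by (auto intro!: SUP_upper2[of t])
          qed
          have Qxx: "ennreal (x\<^sup>2) \<le> Qx n \<omega>" using elim(5)[rule_format, OF t] unfolding g x_def by simp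
          show "ennreal ((norm (g_approx F n T t \<omega> - C 0 t \<omega>))\<^sup>2) \<le> 5 * (T1 \<omega> + T2 \<omega> + T3 \<omega> + T4 \<omega> + Qc n \<omega>)"
          proof (rule ennreal_le_add5)
            show "(norm (g_approx F n T t \<omega> - C 0 t \<omega>))\<^sup>2 \<le> 5 * ((norm (z ** ?Y j \<omega>))\<^sup>2 + (norm (x *\<^sub>R (B ** ?D j \<omega>)))\<^sup>2
               + (norm (x *\<^sub>R (B ** ?c j \<omega>)))\<^sup>2 + (norm (?D j \<omega>))\<^sup>2 + (norm (c t \<omega> - c (tj j) \<omega>))\<^sup>2)"
              unfolding eq using power2_norm_sum5_le[of "z ** ?Y j \<omega>" "x *\<^sub>R (B ** ?D j \<omega>)" "x *\<^sub>R (B ** ?c j \<omega>)" "?D j \<omega>" "- (c t \<omega> - c (tj j) \<omega>)"]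
              by (simp only: norm_minus_cancel)
            have mem: "f j \<le> (\<Sum>j\<le>n. f j)" for f :: "nat \<Rightarrow> ennreal" using j(1) by (intro member_le_sum) auto
            show "ennreal ((norm (z ** ?Y j \<omega>))\<^sup>2) \<le> T1 \<omega>"
            proof -
              have "(norm (z ** ?Y j \<omega>))\<^sup>2 \<le> (norm (?Y j \<omega>))\<^sup>2 * (norm z)\<^sup>2"
                using power_mono[OF norm_matrix_mult_le[of z "?Y j \<omega>"], of 2] by (simp add: power_mult_distrib mult.commute)
              then have "ennreal ((norm (z ** ?Y j \<omega>))\<^sup>2) \<le> ennreal ((norm (?Y j \<omega>))\<^sup>2) * ennreal ((norm z)\<^sup>2)"
                by (simp add: ennreal_mult[symmetric] ennreal_leI)
              also have "\<dots> \<le> ennreal ((norm (?Y j \<omega>))\<^sup>2) * V j \<omega>" by (intro mult_left_mono Vz) simp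
              also have "\<dots> \<le> T1 \<omega>" unfolding T1_def by (rule mem)
              finally show ?thesis .
            qed
            have Bx: "(norm (x *\<^sub>R (B ** X)))\<^sup>2 \<le> (\<beta> * (norm X)\<^sup>2) * x\<^sup>2" for X :: "real^'m^'m"
              using mult_right_mono[OF power_mono[OF norm_matrix_mult_le[of B X], of 2], of "x\<^sup>2"]
              by (simp add: power_mult_distrib \<beta>_def mult.commute)
            have Bx': "ennreal ((norm (x *\<^sub>R (B ** X)))\<^sup>2) \<le> ennreal (\<beta> * (norm X)\<^sup>2) * ennreal (x\<^sup>2)" for X :: "real^'m^'m"
              using ennreal_leI[OF Bx[of X]] \<beta> by (simp add: ennreal_mult')
            show "ennreal ((norm (x *\<^sub>R (B ** ?D j \<omega>)))\<^sup>2) \<le> T2 \<omega>"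
            proof -
              note Bx'[of "?D j \<omega>"]
              also have "ennreal (\<beta> * (norm (?D j \<omega>))\<^sup>2) * ennreal (x\<^sup>2) \<le> ennreal (\<beta> * (norm (?D j \<omega>))\<^sup>2) * U j \<omega>"
                by (intro mult_left_mono Ux) simp
              also have "\<dots> \<le> T2 \<omega>" unfolding T2_def by (rule mem)
              finally show ?thesis .
            qed
            show "ennreal ((norm (x *\<^sub>R (B ** ?c j \<omega>)))\<^sup>2) \<le> T3 \<omega>"
            proof -
              note Bx'[of "?c j \<omega>"]
              also have "ennreal (\<beta> * (norm (?c j \<omega>))\<^sup>2) * ennreal (x\<^sup>2) \<le> T3 \<omega>"
              proof (cases "L < norm (?c j \<omega>)")
                case True
                have "ennreal (\<beta> * (norm (?c j \<omega>))\<^sup>2) * ennreal (x\<^sup>2) \<le> ennreal (\<beta> * tail j \<omega>) * U j \<omega>"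
                  using True by (intro mult_mono Ux) (simp_all add: tail_def)
                also have "\<dots> \<le> (\<Sum>j\<le>n. ennreal (\<beta> * tail j \<omega>) * U j \<omega>)" by (rule mem)
                also have "\<dots> \<le> T3 \<omega>" by (simp add: T3_def)
                finally show ?thesis .
              next
                case False
                then have "(norm (?c j \<omega>))\<^sup>2 \<le> L\<^sup>2" by (intro power_mono) auto
                then have "ennreal (\<beta> * (norm (?c j \<omega>))\<^sup>2) * ennreal (x\<^sup>2) \<le> ennreal (\<beta> * L\<^sup>2) * Qx n \<omega>"
                  using \<beta> by (intro mult_mono Qxx ennreal_leI mult_left_mono) auto
                also have "\<dots> \<le> T3 \<omega>" by (simp add: T3_def)
                finally show ?thesis .
              qed
              finally show ?thesis .
            qed
            show "ennreal ((norm (?D j \<omega>))\<^sup>2) \<le> T4 \<omega>"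
              unfolding T4_def using maxn_ge[OF j(1), of ?D \<omega>] by (intro ennreal_leI power_mono) auto
            show "ennreal ((norm (c t \<omega> - c (tj j) \<omega>))\<^sup>2) \<le> Qc n \<omega>"
              using elim(4)[rule_format, OF t] unfolding g .
          qed auto
        qed
      qed
    qed
    also have "\<dots> = 5 * ((\<integral>\<^sup>+\<omega>. T1 \<omega> \<partial>M) + (\<integral>\<^sup>+\<omega>. T2 \<omega> \<partial>M) + (\<integral>\<^sup>+\<omega>. T3 \<omega> \<partial>M) + (\<integral>\<^sup>+\<omega>. T4 \<omega> \<partial>M) + (\<integral>\<^sup>+\<omega>. Qc n \<omega> \<partial>M))"
      using meas Qc(1)[OF n] by (simp add: nn_integral_cmult nn_integral_add)
    also have "\<dots> \<le> 5 * (ennreal (2 * T * K * \<delta>) + ennreal (8 * T * \<beta> * \<delta>) + ennreal ((\<beta> + 8 * T * \<beta>) * \<delta>) + ennreal \<delta> + ennreal \<delta>)"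
      using elim(3) by (intro mult_left_mono add_mono I1 I2 I3 I4) auto
    also have "\<dots> = ennreal (5 * (2 * T * K * \<delta> + 8 * T * \<beta> * \<delta> + (\<beta> + 8 * T * \<beta>) * \<delta> + \<delta> + \<delta>))"
      by (rule ennreal_sum5) (use T K \<beta> \<delta> in auto)
    also have "5 * (2 * T * K * \<delta> + 8 * T * \<beta> * \<delta> + (\<beta> + 8 * T * \<beta>) * \<delta> + \<delta> + \<delta>) = \<Gamma> * \<delta>"
      by (simp add: \<Gamma>_def algebra_simps)
    also have "\<Gamma> * \<delta> = \<epsilon>" using G by (simp add: \<delta>_def)
    finally show ?case .
  qed
qed

end

section \<open>Products of independent factors\<close>

lemma sets_vimage_algebra_le:
  assumes "f \<in> measurable N L" shows "sets (vimage_algebra (space N) f L) \<subseteq> sets N"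
  using measurable_sets[OF assms] measurable_space[OF assms] by (auto simp: sets_vimage_algebra2)

text \<open>\<open>G j\<close> is generated by the tuple of the variables before \<open>j\<close>;
  disjoint groups of mutually independent variables are independent. For the factors of part a) this
  replaces the Wiener filtration.\<close>

lemma (in prob_space) independent_filtration:
  fixes X :: "nat \<Rightarrow> 'a \<Rightarrow> 'b::euclidean_space"
  assumes ind: "indep_vars (\<lambda>_. borel) X UNIV"
  shows "\<exists>G. dfilt M G \<and> (\<forall>j. X j \<in> borel_measurable (G (Suc j)) \<and> indep_of M (G j) (X j))"
proof -
  have Xm: "X j \<in> borel_measurable M" for j using ind by (auto simp: indep_vars_def)
  define r where "r j \<omega> = restrict (\<lambda>i. X i \<omega>) {..<j}" for j \<omega>
  define G where "G j = vimage_algebra (space M) (r j) (PiM {..<j} (\<lambda>_. borel :: 'b measure))" for j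
  have rm: "r j \<in> measurable M (PiM {..<j} (\<lambda>_. borel))" for j
    unfolding r_def[abs_def] by (intro measurable_restrict Xm)
  have sp: "space (G j) = space M" for j by (simp add: G_def)
  have sub: "subalgebra M (G j)" for j
    unfolding subalgebra_def using sp sets_vimage_algebra_le[OF rm] by (simp add: G_def)
  have rG: "r j \<in> measurable (G j) (PiM {..<j} (\<lambda>_. borel))" for j
    unfolding G_def by (rule measurable_vimage_algebra1) (use measurable_space[OF rm] in auto)
  have XG: "X i \<in> borel_measurable (G j)" if "i < j" for i j
  proof -
    have "(\<lambda>\<omega>. r j \<omega> i) \<in> borel_measurable (G j)"
      by (rule measurable_compose[OF rG measurable_component_singleton]) (use that in simp)
    then show ?thesis using that by (simp add: r_def)
  qed
  have mono: "sets (G i) \<subseteq> sets (G j)" if "i \<le> j" for i j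
  proof -
    have "r i \<in> measurable (G j) (PiM {..<i} (\<lambda>_. borel))"
      unfolding r_def[abs_def] by (intro measurable_restrict XG) (use that in auto)
    from sets_vimage_algebra_le[OF this] show ?thesis by (simp add: G_def sp)
  qed
  have ii: "indep_of M (G j) (X j)" for j
  proof -
    have "indep_var (PiM {..<j} (\<lambda>_. borel)) (r j) (PiM {j} (\<lambda>_. borel)) (\<lambda>\<omega>. restrict (\<lambda>i. X i \<omega>) {j})"
      unfolding r_def[abs_def] by (rule indep_var_restrict[OF ind]) auto
    then have i: "indep_set (sets (G j)) (sets (vimage_algebra (space M) (\<lambda>\<omega>. restrict (\<lambda>i. X i \<omega>) {j}) (PiM {j} (\<lambda>_. borel))))" (is "indep_set _ (sets ?N)")
      unfolding indep_var_eq G_def by (simp add: sets_vimage_algebra)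
    have "(\<lambda>\<omega>. restrict (\<lambda>i. X i \<omega>) {j}) \<in> measurable ?N (PiM {j} (\<lambda>_. borel))"
      by (rule measurable_vimage_algebra1) (auto simp: space_PiM)
    from measurable_compose[OF this measurable_component_singleton[of j]]
    have "X j \<in> borel_measurable ?N" by simp
    from indep_set_mono[OF i order_refl sets_vimage_algebra_le[OF this]] Xm show ?thesis
      by (simp add: indep_of_def)
  qed
  show ?thesis
    using sub mono XG ii by (intro exI[of _ G]) (auto simp: dfilt_def)
qed

lemma maxn_sq_add4_le:
  fixes P Q S U :: "nat \<Rightarrow> 'a \<Rightarrow> 'b::real_normed_vector"
  assumes "\<And>i. i \<le> n \<Longrightarrow> X i \<omega> = P i \<omega> + Q i \<omega> + S i \<omega> + U i \<omega>"
    and "\<And>i. i \<le> n \<Longrightarrow> norm (Q i \<omega>) \<le> q" and "\<And>i. i \<le> n \<Longrightarrow> norm (S i \<omega>) \<le> s"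
  shows "(maxn X n \<omega>)\<^sup>2 \<le> 4 * ((maxn P n \<omega>)\<^sup>2 + q\<^sup>2 + s\<^sup>2 + (maxn U n \<omega>)\<^sup>2)"
proof (rule maxn_sq_leI)
  fix i assume i: "i \<le> n"
  have "(norm (X i \<omega>))\<^sup>2 \<le> (norm (P i \<omega>) + norm (Q i \<omega>) + norm (S i \<omega>) + norm (U i \<omega>))\<^sup>2"
    unfolding assms(1)[OF i]
    by (intro power_mono order_trans[OF norm_triangle_ineq] add_mono order_refl) auto
  also have "\<dots> \<le> (maxn P n \<omega> + q + s + maxn U n \<omega>)\<^sup>2"
    by (intro power_mono add_mono maxn_ge assms i) auto
  also have "\<dots> \<le> 4 * ((maxn P n \<omega>)\<^sup>2 + q\<^sup>2 + s\<^sup>2 + (maxn U n \<omega>)\<^sup>2)"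
  proof -
    have "(a + b + c + d)\<^sup>2 \<le> 4 * (a\<^sup>2 + b\<^sup>2 + c\<^sup>2 + d\<^sup>2)" for a b c d :: real
      using power2_add_le[of "a + b" "c + d"] power2_add_le[of a b] power2_add_le[of c d] by (simp add: add.assoc)
    then show ?thesis .
  qed
  finally show "(norm (X i \<omega>))\<^sup>2 \<le> 4 * ((maxn P n \<omega>)\<^sup>2 + q\<^sup>2 + s\<^sup>2 + (maxn U n \<omega>)\<^sup>2)" .
qed

section \<open>Truncation and comparison over one block\<close>

text \<open>Projection onto a ball is 1-Lipschitz, unlike cutting off by an indicator, so truncated
  states stay as close as the states.\<close>

definition trunc :: "real \<Rightarrow> 'b::euclidean_space \<Rightarrow> 'b" where
  "trunc L = closest_point (cball 0 L)"

lemma trunc: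
  fixes x y :: "'b::euclidean_space"
  assumes L: "L > 0"
  shows "norm (trunc L x) \<le> L" "norm (trunc L x - trunc L y) \<le> norm (x - y)"
    "norm (x - trunc L x) \<le> norm x" "norm x \<le> L \<Longrightarrow> trunc L x = x" "(trunc L :: 'b \<Rightarrow> 'b) \<in> borel_measurable borel"
proof -
  have ne: "convex (cball (0::'b) L)" "closed (cball (0::'b) L)" "cball (0::'b) L \<noteq> {}" using L by auto
  show "norm (trunc L x) \<le> L" using closest_point_in_set[OF ne(2,3), of x] by (simp add: trunc_def)
  show "norm (trunc L x - trunc L y) \<le> norm (x - y)"
    using closest_point_lipschitz[OF ne, of x y] by (simp add: trunc_def dist_norm)
  show "norm (x - trunc L x) \<le> norm x"
    using closest_point_le[OF ne(2), of 0 x] L by (simp add: trunc_def dist_norm)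
  show "norm x \<le> L \<Longrightarrow> trunc L x = x" unfolding trunc_def by (rule closest_point_self) simp
  show "(trunc L :: 'b \<Rightarrow> 'b) \<in> borel_measurable borel"
    unfolding trunc_def by (rule borel_measurable_continuous_onI[OF continuous_on_closest_point[OF ne]])
qed

lemma L2_trunc:
  assumes "L > 0" "L2 M X" shows "L2 M (\<lambda>\<omega>. X \<omega> - trunc L (X \<omega>))"
proof (rule L2_dominated[OF _ L2_integrable_sq[OF assms(2)]])
  show "(\<lambda>\<omega>. X \<omega> - trunc L (X \<omega>)) \<in> borel_measurable M"
    using L2_measurable[OF assms(2)] trunc(5)[OF assms(1)] by (intro borel_measurable_diff) (auto intro: measurable_compose)
  show "AE \<omega> in M. (norm (X \<omega> - trunc L (X \<omega>)))\<^sup>2 \<le> (norm (X \<omega>))\<^sup>2"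
    by (intro AE_I2 power_mono trunc(3) assms) auto
qed

lemma block_maximal:
  fixes G :: "nat \<Rightarrow> 'a \<Rightarrow> real^'m^'m" and A :: "real^'m^'m" and X :: "'a \<Rightarrow> real^'m^'m"
  assumes prob: "prob_space M" and filt: "dfilt M F"
    and Gm: "\<And>i. i < b \<Longrightarrow> G (K * b + i) \<in> borel_measurable (F (Suc (K * b + i)))"
    and Gi: "\<And>i. i < b \<Longrightarrow> indep_of M (F (K * b + i)) (G (K * b + i))"
    and GL2: "\<And>i. i < b \<Longrightarrow> L2 M (G (K * b + i))"
    and G0: "\<And>i. i < b \<Longrightarrow> (\<integral>\<omega>. G (K * b + i) \<omega> \<partial>M) = 0"
    and G2: "\<And>i. i < b \<Longrightarrow> msq M (G (K * b + i)) \<le> p * h"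
    and h: "h \<ge> 0" "real b * h \<le> T" and p: "(norm A)\<^sup>2 \<le> p"
    and X: "X \<in> borel_measurable (F (K * b))" "L2 M X"
  shows "\<And>i. i \<le> b \<Longrightarrow> L2 M (\<lambda>\<omega>. block A h b G K i \<omega> ** X \<omega>) \<and> (\<lambda>\<omega>. block A h b G K i \<omega> ** X \<omega>) \<in> borel_measurable (F (K * b + i))"
    and "(\<integral>\<omega>. (maxn (\<lambda>i \<omega>. block A h b G K i \<omega> ** X \<omega>) b \<omega>)\<^sup>2 \<partial>M) \<le> 3 * exp (3 * (T + 4) * p * T) * msq M X"
proof -
  let ?X = "\<lambda>i \<omega>. block A h b G K i \<omega> ** X \<omega>" and ?F = "\<lambda>i. F (K * b + i)"
  have p0: "p \<ge> 0" using p by (meson zero_le_power2 order_trans)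
  have filt': "dfilt M ?F" using filt by (auto simp: dfilt_def)
  have XF: "X \<in> borel_measurable (?F i)" for i by (rule dfilt_mono[OF filt _ X(1)]) simp
  have md: "mart_diff M (?F i) (\<lambda>\<omega>. G (K * b + i) \<omega> ** X \<omega>)" if "i < b" for i
    by (rule mart_diff_matrix_mult[OF prob dfilt_subalgebra[OF filt] Gi[OF that] GL2[OF that] G0[OF that] XF X(2)])
  have step: "?X (Suc i) \<omega> = ?X i \<omega> + h *\<^sub>R A ** X \<omega> + G (K * b + i) \<omega> ** X \<omega>" for i \<omega>
    by (simp add: block_Suc mm_simps)
  have Xi: "L2 M (?X i) \<and> ?X i \<in> borel_measurable (?F i)" if "i \<le> b" for i
    using that
  proof (induction i)
    case 0 then show ?case using X by (simp add: block_0)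
  next
    case (Suc i)
    have i: "i < b" "i \<le> b" using Suc.prems by auto
    have "?X i \<in> borel_measurable (?F (Suc i))"
      by (rule dfilt_mono[OF filt' _ conjunct2[OF Suc.IH[OF i(2)]]]) simp
    moreover have "L2 M (\<lambda>\<omega>. ?X i \<omega> + h *\<^sub>R A ** X \<omega> + G (K * b + i) \<omega> ** X \<omega>)"
      by (intro L2_add L2_matrix_const_left X mart_diff_L2[OF md] i conjunct1[OF Suc.IH])
    ultimately show ?case
      unfolding step using Gm[OF i(1)] XF[of "Suc i"] by simp
  qed
  then show "\<And>i. i \<le> b \<Longrightarrow> L2 M (?X i) \<and> ?X i \<in> borel_measurable (?F i)" .
  have XL2: "L2 M (?X i)" if "i \<le> b" for i using Xi[OF that] by blast
  have X0: "msq M X \<le> (\<integral>\<omega>. (maxn ?X i \<omega>)\<^sup>2 \<partial>M)" if "i \<le> b" for i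
    using msq_le_maxn[of i M ?X 0] XL2 that by (simp add: block_0)
  have "(\<integral>\<omega>. (maxn ?X b \<omega>)\<^sup>2 \<partial>M) \<le> (3 * msq M (?X 0) + 3 * (T + 4) * T * 0) * exp (3 * (T + 4) * p * T)"
  proof (rule doob_gronwall[OF prob filt' XL2, where U="\<lambda>i \<omega>. h *\<^sub>R A ** X \<omega>" and W="\<lambda>i \<omega>. G (K * b + i) \<omega> ** X \<omega>" and h=h])
    fix i assume i: "i < b"
    show "L2 M (\<lambda>\<omega>. h *\<^sub>R A ** X \<omega>)" by (rule L2_matrix_const_left[OF X(2)])
    show "mart_diff M (?F i) (\<lambda>\<omega>. G (K * b + i) \<omega> ** X \<omega>)" by (rule md[OF i])
    show "(\<lambda>\<omega>. G (K * b + i) \<omega> ** X \<omega>) \<in> borel_measurable (?F (Suc i))" using Gm[OF i] XF[of "Suc i"] by simp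
    show "AE \<omega> in M. ?X (Suc i) \<omega> = ?X i \<omega> + h *\<^sub>R A ** X \<omega> + G (K * b + i) \<omega> ** X \<omega>" using step by simp
    have "msq M (\<lambda>\<omega>. h *\<^sub>R A ** X \<omega>) \<le> (norm (h *\<^sub>R A))\<^sup>2 * msq M X" by (rule msq_matrix_le[OF X(2)])
    also have "\<dots> = h\<^sup>2 * ((norm A)\<^sup>2 * msq M X)" by (simp add: power_mult_distrib)
    also have "\<dots> \<le> h\<^sup>2 * (p * (\<integral>\<omega>. (maxn ?X i \<omega>)\<^sup>2 \<partial>M) + 0)"
      using p p0 X0[of i] i by (intro mult_left_mono) (auto intro!: mult_mono)
    finally show "msq M (\<lambda>\<omega>. h *\<^sub>R A ** X \<omega>) \<le> h\<^sup>2 * (p * (\<integral>\<omega>. (maxn ?X i \<omega>)\<^sup>2 \<partial>M) + 0)" .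
    have "msq M (\<lambda>\<omega>. G (K * b + i) \<omega> ** X \<omega>) \<le> msq M (G (K * b + i)) * msq M X"
      by (rule L2_matrix_mult_indep(2)[OF prob dfilt_subalgebra[OF filt] Gi[OF i] GL2[OF i] XF X(2)])
    also have "\<dots> \<le> (p * h) * (\<integral>\<omega>. (maxn ?X i \<omega>)\<^sup>2 \<partial>M)"
      using G2[OF i] X0[of i] i p0 h by (intro mult_mono) auto
    finally show "msq M (\<lambda>\<omega>. G (K * b + i) \<omega> ** X \<omega>) \<le> h * (p * (\<integral>\<omega>. (maxn ?X i \<omega>)\<^sup>2 \<partial>M) + 0)" by (simp add: mult_ac)
  qed (use h p0 in auto)
  then show "(\<integral>\<omega>. (maxn ?X b \<omega>)\<^sup>2 \<partial>M) \<le> 3 * exp (3 * (T + 4) * p * T) * msq M X"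
    by (simp add: block_0 mult_ac)
qed

context flow
begin

text \<open>Telescoping: a Wiener block sees \<xi> only through one increment, whose moments and
  independence of the past are known.\<close>

lemma noise_block:
  "block A h b (noise h) K i \<omega> = mat 1 + (real i * h) *\<^sub>R A + (\<xi> (real (K * b + i) * h) \<omega> - \<xi> (real (K * b) * h) \<omega>) *\<^sub>R B"
proof (induction i)
  case (Suc i)
  then show ?case by (simp add: block_Suc noise_def algebra_simps)
qed (simp add: block_0)

text \<open>With the truncation \<open>\<tau>\<close> at level \<open>L\<close>, split \<open>V X - V' X'\<close> into \<open>V (X - \<tau> X)\<close>, \<open>(V - V') \<tau> X\<close>,
  \<open>V' (\<tau> X - \<tau> X')\<close> and \<open>V' (\<tau> X' - X')\<close>. Doob's inequality bounds the first and the last term.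
  In the third, \<open>V'\<close> and \<open>X\<close> need not be independent, so \<open>V'\<close> is bounded by \<open>\<Psi>\<close> and split at level \<open>R\<close>.\<close>

lemma block_step:
  fixes G :: "nat \<Rightarrow> 'a \<Rightarrow> real^'m^'m" and X X' :: "'a \<Rightarrow> real^'m^'m"
  assumes filt: "dfilt M F"
    and Gm: "\<And>j. j < m \<Longrightarrow> G j \<in> borel_measurable (F (Suc j))"
    and Gi: "\<And>j. j < m \<Longrightarrow> indep_of M (F j) (G j)"
    and GL2: "\<And>j. j < m \<Longrightarrow> L2 M (G j)"
    and G0: "\<And>j. j < m \<Longrightarrow> (\<integral>\<omega>. G j \<omega> \<partial>M) = 0"
    and G2: "\<And>j. j < m \<Longrightarrow> msq M (G j) \<le> p * h"
    and m: "K * b + b \<le> m" and h: "h \<ge> 0" "real b * h \<le> T" and p: "(norm A)\<^sup>2 \<le> p" "(norm B)\<^sup>2 \<le> p"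
    and X: "X \<in> borel_measurable (F (K * b))" "L2 M X"
    and X': "X' \<in> borel_measurable (FF (real (K * b) * h))" "L2 M X'"
    and \<Psi>: "L2 M \<Psi>" "AE \<omega> in M. \<forall>i\<le>b. norm (block A h b (noise h) K i \<omega>) \<le> \<Psi> \<omega>"
    and L: "L > 0" and R: "R > 0"
  defines "D \<equiv> (\<lambda>i \<omega>. block A h b G K i \<omega> ** X \<omega> - block A h b (noise h) K i \<omega> ** X' \<omega>)"
  shows "\<And>i. i \<le> b \<Longrightarrow> L2 M (D i)"
    and "(\<integral>\<omega>. (maxn D b \<omega>)\<^sup>2 \<partial>M) \<le> 4 * (3 * exp (3 * (T + 4) * p * T) * (8 * msq M (\<lambda>\<omega>. X \<omega> - X' \<omega>) + 3 * msq M (\<lambda>\<omega>. X' \<omega> - trunc L (X' \<omega>)))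
       + L\<^sup>2 * (real m * (\<Sum>j<m. msq M (\<lambda>\<omega>. G j \<omega> - noise h j \<omega>)))
       + (R\<^sup>2 * msq M (\<lambda>\<omega>. X \<omega> - X' \<omega>) + 4 * L\<^sup>2 * (\<integral>\<omega>. (\<Psi> \<omega>)\<^sup>2 * indicator {\<omega>. R < \<bar>\<Psi> \<omega>\<bar>} \<omega> \<partial>M)))"
proof -
  let ?V = "block A h b G K" and ?V' = "block A h b (noise h) K"
  define e0 where "e0 = 3 * exp (3 * (T + 4) * p * T)"
  have e0: "e0 \<ge> 0" by (simp add: e0_def)
  define Y where "Y \<omega> = X \<omega> - trunc L (X \<omega>)" for \<omega>
  define Y' where "Y' \<omega> = X' \<omega> - trunc L (X' \<omega>)" for \<omega>
  have Ym: "Y \<in> borel_measurable (F (K * b))" "L2 M Y" "Y' \<in> borel_measurable (FF (real (K * b) * h))" "L2 M Y'"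
    unfolding Y_def[abs_def] Y'_def[abs_def] using X X' L2_trunc[OF L] measurable_compose[OF X(1) trunc(5)[OF L]] measurable_compose[OF X'(1) trunc(5)[OF L]]
    by (auto intro!: borel_measurable_diff)
  have G': "\<And>i. i < b \<Longrightarrow> G (K * b + i) \<in> borel_measurable (F (Suc (K * b + i)))" "\<And>i. i < b \<Longrightarrow> indep_of M (F (K * b + i)) (G (K * b + i))"
    "\<And>i. i < b \<Longrightarrow> L2 M (G (K * b + i))" "\<And>i. i < b \<Longrightarrow> (\<integral>\<omega>. G (K * b + i) \<omega> \<partial>M) = 0" "\<And>i. i < b \<Longrightarrow> msq M (G (K * b + i)) \<le> p * h"
    using Gm Gi GL2 G0 G2 m by auto
  note nf = noise_facts[OF h(1)]
  have N2: "msq M (noise h j) \<le> p * h" for j using nf(6)[of j] p h by (auto intro: mult_right_mono)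
  note BM = block_maximal[OF prob_space_axioms filt G' h p(1)]
  note BM' = block_maximal[where F="\<lambda>j. FF (real j * h)" and K=K and b=b and G="noise h", OF prob_space_axioms nf(1) nf(2) nf(3) nf(4) nf(5) N2 h p(1)]
  have VX: "L2 M (\<lambda>\<omega>. ?V i \<omega> ** X \<omega>)" "L2 M (\<lambda>\<omega>. ?V i \<omega> ** Y \<omega>)" "L2 M (\<lambda>\<omega>. ?V' i \<omega> ** X' \<omega>)" "L2 M (\<lambda>\<omega>. ?V' i \<omega> ** Y' \<omega>)" if "i \<le> b" for i
    using BM(1)[OF _ _ _ _ _ X that] BM(1)[OF _ _ _ _ _ Ym(1,2) that] BM'(1)[OF X' that] BM'(1)[OF Ym(3,4) that] by auto
  show DL2: "L2 M (D i)" if "i \<le> b" for i unfolding D_def by (intro L2_diff VX that)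
  have mV: "(\<integral>\<omega>. (maxn (\<lambda>i \<omega>. ?V i \<omega> ** Y \<omega>) b \<omega>)\<^sup>2 \<partial>M) \<le> e0 * msq M Y"
    unfolding e0_def by (rule BM(2)[OF _ _ _ _ _ Ym(1,2)])
  have mV': "(\<integral>\<omega>. (maxn (\<lambda>i \<omega>. ?V' i \<omega> ** Y' \<omega>) b \<omega>)\<^sup>2 \<partial>M) \<le> e0 * msq M Y'"
    unfolding e0_def by (rule BM'(2)[OF Ym(3,4)])
  \<comment> \<open>Bounds the difference of the two propagators at every \<open>i\<close>. The
    triangle inequality is used because the differences are orthogonal in neither
    filtration.\<close>
  define d where "d \<omega> = (\<Sum>j<m. norm (G j \<omega> - noise h j \<omega>))" for \<omega>
  have rL2: "L2 M (\<lambda>\<omega>. G j \<omega> - noise h j \<omega>)" if "j < m" for j by (intro L2_diff GL2 nf that)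
  have nrL2: "L2 M (\<lambda>\<omega>. norm (G j \<omega> - noise h j \<omega>))" if "j < m" for j
    using rL2[OF that] L2_norm_iff[OF L2_measurable[OF rL2[OF that]]] by simp
  have dL2: "L2 M d" unfolding d_def[abs_def] by (rule L2_sum) (use nrL2 in auto)
  have d2: "(\<integral>\<omega>. (d \<omega>)\<^sup>2 \<partial>M) \<le> real m * (\<Sum>j<m. msq M (\<lambda>\<omega>. G j \<omega> - noise h j \<omega>))"
    using integral_power2_norm_sum_le[of "{..<m}" M "\<lambda>j \<omega>. norm (G j \<omega> - noise h j \<omega>)"] nrL2 by (simp add: d_def)
  define z where "z \<omega> = norm (X \<omega> - X' \<omega>)" for \<omega>
  have zL2: "L2 M (\<lambda>\<omega>. X \<omega> - X' \<omega>)" by (rule L2_diff[OF X(2) X'(2)])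
  define I where "I \<omega> = (\<Psi> \<omega>)\<^sup>2 * indicator {\<omega>. R < \<bar>\<Psi> \<omega>\<bar>} \<omega>" for \<omega>
  have Ii: "integrable M I" unfolding I_def[abs_def]
    by (rule Bochner_Integration.integrable_bound[OF L2_integrable_sq[OF \<Psi>(1)]])
      (use L2_measurable[OF \<Psi>(1)] in \<open>auto simp: indicator_def\<close>)
  have key: "AE \<omega> in M. (maxn D b \<omega>)\<^sup>2 \<le> 4 * ((maxn (\<lambda>i \<omega>. ?V i \<omega> ** Y \<omega>) b \<omega>)\<^sup>2 + L\<^sup>2 * (d \<omega>)\<^sup>2
      + (R\<^sup>2 * (z \<omega>)\<^sup>2 + 4 * L\<^sup>2 * I \<omega>) + (maxn (\<lambda>i \<omega>. ?V' i \<omega> ** Y' \<omega>) b \<omega>)\<^sup>2)"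
    using \<Psi>(2)
  proof eventually_elim
    case (elim \<omega>)
    \<comment> \<open>The two bounds on truncated states are used separately: the Lipschitz bound
      where \<Psi> is at most \<open>R\<close>, the ball bound where \<Psi> is larger.\<close>
    define s where "s = \<Psi> \<omega> * min (z \<omega>) (2 * L)"
    have \<Psi>0: "0 \<le> \<Psi> \<omega>" using elim[rule_format, of 0] by (meson le0 norm_ge_zero order_trans)
    have "(maxn D b \<omega>)\<^sup>2 \<le> 4 * ((maxn (\<lambda>i \<omega>. ?V i \<omega> ** Y \<omega>) b \<omega>)\<^sup>2 + (L * d \<omega>)\<^sup>2 + s\<^sup>2 + (maxn (\<lambda>i \<omega>. ?V' i \<omega> ** Y' \<omega>) b \<omega>  )\<^sup>2)"
    proof -
      have "(maxn D b \<omega>)\<^sup>2 \<le> 4 * ((maxn (\<lambda>i \<omega>. ?V i \<omega> ** Y \<omega>) b \<omega>)\<^sup>2 + (L * d \<omega>)\<^sup>2 + s\<^sup>2 + (maxn (\<lambda>i \<omega>. - (?V' i \<omega> ** Y' \<omega>)) b \<omega>)\<^sup>2)"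
      proof (rule maxn_sq_add4_le[where Q="\<lambda>i \<omega>. (?V i \<omega> - ?V' i \<omega>) ** trunc L (X \<omega>)" and S="\<lambda>i \<omega>. ?V' i \<omega> ** (trunc L (X \<omega>) - trunc L (X' \<omega>))"])
        fix i assume i: "i \<le> b"
        show "D i \<omega> = ?V i \<omega> ** Y \<omega> + (?V i \<omega> - ?V' i \<omega>) ** trunc L (X \<omega>) + ?V' i \<omega> ** (trunc L (X \<omega>) - trunc L (X' \<omega>)) + - (?V' i \<omega> ** Y' \<omega>)"
          by (simp add: D_def Y_def Y'_def mm_simps)
        have "?V i \<omega> - ?V' i \<omega> = (\<Sum>k<i. G (K * b + k) \<omega> - noise h (K * b + k) \<omega>)"
          by (simp add: block_def sum.distrib sum_subtractf)
        then have "norm (?V i \<omega> - ?V' i \<omega>) \<le> (\<Sum>k<i. norm (G (K * b + k) \<omega> - noise h (K * b + k) \<omega>))"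
          by (simp add: norm_sum)
        also have "\<dots> = (\<Sum>j\<in>(\<lambda>k. K * b + k) ` {..<i}. norm (G j \<omega> - noise h j \<omega>))"
          by (subst sum.reindex) (auto simp: inj_on_def)
        also have "\<dots> \<le> d \<omega>" unfolding d_def by (rule sum_mono2) (use i m in auto)
        finally have vd: "norm (?V i \<omega> - ?V' i \<omega>) \<le> d \<omega>" .
        have "norm ((?V i \<omega> - ?V' i \<omega>) ** trunc L (X \<omega>)) \<le> norm (?V i \<omega> - ?V' i \<omega>) * norm (trunc L (X \<omega>))"
          by (rule norm_matrix_mult_le)
        also have "\<dots> \<le> d \<omega> * L" using vd trunc(1)[OF L, of "X \<omega>"] order_trans[OF norm_ge_zero vd] by (intro mult_mono) auto
        finally show "norm ((?V i \<omega> - ?V' i \<omega>) ** trunc L (X \<omega>)) \<le> L * d \<omega>" by (simp add: mult.commute)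
        have "norm (?V' i \<omega> ** (trunc L (X \<omega>) - trunc L (X' \<omega>))) \<le> norm (?V' i \<omega>) * norm (trunc L (X \<omega>) - trunc L (X' \<omega>))"
          by (rule norm_matrix_mult_le)
        also have "\<dots> \<le> s" unfolding s_def
        proof (rule mult_mono)
          show "norm (?V' i \<omega>) \<le> \<Psi> \<omega>" using elim i by blast
          have "norm (trunc L (X \<omega>) - trunc L (X' \<omega>)) \<le> norm (trunc L (X \<omega>)) + norm (trunc L (X' \<omega>))" by (rule norm_triangle_ineq4)
          also have "\<dots> \<le> 2 * L" using trunc(1)[OF L, of "X \<omega>"] trunc(1)[OF L, of "X' \<omega>"] by linarith
          finally show "norm (trunc L (X \<omega>) - trunc L (X' \<omega>)) \<le> min (z \<omega>) (2 * L)"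
            using trunc(2)[OF L, of "X \<omega>" "X' \<omega>"] by (simp add: z_def)
        qed (use \<Psi>0 in auto)
        finally show "norm (?V' i \<omega> ** (trunc L (X \<omega>) - trunc L (X' \<omega>))) \<le> s" .
      qed
      then show ?thesis by (simp add: maxn_def)
    qed
    moreover have "s\<^sup>2 \<le> R\<^sup>2 * (z \<omega>)\<^sup>2 + 4 * L\<^sup>2 * I \<omega>"
    proof (cases "R < \<Psi> \<omega>")
      case True
      have "s\<^sup>2 = (\<Psi> \<omega>)\<^sup>2 * (min (z \<omega>) (2 * L))\<^sup>2" by (simp add: s_def power_mult_distrib)
      also have "\<dots> \<le> (\<Psi> \<omega>)\<^sup>2 * (2 * L)\<^sup>2" by (intro mult_left_mono power_mono) (use L in \<open>auto simp: z_def\<close>)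
      also have "\<dots> = 4 * L\<^sup>2 * I \<omega>" using True \<Psi>0 by (simp add: I_def power_mult_distrib)
      finally show ?thesis by (smt (verit) mult_nonneg_nonneg zero_le_power2)
    next
      case False
      have "s\<^sup>2 = (\<Psi> \<omega>)\<^sup>2 * (min (z \<omega>) (2 * L))\<^sup>2" by (simp add: s_def power_mult_distrib)
      also have "\<dots> \<le> R\<^sup>2 * (z \<omega>)\<^sup>2" using False \<Psi>0 L by (intro mult_mono power_mono) (auto simp: z_def)
      finally show ?thesis by (simp add: I_def add_increasing2)
    qed
    ultimately show ?case by (simp add: power_mult_distrib)
  qed
  have ints: "integrable M (\<lambda>\<omega>. (maxn D b \<omega>)\<^sup>2)" "integrable M (\<lambda>\<omega>. (maxn (\<lambda>i \<omega>. ?V i \<omega> ** Y \<omega>) b \<omega>)\<^sup>2)"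
    "integrable M (\<lambda>\<omega>. (maxn (\<lambda>i \<omega>. ?V' i \<omega> ** Y' \<omega>) b \<omega>)\<^sup>2)" "integrable M (\<lambda>\<omega>. (d \<omega>)\<^sup>2)" "integrable M (\<lambda>\<omega>. (z \<omega>)\<^sup>2)"
    using L2_integrable_sq[OF maxn_L2[OF DL2]] L2_integrable_sq[OF maxn_L2[OF VX(2)]] L2_integrable_sq[OF maxn_L2[OF VX(4)]] L2_integrable_sq[OF dL2] L2_integrable_sq[OF zL2]
    by (simp_all add: z_def)
  have "(\<integral>\<omega>. (maxn D b \<omega>)\<^sup>2 \<partial>M) \<le> (\<integral>\<omega>. 4 * ((maxn (\<lambda>i \<omega>. ?V i \<omega> ** Y \<omega>) b \<omega>)\<^sup>2 + L\<^sup>2 * (d \<omega>)\<^sup>2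
      + (R\<^sup>2 * (z \<omega>)\<^sup>2 + 4 * L\<^sup>2 * I \<omega>) + (maxn (\<lambda>i \<omega>. ?V' i \<omega> ** Y' \<omega>) b \<omega>)\<^sup>2) \<partial>M)"
    by (rule integral_mono_AE[OF ints(1) _ key]) (intro integrable_mult_right Bochner_Integration.integrable_add ints Ii)
  also have "\<dots> = 4 * ((\<integral>\<omega>. (maxn (\<lambda>i \<omega>. ?V i \<omega> ** Y \<omega>) b \<omega>)\<^sup>2 \<partial>M) + L\<^sup>2 * (\<integral>\<omega>. (d \<omega>)\<^sup>2 \<partial>M)
      + (R\<^sup>2 * (\<integral>\<omega>. (z \<omega>)\<^sup>2 \<partial>M) + 4 * L\<^sup>2 * (\<integral>\<omega>. I \<omega> \<partial>M)) + (\<integral>\<omega>. (maxn (\<lambda>i \<omega>. ?V' i \<omega> ** Y' \<omega>) b \<omega>)\<^sup>2 \<partial>M))"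
    using ints Ii by simp
  also have "\<dots> \<le> 4 * (e0 * (8 * msq M (\<lambda>\<omega>. X \<omega> - X' \<omega>) + 2 * msq M Y') + L\<^sup>2 * (real m * (\<Sum>j<m. msq M (\<lambda>\<omega>. G j \<omega> - noise h j \<omega>)))
      + (R\<^sup>2 * msq M (\<lambda>\<omega>. X \<omega> - X' \<omega>) + 4 * L\<^sup>2 * (\<integral>\<omega>. I \<omega> \<partial>M)) + e0 * msq M Y')"
  proof (intro mult_left_mono add_mono d2 mV')
    \<comment> \<open>Fourth moments are available for the Wiener scheme only, so the tail of
      \<open>X\<close> is reduced to that of \<open>X'\<close> by the Lipschitz property.\<close>
    have "msq M Y \<le> (\<integral>\<omega>. 8 * (norm (X \<omega> - X' \<omega>))\<^sup>2 + 2 * (norm (Y' \<omega>))\<^sup>2 \<partial>M)"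
    proof (rule integral_mono)
      fix \<omega>
      have "Y \<omega> = (X \<omega> - X' \<omega>) - (trunc L (X \<omega>) - trunc L (X' \<omega>)) + Y' \<omega>" by (simp add: Y_def Y'_def)
      then have "(norm (Y \<omega>))\<^sup>2 \<le> 2 * (norm ((X \<omega> - X' \<omega>) - (trunc L (X \<omega>) - trunc L (X' \<omega>))))\<^sup>2 + 2 * (norm (Y' \<omega>))\<^sup>2"
        by (simp only: power2_norm_add_le)
      also have "(norm ((X \<omega> - X' \<omega>) - (trunc L (X \<omega>) - trunc L (X' \<omega>))))\<^sup>2 \<le> 2 * (norm (X \<omega> - X' \<omega>))\<^sup>2 + 2 * (norm (trunc L (X \<omega>) - trunc L (X' \<omega>)))\<^sup>2"
        by (rule power2_norm_diff_le)
      also have "(norm (trunc L (X \<omega>) - trunc L (X' \<omega>)))\<^sup>2 \<le> (norm (X \<omega> - X' \<omega>))\<^sup>2"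
        by (intro power_mono trunc(2) L) simp
      finally show "(norm (Y \<omega>))\<^sup>2 \<le> 8 * (norm (X \<omega> - X' \<omega>))\<^sup>2 + 2 * (norm (Y' \<omega>))\<^sup>2" by simp
    qed (use L2_integrable_sq[OF Ym(2)] L2_integrable_sq[OF Ym(4)] L2_integrable_sq[OF zL2] in auto)
    also have "\<dots> = 8 * msq M (\<lambda>\<omega>. X \<omega> - X' \<omega>) + 2 * msq M Y'"
      using L2_integrable_sq[OF Ym(4)] L2_integrable_sq[OF zL2] by simp
    finally have "e0 * msq M Y \<le> e0 * (8 * msq M (\<lambda>\<omega>. X \<omega> - X' \<omega>) + 2 * msq M Y')" using e0 by (rule mult_left_mono)
    with mV show "(\<integral>\<omega>. (maxn (\<lambda>i \<omega>. ?V i \<omega> ** Y \<omega>) b \<omega>)\<^sup>2 \<partial>M) \<le> e0 * (8 * msq M (\<lambda>\<omega>. X \<omega> - X' \<omega>) + 2 * msq M Y')" by linarith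
  qed (use L in \<open>auto simp: z_def\<close>)
  finally show "(\<integral>\<omega>. (maxn D b \<omega>)\<^sup>2 \<partial>M) \<le> 4 * (3 * exp (3 * (T + 4) * p * T) * (8 * msq M (\<lambda>\<omega>. X \<omega> - X' \<omega>) + 3 * msq M (\<lambda>\<omega>. X' \<omega> - trunc L (X' \<omega>)))
       + L\<^sup>2 * (real m * (\<Sum>j<m. msq M (\<lambda>\<omega>. G j \<omega> - noise h j \<omega>)))
       + (R\<^sup>2 * msq M (\<lambda>\<omega>. X \<omega> - X' \<omega>) + 4 * L\<^sup>2 * (\<integral>\<omega>. (\<Psi> \<omega>)\<^sup>2 * indicator {\<omega>. R < \<bar>\<Psi> \<omega>\<bar>} \<omega> \<partial>M)))"
    unfolding e0_def[symmetric] Y'_def[symmetric] I_def[symmetric] by (simp add: algebra_simps)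
qed

end

lemma coarse_adapted:
  fixes G :: "nat \<Rightarrow> 'a \<Rightarrow> real^'m^'m" and A :: "real^'m^'m"
  assumes prob: "prob_space M" and filt: "dfilt M F"
    and Gm: "\<And>j. j < m \<Longrightarrow> G j \<in> borel_measurable (F (Suc j))"
    and Gi: "\<And>j. j < m \<Longrightarrow> indep_of M (F j) (G j)"
    and GL2: "\<And>j. j < m \<Longrightarrow> L2 M (G j)"
    and G0: "\<And>j. j < m \<Longrightarrow> (\<integral>\<omega>. G j \<omega> \<partial>M) = 0"
    and G2: "\<And>j. j < m \<Longrightarrow> msq M (G j) \<le> p * h"
    and h: "h \<ge> 0" "real b * h \<le> T" and p: "(norm A)\<^sup>2 \<le> p"
    and K: "K * b \<le> m"
  shows "coarse A h b G K \<in> borel_measurable (F (K * b)) \<and> L2 M (coarse A h b G K)"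
  using K
proof (induction K)
  case 0
  interpret prob_space M by fact
  have "coarse A h b G 0 = (\<lambda>_. mat 1)" by (simp add: fun_eq_iff)
  then show ?case by simp
next
  case (Suc K)
  then have IH: "coarse A h b G K \<in> borel_measurable (F (K * b))" "L2 M (coarse A h b G K)" and le: "K * b + b \<le> m" by auto
  have eq: "coarse A h b G (Suc K) = (\<lambda>\<omega>. block A h b G K b \<omega> ** coarse A h b G K \<omega>)" by (simp add: fun_eq_iff)
  have "L2 M (\<lambda>\<omega>. block A h b G K b \<omega> ** coarse A h b G K \<omega>) \<and>
    (\<lambda>\<omega>. block A h b G K b \<omega> ** coarse A h b G K \<omega>) \<in> borel_measurable (F (K * b + b))"
    by (rule block_maximal(1)[OF prob filt _ _ _ _ _ h p IH order_refl]) (use Gm Gi GL2 G0 G2 le in auto)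
  then show ?case unfolding eq by (simp add: add.commute)
qed

text \<open>The error vanishes inside the ball; outside it the square is at most the fourth power
  divided by \<open>L^2\<close>.\<close>

lemma trunc_tail:
  fixes X :: "'a \<Rightarrow> 'b::euclidean_space"
  assumes X: "L2 M X" and m4: "(\<integral>\<^sup>+\<omega>. ennreal ((norm (X \<omega>))^4) \<partial>M) \<le> ennreal q" "q \<ge> 0" and L: "L > 0"
  shows "msq M (\<lambda>\<omega>. X \<omega> - trunc L (X \<omega>)) \<le> q / L\<^sup>2"
proof -
  have [measurable]: "X \<in> borel_measurable M" using X by (simp add: L2_def)
  have le: "(norm (x - trunc L x))\<^sup>2 \<le> (1 / L\<^sup>2) * (norm x)^4" for x :: 'b
  proof (cases "norm x \<le> L")
    case True
    then show ?thesis using trunc(4)[OF L True] by simp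
  next
    case False
    have "(norm (x - trunc L x))\<^sup>2 \<le> (norm x)\<^sup>2 * 1" using trunc(3)[OF L, of x] by (simp add: power_mono)
    also have "\<dots> \<le> (norm x)\<^sup>2 * ((norm x)\<^sup>2 / L\<^sup>2)"
      using False L by (intro mult_left_mono) (auto intro!: power_mono)
    also have "\<dots> = (1 / L\<^sup>2) * (norm x)^4" by (simp add: power4_eq_xxxx power2_eq_square)
    finally show ?thesis .
  qed
  have "(\<integral>\<^sup>+\<omega>. ennreal ((norm (X \<omega> - trunc L (X \<omega>)))\<^sup>2) \<partial>M) \<le> (\<integral>\<^sup>+\<omega>. ennreal (1 / L\<^sup>2) * ennreal ((norm (X \<omega>))^4) \<partial>M)"
    using le by (intro nn_integral_mono) (simp add: ennreal_mult[symmetric] ennreal_leI)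
  also have "\<dots> = ennreal (1 / L\<^sup>2) * (\<integral>\<^sup>+\<omega>. ennreal ((norm (X \<omega>))^4) \<partial>M)" by (rule nn_integral_cmult) measurable
  also have "\<dots> \<le> ennreal (1 / L\<^sup>2) * ennreal q" by (intro mult_left_mono m4) simp
  also have "\<dots> = ennreal (q / L\<^sup>2)" using m4 by (simp add: ennreal_mult[symmetric])
  finally show ?thesis
    using L2_nnI(2)[OF L2_measurable[OF L2_trunc[OF L X]]] m4(2) by simp
qed

lemma power4_add_le: "(x + y)^4 \<le> 8 * x^4 + 8 * (y::real)^4"
proof -
  have "((x + y)\<^sup>2)\<^sup>2 \<le> (2 * x\<^sup>2 + 2 * y\<^sup>2)\<^sup>2" by (intro power_mono power2_add_le) simp
  also have "\<dots> \<le> 2 * (2 * x\<^sup>2)\<^sup>2 + 2 * (2 * y\<^sup>2)\<^sup>2" by (rule power2_add_le)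
  finally show ?thesis by (simp add: power_mult_distrib flip: power_mult)
qed

section \<open>Centered factors and moments of the Wiener scheme\<close>

context flow
begin

definition centered_factor :: "(real \<Rightarrow> real \<Rightarrow> 'a \<Rightarrow> real^'m^'m) \<Rightarrow> real \<Rightarrow> nat \<Rightarrow> 'a \<Rightarrow> real^'m^'m" where
  "centered_factor F h j \<omega> = F (real j * h) (real (Suc j) * h) \<omega> - expectation (F (real j * h) (real (Suc j) * h))"

text \<open>One constant for the drift coefficient and for the variance rate of both noises; a
  centered factor has variance at most twice that of the Wiener noise plus
  \<open>8 * h\<close>.\<close>

abbreviation pp :: real where "pp \<equiv> (norm A)\<^sup>2 + 2 * (norm B)\<^sup>2 + 8"

text \<open>The filtration is existential because it is generated by the factors of the grid and so
  changes with \<open>h\<close>. All errors scale with \<open>h^2\<close>, including the centered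
  one.\<close>

definition grid_ok :: "(real \<Rightarrow> real \<Rightarrow> 'a \<Rightarrow> real^'m^'m) \<Rightarrow> real \<Rightarrow> real \<Rightarrow> real \<Rightarrow> bool" where
  "grid_ok F T e h \<longleftrightarrow> (\<forall>m. real m * h \<le> T \<longrightarrow> (\<exists>G. dfilt M G \<and>
    (\<forall>j. centered_factor F h j \<in> borel_measurable (G (Suc j)) \<and> indep_of M (G j) (centered_factor F h j) \<and> L2 M (centered_factor F h j) \<and> expectation (centered_factor F h j) = 0) \<and>
    (\<forall>j<m. msq M (centered_factor F h j) \<le> pp * h \<and> (norm (expectation (F (real j * h) (real (Suc j) * h)) - mat 1 - h *\<^sub>R A))\<^sup>2 \<le> e * h\<^sup>2 \<and>
       msq M (\<lambda>\<omega>. centered_factor F h j \<omega> - noise h j \<omega>) \<le> 4 * e * h\<^sup>2) \<and>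
    (\<forall>j. prods F h j \<in> borel_measurable (G j) \<and> L2 M (prods F h j))))"

lemma grid_ok_obtain:
  assumes "grid_ok F T e h" "real m * h \<le> T"
  obtains G where "dfilt M G"
    "\<And>j. centered_factor F h j \<in> borel_measurable (G (Suc j))" "\<And>j. indep_of M (G j) (centered_factor F h j)" "\<And>j. L2 M (centered_factor F h j)" "\<And>j. expectation (centered_factor F h j) = 0"
    "\<And>j. j < m \<Longrightarrow> msq M (centered_factor F h j) \<le> pp * h" "\<And>j. j < m \<Longrightarrow> (norm (expectation (F (real j * h) (real (Suc j) * h)) - mat 1 - h *\<^sub>R A))\<^sup>2 \<le> e * h\<^sup>2"
    "\<And>j. j < m \<Longrightarrow> msq M (\<lambda>\<omega>. centered_factor F h j \<omega> - noise h j \<omega>) \<le> 4 * e * h\<^sup>2"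
    "\<And>j. prods F h j \<in> borel_measurable (G j)" "\<And>j. L2 M (prods F h j)"
  using assms(1)[unfolded grid_ok_def, THEN spec, THEN mp, OF assms(2)]
proof (elim exE conjE, goal_cases)
  case (1 G)
  show thesis by (rule that[of G]) (use 1 in blast)+
qed

text \<open>By \<open>prop_i\<close> a factor minus its mean differs from the Wiener noise by the
  centered \<open>R\<close> alone. Its mean square is of order \<open>e * h^2\<close>, small enough
  to be summed over all steps without orthogonality.\<close>

lemma independent_products_grid:
  fixes F :: "real \<Rightarrow> real \<Rightarrow> 'a \<Rightarrow> real^'m^'m"
  assumes pi: "prop_i M \<xi> A B F" and pii: "prop_ii M F"
    and FL2: "\<And>s t. 0 \<le> s \<Longrightarrow> s \<le> t \<Longrightarrow> L2 M (F s t)" and e: "0 < e" "e \<le> 1"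
  shows "\<forall>\<^sub>F h in at_right 0. grid_ok F T e h"
proof -
  obtain R where R: "small_o M R" and FR: "\<And>s t. 0 \<le> s \<Longrightarrow> s \<le> t \<Longrightarrow>
      AE \<omega> in M. F s t \<omega> = mat 1 + (t - s) *\<^sub>R A + (\<xi> t \<omega> - \<xi> s \<omega>) *\<^sub>R B + R s t \<omega>"
    using pi unfolding prop_i_def by blast
  have h1: "\<forall>\<^sub>F h in at_right 0. (h::real) < 1"
    by (rule order_tendstoD(2)[OF tendsto_ident_at]) simp
  show ?thesis
    using small_oD[OF R e(1), of T] h1 eventually_at_right_less[of "0::real"]
  proof eventually_elim
    case (elim h)
    note h = elim(3)
    have tj: "0 \<le> real j * h" "real j * h \<le> real (Suc j) * h" "real (Suc j) * h = real j * h + h" for j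
      using h by (auto simp: algebra_simps)
    define X where "X j = F (real j * h) (real (Suc j) * h)" for j
    have XL2: "L2 M (X j)" for j unfolding X_def by (intro FL2 tj)
    have "indep_vars (\<lambda>_. borel) (\<lambda>k. F (real k * h) (real k * h + h)) UNIV"
      using pii[unfolded prop_ii_def, rule_format, OF h, THEN conjunct1, rule_format, of "\<lambda>k. real k * h"] tj(3) by simp
    moreover have "X = (\<lambda>k. F (real k * h) (real k * h + h))" by (rule ext) (simp only: X_def tj(3))
    ultimately have "indep_vars (\<lambda>_. borel) X UNIV" by simp
    then obtain G where G: "dfilt M G" "\<And>j. X j \<in> borel_measurable (G (Suc j))" "\<And>j. indep_of M (G j) (X j)"
      using independent_filtration by blast
    note nf = noise_facts[OF less_imp_le[OF h]]
    have gX: "centered_factor F h j = (\<lambda>\<omega>. X j \<omega> - expectation (X j))" for j by (simp add: fun_eq_iff centered_factor_def X_def)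
    have g1: "centered_factor F h j \<in> borel_measurable (G (Suc j)) \<and> indep_of M (G j) (centered_factor F h j) \<and> L2 M (centered_factor F h j) \<and> expectation (centered_factor F h j) = 0" for j
      unfolding gX using centered_L2[OF XL2] G(2) indep_of_compose[OF prob_space_axioms G(3)[of j], of "\<lambda>x. x - expectation (X j)"]
      by auto
    have g2: "msq M (centered_factor F h j) \<le> pp * h \<and> (norm (expectation (X j) - mat 1 - h *\<^sub>R A))\<^sup>2 \<le> e * h\<^sup>2 \<and>
       msq M (\<lambda>\<omega>. centered_factor F h j \<omega> - noise h j \<omega>) \<le> 4 * e * h\<^sup>2" if sT: "real j * h \<le> T" for j
    proof -
      define r where "r = R (real j * h) (real j * h + h)"
      have r: "L2 M r" "msq M r \<le> e * h\<^sup>2" using elim(1) tj sT by (auto simp: r_def)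
      have eq: "AE \<omega> in M. X j \<omega> = mat 1 + h *\<^sub>R A + noise h j \<omega> + r \<omega>"
        using FR[OF tj(1,2)[of j]] by eventually_elim (simp add: X_def r_def noise_def tj(3) del: of_nat_Suc)
      note ints = L2_integrable[OF finite_measure_axioms]
      have EX: "expectation (X j) = mat 1 + h *\<^sub>R A + expectation r"
      proof -
        have "expectation (X j) = expectation (\<lambda>\<omega>. mat 1 + h *\<^sub>R A + noise h j \<omega> + r \<omega>)"
          using eq L2_measurable[OF XL2] L2_measurable[OF r(1)] L2_measurable[OF nf(4)]
          by (intro integral_cong_AE) auto
        then show ?thesis using ints[OF nf(4)] ints[OF r(1)] nf(5) by (simp add: prob_space)
      qed
      have 1: "(norm (expectation (X j) - mat 1 - h *\<^sub>R A))\<^sup>2 \<le> e * h\<^sup>2"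
        using order_trans[OF norm_expectation_sq_le[OF r(1)] r(2)] by (simp add: EX)
      have "AE \<omega> in M. centered_factor F h j \<omega> - noise h j \<omega> = r \<omega> - expectation r"
        using eq by eventually_elim (simp add: gX EX)
      then have "msq M (\<lambda>\<omega>. centered_factor F h j \<omega> - noise h j \<omega>) = msq M (\<lambda>\<omega>. r \<omega> - expectation r)"
        using L2_measurable[OF L2_diff[OF conjunct1[OF conjunct2[OF conjunct2[OF g1]]] nf(4)]] L2_measurable[OF centered_L2(1)[OF r(1)]]
        by (intro msq_cong_AE) auto
      also have "\<dots> \<le> 4 * e * h\<^sup>2" using centered_L2(3)[OF r(1)] r(2) by simp
      finally have 2: "msq M (\<lambda>\<omega>. centered_factor F h j \<omega> - noise h j \<omega>) \<le> 4 * e * h\<^sup>2" .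
      have "msq M (centered_factor F h j) = msq M (\<lambda>\<omega>. noise h j \<omega> + (centered_factor F h j \<omega> - noise h j \<omega>))" by simp
      also have "\<dots> \<le> 2 * msq M (noise h j) + 2 * msq M (\<lambda>\<omega>. centered_factor F h j \<omega> - noise h j \<omega>)"
        using g1[of j] by (intro integral_power2_norm_add_le L2_diff nf) auto
      \<comment> \<open>With \<open>e\<close> and \<open>h\<close> at most 1 the bound
        \<open>4 * e * h^2\<close> is below \<open>4 * h\<close>; this is the origin of the 8 in
        \<open>pp\<close>.\<close>
      also have "\<dots> \<le> 2 * ((norm B)\<^sup>2 * h) + 2 * (4 * 1 * h)"
      proof (intro add_mono mult_left_mono order_trans[OF 2])
        show "4 * e * h\<^sup>2 \<le> 4 * 1 * h"
          using e h elim(2) by (simp add: power2_eq_square mult_le_one)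
      qed (use nf(6)[of j] in auto)
      also have "\<dots> \<le> pp * h" using h by (simp add: algebra_simps)
      finally show ?thesis using 1 2 by blast
    qed
    have Y: "prods F h j \<in> borel_measurable (G j) \<and> L2 M (prods F h j)" for j
    proof (induction j)
      case (Suc j)
      have "L2 M (\<lambda>\<omega>. X j \<omega> ** prods F h j \<omega>)"
        by (rule L2_matrix_mult_indep(1)[OF prob_space_axioms dfilt_subalgebra[OF G(1)] G(3) XL2]) (use Suc in auto)
      moreover have "prods F h j \<in> borel_measurable (G (Suc j))"
        by (rule dfilt_mono[OF G(1) _ conjunct1[OF Suc]]) simp
      ultimately show ?case using G(2)[of j] by (simp add: prods_Suc[abs_def] X_def)
    qed (simp add: prods_0)
    show ?case unfolding grid_ok_def
    proof (intro allI impI)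
      fix m assume m: "real m * h \<le> T"
      have "real j * h \<le> T" if "j < m" for j
        using mult_right_mono[of "real j" "real m" h] that h m by linarith
      then show "\<exists>G. dfilt M G \<and>
        (\<forall>j. centered_factor F h j \<in> borel_measurable (G (Suc j)) \<and> indep_of M (G j) (centered_factor F h j) \<and> L2 M (centered_factor F h j) \<and> expectation (centered_factor F h j) = 0) \<and>
        (\<forall>j<m. msq M (centered_factor F h j) \<le> pp * h \<and> (norm (expectation (F (real j * h) (real (Suc j) * h)) - mat 1 - h *\<^sub>R A))\<^sup>2 \<le> e * h\<^sup>2 \<and>
           msq M (\<lambda>\<omega>. centered_factor F h j \<omega> - noise h j \<omega>) \<le> 4 * e * h\<^sup>2) \<and>
        (\<forall>j. prods F h j \<in> borel_measurable (G j) \<and> L2 M (prods F h j))"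
        using G(1) g1 g2 Y unfolding X_def by blast
    qed
  qed
qed

text \<open>Each block is independent of the scheme at its start, so fourth moments multiply. The
  factor \<open>Q\<close> depends on \<open>T\<close> only, not on \<open>h\<close> or
  \<open>b\<close>, so the bound is uniform in the mesh once the number of blocks is fixed.\<close>

lemma coarse_fourth_moment:
  assumes h: "0 \<le> h" "real b * h \<le> T"
  defines "Q \<equiv> 8 * (norm (mat 1 :: real^'m^'m) + T * norm A)^4 + 8 * ((norm B)^4 * (3 * T\<^sup>2))"
  shows "(\<integral>\<^sup>+\<omega>. ennreal ((norm (coarse A h b (noise h) K \<omega>))^4) \<partial>M) \<le> ennreal ((norm (mat 1 :: real^'m^'m))^4 * Q ^ K)"
proof (induction K)
  case 0
  show ?case by (simp add: emeasure_space_1)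
next
  case (Suc K)
  note nf = noise_facts[OF h(1)]
  have Q0: "Q \<ge> 0" by (simp add: Q_def)
  let ?s = "real (K * b) * h" and ?t = "real (K * b + b) * h"
  have st: "0 \<le> ?s" "?s \<le> ?t" "?t - ?s = real b * h" using h by (auto simp: algebra_simps)
  have T0: "0 \<le> T" using h by (meson mult_nonneg_nonneg of_nat_0_le_iff order_trans)
  define V where "V \<omega> = (norm (block A h b (noise h) K b \<omega>))^4" for \<omega>
  define V' where "V' x = (norm (mat 1 + (real b * h) *\<^sub>R A + x *\<^sub>R B))^4" for x :: real
  have VV: "V \<omega> = V' (\<xi> ?t \<omega> - \<xi> ?s \<omega>)" for \<omega> unfolding V_def V'_def noise_block by simp
  have Vi: "indep_of M (FF ?s) (\<lambda>\<omega>. ennreal (V \<omega>))"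
    unfolding VV by (rule indep_of_compose[OF prob_space_axioms indep_increment[OF st(1,2)]]) (simp add: V'_def)
  have EV: "(\<integral>\<^sup>+\<omega>. ennreal (V \<omega>) \<partial>M) \<le> ennreal Q"
  proof -
    define a where "a = norm (mat 1 :: real^'m^'m) + T * norm A"
    have le: "V \<omega> \<le> 8 * a^4 + 8 * ((norm B)^4 * (\<xi> ?t \<omega> - \<xi> ?s \<omega>)^4)" for \<omega>
    proof -
      let ?x = "\<xi> ?t \<omega> - \<xi> ?s \<omega>"
      have "norm (mat 1 + (real b * h) *\<^sub>R A + ?x *\<^sub>R B) \<le> norm (mat 1 :: real^'m^'m) + norm ((real b * h) *\<^sub>R A) + norm (?x *\<^sub>R B)"
        by (intro order_trans[OF norm_triangle_ineq] add_mono order_refl)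
      also have "\<dots> \<le> a + \<bar>?x\<bar> * norm B"
        using mult_right_mono[OF h(2), of "norm A"] h(1) by (simp add: a_def)
      finally have "V \<omega> \<le> (a + \<bar>?x\<bar> * norm B)^4" unfolding VV V'_def by (rule power_mono) simp
      also have "\<dots> \<le> 8 * a^4 + 8 * (\<bar>?x\<bar> * norm B)^4" by (rule power4_add_le)
      finally show ?thesis by (simp add: power_mult_distrib mult.commute)
    qed
    have "(\<integral>\<^sup>+\<omega>. ennreal (V \<omega>) \<partial>M) \<le> (\<integral>\<^sup>+\<omega>. ennreal (8 * a^4 + 8 * ((norm B)^4 * (\<xi> ?t \<omega> - \<xi> ?s \<omega>)^4)) \<partial>M)"
      by (intro nn_integral_mono ennreal_leI le)
    also have "\<dots> = ennreal (\<integral>\<omega>. 8 * a^4 + 8 * ((norm B)^4 * (\<xi> ?t \<omega> - \<xi> ?s \<omega>)^4) \<partial>M)"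
      using increment_moment(1)[OF st(1,2), of 4] by (intro nn_integral_eq_integral) auto
    also have "(\<integral>\<omega>. 8 * a^4 + 8 * ((norm B)^4 * (\<xi> ?t \<omega> - \<xi> ?s \<omega>)^4) \<partial>M) = 8 * a^4 + 8 * ((norm B)^4 * (3 * (real b * h)\<^sup>2))"
      using increment_moment(1)[OF st(1,2), of 4] increment_moment(4)[OF st(1,2)] by (simp add: prob_space st(3) del: of_nat_add of_nat_mult)
    also have "\<dots> \<le> Q" unfolding Q_def a_def using h by (intro add_left_mono mult_left_mono power_mono) auto
    finally show ?thesis by (simp add: ennreal_leI)
  qed
  have cm: "coarse A h b (noise h) K \<in> borel_measurable (FF ?s)"
    by (rule conjunct1[OF coarse_adapted[where F="\<lambda>j. FF (real j * h)" and m="K * b" and p="max ((norm A)\<^sup>2) ((norm B)\<^sup>2)", OF prob_space_axioms nf(1) nf(2) nf(3) nf(4) nf(5) _ h]])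
      (use nf(6) h in \<open>auto intro: mult_right_mono\<close>)
  have "(\<integral>\<^sup>+\<omega>. ennreal ((norm (coarse A h b (noise h) (Suc K) \<omega>))^4) \<partial>M)
    \<le> (\<integral>\<^sup>+\<omega>. ennreal ((norm (coarse A h b (noise h) K \<omega>))^4) * ennreal (V \<omega>) \<partial>M)"
  proof (rule nn_integral_mono)
    fix \<omega>
    have "(norm (coarse A h b (noise h) (Suc K) \<omega>))^4 \<le> (norm (block A h b (noise h) K b \<omega>) * norm (coarse A h b (noise h) K \<omega>))^4"
      by (intro power_mono) (simp_all add: norm_matrix_mult_le)
    then show "ennreal ((norm (coarse A h b (noise h) (Suc K) \<omega>))^4) \<le> ennreal ((norm (coarse A h b (noise h) K \<omega>))^4) * ennreal (V \<omega>)"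
      by (simp add: V_def power_mult_distrib ennreal_mult[symmetric] mult.commute ennreal_leI)
  qed
  also have "\<dots> = (\<integral>\<^sup>+\<omega>. ennreal ((norm (coarse A h b (noise h) K \<omega>))^4) \<partial>M) * (\<integral>\<^sup>+\<omega>. ennreal (V \<omega>) \<partial>M)"
    by (rule indep_of_nn_integral_mult[OF prob_space_axioms FF_sub Vi]) (use cm in simp)
  also have "\<dots> \<le> ennreal ((norm (mat 1 :: real^'m^'m))^4 * Q ^ K) * ennreal Q"
    by (intro mult_mono Suc EV) auto
  also have "\<dots> = ennreal ((norm (mat 1 :: real^'m^'m))^4 * Q ^ Suc K)"
    using Q0 by (simp add: ennreal_mult[symmetric] mult_ac)
  finally show ?case .
qed

end

text \<open>The block length is rounded up so that every index up to \<open>n\<close> lies in one of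
  the \<open>N\<close> blocks. The blocks overshoot \<open>T\<close>, but stay below
  \<open>2 * T\<close>.\<close>

lemma block_grid:
  fixes n N :: nat
  assumes N: "N > 0" and n: "N \<le> n" and T: "T > 0"
  defines "h \<equiv> T / real n" and "b \<equiv> n div N + 1"
  shows "h > 0" "real n * h = T" "n < N * b" "real (N * b) * h \<le> 2 * T" "real b * h \<le> 2 * T" "real b * h \<le> 2 * T / real N"
proof -
  have n0: "n > 0" using N n by simp
  show h: "h > 0" and nh: "real n * h = T" using n0 T by (auto simp: h_def)
  show lt: "n < N * b"
    using mult_div_mod_eq[of N n] mod_less_divisor[OF N, of n] unfolding b_def distrib_left mult_1_right by linarith
  have "N * b \<le> 2 * n" unfolding b_def distrib_left mult_1_right using n times_div_less_eq_dividend[of N n] by linarith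
  then have "real (N * b) \<le> 2 * real n" using of_nat_mono[of "N * b" "2 * n", where 'a=real] by simp
  from mult_right_mono[OF this less_imp_le[OF h]] nh show Nb: "real (N * b) * h \<le> 2 * T" by simp
  have "real b \<le> real (N * b)" using N by (intro of_nat_mono) simp
  from mult_right_mono[OF this less_imp_le[OF h]] Nb show "real b * h \<le> 2 * T" by linarith
  show "real b * h \<le> 2 * T / real N" using Nb N by (simp add: pos_le_divide_eq mult_ac)
qed

section \<open>The limit over a fixed number of blocks\<close>

context flow
begin

text \<open>The constants of \<open>block_step\<close> are fixed in the order \<open>L\<close>,
  \<open>R\<close>, \<open>e\<close>, \<open>d\<close>, each depending on the earlier ones; the four
  resulting contributions are at most a quarter of \<delta> each. The initial difference must be
  smaller than \<open>d\<close>, so the hypothesis is needed for all \<delta>.\<close>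

lemma block_difference:
  fixes F :: "real \<Rightarrow> real \<Rightarrow> 'a \<Rightarrow> real^'m^'m"
  assumes pi: "prop_i M \<xi> A B F" and pii: "prop_ii M F"
    and FL2: "\<And>s t. 0 \<le> s \<Longrightarrow> s \<le> t \<Longrightarrow> L2 M (F s t)"
    and T: "T > 0" and K: "K < N" and \<delta>: "\<delta> > 0"
  defines "h \<equiv> \<lambda>n. T / real n" and "b \<equiv> \<lambda>n. n div N + 1"
  defines "z \<equiv> \<lambda>n K \<omega>. coarse A (h n) (b n) (centered_factor F (h n)) K \<omega> - coarse A (h n) (b n) (noise (h n)) K \<omega>"
    and "D \<equiv> \<lambda>n i \<omega>. block A (h n) (b n) (centered_factor F (h n)) K i \<omega> ** coarse A (h n) (b n) (centered_factor F (h n)) K \<omega>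
      - block A (h n) (b n) (noise (h n)) K i \<omega> ** coarse A (h n) (b n) (noise (h n)) K \<omega>"
  assumes IH: "\<And>\<delta>. \<delta> > 0 \<Longrightarrow> \<forall>\<^sub>F n in sequentially. msq M (z n K) \<le> \<delta>"
  shows "\<forall>\<^sub>F n in sequentially. (\<forall>i\<le>b n. L2 M (D n i)) \<and> (\<integral>\<omega>. (maxn (D n) (b n) \<omega>)\<^sup>2 \<partial>M) \<le> \<delta>"
proof -
  define T2 where "T2 = 2 * T"
  have T2: "T2 > 0" using T by (simp add: T2_def)
  define e0 where "e0 = 3 * exp (3 * (T2 + 4) * pp * T2)"
  have e0: "e0 > 0" by (simp add: e0_def)
  have pA: "(norm A)\<^sup>2 \<le> pp" "(norm B)\<^sup>2 \<le> pp" using zero_le_power2[of "norm A"] zero_le_power2[of "norm B"] by linarith+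
  obtain S where S: "L2 M S" "\<And>\<omega>. 0 \<le> S \<omega>" "AE \<omega> in M. \<forall>t. 0 \<le> t \<longrightarrow> t \<le> 0 + T2 \<longrightarrow> norm (\<xi> t \<omega> - \<xi> 0 \<omega>) \<le> S \<omega>"
    using xi_sup(2)[OF order_refl T2] by blast
  \<comment> \<open>By \<open>noise_block\<close> this bounds all Wiener propagators for every
    \<open>n\<close>: one increment of \<xi> is at most twice the envelope \<open>S\<close>. Its
    independence of \<open>n\<close> makes the level \<open>R\<close> uniform.\<close>
  define \<Psi> where "\<Psi> \<omega> = (norm (mat 1 :: real^'m^'m) + T2 * norm A) + (2 * norm B) *\<^sub>R S \<omega>" for \<omega>
  have \<Psi>: "L2 M \<Psi>" unfolding \<Psi>_def[abs_def] by (rule L2_add[OF L2_const L2_scaleR[OF S(1)]])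
  define m4 where "m4 = (norm (mat 1 :: real^'m^'m))^4 * (8 * (norm (mat 1 :: real^'m^'m) + T2 * norm A)^4 + 8 * ((norm B)^4 * (3 * T2\<^sup>2))) ^ K"
  have m4: "m4 \<ge> 0" unfolding m4_def using T2 by (intro mult_nonneg_nonneg zero_le_power add_nonneg_nonneg) auto
  \<comment> \<open>Solves \<open>12 * e0 * (m4 / L^2) \<le> \<delta> / 4\<close>; the summand 1
    keeps \<open>L\<close> positive.\<close>
  define L where "L = sqrt (48 * e0 * m4 / \<delta> + 1)"
  have L2': "L\<^sup>2 = 48 * e0 * m4 / \<delta> + 1" and L: "L > 0"
    using e0 m4 \<delta> by (auto simp: L_def intro!: add_nonneg_pos)
  have Lp: "L\<^sup>2 > 0" using L by simp
  have b1: "12 * e0 * (m4 / L\<^sup>2) \<le> \<delta> / 4"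
  proof -
    have "48 * e0 * m4 \<le> \<delta> * L\<^sup>2" unfolding L2' using \<delta> by (simp add: distrib_left)
    then show ?thesis using Lp by (simp add: pos_divide_le_eq field_simps)
  qed
  obtain R where R: "R > 0" "(\<integral>\<omega>. (\<Psi> \<omega>)\<^sup>2 * indicator {\<omega>. R < \<bar>\<Psi> \<omega>\<bar>} \<omega> \<partial>M) < \<delta> / (64 * L\<^sup>2)"
    using L2_tail[OF \<Psi>, of "\<delta> / (64 * L\<^sup>2)"] \<delta> Lp by auto
  \<comment> \<open>Chosen for the difference of the noises, which enters as
    \<open>16 * L^2 * e * T2^2\<close>.\<close>
  define e where "e = min 1 (\<delta> / (64 * L\<^sup>2 * T2\<^sup>2))"
  have e: "0 < e" "e \<le> 1" using \<delta> Lp T2 by (auto simp: e_def)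
  have b3: "16 * L\<^sup>2 * e * T2\<^sup>2 \<le> \<delta> / 4"
  proof -
    have "16 * L\<^sup>2 * T2\<^sup>2 * e \<le> 16 * L\<^sup>2 * T2\<^sup>2 * (\<delta> / (64 * L\<^sup>2 * T2\<^sup>2))" by (rule mult_left_mono) (auto simp: e_def)
    also have "\<dots> = \<delta> / 4" using Lp T2 by simp
    finally show ?thesis by (simp add: mult_ac)
  qed
  define d where "d = \<delta> / (16 * (8 * e0 + R\<^sup>2))"
  have dp: "8 * e0 + R\<^sup>2 > 0" using e0 by (intro add_pos_nonneg) auto
  have d: "d > 0" using dp \<delta> by (simp add: d_def)
  have "4 * q * (\<delta> / (16 * q)) = \<delta> / 4" if "q > 0" for q using that by simp
  from this[OF dp] have d4: "4 * (8 * e0 + R\<^sup>2) * d = \<delta> / 4" unfolding d_def .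
  have ev: "\<forall>\<^sub>F n in sequentially. grid_ok F T2 e (T / real n)"
    by (rule eventually_at_right_inverse[OF T], rule independent_products_grid[OF pi pii FL2 e])
  show ?thesis
    using ev IH[OF d] eventually_ge_at_top[of N]
  proof eventually_elim
    case (elim n)
    have N0: "N > 0" using K by simp
    let ?h = "h n" and ?b = "b n"
    have bb: "?b = n div N + 1" by (simp add: b_def)
    have bh: "?h = T / real n" by (simp add: h_def)
    note bg = block_grid[OF N0 elim(3) T, folded T2_def bh bb]
    define m where "m = N * ?b"
    have h0: "0 \<le> ?h" using bg(1) by simp
    have mh: "real m * ?h \<le> T2" and bT: "real ?b * ?h \<le> T2" using bg(4,5) by (simp_all only: m_def)
    have Km: "K * ?b + ?b \<le> m" using mult_le_mono1[of "Suc K" N ?b] K by (simp add: m_def)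
    then have Km': "K * ?b \<le> m" by simp
    obtain G where G: "dfilt M G"
      "\<And>j. centered_factor F ?h j \<in> borel_measurable (G (Suc j))" "\<And>j. indep_of M (G j) (centered_factor F ?h j)" "\<And>j. L2 M (centered_factor F ?h j)" "\<And>j. expectation (centered_factor F ?h j) = 0"
      and Gj: "\<And>j. j < m \<Longrightarrow> msq M (centered_factor F ?h j) \<le> pp * ?h" "\<And>j. j < m \<Longrightarrow> msq M (\<lambda>\<omega>. centered_factor F ?h j \<omega> - noise ?h j \<omega>) \<le> 4 * e * ?h\<^sup>2"
      by (rule grid_ok_obtain[OF elim(1)[folded bh] mh]) blast
    note nf = noise_facts[OF h0]
    have N2: "msq M (noise ?h j) \<le> pp * ?h" for j using nf(6)[of j] pA h0 by (auto intro: mult_right_mono)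
    let ?X = "coarse A ?h ?b (centered_factor F ?h) K" and ?X' = "coarse A ?h ?b (noise ?h) K"
    have X: "?X \<in> borel_measurable (G (K * ?b))" "L2 M ?X"
      using coarse_adapted[OF prob_space_axioms G(1,2,3,4,5) Gj(1) h0 bT pA(1) Km'] by blast+
    have X': "?X' \<in> borel_measurable (FF (real (K * ?b) * ?h))" "L2 M ?X'"
      using coarse_adapted[where F="\<lambda>j. FF (real j * ?h)", OF prob_space_axioms nf(1) nf(2) nf(3) nf(4) nf(5) N2 h0 bT pA(1) Km'] by blast+
    have P: "AE \<omega> in M. \<forall>i\<le>?b. norm (block A ?h ?b (noise ?h) K i \<omega>) \<le> \<Psi> \<omega>"
      using S(3)
    proof eventually_elim
      case (elim \<omega>)
      show ?case
      proof (intro allI impI)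
        fix i assume i: "i \<le> ?b"
        have aux: "real l * ?h \<le> T2" if "l \<le> m" for l
          by (rule order_trans[OF mult_right_mono[OF of_nat_mono[OF that, where 'a=real] h0] mh])
        have le1: "real (K * ?b + i) * ?h \<le> T2" by (rule aux) (use Km i in linarith)
        have le2: "real (K * ?b) * ?h \<le> T2" by (rule aux) (use Km in linarith)
        have le3: "real i * ?h \<le> T2" by (rule aux) (use Km i in linarith)
        let ?x = "\<xi> (real (K * ?b + i) * ?h) \<omega> - \<xi> (real (K * ?b) * ?h) \<omega>"
        have "norm (\<xi> (real (K * ?b + i) * ?h) \<omega> - \<xi> 0 \<omega>) \<le> S \<omega>" "norm (\<xi> (real (K * ?b) * ?h) \<omega> - \<xi> 0 \<omega>) \<le> S \<omega>"
          by (rule elim[rule_format]; use le1 le2 h0 in simp)+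
        then have x: "\<bar>?x\<bar> \<le> 2 * S \<omega>" unfolding real_norm_def by linarith
        have "norm (block A ?h ?b (noise ?h) K i \<omega>) \<le> norm (mat 1 :: real^'m^'m) + norm ((real i * ?h) *\<^sub>R A) + norm (?x *\<^sub>R B)"
          unfolding noise_block by (intro order_trans[OF norm_triangle_ineq] add_mono order_refl)
        also have "\<dots> \<le> norm (mat 1 :: real^'m^'m) + T2 * norm A + (2 * S \<omega>) * norm B"
          using mult_right_mono[OF le3, of "norm A"] mult_right_mono[OF x, of "norm B"] h0 by simp
        finally show "norm (block A ?h ?b (noise ?h) K i \<omega>) \<le> \<Psi> \<omega>" by (simp add: \<Psi>_def mult_ac)
      qed
    qed
    note BS = block_step[OF G(1,2,3,4,5) Gj(1) Km h0 bT pA X X' \<Psi> P L R(1)]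
    have DL: "L2 M (D n i)" if "i \<le> ?b" for i unfolding D_def by (rule BS(1)) (use that in auto)
    have tr: "msq M (\<lambda>\<omega>. ?X' \<omega> - trunc L (?X' \<omega>)) \<le> m4 / L\<^sup>2"
      by (rule trunc_tail[OF X'(2) _ m4 L]) (unfold m4_def, rule coarse_fourth_moment[OF h0 bT])
    have sm: "real m * (\<Sum>j<m. msq M (\<lambda>\<omega>. centered_factor F ?h j \<omega> - noise ?h j \<omega>)) \<le> 4 * e * T2\<^sup>2"
    proof -
      have "(\<Sum>j<m. msq M (\<lambda>\<omega>. centered_factor F ?h j \<omega> - noise ?h j \<omega>)) \<le> (\<Sum>j<m. 4 * e * ?h\<^sup>2)" by (intro sum_mono Gj) auto
      then have "real m * (\<Sum>j<m. msq M (\<lambda>\<omega>. centered_factor F ?h j \<omega> - noise ?h j \<omega>)) \<le> real m * (real m * (4 * e * ?h\<^sup>2))"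
        by (intro mult_left_mono) auto
      also have "\<dots> = 4 * e * (real m * ?h)\<^sup>2" by (simp add: power2_eq_square)
      also have "\<dots> \<le> 4 * e * T2\<^sup>2" using mh h0 e by (intro mult_left_mono power_mono) auto
      finally show ?thesis .
    qed
    have zd: "msq M (\<lambda>\<omega>. ?X \<omega> - ?X' \<omega>) \<le> d" using elim(2) by (simp add: z_def)
    have "(\<integral>\<omega>. (maxn (D n) ?b \<omega>)\<^sup>2 \<partial>M) \<le> 4 * (e0 * (8 * msq M (\<lambda>\<omega>. ?X \<omega> - ?X' \<omega>) + 3 * msq M (\<lambda>\<omega>. ?X' \<omega> - trunc L (?X' \<omega>)))
       + L\<^sup>2 * (real m * (\<Sum>j<m. msq M (\<lambda>\<omega>. centered_factor F ?h j \<omega> - noise ?h j \<omega>)))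
       + (R\<^sup>2 * msq M (\<lambda>\<omega>. ?X \<omega> - ?X' \<omega>) + 4 * L\<^sup>2 * (\<integral>\<omega>. (\<Psi> \<omega>)\<^sup>2 * indicator {\<omega>. R < \<bar>\<Psi> \<omega>\<bar>} \<omega> \<partial>M)))"
      unfolding D_def e0_def by (rule BS(2))
    also have "\<dots> \<le> 4 * (e0 * (8 * d + 3 * (m4 / L\<^sup>2)) + L\<^sup>2 * (4 * e * T2\<^sup>2) + (R\<^sup>2 * d + 4 * L\<^sup>2 * (\<delta> / (64 * L\<^sup>2))))"
      using e0 R(2) by (intro mult_left_mono add_mono zd tr sm) auto
    also have "\<dots> = 4 * (8 * e0 + R\<^sup>2) * d + 12 * e0 * (m4 / L\<^sup>2) + 16 * L\<^sup>2 * e * T2\<^sup>2 + \<delta> / 4"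
      using Lp by (simp add: algebra_simps)
    also have "\<dots> \<le> \<delta>" using d4 b1 b3 by linarith
    finally show ?case using DL by blast
  qed
qed

text \<open>Induction over the blocks with \<delta> left arbitrary, since passing a block worsens
  the error by factors that depend on \<delta>; with \<open>N\<close> fixed this happens finitely
  often.\<close>

lemma blocks_converge:
  fixes F :: "real \<Rightarrow> real \<Rightarrow> 'a \<Rightarrow> real^'m^'m"
  assumes pi: "prop_i M \<xi> A B F" and pii: "prop_ii M F"
    and FL2: "\<And>s t. 0 \<le> s \<Longrightarrow> s \<le> t \<Longrightarrow> L2 M (F s t)"
    and T: "T > 0" and K: "K \<le> N" and \<delta>: "\<delta> > 0"
  shows "\<forall>\<^sub>F n in sequentially. msq M (\<lambda>\<omega>. coarse A (T / real n) (n div N + 1) (centered_factor F (T / real n)) K \<omega>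
    - coarse A (T / real n) (n div N + 1) (noise (T / real n)) K \<omega>) \<le> \<delta>"
  using K \<delta>
proof (induction K arbitrary: \<delta>)
  case 0
  then show ?case by simp
next
  case (Suc K)
  have K: "K < N" "K \<le> N" using Suc.prems by auto
  let ?D = "\<lambda>n i \<omega>. block A (T / real n) (n div N + 1) (centered_factor F (T / real n)) K i \<omega> ** coarse A (T / real n) (n div N + 1) (centered_factor F (T / real n)) K \<omega>
      - block A (T / real n) (n div N + 1) (noise (T / real n)) K i \<omega> ** coarse A (T / real n) (n div N + 1) (noise (T / real n)) K \<omega>"
  have "\<forall>\<^sub>F n in sequentially. (\<forall>i\<le>n div N + 1. L2 M (?D n i)) \<and> (\<integral>\<omega>. (maxn (?D n) (n div N + 1) \<omega>)\<^sup>2 \<partial>M) \<le> \<delta>"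
    by (rule block_difference[OF pi pii FL2 T K(1) Suc.prems(2) Suc.IH[OF K(2)]])
  then show ?case
  proof eventually_elim
    case (elim n)
    \<comment> \<open>The last index within a block gives the difference at the start of the next
      one.\<close>
    have "msq M (?D n (n div N + 1)) \<le> (\<integral>\<omega>. (maxn (?D n) (n div N + 1) \<omega>)\<^sup>2 \<partial>M)"
      by (rule msq_le_maxn) (use elim in auto)
    then show ?case using elim by simp
  qed
qed

text \<open>Two Euler schemes lie between product and flow: one driven by the centered factors, one
  by \<xi>. \<open>N\<close> is fixed to make both freezing errors small; the distance of the
  schemes then tends to 0 as \<open>n\<close> grows.\<close>

lemma independent_products_converge_grid:
  fixes F :: "real \<Rightarrow> real \<Rightarrow> 'a \<Rightarrow> real^'m^'m"
  assumes pi: "prop_i M \<xi> A B F" and pii: "prop_ii M F"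
    and FL2: "\<And>s t. 0 \<le> s \<Longrightarrow> s \<le> t \<Longrightarrow> L2 M (F s t)"
    and T: "T > 0" and \<delta>: "\<delta> > 0"
  shows "\<forall>\<^sub>F n in sequentially. (\<forall>j\<le>n. L2 M (prods F (T / real n) j) \<and> L2 M (cg (T / real n) j)) \<and>
    (\<integral>\<omega>. (maxn (\<lambda>j \<omega>. prods F (T / real n) j \<omega> - cg (T / real n) j \<omega>) n \<omega>)\<^sup>2 \<partial>M) \<le> \<delta>"
proof -
  define T2 where "T2 = 2 * T"
  have T2: "T2 > 0" "T \<le> T2" using T by (auto simp: T2_def)
  have pA: "(norm A)\<^sup>2 \<le> pp" "(norm B)\<^sup>2 \<le> pp" using zero_le_power2[of "norm A"] zero_le_power2[of "norm B"] by linarith+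
  have p0: "0 \<le> pp" using pA(1) by (meson order_trans zero_le_power2)
  define U where "U = uniC pp T2 (one_sq TYPE('m)) + 1"
  have U: "U > 0" "uniC pp T2 (one_sq TYPE('m)) \<le> U"
    using uniC_nonneg[OF p0 less_imp_le[OF T2(1)], of "one_sq TYPE('m)"] by (auto simp: U_def)
  obtain \<kappa> where \<kappa>: "\<kappa> \<ge> 0" and fg: "\<And>h n b p. 0 < h \<Longrightarrow> real n * h \<le> T2 \<Longrightarrow> real b * h \<le> T2 \<Longrightarrow> 0 < b \<Longrightarrow> \<kappa> * h \<le> 1 \<Longrightarrow>
      (norm A)\<^sup>2 \<le> p \<Longrightarrow> (norm B)\<^sup>2 \<le> p \<Longrightarrow>
    (\<integral>\<omega>. (maxn (cg h) n \<omega>)\<^sup>2 \<partial>M) \<le> uniK p T2 (one_sq TYPE('m)) \<and>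
    (\<forall>j\<le>n. cg h j \<in> borel_measurable (FF (real j * h)) \<and> L2 M (cg h j)) \<and>
    (\<forall>j\<le>n. euler A h b (noise h) j \<in> borel_measurable (FF (real j * h)) \<and> L2 M (euler A h b (noise h) j)) \<and>
    (\<integral>\<omega>. (maxn (\<lambda>j \<omega>. cg h j \<omega> - euler A h b (noise h) j \<omega>) n \<omega>)\<^sup>2 \<partial>M) \<le> uniC p T2 (one_sq TYPE('m)) * (real b * h + \<kappa> * h)"
    by (rule flow_grid_obtain[OF T2(1)]) blast
  \<comment> \<open>Solves \<open>6 * U * (2 * T / real N) \<le> \<delta> / 4\<close>, where 6
    counts the freezing errors 2 and 4 of the nested triangle inequalities.\<close>
  obtain N :: nat where N': "48 * U * T / \<delta> < real N" using reals_Archimedean2 by blast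
  have N: "N > 0"
  proof (rule ccontr)
    assume "\<not> N > 0"
    moreover have "0 \<le> 48 * U * T / \<delta>" using U T \<delta> by (intro divide_nonneg_pos mult_nonneg_nonneg) auto
    ultimately show False using N' by simp
  qed
  have bN: "6 * U * (2 * T / real N) \<le> \<delta> / 4"
    using N' N \<delta> by (simp add: field_simps)
  define e where "e = min 1 (\<delta> / (8 * U))"
  have e: "0 < e" "e \<le> 1" using \<delta> U by (auto simp: e_def)
  have be: "2 * U * e \<le> \<delta> / 4"
  proof -
    have "2 * U * e \<le> 2 * U * (\<delta> / (8 * U))" using U by (intro mult_left_mono) (auto simp: e_def)
    also have "\<dots> = \<delta> / 4" using U by simp
    finally show ?thesis .
  qed
  \<comment> \<open>The maximum over all blocks is bounded by a sum of \<open>N\<close> terms, which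
    enters with the factor 4.\<close>
  define d where "d = \<delta> / (16 * real N)"
  have d: "d > 0" "4 * (real N * d) = \<delta> / 4" using N \<delta> by (auto simp: d_def)
  let ?b = "\<lambda>n. n div N + 1"
  let ?Z = "\<lambda>n. euler A (T / real n) (?b n) (centered_factor F (T / real n))" and ?Z' = "\<lambda>n. euler A (T / real n) (?b n) (noise (T / real n))"
  define D where "D n K i \<omega> = block A (T / real n) (?b n) (centered_factor F (T / real n)) K i \<omega> ** coarse A (T / real n) (?b n) (centered_factor F (T / real n)) K \<omega>
      - block A (T / real n) (?b n) (noise (T / real n)) K i \<omega> ** coarse A (T / real n) (?b n) (noise (T / real n)) K \<omega>" for n K i \<omega>
  have bc: "\<forall>\<^sub>F n in sequentially. msq M (\<lambda>\<omega>. coarse A (T / real n) (?b n) (centered_factor F (T / real n)) K \<omega>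
    - coarse A (T / real n) (?b n) (noise (T / real n)) K \<omega>) \<le> \<gamma>" if "K \<le> N" "\<gamma> > 0" for K \<gamma>
    by (rule blocks_converge[OF pi pii FL2 T that])
  have bd: "\<forall>\<^sub>F n in sequentially. \<forall>K\<in>{..<N}. (\<forall>i\<le>?b n. L2 M (D n K i)) \<and> (\<integral>\<omega>. (maxn (D n K) (?b n) \<omega>)\<^sup>2 \<partial>M) \<le> d"
  proof (rule eventually_ball_finite[OF finite_lessThan], rule ballI)
    fix K assume "K \<in> {..<N}"
    then have K: "K < N" by simp
    show "\<forall>\<^sub>F n in sequentially. (\<forall>i\<le>?b n. L2 M (D n K i)) \<and> (\<integral>\<omega>. (maxn (D n K) (?b n) \<omega>)\<^sup>2 \<partial>M) \<le> d"
      unfolding D_def[abs_def] by (rule block_difference[OF pi pii FL2 T K d(1) bc[OF less_imp_le[OF K]]])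
  qed
  have ev: "\<forall>\<^sub>F h in at_right 0. (h * \<kappa> < 1 \<and> h * (4 * U * \<kappa>) < \<delta> / 4) \<and> grid_ok F T2 e h"
  proof (intro eventually_conj)
    show "\<forall>\<^sub>F h in at_right 0. (h::real) * \<kappa> < 1"
      by (rule order_tendstoD(2)[OF tendsto_mult[OF tendsto_ident_at tendsto_const]]) simp
    show "\<forall>\<^sub>F h in at_right 0. (h::real) * (4 * U * \<kappa>) < \<delta> / 4"
      by (rule order_tendstoD(2)[OF tendsto_mult[OF tendsto_ident_at tendsto_const]]) (use \<delta> in simp)
    show "eventually (grid_ok F T2 e) (at_right 0)" by (rule independent_products_grid[OF pi pii FL2 e])
  qed
  show ?thesis
    using eventually_at_right_inverse[OF T ev] bd eventually_ge_at_top[of N]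
  proof eventually_elim
    case (elim n)
    define h where "h = T / real n"
    define b where "b = n div N + 1"
    note bg = block_grid[OF N elim(3) T, folded h_def b_def T2_def]
    have h: "h > 0" and h0: "0 \<le> h" and nh: "real n * h = T" and nhT: "real n * h \<le> T2" and b: "b > 0"
      using bg(1,2) T2 by (auto simp: b_def)
    have hk: "\<kappa> * h \<le> 1" and hd: "h * (4 * U * \<kappa>) \<le> \<delta> / 4" and ok: "grid_ok F T2 e h"
      using elim(1) by (auto simp: h_def mult.commute)
    let ?Y = "prods F h" and ?Zn = "euler A h b (centered_factor F h)" and ?Zn' = "euler A h b (noise h)"
    obtain G where G: "dfilt M G"
      "\<And>j. centered_factor F h j \<in> borel_measurable (G (Suc j))" "\<And>j. indep_of M (G j) (centered_factor F h j)" "\<And>j. L2 M (centered_factor F h j)" "\<And>j. expectation (centered_factor F h j) = 0"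
      "\<And>j. j < n \<Longrightarrow> msq M (centered_factor F h j) \<le> pp * h" "\<And>j. j < n \<Longrightarrow> (norm (expectation (F (real j * h) (real (Suc j) * h)) - mat 1 - h *\<^sub>R A))\<^sup>2 \<le> e * h\<^sup>2"
      "\<And>j. ?Y j \<in> borel_measurable (G j)" "\<And>j. L2 M (?Y j)"
      by (rule grid_ok_obtain[OF ok nhT]) blast
    define r where "r j = expectation (F (real j * h) (real (Suc j) * h)) - mat 1 - h *\<^sub>R A" for j
    have aL2: "L2 M (\<lambda>\<omega>. r j ** ?Y j \<omega>)" for j by (rule L2_matrix_const_left[OF G(9)])
    have a2: "msq M (\<lambda>\<omega>. r j ** ?Y j \<omega>) \<le> e * h\<^sup>2 * (1 + msq M (?Y j))" if "j < n" for j
    proof -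
      have "msq M (\<lambda>\<omega>. r j ** ?Y j \<omega>) \<le> (norm (r j))\<^sup>2 * msq M (?Y j)" by (rule msq_matrix_le[OF G(9)])
      also have "\<dots> \<le> (e * h\<^sup>2) * (1 + msq M (?Y j))"
        using G(7)[OF that] e by (intro mult_mono) (auto simp: r_def)
      finally show ?thesis .
    qed
    \<comment> \<open>The centered factor is itself the driving noise, so the martingale
      perturbation is zero and only the error of the mean appears as \<open>a\<close>.\<close>
    have md: "mart_diff M (G j) (\<lambda>_. 0 :: real^'m^'m)" for j by (simp add: mart_diff_def)
    have m2: "msq M (\<lambda>_. 0 :: real^'m^'m) \<le> e * h * (1 + msq M (?Y j))" for j
      using e h0 by (simp add: add_nonneg_nonneg)
    have step: "AE \<omega> in M. ?Y (Suc j) \<omega> = ?Y j \<omega> + (h *\<^sub>R A ** ?Y j \<omega> + r j ** ?Y j \<omega>) + (centered_factor F h j \<omega> ** ?Y j \<omega> + 0)" for j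
    proof (intro AE_I2)
      fix \<omega>
      have "F (real j * h) (real (Suc j) * h) \<omega> = mat 1 + h *\<^sub>R A + r j + centered_factor F h j \<omega>" by (simp add: centered_factor_def r_def)
      then show "?Y (Suc j) \<omega> = ?Y j \<omega> + (h *\<^sub>R A ** ?Y j \<omega> + r j ** ?Y j \<omega>) + (centered_factor F h j \<omega> ** ?Y j \<omega> + 0)"
        unfolding prods_Suc by (simp add: mm_simps)
    qed
    have m0: "(\<lambda>_. 0 :: real^'m^'m) \<in> borel_measurable (G (Suc j))" for j by simp
    have Z0: "?Zn 0 = ?Y 0" by (simp add: euler_0 prods_0)
    have Y0: "msq M (?Y 0) \<le> one_sq TYPE('m)" by (simp add: prods_0 prob_space)
    note P = perturbed_scheme[OF prob_space_axioms G(1,2,3,4,5,6,8,9) aL2 md m0 step h0 nhT bg(5) pA(1) b less_imp_le[OF e(1)] e(2) a2 m2 Z0 euler_Suc[OF b] Y0]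
    have ZL2: "L2 M (?Zn j)" if "j \<le> n" for j using P(2) that by blast
    have YZ: "(\<integral>\<omega>. (maxn (\<lambda>j \<omega>. ?Y j \<omega> - ?Zn j \<omega>) n \<omega>)\<^sup>2 \<partial>M) \<le> U * (real b * h + e)"
    proof -
      have "(\<integral>\<omega>. (maxn (\<lambda>j \<omega>. ?Y j \<omega> - ?Zn j \<omega>) n \<omega>)\<^sup>2 \<partial>M) \<le> uniC pp T2 (one_sq TYPE('m)) * (real b * h + e)" by (rule P(3))
      also have "\<dots> \<le> U * (real b * h + e)" using U h0 e by (intro mult_right_mono) auto
      finally show ?thesis .
    qed
    note fgn = fg[OF h nhT bg(5) b hk pA]
    have cL2: "L2 M (cg h j)" and Z'L2: "L2 M (?Zn' j)" if "j \<le> n" for j using fgn that by blast+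
    have cZ: "(\<integral>\<omega>. (maxn (\<lambda>j \<omega>. cg h j \<omega> - ?Zn' j \<omega>) n \<omega>)\<^sup>2 \<partial>M) \<le> U * (real b * h + \<kappa> * h)"
    proof -
      have "(\<integral>\<omega>. (maxn (\<lambda>j \<omega>. cg h j \<omega> - ?Zn' j \<omega>) n \<omega>)\<^sup>2 \<partial>M) \<le> uniC pp T2 (one_sq TYPE('m)) * (real b * h + \<kappa> * h)" using fgn by blast
      also have "\<dots> \<le> U * (real b * h + \<kappa> * h)" using U h0 \<kappa> by (intro mult_right_mono) auto
      finally show ?thesis .
    qed
    have DL2: "L2 M (D n K i)" and Dd: "(\<integral>\<omega>. (maxn (D n K) b \<omega>)\<^sup>2 \<partial>M) \<le> d" if "K < N" "i \<le> b" for K i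
      using elim(2) that unfolding b_def by blast+
    have ZZ: "(\<integral>\<omega>. (maxn (\<lambda>j \<omega>. ?Zn j \<omega> - ?Zn' j \<omega>) n \<omega>)\<^sup>2 \<partial>M) \<le> real N * d"
    proof -
      have i1: "integrable M (\<lambda>\<omega>. (maxn (\<lambda>j \<omega>. ?Zn j \<omega> - ?Zn' j \<omega>) n \<omega>)\<^sup>2)"
        using L2_integrable_sq[OF maxn_L2[OF L2_diff[OF ZL2 Z'L2], of n]] by simp
      have i2: "integrable M (\<lambda>\<omega>. (maxn (D n K) b \<omega>)\<^sup>2)" if "K < N" for K
        using L2_integrable_sq[OF maxn_L2[OF DL2[OF that], of b]] by simp
      have "(\<integral>\<omega>. (maxn (\<lambda>j \<omega>. ?Zn j \<omega> - ?Zn' j \<omega>) n \<omega>)\<^sup>2 \<partial>M) \<le> (\<integral>\<omega>. (\<Sum>K<N. (maxn (D n K) b \<omega>)\<^sup>2) \<partial>M)"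
      proof (rule integral_mono[OF i1])
        show "integrable M (\<lambda>\<omega>. \<Sum>K<N. (maxn (D n K) b \<omega>)\<^sup>2)" by (intro Bochner_Integration.integrable_sum i2) simp
        fix \<omega>
        \<comment> \<open>The index attaining the maximum lies in some block, whose own maximum is
          one summand.\<close>
        show "(maxn (\<lambda>j \<omega>. ?Zn j \<omega> - ?Zn' j \<omega>) n \<omega>)\<^sup>2 \<le> (\<Sum>K<N. (maxn (D n K) b \<omega>)\<^sup>2)"
        proof (rule maxn_sq_leI)
          fix j assume "j \<le> n"
          then have K: "j div b < N" and i: "j mod b \<le> b"
            using bg(3) b by (auto simp: less_mult_imp_div_less intro: less_imp_le)
          have "?Zn j \<omega> - ?Zn' j \<omega> = D n (j div b) (j mod b) \<omega>"
            unfolding D_def euler_def h_def[symmetric] b_def[symmetric] ..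
          then have "(norm (?Zn j \<omega> - ?Zn' j \<omega>))\<^sup>2 \<le> (maxn (D n (j div b)) b \<omega>)\<^sup>2"
            using maxn_ge[OF i, of "D n (j div b)" \<omega>] by (intro power_mono) auto
          also have "\<dots> \<le> (\<Sum>K<N. (maxn (D n K) b \<omega>)\<^sup>2)"
            by (rule member_le_sum[of "j div b" "{..<N}" "\<lambda>K. (maxn (D n K) b \<omega>)\<^sup>2"]) (use K in auto)
          finally show "(norm (?Zn j \<omega> - ?Zn' j \<omega>))\<^sup>2 \<le> (\<Sum>K<N. (maxn (D n K) b \<omega>)\<^sup>2)" .
        qed
      qed
      also have "\<dots> = (\<Sum>K<N. \<integral>\<omega>. (maxn (D n K) b \<omega>)\<^sup>2 \<partial>M)" by (intro Bochner_Integration.integral_sum i2) simp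
      also have "\<dots> \<le> (\<Sum>K<N. d)" by (rule sum_mono) (use elim(2) in \<open>auto simp: b_def\<close>)
      finally show ?thesis by simp
    qed
    have t1: "(\<integral>\<omega>. (maxn (\<lambda>j \<omega>. ?Y j \<omega> - cg h j \<omega>) n \<omega>)\<^sup>2 \<partial>M)
      \<le> 2 * (\<integral>\<omega>. (maxn (\<lambda>j \<omega>. ?Y j \<omega> - ?Zn j \<omega>) n \<omega>)\<^sup>2 \<partial>M) + 2 * (\<integral>\<omega>. (maxn (\<lambda>j \<omega>. cg h j \<omega> - ?Zn j \<omega>) n \<omega>)\<^sup>2 \<partial>M)"
      by (rule maxn_diff_triangle) (use G(9) cL2 ZL2 in blast)+
    have t2: "(\<integral>\<omega>. (maxn (\<lambda>j \<omega>. cg h j \<omega> - ?Zn j \<omega>) n \<omega>)\<^sup>2 \<partial>M)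
      \<le> 2 * (\<integral>\<omega>. (maxn (\<lambda>j \<omega>. cg h j \<omega> - ?Zn' j \<omega>) n \<omega>)\<^sup>2 \<partial>M) + 2 * (\<integral>\<omega>. (maxn (\<lambda>j \<omega>. ?Zn j \<omega> - ?Zn' j \<omega>) n \<omega>)\<^sup>2 \<partial>M)"
      by (rule maxn_diff_triangle) (use cL2 ZL2 Z'L2 in blast)+
    have "(\<integral>\<omega>. (maxn (\<lambda>j \<omega>. ?Y j \<omega> - cg h j \<omega>) n \<omega>)\<^sup>2 \<partial>M)
      \<le> 2 * (U * (real b * h + e)) + 2 * (2 * (U * (real b * h + \<kappa> * h)) + 2 * (real N * d))"
      by (intro order_trans[OF t1] add_mono mult_left_mono order_trans[OF t2] YZ cZ ZZ) simp_all
    also have "\<dots> = 6 * U * (real b * h) + 2 * U * e + h * (4 * U * \<kappa>) + 4 * (real N * d)" by (simp add: algebra_simps)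
    also have "\<dots> \<le> 6 * U * (2 * T / real N) + \<delta> / 4 + \<delta> / 4 + \<delta> / 4"
      using block_grid(6)[OF N elim(3) T, folded h_def b_def] U be hd d(2) by (intro add_mono mult_left_mono) auto
    also have "\<dots> \<le> \<delta>" using bN by linarith
    finally show ?case unfolding h_def[symmetric] using G(9) cL2 by blast
  qed
qed

text \<open>The product is constant between grid points, so the error is the grid error plus the
  oscillation of the flow over one mesh.\<close>

lemma independent_products_converge:
  fixes F :: "real \<Rightarrow> real \<Rightarrow> 'a \<Rightarrow> real^'m^'m"
  assumes pi: "prop_i M \<xi> A B F" and pii: "prop_ii M F"
    and FL2: "\<And>s t. 0 \<le> s \<Longrightarrow> s \<le> t \<Longrightarrow> L2 M (F s t)" and T: "T > 0"
  shows "(\<lambda>n. mean_sup_sq M T (\<lambda>t \<omega>. f_approx F n T t \<omega> - C 0 t \<omega>)) \<longlonglongrightarrow> 0"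
proof (rule tendsto_0_le_ennreal)
  fix \<epsilon> :: real assume \<epsilon>: "0 < \<epsilon>"
  define \<delta> where "\<delta> = \<epsilon> / 4"
  have \<delta>: "\<delta> > 0" using \<epsilon> by (simp add: \<delta>_def)
  obtain S where S: "L2 M S" "AE \<omega> in M. \<forall>t. 0 \<le> t \<longrightarrow> t \<le> T \<longrightarrow> norm (c t \<omega>) \<le> S \<omega>"
    using c_sup[OF T] by blast
  obtain Q where Q: "\<And>n. n > 0 \<Longrightarrow> Q n \<in> borel_measurable M"
    "\<And>n. n > 0 \<Longrightarrow> AE \<omega> in M. \<forall>t. 0 \<le> t \<longrightarrow> t \<le> T \<longrightarrow> ennreal ((norm (c t \<omega> - c (gfloor T n t) \<omega>))\<^sup>2) \<le> Q n \<omega>"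
    "(\<lambda>n. \<integral>\<^sup>+\<omega>. Q n \<omega> \<partial>M) \<longlonglongrightarrow> 0"
    using oscillation_tendsto_0[OF T c_meas c_continuous S] by blast
  have e1: "\<forall>\<^sub>F n in sequentially. (\<integral>\<^sup>+\<omega>. Q n \<omega> \<partial>M) < ennreal \<delta>"
    by (rule order_tendstoD(2)[OF Q(3)]) (use \<delta> in simp)
  have gr: "\<forall>\<^sub>F n in sequentially. (\<forall>j\<le>n. L2 M (prods F (T / real n) j) \<and> L2 M (cg (T / real n) j)) \<and>
    (\<integral>\<omega>. (maxn (\<lambda>j \<omega>. prods F (T / real n) j \<omega> - cg (T / real n) j \<omega>) n \<omega>)\<^sup>2 \<partial>M) \<le> \<delta>"
    by (rule independent_products_converge_grid[OF pi pii FL2 T \<delta>])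
  show "\<forall>\<^sub>F n in sequentially. mean_sup_sq M T (\<lambda>t \<omega>. f_approx F n T t \<omega> - C 0 t \<omega>) \<le> ennreal \<epsilon>"
    using gr e1 eventually_gt_at_top[of 0]
  proof eventually_elim
    case (elim n)
    note n = elim(3)
    let ?h = "T / real n"
    let ?D = "\<lambda>j \<omega>. prods F ?h j \<omega> - cg ?h j \<omega>"
    have DL: "L2 M (maxn ?D n)" using elim(1) by (intro maxn_L2 L2_diff) auto
    have "mean_sup_sq M T (\<lambda>t \<omega>. f_approx F n T t \<omega> - C 0 t \<omega>) \<le> (\<integral>\<^sup>+\<omega>. 2 * ennreal ((maxn ?D n \<omega>)\<^sup>2) + 2 * Q n \<omega> \<partial>M)"
      unfolding mean_sup_sq_def
    proof (rule nn_integral_mono_AE)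
      show "AE \<omega> in M. (SUP t\<in>{0..T}. ennreal ((norm (f_approx F n T t \<omega> - C 0 t \<omega>))\<^sup>2)) \<le> 2 * ennreal ((maxn ?D n \<omega>)\<^sup>2) + 2 * Q n \<omega>"
        using cg_eq[of ?h] Q(2)[OF n]
      proof eventually_elim
        case (elim \<omega>)
        show ?case
        proof (rule SUP_least)
          fix t assume "t \<in> {0..T}"
          then have t: "0 \<le> t" "t \<le> T" by auto
          obtain j where j: "j \<le> n" "gfloor T n t = real j * ?h" "nat \<lfloor>real n * t / T\<rfloor> = j"
            "t \<in> {real j * ?h..real j * ?h + ?h}"
            by (rule gfloor_cases[OF T n t])
          let ?d = "c t \<omega> - c (gfloor T n t) \<omega>"
          have "c (gfloor T n t) \<omega> = cg ?h j \<omega>" using elim(1) j(2) by simp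
          then have "f_approx F n T t \<omega> - C 0 t \<omega> = ?D j \<omega> - ?d"
            unfolding f_approx_eq j(3) c_def[symmetric] by simp
          then have "(norm (f_approx F n T t \<omega> - C 0 t \<omega>))\<^sup>2 \<le> 2 * (norm (?D j \<omega>))\<^sup>2 + 2 * (norm ?d)\<^sup>2"
            by (simp only: power2_norm_diff_le)
          also have "\<dots> \<le> 2 * (maxn ?D n \<omega>)\<^sup>2 + 2 * (norm ?d)\<^sup>2"
            using maxn_ge[OF j(1), of ?D \<omega>] by (intro add_mono mult_left_mono power_mono) auto
          finally have "ennreal ((norm (f_approx F n T t \<omega> - C 0 t \<omega>))\<^sup>2) \<le> ennreal (2 * (maxn ?D n \<omega>)\<^sup>2 + 2 * (norm ?d)\<^sup>2)"
            by (rule ennreal_leI)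
          also have "\<dots> = 2 * ennreal ((maxn ?D n \<omega>)\<^sup>2) + 2 * ennreal ((norm ?d)\<^sup>2)"
            by (simp add: ennreal_mult)
          also have "\<dots> \<le> 2 * ennreal ((maxn ?D n \<omega>)\<^sup>2) + 2 * Q n \<omega>"
            using elim(2) t by (intro add_left_mono mult_left_mono) auto
          finally show "ennreal ((norm (f_approx F n T t \<omega> - C 0 t \<omega>))\<^sup>2) \<le> 2 * ennreal ((maxn ?D n \<omega>)\<^sup>2) + 2 * Q n \<omega>" .
        qed
      qed
    qed
    also have "\<dots> = 2 * (\<integral>\<^sup>+\<omega>. ennreal ((maxn ?D n \<omega>)\<^sup>2) \<partial>M) + 2 * (\<integral>\<^sup>+\<omega>. Q n \<omega> \<partial>M)"
      using Q(1)[OF n] L2_measurable[OF DL] by (simp add: nn_integral_cmult nn_integral_add)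
    also have "\<dots> \<le> 2 * ennreal \<delta> + 2 * ennreal \<delta>"
    proof (intro add_mono mult_left_mono)
      show "(\<integral>\<^sup>+\<omega>. ennreal ((maxn ?D n \<omega>)\<^sup>2) \<partial>M) \<le> ennreal \<delta>"
        using L2_nn_msq[OF DL] elim(1) by (simp add: ennreal_leI)
    qed (use elim(2) in auto)
    also have "\<dots> = (2 + 2) * ennreal \<delta>" by (simp only: distrib_right)
    also have "\<dots> = ennreal (4 * \<delta>)" using \<delta> by (simp add: ennreal_mult)
    also have "4 * \<delta> = \<epsilon>" by (simp add: \<delta>_def)
    finally show ?case .
  qed
qed

end

theorem theorem3p1:
  fixes M :: "'a measure"
    and \<FF> :: "real \<Rightarrow> 'a measure"
    and \<xi> :: "real \<Rightarrow> 'a \<Rightarrow> real"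
    and A B :: "real^'m^'m"
    and C F :: "real \<Rightarrow> real \<Rightarrow> 'a \<Rightarrow> real^'m^'m"
    and T :: real
  assumes "prob_space M"
    and "wiener_process M \<FF> \<xi>"
    and "solution_flow M \<FF> \<xi> A B C"
    and "\<And>s t. 0 \<le> s \<Longrightarrow> s \<le> t \<Longrightarrow> L2 M (F s t)"
    and "T > 0"
  shows "(prop_i M \<xi> A B F \<and> prop_ii M F \<longrightarrow>
            (\<lambda>n. mean_sup_sq M T (\<lambda>t \<omega>. f_approx F n T t \<omega> - C 0 t \<omega>)) \<longlonglongrightarrow> 0) \<and>
         (prop_i' M \<FF> \<xi> A B F \<and> prop_ii M F \<and>
          independent_of_past M \<FF> \<xi> F \<and> path_regular M \<xi> B F \<longrightarrow>
            (\<lambda>n. mean_sup_sq M T (\<lambda>t \<omega>. g_approx F n T t \<omega> - C 0 t \<omega>)) \<longlonglongrightarrow> 0)"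
proof -
  interpret prob_space M by fact
  interpret flow M \<FF> \<xi> A B C by unfold_locales fact+
  show ?thesis
  proof (intro conjI impI; elim conjE)
    assume "prop_i M \<xi> A B F" "prop_ii M F"
    then show "(\<lambda>n. mean_sup_sq M T (\<lambda>t \<omega>. f_approx F n T t \<omega> - C 0 t \<omega>)) \<longlonglongrightarrow> 0"
      by (rule independent_products_converge[OF _ _ assms(4,5)])
  next
    assume "prop_i' M \<FF> \<xi> A B F" "independent_of_past M \<FF> \<xi> F" "path_regular M \<xi> B F"
    then show "(\<lambda>n. mean_sup_sq M T (\<lambda>t \<omega>. g_approx F n T t \<omega> - C 0 t \<omega>)) \<longlonglongrightarrow> 0"
      by (intro interpolated_products_converge[OF assms(5) _ _ _ assms(4)])
  qed
qed

end
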